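(* Let $1\le p,q\le\infty$ and $r_{\lambda,p,q}>0$. Then $$\sup_{f\in\boldsymbol{W}^r_{p,w}(\mathbb{R})}\|f-V_nf\|_{L_{q,w}(\mathbb{R})}\ll n^{-r_{\lambda,p,q}},\qquad n\in\mathbb{N}.$$
   Context: Fix $\lambda>1$, $a>0$, $b\in\mathbb{R}$ and the univariate Freud weight $w(x)=\exp(-a|x|^\lambda+b)$, $x\in\mathbb{R}$. For $1\le p\le\infty$, $L_{p,w}(\mathbb{R})$ is the space of measurable functions $f$ on $\mathbb{R}$ with finite norm $\|f\|_{L_{p,w}(\mathbb{R})}=\big(\int_{\mathbb{R}}|f(x)w(x)|^p\,dx\big)^{1/p}$ if $p<\infty$, and $\|f\|_{L_{\infty,w}(\mathbb{R})}=\operatorname{ess\,sup}_{x\in\mathbb{R}}|f(x)w(x)|$. For $r\in\mathbb{N}$, $W^r_{p,w}(\mathbb{R})$ is the space of all $f\in L_{p,w}(\mathbb{R})$ whose weak derivatives $f^{(k)}$, $0\le k\le r$, belong to $L_{p,w}(\mathbb{R})$, with norm $\|f\|_{W^r_{p,w}(\mathbb{R})}=\big(\sum_{k=0}^r\|f^{(k)}\|_{L_{p,w}(\mathbb{R})}^p\big)^{1/p}$ (maximum over $k$ if $p=\infty$); $\boldsymbol{W}^r_{p,w}(\mathbb{R})$ denotes its unit ball. Notation: $r_\lambda=(1-1/\lambda)r$; $\delta_{\lambda,p,q}=(1-1/\lambda)(1/p-1/q)$ if $p\le q$ and $\delta_{\lambda,p,q}=(1/\lambda)(1/q-1/p)$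 if $p>q$ (with $1/\infty=0$); $r_{\lambda,p,q}=r_\lambda-\delta_{\lambda,p,q}$. Let $(p_k)_{k\in\mathbb{N}_0}$ be the sequence of orthonormal polynomials with respect to the weight $w^2$ ($\deg p_k=k$, $\int_{\mathbb{R}}p_jp_kw^2\,dx=\delta_{jk}$). For $f\in L_{p,w}(\mathbb{R})$ put $\hat f(k)=\int_{\mathbb{R}}f(x)p_k(x)w^2(x)\,dx$, $S_mf=\sum_{k=0}^{m-1}\hat f(k)p_k$, and let $V_mf=\frac1m\sum_{k=m+1}^{2m}S_kf$ be the $m$th de la Vallée Poussin sum, $m\in\mathbb{N}$. $A_n\ll B_n$ means that there is a constant $C>0$ independent of $n$ (it may depend on $\lambda,a,b,r,p,q$) with $A_n\le CB_n$ for all indicated $n$. *)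

theory Defs
  imports
    "HOL-Analysis.Analysis"
    "HOL-Probability.Essential_Supremum"
    "HOL-Computational_Algebra.Polynomial"
begin

definition freud_weight :: "real \<Rightarrow> real \<Rightarrow> real \<Rightarrow> real \<Rightarrow> real" where
  "freud_weight l a b x = exp (- a * \<bar>x\<bar> powr l + b)"

text \<open>Exponents \<open>p \<in> [1, \<infinity>]\<close> are extended nonnegative reals; the following is \<open>1/p\<close>, with
  \<open>1/\<infinity> = 0\<close>.\<close>

definition recip :: "ennreal \<Rightarrow> real" where
  "recip p = enn2real (inverse p)"

definition ennpowr :: "ennreal \<Rightarrow> real \<Rightarrow> ennreal" where
  "ennpowr x s = (if x = \<infinity> then \<infinity> else ennreal (enn2real x powr s))"

text \<open>The norms take values in \<open>[0, \<infinity>]\<close>. They are meaningful for Lebesgue measurable functions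
  only.\<close>

definition wLp_norm :: "(real \<Rightarrow> real) \<Rightarrow> ennreal \<Rightarrow> (real \<Rightarrow> real) \<Rightarrow> ennreal" where
  "wLp_norm w p f =
    (if p = \<infinity> then esssup lebesgue (\<lambda>x. ennreal \<bar>f x * w x\<bar>)
     else ennpowr (\<integral>\<^sup>+ x. ennreal (\<bar>f x * w x\<bar> powr enn2real p) \<partial>lebesgue) (1 / enn2real p))"

definition wLp :: "(real \<Rightarrow> real) \<Rightarrow> ennreal \<Rightarrow> (real \<Rightarrow> real) set" where
  "wLp w p = {f \<in> borel_measurable lebesgue. wLp_norm w p f < \<infinity>}"

definition test_function :: "(real \<Rightarrow> real) \<Rightarrow> bool" where
  "test_function \<phi> \<longleftrightarrow>
    (\<forall>k x. (deriv ^^ k) \<phi> field_differentiable (at x)) \<and> compact (closure {x. \<phi> x \<noteq> 0})"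

definition locally_integrable :: "(real \<Rightarrow> real) \<Rightarrow> bool" where
  "locally_integrable f \<longleftrightarrow> (\<forall>K. compact K \<longrightarrow> set_integrable lebesgue K f)"

definition is_weak_deriv :: "nat \<Rightarrow> (real \<Rightarrow> real) \<Rightarrow> (real \<Rightarrow> real) \<Rightarrow> bool" where
  "is_weak_deriv k f g \<longleftrightarrow> locally_integrable f \<and> locally_integrable g \<and>
    (\<forall>\<phi>. test_function \<phi> \<longrightarrow>
      (LINT x|lebesgue. f x * (deriv ^^ k) \<phi> x) = (-1) ^ k * (LINT x|lebesgue. g x * \<phi> x))"

text \<open>A weak derivative is unique up to null sets, and the norms do not see null sets, so the
  choice of representative below is immaterial.\<close>

definition weak_deriv :: "nat \<Rightarrow> (real \<Rightarrow> real) \<Rightarrow> real \<Rightarrow> real" where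
  "weak_deriv k f = (if k = 0 then f else (SOME g. is_weak_deriv k f g))"

definition wSobolev :: "(real \<Rightarrow> real) \<Rightarrow> nat \<Rightarrow> ennreal \<Rightarrow> (real \<Rightarrow> real) set" where
  "wSobolev w r p = {f \<in> wLp w p. \<forall>k\<le>r. \<exists>g \<in> wLp w p. is_weak_deriv k f g}"

definition wSobolev_norm :: "(real \<Rightarrow> real) \<Rightarrow> nat \<Rightarrow> ennreal \<Rightarrow> (real \<Rightarrow> real) \<Rightarrow> ennreal" where
  "wSobolev_norm w r p f =
    (if p = \<infinity> then Max ((\<lambda>k. wLp_norm w p (weak_deriv k f)) ` {..r})
     else ennpowr (\<Sum>k\<le>r. ennpowr (wLp_norm w p (weak_deriv k f)) (enn2real p)) (1 / enn2real p))"

definition wSobolev_ball :: "(real \<Rightarrow> real) \<Rightarrow> nat \<Rightarrow> ennreal \<Rightarrow> (real \<Rightarrow> real) set" where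
  "wSobolev_ball w r p = {f \<in> wSobolev w r p. wSobolev_norm w r p f \<le> 1}"

definition r_exponent :: "real \<Rightarrow> nat \<Rightarrow> real" where
  "r_exponent l r = (1 - 1 / l) * real r"

definition delta_exponent :: "real \<Rightarrow> ennreal \<Rightarrow> ennreal \<Rightarrow> real" where
  "delta_exponent l p q =
    (if p \<le> q then (1 - 1 / l) * (recip p - recip q) else (1 / l) * (recip q - recip p))"

definition rate_exponent :: "real \<Rightarrow> nat \<Rightarrow> ennreal \<Rightarrow> ennreal \<Rightarrow> real" where
  "rate_exponent l r p q = r_exponent l r - delta_exponent l p q"

text \<open>This determines the polynomials up to signs, which cancel in \<open>fourier_sum\<close>.\<close>

definition orthonormal_polys :: "(real \<Rightarrow> real) \<Rightarrow> (nat \<Rightarrow> real poly) \<Rightarrow> bool" where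
  "orthonormal_polys w P \<longleftrightarrow>
    (\<forall>k. degree (P k) = k) \<and>
    (\<forall>j k. (LINT x|lebesgue. poly (P j) x * poly (P k) x * (w x)\<^sup>2) = (if j = k then 1 else 0))"

definition fourier_coeff ::
  "(real \<Rightarrow> real) \<Rightarrow> (nat \<Rightarrow> real poly) \<Rightarrow> (real \<Rightarrow> real) \<Rightarrow> nat \<Rightarrow> real" where
  "fourier_coeff w P f k = (LINT x|lebesgue. f x * poly (P k) x * (w x)\<^sup>2)"

definition fourier_sum ::
  "(real \<Rightarrow> real) \<Rightarrow> (nat \<Rightarrow> real poly) \<Rightarrow> nat \<Rightarrow> (real \<Rightarrow> real) \<Rightarrow> real \<Rightarrow> real" where
  "fourier_sum w P m f x = (\<Sum>k<m. fourier_coeff w P f k * poly (P k) x)"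

definition vallee_poussin ::
  "(real \<Rightarrow> real) \<Rightarrow> (nat \<Rightarrow> real poly) \<Rightarrow> nat \<Rightarrow> (real \<Rightarrow> real) \<Rightarrow> real \<Rightarrow> real" where
  "vallee_poussin w P m f x = (1 / real m) * (\<Sum>k = m + 1..2 * m. fourier_sum w P k f x)"

end

theory Submission
  imports Defs
begin

text \<open>A polynomial of degree \<open>n\<close>, multiplied by \<open>w\<close>, is negligible outside an interval of length
  proportional to \<open>n\<^bsup>1/l\<^esup>\<close> (restricted range inequality). Inside it the substitution of polynomials for the
  weight gives the bound \<open>n\<^bsup>1-1/l\<^esup>\<close> for the reciprocal of the Christoffel function. With the
  Christoffel-Darboux formula this bounds the weighted \<open>L\<^sub>1\<close> norms of the kernel of \<open>V\<^sub>n\<close>, so that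
  \<open>V\<^sub>n\<close> is bounded on all \<open>L\<^sub>p\<close> by Schur's test; and since \<open>V\<^sub>n\<close> reproduces polynomials of degree \<open>n\<close>,
  the same bounds give the Nikolskii inequality between \<open>L\<^sub>p\<close> and \<open>L\<^sub>q\<close>.

  For the Jackson estimate in \<open>L\<^sub>p\<close> with one derivative, subtract \<open>f 0\<close>, cut \<open>f\<close> off, divide it by a
  polynomial \<open>S\<close> that imitates \<open>1/w\<close>, convolve with a polynomial kernel and multiply by \<open>S\<close>; Hardy's
  inequality controls the error. Iterating over primitives gives the rate \<open>n\<^bsup>-(1-1/l)r\<^esup>\<close>, for \<open>V\<^sub>n\<close> as
  well because it is bounded and reproduces polynomials. To pass from \<open>L\<^sub>p\<close> to \<open>L\<^sub>q\<close>, write \<open>f - V\<^sub>n f\<close>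
  as the sum of the differences \<open>V\<^bsub>2N\<^esub> f - V\<^bsub>N\<^esub> f\<close>, \<open>N = 2\<^sup>j n\<close>, and apply the Nikolskii inequality
  to each of them.\<close>

subsection \<open>Estimates in \<open>L\<^sub>p\<close>\<close>

text \<open>The number \<open>width n / n = n powr (- \<beta>)\<close> is the length on which a
  weighted polynomial of degree n can vary. It is the reciprocal of the Christoffel bound, the width
  of the kernel of \<open>V\<^sub>n\<close> and the gain per derivative in Jackson's estimate. The
  hypothesis l > 1 lets w beat the growth of polynomials, gives the Taylor remainder of
  \<open>\<bar>x\<bar> powr l\<close> an exponent above 1, so that it can be imitated by polynomials
  of degree O(n), and makes the factor \<open>\<Omega> = 1 + \<bar>x\<bar> powr (l - 1)\<close>
  gained by Hardy's inequality unbounded. The obstacle is that unweighted approximation gives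
  information on a bounded interval only, while a polynomial may explode outside. Estimates on an
  interval of length O(\<open>width n\<close>) are therefore completed by the restricted range
  inequality, always taken at the true degree of the polynomial. The passage to
  \<open>L\<^sub>q\<close> costs a power \<delta> of the degree in each dyadic block; positivity of
  the rate is exactly what makes the sum over the blocks geometric.\<close>

lemma ennpowr_ennreal [simp]: "0 \<le> r \<Longrightarrow> ennpowr (ennreal r) s = ennreal (r powr s)"
  by (simp add: ennpowr_def)

lemma ennpowr_top [simp]: "ennpowr \<infinity> s = \<infinity>" "ennpowr top s = top"
  by (simp_all add: ennpowr_def)

lemma ennpowr_0 [simp]: "ennpowr 0 s = 0"
  by (simp add: ennpowr_def)

lemma ennpowr_mono:
  assumes "x \<le> y" "0 \<le> s"
  shows "ennpowr x s \<le> ennpowr y s"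
proof (cases "y = \<infinity>")
  case False
  then obtain b where b: "y = ennreal b" "0 \<le> b"
    by (cases y) auto
  with assms obtain c where c: "x = ennreal c" "0 \<le> c"
    by (cases x) (auto simp: top_unique)
  show ?thesis
    using assms b c by (auto intro!: ennreal_leI powr_mono2)
qed simp

lemma ennpowr_mult:
  assumes "0 < r"
  shows "ennpowr (ennreal r * x) s = ennreal (r powr s) * ennpowr x s"
proof (cases x)
  case (real b)
  then show ?thesis
    using assms by (simp add: ennreal_mult[symmetric] powr_mult)
next
  case top
  then show ?thesis
    using assms by (simp add: ennreal_mult_top)
qed

lemma ennpowr_eq_0_iff: "0 < s \<Longrightarrow> ennpowr x s = 0 \<longleftrightarrow> x = 0"
  by (cases x) (auto simp: ennreal_eq_0_iff)

lemma ennpowr_1 [simp]: "ennpowr x 1 = x"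
  by (cases x) auto

lemma ennpowr_ennpowr:
  "ennpowr (ennpowr x s) t = ennpowr x (s * t)"
  by (cases x) (auto simp: powr_powr)

lemma measurable_ennpowr [measurable (raw)]:
  assumes [measurable]: "f \<in> borel_measurable M"
  shows "(\<lambda>x. ennpowr (f x) s) \<in> borel_measurable M"
  unfolding ennpowr_def by measurable

text \<open>Case distinctions on exponents go through this rule, so that a finite exponent is
  handled as a real number.\<close>

lemma exponent_cases:
  assumes "(1::ennreal) \<le> p"
  obtains "p = \<infinity>" "recip p = 0"
  | s where "1 \<le> s" "p = ennreal s" "p \<noteq> \<infinity>" "enn2real p = s" "recip p = 1 / s"
proof (cases p)
  case (real r)
  then have "1 \<le> r" using assms by simp
  moreover have "recip p = 1 / r"
    using real \<open>1 \<le> r\<close> by (simp add: recip_def inverse_ennreal divide_inverse)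
  ultimately show ?thesis using that(2)[of r] real by auto
next
  case top
  then show ?thesis using that(1) by (simp add: recip_def)
qed

lemma recip_bounds:
  assumes "(1::ennreal) \<le> p"
  shows "0 \<le> recip p" "recip p \<le> 1"
  using assms by (auto elim!: exponent_cases)

lemma recip_antimono:
  assumes "(1::ennreal) \<le> p" "p \<le> q"
  shows "recip q \<le> recip p"
proof -
  have q: "1 \<le> q" using assms by auto
  show ?thesis
  proof (cases rule: exponent_cases[OF assms(1)])
    case 1
    then show ?thesis using assms by (simp add: top_unique)
  next
    case p: (2 s)
    show ?thesis
    proof (cases rule: exponent_cases[OF q])
      case 1
      then show ?thesis using recip_bounds[OF assms(1)] by simp
    next
      case (2 t)
      then show ?thesis using p assms by (auto simp: frac_le)
    qed
  qed
qed

text \<open>Integrate Young's inequality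
  \<open>y \<le> s powr (1 - p) / p * y powr p + (1 - 1 / p) * s\<close> against the weight k. No
  conjugate exponent occurs, so p = 1 and infinite values of h are covered.\<close>

lemma jensen_nn_integral:
  fixes k h :: "'a \<Rightarrow> ennreal"
  assumes [measurable]: "k \<in> borel_measurable M" "h \<in> borel_measurable M"
    and A: "(\<integral>\<^sup>+x. k x \<partial>M) \<le> ennreal A" "0 < A" and p: "1 \<le> p"
    and I: "(\<integral>\<^sup>+x. k x * ennpowr (h x) p \<partial>M) \<le> ennreal i" "0 \<le> i"
  shows "(\<integral>\<^sup>+x. k x * h x \<partial>M) \<le> ennreal (A powr (1 - 1 / p) * i powr (1 / p))"
proof (cases "i = 0")
  case True
  then have "(\<integral>\<^sup>+x. k x * ennpowr (h x) p \<partial>M) = 0"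
    using I by simp
  then have "AE x in M. k x * ennpowr (h x) p = 0"
    by (subst (asm) nn_integral_0_iff_AE) auto
  then have "AE x in M. k x * h x = 0"
    by eventually_elim (use p in \<open>auto simp: ennpowr_eq_0_iff\<close>)
  then have "(\<integral>\<^sup>+x. k x * h x \<partial>M) = 0"
    by (subst nn_integral_0_iff_AE) auto
  then show ?thesis by simp
next
  case False
  then have i: "0 < i" using I by simp
  \<comment> \<open>With this s the two terms of Young's inequality integrate to multiples of
    \<open>s * A\<close> that add up to exactly \<open>s * A\<close>.\<close>
  define s where "s = (i / A) powr (1 / p)"
  have s: "0 < s" using i A by (simp add: s_def)
  have sp: "s powr p = i / A" using p i A by (simp add: s_def powr_powr)
  have real_bound: "y \<le> s powr (1 - p) / p * y powr p + (1 - 1 / p) * s" if "0 \<le> y" for y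
  proof (cases "y = 0")
    case False
    then have y: "0 < y" using that by simp
    have "(s powr (1 - p) * y powr p) powr (1 / p) * s powr (1 - 1 / p) =
        (s powr ((1 - p) / p) * s powr (1 - 1 / p)) * y"
      using s y p by (simp add: powr_mult powr_powr)
    also have "s powr ((1 - p) / p) * s powr (1 - 1 / p) = s powr ((1 - p) / p + (1 - 1 / p))"
      by (rule powr_add[symmetric])
    also have "(1 - p) / p + (1 - 1 / p) = 0" using p by (simp add: field_simps)
    finally have "y = (s powr (1 - p) * y powr p) powr (1 / p) * s powr (1 - 1 / p)"
      using s by simp
    also have "\<dots> \<le> (1 / p) * (s powr (1 - p) * y powr p) + (1 - 1 / p) * s"
      by (rule Youngs_inequality_0) (use p s y in auto)
    finally show ?thesis by simp
  qed (use p s in auto)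
  have bound: "h x \<le> ennreal (s powr (1 - p) / p) * ennpowr (h x) p + ennreal ((1 - 1 / p) * s)" for x
  proof (cases "h x")
    case (real r)
    then show ?thesis
      using real_bound[of r] p s
      by (simp add: ennreal_mult[symmetric] ennreal_plus[symmetric] del: ennreal_plus)
  next
    case top
    then show ?thesis using p s by (simp add: ennreal_mult_top)
  qed
  have "(\<integral>\<^sup>+x. k x * h x \<partial>M) \<le>
     (\<integral>\<^sup>+x. ennreal (s powr (1 - p) / p) * (k x * ennpowr (h x) p) + ennreal ((1 - 1 / p) * s) * k x \<partial>M)"
    by (rule nn_integral_mono, rule order_trans[OF mult_left_mono[OF bound]])
       (auto simp: distrib_left ac_simps)
  also have "\<dots> = ennreal (s powr (1 - p) / p) * (\<integral>\<^sup>+x. k x * ennpowr (h x) p \<partial>M)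
      + ennreal ((1 - 1 / p) * s) * (\<integral>\<^sup>+x. k x \<partial>M)"
    by (simp add: nn_integral_add nn_integral_cmult)
  also have "\<dots> \<le> ennreal (s powr (1 - p) / p) * ennreal i + ennreal ((1 - 1 / p) * s) * ennreal A"
    by (intro add_mono mult_left_mono I A) auto
  also have "\<dots> = ennreal (s powr (1 - p) / p * i + (1 - 1 / p) * s * A)"
    using s i A p by (simp add: ennreal_mult[symmetric] ennreal_plus[symmetric] del: ennreal_plus)
  also have "s powr (1 - p) * i = s * A"
  proof -
    have "s powr (1 - p) = s / (i / A)"
      using s sp by (simp add: powr_diff)
    then show ?thesis using i A by simp
  qed
  then have "s powr (1 - p) / p * i + (1 - 1 / p) * s * A = s * A"
    using p by (simp add: field_simps)
  also have "s * A = A powr (1 - 1 / p) * i powr (1 / p)"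
    using A i by (simp add: s_def powr_diff powr_divide field_simps)
  finally show ?thesis .
qed

lemma jensen_ennpowr:
  fixes k h :: "'a \<Rightarrow> ennreal"
  assumes [measurable]: "k \<in> borel_measurable M" "h \<in> borel_measurable M"
    and A: "(\<integral>\<^sup>+x. k x \<partial>M) \<le> ennreal A" "0 < A" and p: "1 \<le> p"
  shows "ennpowr (\<integral>\<^sup>+x. k x * h x \<partial>M) p
    \<le> ennreal (A powr (p - 1)) * (\<integral>\<^sup>+x. k x * ennpowr (h x) p \<partial>M)"
proof (cases "\<integral>\<^sup>+x. k x * ennpowr (h x) p \<partial>M")
  case (real i)
  have "(\<integral>\<^sup>+x. k x * h x \<partial>M) \<le> ennreal (A powr (1 - 1 / p) * i powr (1 / p))"
    by (rule jensen_nn_integral) (use assms real in auto)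
  then have "ennpowr (\<integral>\<^sup>+x. k x * h x \<partial>M) p
      \<le> ennpowr (ennreal (A powr (1 - 1 / p) * i powr (1 / p))) p"
    by (rule ennpowr_mono) (use p in auto)
  also have "\<dots> = ennreal ((A powr (1 - 1 / p) * i powr (1 / p)) powr p)"
    by simp
  also have "(A powr (1 - 1 / p) * i powr (1 / p)) powr p = A powr (p - 1) * i"
    using A real p by (simp add: powr_mult powr_powr left_diff_distrib)
  finally show ?thesis using real by (simp add: ennreal_mult)
next
  case top
  then show ?thesis using A by (simp add: ennreal_mult_top)
qed

text \<open>Norm bounds are kept as a predicate with a real bound: roots of extended reals are
  avoided, and u may be a kernel integral or a series whose finiteness is not known
  beforehand.\<close>

definition Lp_le :: "ennreal \<Rightarrow> (real \<Rightarrow> ennreal) \<Rightarrow> real \<Rightarrow> bool" where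
  "Lp_le p u c \<longleftrightarrow>
    (if p = \<infinity> then AE x in lborel. u x \<le> ennreal c
     else (\<integral>\<^sup>+x. ennpowr (u x) (enn2real p) \<partial>lborel) \<le> ennreal (c powr enn2real p))"

lemma Lp_le_mono:
  assumes "Lp_le p v c" "AE x in lborel. u x \<le> v x" "1 \<le> p" "0 \<le> c" "c \<le> d"
  shows "Lp_le p u d"
proof (cases rule: exponent_cases[OF \<open>1 \<le> p\<close>])
  case 1
  have "AE x in lborel. v x \<le> ennreal c" using assms(1) 1 by (simp add: Lp_le_def)
  then have "AE x in lborel. u x \<le> ennreal d"
    using assms(2) by eventually_elim (use assms(4,5) in \<open>meson ennreal_leI order_trans\<close>)
  then show ?thesis using 1 by (simp add: Lp_le_def)
next
  case (2 s)
  have "(\<integral>\<^sup>+x. ennpowr (u x) s \<partial>lborel) \<le> (\<integral>\<^sup>+x. ennpowr (v x) s \<partial>lborel)"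
  proof (rule nn_integral_mono_AE, use assms(2) in eventually_elim)
    fix x assume "u x \<le> v x"
    then show "ennpowr (u x) s \<le> ennpowr (v x) s"
      by (rule ennpowr_mono) (use 2 in simp)
  qed
  also have "\<dots> \<le> ennreal (c powr s)" using assms(1) 2 by (simp add: Lp_le_def)
  also have "\<dots> \<le> ennreal (d powr s)"
    using assms(4,5) 2 by (intro ennreal_leI powr_mono2) auto
  finally show ?thesis using 2 by (simp add: Lp_le_def)
qed

lemma Lp_le_cmult:
  assumes "Lp_le p u c" "0 < r" "0 \<le> c" "1 \<le> p" and [measurable]: "u \<in> borel_measurable borel"
  shows "Lp_le p (\<lambda>x. ennreal r * u x) (r * c)"
proof (cases rule: exponent_cases[OF \<open>1 \<le> p\<close>])
  case 1
  have "AE x in lborel. u x \<le> ennreal c" using assms(1) 1 by (simp add: Lp_le_def)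
  then have "AE x in lborel. ennreal r * u x \<le> ennreal (r * c)"
    by eventually_elim (use assms in \<open>simp add: ennreal_mult mult_left_mono\<close>)
  then show ?thesis using 1 by (simp add: Lp_le_def)
next
  case (2 s)
  have "(\<integral>\<^sup>+x. ennpowr (ennreal r * u x) s \<partial>lborel)
      = ennreal (r powr s) * (\<integral>\<^sup>+x. ennpowr (u x) s \<partial>lborel)"
    using assms(2) by (simp add: ennpowr_mult nn_integral_cmult)
  also have "\<dots> \<le> ennreal (r powr s) * ennreal (c powr s)"
    using assms(1) 2 by (intro mult_left_mono) (auto simp: Lp_le_def)
  also have "\<dots> = ennreal ((r * c) powr s)"
    using assms by (simp add: ennreal_mult powr_mult)
  finally show ?thesis using 2 by (simp add: Lp_le_def)
qed

lemma Lp_le_AE_finite: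
  assumes "Lp_le p u c" "1 \<le> p" and [measurable]: "u \<in> borel_measurable borel"
  shows "AE x in lborel. u x < \<infinity>"
proof (cases rule: exponent_cases[OF \<open>1 \<le> p\<close>])
  case 1
  have "AE x in lborel. u x \<le> ennreal c" using assms(1) 1 by (simp add: Lp_le_def)
  then show ?thesis
    by eventually_elim (auto simp: le_less_trans)
next
  case (2 s)
  have "(\<integral>\<^sup>+x. ennpowr (u x) s \<partial>lborel) \<le> ennreal (c powr s)"
    using assms(1) 2 by (simp add: Lp_le_def)
  then have "(\<integral>\<^sup>+x. ennpowr (u x) s \<partial>lborel) \<noteq> \<infinity>"
    by (auto simp: top_unique)
  then have "AE x in lborel. ennpowr (u x) s \<noteq> \<infinity>"
    by (intro nn_integral_noteq_infinite) auto
  then show ?thesis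
    by eventually_elim (auto simp: less_top[symmetric])
qed

text \<open>Countable Minkowski: Jensen's inequality for the weights \<open>\<alpha> j\<close> applied to \<open>u j / \<alpha> j\<close>.\<close>

lemma Lp_le_suminf:
  fixes u :: "nat \<Rightarrow> real \<Rightarrow> ennreal"
  assumes u: "\<And>j. Lp_le p (u j) (\<alpha> j)" and p: "1 \<le> p"
    and \<alpha>: "\<And>j. 0 < \<alpha> j" "summable \<alpha>"
    and [measurable]: "\<And>j. u j \<in> borel_measurable borel"
  shows "Lp_le p (\<lambda>x. \<Sum>j. u j x) (\<Sum>j. \<alpha> j)"
proof -
  define A where "A = (\<Sum>j. \<alpha> j)"
  have A: "0 < A" unfolding A_def by (rule suminf_pos) (use \<alpha> in auto)
  have sumA: "(\<Sum>j. ennreal (\<alpha> j)) = ennreal A"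
    unfolding A_def by (rule suminf_ennreal2) (use \<alpha> in \<open>auto intro: less_imp_le\<close>)
  have inv: "ennreal (\<alpha> j) * (ennreal (1 / \<alpha> j) * y) = y" for j y
    using \<alpha>(1)[of j] by (simp add: mult.assoc[symmetric] ennreal_mult[symmetric])
  show ?thesis
  proof (cases rule: exponent_cases[OF \<open>1 \<le> p\<close>])
    case 1
    have "AE x in lborel. u j x \<le> ennreal (\<alpha> j)" for j using u[of j] 1 by (simp add: Lp_le_def)
    then have "AE x in lborel. \<forall>j. u j x \<le> ennreal (\<alpha> j)" by (simp add: AE_all_countable)
    then have "AE x in lborel. (\<Sum>j. u j x) \<le> (\<Sum>j. ennreal (\<alpha> j))"
      by eventually_elim (intro suminf_le, auto)
    then show ?thesis using 1 sumA by (simp add: Lp_le_def A_def)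
  next
    case (2 s)
    have pw: "ennpowr (\<Sum>j. u j x) s \<le> ennreal (A powr (s - 1)) *
        (\<Sum>j. ennreal (\<alpha> j) * ennpowr (ennreal (1 / \<alpha> j) * u j x) s)" for x
      using jensen_ennpowr[of "\<lambda>j. ennreal (\<alpha> j)" "count_space UNIV"
            "\<lambda>j. ennreal (1 / \<alpha> j) * u j x" A s] sumA A 2
      by (simp add: nn_integral_count_space_nat inv)
    have "(\<integral>\<^sup>+x. ennpowr (\<Sum>j. u j x) s \<partial>lborel) \<le> (\<integral>\<^sup>+x. ennreal (A powr (s - 1)) *
        (\<Sum>j. ennreal (\<alpha> j) * ennpowr (ennreal (1 / \<alpha> j) * u j x) s) \<partial>lborel)"
      by (intro nn_integral_mono pw)
    also have "\<dots> = ennreal (A powr (s - 1)) * (\<Sum>j. ennreal (\<alpha> j) *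
        (\<integral>\<^sup>+x. ennpowr (ennreal (1 / \<alpha> j) * u j x) s \<partial>lborel))"
      by (simp add: nn_integral_cmult nn_integral_suminf)
    also have "\<dots> \<le> ennreal (A powr (s - 1)) * (\<Sum>j. ennreal (\<alpha> j))"
    proof (intro mult_left_mono suminf_le)
      fix j
      have "Lp_le p (\<lambda>x. ennreal (1 / \<alpha> j) * u j x) (1 / \<alpha> j * \<alpha> j)"
        by (rule Lp_le_cmult) (use u \<alpha> p in \<open>auto intro: less_imp_le\<close>)
      then have "(\<integral>\<^sup>+x. ennpowr (ennreal (1 / \<alpha> j) * u j x) s \<partial>lborel) \<le> 1"
        using 2 \<alpha>(1)[of j] by (simp add: Lp_le_def)
      then show "ennreal (\<alpha> j) * (\<integral>\<^sup>+x. ennpowr (ennreal (1 / \<alpha> j) * u j x) s \<partial>lborel)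
          \<le> ennreal (\<alpha> j)"
        using mult_left_mono[of _ 1 "ennreal (\<alpha> j)"] by simp
    qed auto
    also have "\<dots> = ennreal (A powr s)"
      using A 2 unfolding sumA by (simp add: ennreal_mult[symmetric] powr_diff)
    finally show ?thesis using 2 by (simp add: Lp_le_def A_def)
  qed
qed

text \<open>As for series, with Jensen's inequality on a two-point space: \<open>True\<close>
  carries the mass c and \<open>False\<close> the mass d.\<close>

lemma Lp_le_add:
  assumes u: "Lp_le p u c" and v: "Lp_le p v d" and p: "1 \<le> p"
    and c: "0 < c" and d: "0 < d"
    and [measurable]: "u \<in> borel_measurable borel" "v \<in> borel_measurable borel"
  shows "Lp_le p (\<lambda>x. u x + v x) (c + d)"
proof (cases rule: exponent_cases[OF \<open>1 \<le> p\<close>])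
  case 1
  have "AE x in lborel. u x \<le> ennreal c" "AE x in lborel. v x \<le> ennreal d"
    using u v 1 by (auto simp: Lp_le_def)
  then have "AE x in lborel. u x + v x \<le> ennreal (c + d)"
    by eventually_elim (use c d in \<open>auto simp: ennreal_plus add_mono\<close>)
  then show ?thesis using 1 by (simp add: Lp_le_def)
next
  case (2 s)
  have inv: "ennreal r * (ennreal (1 / r) * y) = y" if "0 < r" for r y
    using that by (simp add: mult.assoc[symmetric] ennreal_mult[symmetric])
  have norm: "(\<integral>\<^sup>+x. ennpowr (ennreal (1 / r) * f x) s \<partial>lborel) \<le> 1"
    if "0 < r" "Lp_le p f r" and [measurable]: "f \<in> borel_measurable borel" for r f
  proof -
    have "Lp_le p (\<lambda>x. ennreal (1 / r) * f x) (1 / r * r)"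
      by (rule Lp_le_cmult) (use that p in auto)
    then show ?thesis using 2 that by (simp add: Lp_le_def)
  qed
  have pw: "ennpowr (u x + v x) s \<le> ennreal ((c + d) powr (s - 1)) *
      (ennreal c * ennpowr (ennreal (1 / c) * u x) s + ennreal d * ennpowr (ennreal (1 / d) * v x) s)" for x
    using jensen_ennpowr[of "\<lambda>b. ennreal (if b then c else d)" "count_space UNIV"
          "\<lambda>b. if b then ennreal (1 / c) * u x else ennreal (1 / d) * v x" "c + d" s] c d 2
    by (simp add: nn_integral_count_space_finite UNIV_bool inv add.commute ennreal_plus[symmetric]
          del: ennreal_plus)
  have "(\<integral>\<^sup>+x. ennpowr (u x + v x) s \<partial>lborel) \<le> (\<integral>\<^sup>+x. ennreal ((c + d) powr (s - 1)) *
      (ennreal c * ennpowr (ennreal (1 / c) * u x) s + ennreal d * ennpowr (ennreal (1 / d) * v x) s) \<partial>lborel)"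
    by (intro nn_integral_mono pw)
  also have "\<dots> = ennreal ((c + d) powr (s - 1)) *
      (ennreal c * (\<integral>\<^sup>+x. ennpowr (ennreal (1 / c) * u x) s \<partial>lborel)
       + ennreal d * (\<integral>\<^sup>+x. ennpowr (ennreal (1 / d) * v x) s \<partial>lborel))"
    by (simp add: nn_integral_cmult nn_integral_add)
  also have "\<dots> \<le> ennreal ((c + d) powr (s - 1)) * (ennreal c * 1 + ennreal d * 1)"
    by (intro mult_left_mono add_mono norm) (use assms in auto)
  also have "\<dots> = ennreal ((c + d) powr s)"
    using c d by (simp add: ennreal_plus[symmetric] ennreal_mult[symmetric] powr_diff del: ennreal_plus)
  finally show ?thesis using 2 by (simp add: Lp_le_def)
qed

text \<open>Row integrals at most A allow Jensen's inequality for the weight \<open>k x\<close>,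
  which costs \<open>A powr (s - 1)\<close>; after Fubini the column integrals contribute the
  remaining factor A. The same kernel bound thus serves all p.\<close>

lemma schur_test:
  fixes k :: "real \<Rightarrow> real \<Rightarrow> ennreal"
  assumes k [measurable]: "case_prod k \<in> borel_measurable (borel \<Otimes>\<^sub>M borel)"
    and row: "\<And>x. (\<integral>\<^sup>+t. k x t \<partial>lborel) \<le> ennreal A"
    and col: "\<And>t. (\<integral>\<^sup>+x. k x t \<partial>lborel) \<le> ennreal A"
    and A: "0 < A" and p: "1 \<le> p" and c: "0 \<le> c"
    and h: "Lp_le p h c" and [measurable]: "h \<in> borel_measurable borel"
  shows "Lp_le p (\<lambda>x. \<integral>\<^sup>+t. k x t * h t \<partial>lborel) (A * c)"
proof (cases rule: exponent_cases[OF \<open>1 \<le> p\<close>])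
  case 1
  have hc: "AE t in lborel. h t \<le> ennreal c" using h 1 by (simp add: Lp_le_def)
  have "(\<integral>\<^sup>+t. k x t * h t \<partial>lborel) \<le> ennreal (A * c)" for x
  proof -
    have "(\<integral>\<^sup>+t. k x t * h t \<partial>lborel) \<le> (\<integral>\<^sup>+t. k x t * ennreal c \<partial>lborel)"
      by (rule nn_integral_mono_AE) (use hc in eventually_elim, auto intro: mult_left_mono)
    also have "\<dots> = (\<integral>\<^sup>+t. k x t \<partial>lborel) * ennreal c"
      by (simp add: nn_integral_multc)
    also have "\<dots> \<le> ennreal A * ennreal c"
      by (intro mult_right_mono row) auto
    finally show ?thesis using A c by (simp add: ennreal_mult)
  qed
  then show ?thesis using 1 by (simp add: Lp_le_def)
next
  case (2 s)
  have "(\<integral>\<^sup>+x. ennpowr (\<integral>\<^sup>+t. k x t * h t \<partial>lborel) s \<partial>lborel)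
      \<le> (\<integral>\<^sup>+x. ennreal (A powr (s - 1)) * (\<integral>\<^sup>+t. k x t * ennpowr (h t) s \<partial>lborel) \<partial>lborel)"
    by (intro nn_integral_mono jensen_ennpowr) (use row A 2 in auto)
  also have "\<dots> = ennreal (A powr (s - 1)) * (\<integral>\<^sup>+x. (\<integral>\<^sup>+t. k x t * ennpowr (h t) s \<partial>lborel) \<partial>lborel)"
    by (rule nn_integral_cmult) simp
  also have "(\<integral>\<^sup>+x. (\<integral>\<^sup>+t. k x t * ennpowr (h t) s \<partial>lborel) \<partial>lborel)
      = (\<integral>\<^sup>+t. (\<integral>\<^sup>+x. k x t * ennpowr (h t) s \<partial>lborel) \<partial>lborel)"
    by (rule lborel_pair.Fubini') simp
  also have "\<dots> = (\<integral>\<^sup>+t. (\<integral>\<^sup>+x. k x t \<partial>lborel) * ennpowr (h t) s \<partial>lborel)"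
    by (simp add: nn_integral_multc)
  also have "\<dots> \<le> (\<integral>\<^sup>+t. ennreal A * ennpowr (h t) s \<partial>lborel)"
    by (intro nn_integral_mono mult_right_mono col) auto
  also have "\<dots> = ennreal A * (\<integral>\<^sup>+t. ennpowr (h t) s \<partial>lborel)"
    by (simp add: nn_integral_cmult)
  also have "\<dots> \<le> ennreal A * ennreal (c powr s)"
    using h 2 by (intro mult_left_mono) (auto simp: Lp_le_def)
  also have "ennreal (A powr (s - 1)) * (ennreal A * ennreal (c powr s)) = ennreal ((A * c) powr s)"
    using A c by (simp add: ennreal_mult[symmetric] powr_mult powr_diff)
  finally show ?thesis using 2 by (simp add: Lp_le_def mult_left_mono)
qed

text \<open>Hoelder's inequality on an interval of length \<open>2 * R\<close>: for finite p,
  Jensen's inequality with exponent \<open>s / t\<close> is applied to the t-th power of h.\<close>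

lemma Lp_le_interval:
  assumes h: "Lp_le p h c" and q: "1 \<le> q" "q \<le> p" and R: "0 < R" and c: "0 \<le> c"
    and [measurable]: "h \<in> borel_measurable borel"
  shows "Lp_le q (\<lambda>x. h x * indicator {-R..R} x) ((2 * R) powr (recip q - recip p) * c)"
proof -
  have p: "1 \<le> p" using q by auto
  have len: "(\<integral>\<^sup>+x. indicator {-R..R} x \<partial>lborel) = ennreal (2 * R)"
    using R by simp
  show ?thesis
  proof (cases rule: exponent_cases[OF p])
    case 1
    have hc: "AE t in lborel. h t \<le> ennreal c" using h 1 by (simp add: Lp_le_def)
    show ?thesis
    proof (cases rule: exponent_cases[OF q(1)])
      case q': 1
      have "AE t in lborel. h t * indicator {-R..R} t \<le> ennreal c"
        using hc by eventually_elim (auto split: split_indicator)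
      then show ?thesis using 1 q' R by (simp add: Lp_le_def)
    next
      case (2 s)
      have "(\<integral>\<^sup>+x. ennpowr (h x * indicator {-R..R} x) s \<partial>lborel)
          \<le> (\<integral>\<^sup>+x. ennreal (c powr s) * indicator {-R..R} x \<partial>lborel)"
      proof (rule nn_integral_mono_AE, use hc in eventually_elim)
        fix x assume "h x \<le> ennreal c"
        then have "ennpowr (h x) s \<le> ennpowr (ennreal c) s"
          by (rule ennpowr_mono) (use 2 in auto)
        then show "ennpowr (h x * indicator {-R..R} x) s \<le> ennreal (c powr s) * indicator {-R..R} x"
          using c by (auto split: split_indicator)
      qed
      also have "\<dots> = ennreal (c powr s) * ennreal (2 * R)"
        using R by (simp add: nn_integral_cmult len del: ennreal_mult'')
      also have "\<dots> = ennreal (((2 * R) powr (1 / s) * c) powr s)"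
        using R c 2 by (simp add: ennreal_mult[symmetric] powr_mult powr_powr ac_simps)
      finally show ?thesis using 1 2 by (simp add: Lp_le_def)
    qed
  next
    case pp: (2 s)
    have "q \<noteq> \<infinity>" using pp q by (auto simp: top_unique)
    then obtain t where t: "1 \<le> t" "q = ennreal t" "enn2real q = t" "recip q = 1 / t"
      using exponent_cases[OF q(1)] by metis
    have ts: "t \<le> s" using q pp t by simp
    have "(\<integral>\<^sup>+x. ennpowr (h x * indicator {-R..R} x) t \<partial>lborel)
        = (\<integral>\<^sup>+x. indicator {-R..R} x * ennpowr (h x) t \<partial>lborel)"
      by (intro nn_integral_cong) (auto split: split_indicator)
    also have "\<dots> \<le> ennreal ((2 * R) powr (1 - 1 / (s / t)) * (c powr s) powr (1 / (s / t)))"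
    proof (rule jensen_nn_integral)
      have "(\<integral>\<^sup>+x. indicator {-R..R} x * ennpowr (ennpowr (h x) t) (s / t) \<partial>lborel)
         \<le> (\<integral>\<^sup>+x. ennpowr (h x) s \<partial>lborel)"
        using t by (intro nn_integral_mono) (auto split: split_indicator simp: ennpowr_ennpowr)
      also have "\<dots> \<le> ennreal (c powr s)" using h pp by (simp add: Lp_le_def)
      finally show "(\<integral>\<^sup>+x. indicator {-R..R} x * ennpowr (ennpowr (h x) t) (s / t) \<partial>lborel)
          \<le> ennreal (c powr s)" .
    qed (use R ts t pp len in auto)
    also have "(2 * R) powr (1 - 1 / (s / t)) * (c powr s) powr (1 / (s / t))
        = ((2 * R) powr (1 / t - 1 / s) * c) powr t"
    proof -
      have "(1 / t - 1 / s) * t = 1 - t / s" using t pp by (simp add: field_simps)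
      then show ?thesis using R c t pp by (simp add: powr_mult powr_powr)
    qed
    finally show ?thesis using t pp \<open>q \<noteq> \<infinity>\<close> by (simp add: Lp_le_def)
  qed
qed

text \<open>Enlarging the power of \<open>2 * R\<close> to the first power gives one form for every
  p. The loss is harmless where exponential factors decide.\<close>

lemma nn_integral_interval_le:
  assumes h: "Lp_le p h c" and p: "1 \<le> p" and R: "1 \<le> R" and c: "0 \<le> c"
    and [measurable]: "h \<in> borel_measurable borel"
  shows "(\<integral>\<^sup>+x. h x * indicator {-R..R} x \<partial>lborel) \<le> ennreal (2 * R * c)"
proof -
  have "Lp_le 1 (\<lambda>x. h x * indicator {-R..R} x) ((2 * R) powr (recip 1 - recip p) * c)"
    by (rule Lp_le_interval) (use assms in auto)
  then have "(\<integral>\<^sup>+x. h x * indicator {-R..R} x \<partial>lborel) \<le> ennreal ((2 * R) powr (recip 1 - recip p) * c)"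
    using c by (simp add: Lp_le_def)
  also have "(2 * R) powr (recip 1 - recip p) \<le> (2 * R) powr 1"
    using R recip_bounds[OF p] by (intro powr_mono) (auto simp: recip_def)
  then have "ennreal ((2 * R) powr (recip 1 - recip p) * c) \<le> ennreal (2 * R * c)"
    using R c by (intro ennreal_leI mult_right_mono) auto
  finally show ?thesis .
qed

text \<open>The abstract Nikolskii inequality. Since k is at most \<kappa>, Jensen's inequality
  bounds u uniformly by its \<open>L\<^sub>p\<close> norm; for finite q, interpolate by
  \<open>u powr t \<le> D powr (t - s) * u powr s\<close>.\<close>

lemma Lp_le_reproducing:
  fixes k :: "real \<Rightarrow> real \<Rightarrow> ennreal"
  assumes k [measurable]: "case_prod k \<in> borel_measurable (borel \<Otimes>\<^sub>M borel)"
    and repr: "\<And>x. u x \<le> (\<integral>\<^sup>+t. k x t * u t \<partial>lborel)"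
    and row: "\<And>x. (\<integral>\<^sup>+t. k x t \<partial>lborel) \<le> ennreal A"
    and bnd: "\<And>x t. k x t \<le> ennreal \<kappa>"
    and A: "1 \<le> A" and \<kappa>: "0 < \<kappa>" and c: "0 < c"
    and p: "1 \<le> p" "p \<le> q"
    and u: "Lp_le p u c" and [measurable]: "u \<in> borel_measurable borel"
  shows "Lp_le q u (A * \<kappa> powr (recip p - recip q) * c)"
proof -
  have q: "1 \<le> q" using p by auto
  show ?thesis
  proof (cases rule: exponent_cases[OF p(1)])
    case 1
    then have "q = p" using p by (simp add: top_unique)
    then show ?thesis
      using u A c \<kappa> p by (auto intro: Lp_le_mono[of p u c])
  next
    case pp: (2 s)
    define D where "D = A * \<kappa> powr (1 / s) * c"
    have D: "0 < D" using A \<kappa> c by (simp add: D_def)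
    have pw: "u x \<le> ennreal D" for x
    proof -
      have "u x \<le> (\<integral>\<^sup>+t. k x t * u t \<partial>lborel)" by (rule repr)
      also have "\<dots> \<le> ennreal (A powr (1 - 1 / s) * (\<kappa> * c powr s) powr (1 / s))"
      proof (rule jensen_nn_integral)
        have "(\<integral>\<^sup>+t. k x t * ennpowr (u t) s \<partial>lborel) \<le> (\<integral>\<^sup>+t. ennreal \<kappa> * ennpowr (u t) s \<partial>lborel)"
          by (intro nn_integral_mono mult_right_mono bnd) auto
        also have "\<dots> = ennreal \<kappa> * (\<integral>\<^sup>+t. ennpowr (u t) s \<partial>lborel)"
          by (simp add: nn_integral_cmult)
        also have "\<dots> \<le> ennreal \<kappa> * ennreal (c powr s)"
          using u pp by (intro mult_left_mono) (auto simp: Lp_le_def)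
        finally show "(\<integral>\<^sup>+t. k x t * ennpowr (u t) s \<partial>lborel) \<le> ennreal (\<kappa> * c powr s)"
          using \<kappa> by (simp add: ennreal_mult)
      qed (use row A pp \<kappa> in auto)
      also have "\<dots> \<le> ennreal D"
      proof (rule ennreal_leI)
        have "A powr (1 - 1 / s) \<le> A powr 1" using A pp by (intro powr_mono) auto
        moreover have "(\<kappa> * c powr s) powr (1 / s) = \<kappa> powr (1 / s) * c"
          using \<kappa> c pp by (simp add: powr_mult powr_powr)
        ultimately show "A powr (1 - 1 / s) * (\<kappa> * c powr s) powr (1 / s) \<le> D"
          unfolding D_def using A \<kappa> c by (simp add: mult.assoc mult_right_mono)
      qed
      finally show ?thesis .
    qed
    show ?thesis
    proof (cases rule: exponent_cases[OF q])
      case 1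
      then show ?thesis using pw pp by (simp add: Lp_le_def D_def)
    next
      case (2 t)
      have st: "s \<le> t" using p pp 2 by simp
      have "(\<integral>\<^sup>+x. ennpowr (u x) t \<partial>lborel)
          \<le> (\<integral>\<^sup>+x. ennreal (D powr (t - s)) * ennpowr (u x) s \<partial>lborel)"
      proof (rule nn_integral_mono)
        fix x
        obtain y where y: "u x = ennreal y" "0 \<le> y"
          using pw[of x] by (cases "u x") (auto simp: top_unique)
        have "y \<le> D" using pw[of x] y D by simp
        then have "y powr t \<le> D powr (t - s) * y powr s"
        proof (cases "y = 0")
          case False
          have "y powr t = y powr (t - s) * y powr s"
            using y False by (simp add: powr_add[symmetric])
          also have "\<dots> \<le> D powr (t - s) * y powr s"
            using y st \<open>y \<le> D\<close> by (intro mult_right_mono powr_mono2) auto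
          finally show ?thesis .
        qed simp
        then show "ennpowr (u x) t \<le> ennreal (D powr (t - s)) * ennpowr (u x) s"
          using y by (simp add: ennreal_mult[symmetric])
      qed
      also have "\<dots> = ennreal (D powr (t - s)) * (\<integral>\<^sup>+x. ennpowr (u x) s \<partial>lborel)"
        by (simp add: nn_integral_cmult)
      also have "\<dots> \<le> ennreal (D powr (t - s)) * ennreal (c powr s)"
        using u pp by (intro mult_left_mono) (auto simp: Lp_le_def)
      also have "\<dots> = ennreal (D powr (t - s) * c powr s)"
        by (simp add: ennreal_mult)
      also have "\<dots> \<le> ennreal ((A * \<kappa> powr (1 / s - 1 / t) * c) powr t)"
      proof (rule ennreal_leI)
        have "D powr (t - s) * c powr s = A powr (t - s) * \<kappa> powr ((t - s) / s) * c powr t"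
          using A \<kappa> c by (simp add: D_def powr_mult powr_powr powr_add[symmetric])
        also have "(t - s) / s = (1 / s - 1 / t) * t" using pp 2 by (simp add: field_simps)
        also have "A powr (t - s) * \<kappa> powr ((1 / s - 1 / t) * t) * c powr t
            \<le> A powr t * \<kappa> powr ((1 / s - 1 / t) * t) * c powr t"
          using A pp by (intro mult_right_mono powr_mono) auto
        also have "\<dots> = (A * \<kappa> powr (1 / s - 1 / t) * c) powr t"
          using A \<kappa> c by (simp add: powr_mult powr_powr)
        finally show "D powr (t - s) * c powr s \<le> (A * \<kappa> powr (1 / s - 1 / t) * c) powr t" .
      qed
      finally show ?thesis using 2 pp by (simp add: Lp_le_def)
    qed
  qed
qed

subsection \<open>Weak derivatives and absolute continuity\<close>

definition smooth_fun :: "(real \<Rightarrow> real) \<Rightarrow> bool" where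
  "smooth_fun f \<longleftrightarrow> (\<forall>k x. (deriv ^^ k) f field_differentiable (at x))"

text \<open>Smoothness is proved by membership in a family closed under differentiation, which
  spares formulas for higher derivatives.\<close>

lemma smooth_fun_coinduct:
  assumes "f \<in> F"
    and "\<And>g. g \<in> F \<Longrightarrow> \<exists>g'\<in>F. \<forall>x. (g has_field_derivative g' x) (at x)"
  shows "smooth_fun f"
proof -
  have step: "deriv g \<in> F \<and> (\<forall>x. g field_differentiable (at x))" if g: "g \<in> F" for g
  proof -
    obtain g' where g': "g' \<in> F" "\<And>x. (g has_field_derivative g' x) (at x)"
      using assms(2)[OF g] by blast
    then have "deriv g = g'" by (auto intro: DERIV_imp_deriv)
    with g' show ?thesis by (auto simp: field_differentiable_def)
  qed
  have "(deriv ^^ k) f \<in> F" for k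
    by (induction k) (use assms(1) step in auto)
  then show ?thesis using step by (auto simp: smooth_fun_def)
qed

lemma smooth_fun_antideriv:
  assumes "\<And>x. (f has_field_derivative g x) (at x)" "smooth_fun g"
  shows "smooth_fun f"
proof -
  have d: "deriv f = g" using assms(1) by (auto intro: DERIV_imp_deriv)
  have "(deriv ^^ k) f field_differentiable (at x)" for k x
  proof (cases k)
    case 0
    then show ?thesis using assms(1) by (auto simp: field_differentiable_def)
  next
    case (Suc j)
    then show ?thesis using assms(2) d
      by (simp add: funpow_swap1 smooth_fun_def)
  qed
  then show ?thesis by (simp add: smooth_fun_def)
qed

lemma smooth_fun_deriv: "smooth_fun f \<Longrightarrow> smooth_fun (deriv f)"
  unfolding smooth_fun_def
proof (intro allI)
  fix k x assume *: "\<forall>k x. (deriv ^^ k) f field_differentiable (at x)"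
  from *[THEN spec, of "Suc k"] show "(deriv ^^ k) (deriv f) field_differentiable (at x)"
    by (simp add: funpow_swap1)
qed

lemma smooth_fun_has_deriv: "smooth_fun f \<Longrightarrow> (f has_field_derivative deriv f x) (at x)"
  unfolding smooth_fun_def
proof -
  assume *: "\<forall>k x. (deriv ^^ k) f field_differentiable (at x)"
  from *[THEN spec, of 0] show ?thesis by (simp add: DERIV_deriv_iff_field_differentiable)
qed

lemma smooth_fun_lin_comb:
  assumes "smooth_fun f" "smooth_fun g"
  shows "smooth_fun (\<lambda>x. r * f x + s * g x)"
proof (rule smooth_fun_coinduct[where F="{\<lambda>x. r * f x + s * g x | r s f g. smooth_fun f \<and> smooth_fun g}"])
  fix h assume "h \<in> {\<lambda>x. r * f x + s * g x | r s f g. smooth_fun f \<and> smooth_fun g}"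
  then obtain r s f g where h: "h = (\<lambda>x. r * f x + s * g x)" and fg: "smooth_fun f" "smooth_fun g"
    by blast
  have "(h has_field_derivative r * deriv f x + s * deriv g x) (at x)" for x
    unfolding h using fg by (auto intro!: derivative_eq_intros smooth_fun_has_deriv)
  then show "\<exists>g'\<in>{\<lambda>x. r * f x + s * g x | r s f g. smooth_fun f \<and> smooth_fun g}.
      \<forall>x. (h has_field_derivative g' x) (at x)"
    using smooth_fun_deriv[OF fg(1)] smooth_fun_deriv[OF fg(2)]
    by (intro bexI[where x="\<lambda>x. r * deriv f x + s * deriv g x"]) auto
qed (use assms in blast)

lemma smooth_fun_affine:
  assumes "smooth_fun f"
  shows "smooth_fun (\<lambda>x. r * f (c * x + d))"
proof (rule smooth_fun_coinduct[where F="{\<lambda>x. r * f (c * x + d) | r f. smooth_fun f}"])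
  fix h assume "h \<in> {\<lambda>x. r * f (c * x + d) | r f. smooth_fun f}"
  then obtain r f where h: "h = (\<lambda>x. r * f (c * x + d))" and f: "smooth_fun f"
    by blast
  have "(h has_field_derivative (r * c) * deriv f (c * x + d)) (at x)" for x
  proof -
    have "((\<lambda>x. c * x + d) has_field_derivative c) (at x)"
      by (auto intro!: derivative_eq_intros)
    from DERIV_cmult[OF DERIV_chain2[OF smooth_fun_has_deriv[OF f] this], of r]
    show ?thesis unfolding h by (simp add: ac_simps)
  qed
  then show "\<exists>g'\<in>{\<lambda>x. r * f (c * x + d) | r f. smooth_fun f}.
      \<forall>x. (h has_field_derivative g' x) (at x)"
    using smooth_fun_deriv[OF f]
    by (intro bexI[where x="\<lambda>x. (r * c) * deriv f (c * x + d)"]) auto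
qed (use assms in blast)

text \<open>The classical bump is \<open>bump 1 0\<close>. The factor with p and m is carried along
  because every derivative of the bump is of this form again.\<close>

definition bump :: "real poly \<Rightarrow> nat \<Rightarrow> real \<Rightarrow> real" where
  "bump p m x = (if 0 < x \<and> x < 1
     then poly p x / (x * (1 - x)) ^ m * exp (- 1 / (x * (1 - x))) else 0)"

lemma has_deriv_0_quadratic:
  fixes f :: "real \<Rightarrow> real"
  assumes "\<And>x. \<bar>f x\<bar> \<le> C * (x - z)\<^sup>2"
  shows "(f has_field_derivative 0) (at z)"
proof -
  have f0: "f z = 0" using assms[of z] by simp
  have "((\<lambda>h. (f (z + h) - f z) / h) \<longlongrightarrow> 0) (at 0)"
  proof (rule Lim_null_comparison)
    show "\<forall>\<^sub>F h in at 0. norm ((f (z + h) - f z) / h) \<le> \<bar>C\<bar> * \<bar>h\<bar>"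
      unfolding eventually_at_filter
    proof (intro always_eventually allI impI)
      fix h :: real assume "h \<noteq> 0"
      have "\<bar>f (z + h)\<bar> \<le> C * h\<^sup>2" using assms[of "z + h"] by simp
      also have "\<dots> \<le> \<bar>C\<bar> * h\<^sup>2" by (intro mult_right_mono) auto
      finally have "\<bar>f (z + h)\<bar> / \<bar>h\<bar> \<le> \<bar>C\<bar> * h\<^sup>2 / \<bar>h\<bar>"
        by (intro divide_right_mono) auto
      also have "\<dots> = \<bar>C\<bar> * \<bar>h\<bar>"
      proof -
        have "h\<^sup>2 / \<bar>h\<bar> = \<bar>h\<bar>" by (cases "0 \<le> h") (auto simp: power2_eq_square)
        then show ?thesis by (metis times_divide_eq_right)
      qed
      finally show "norm ((f (z + h) - f z) / h) \<le> \<bar>C\<bar> * \<bar>h\<bar>"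
        by (simp add: f0)
    qed
    show "((\<lambda>h. \<bar>C\<bar> * \<bar>h\<bar>) \<longlongrightarrow> 0) (at 0)"
      by (rule tendsto_eq_intros refl | simp)+
  qed
  then show ?thesis by (simp add: DERIV_def)
qed

lemma power_le_exp:
  fixes x :: real
  assumes "0 \<le> x"
  shows "x ^ k / fact k \<le> exp x"
proof -
  have "(\<Sum>n\<in>{k}. inverse (fact n) * x ^ n) \<le> (\<Sum>n. inverse (fact n) * x ^ n)"
    by (rule sum_le_suminf) (use assms summable_exp in auto)
  then show ?thesis by (simp add: exp_def divide_inverse mult.commute)
qed

text \<open>With \<open>e = x * (1 - x)\<close>, the factor \<open>exp (- 1 / e)\<close> is at most
  \<open>fact (m + 2) * e ^ (m + 2)\<close>. This cancels the pole of order m and leaves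
  \<open>e\<^sup>2\<close>, whence derivative 0 at the junctions 0 and 1.\<close>

lemma bump_quadratic: "\<exists>C. \<forall>x. \<bar>bump p m x\<bar> \<le> C * x\<^sup>2 \<and> \<bar>bump p m x\<bar> \<le> C * (x - 1)\<^sup>2"
proof -
  have "bounded (poly p ` {0..1})"
    by (intro compact_imp_bounded compact_continuous_image continuous_intros) auto
  then obtain B where "\<forall>x\<in>{0..1}. \<bar>poly p x\<bar> \<le> B"
    by (auto simp: bounded_iff)
  then have B: "\<bar>poly p x\<bar> \<le> B" if "x \<in> {0..1}" for x
    using that by blast
  have B0: "0 \<le> B" using B[of 0] by simp
  define C where "C = B * fact (m + 2)"
  have C0: "0 \<le> C" using B0 by (simp add: C_def)
  have main: "\<bar>bump p m x\<bar> \<le> C * (x * (1 - x))\<^sup>2" for x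
  proof (cases "0 < x \<and> x < 1")
    case True
    define e where "e = x * (1 - x)"
    have e: "0 < e" using True by (simp add: e_def)
    have "(1 / e) ^ (m + 2) / fact (m + 2) \<le> exp (1 / e)"
      by (rule power_le_exp) (use e in simp)
    then have "1 / exp (1 / e) \<le> 1 / ((1 / e) ^ (m + 2) / fact (m + 2))"
      by (intro divide_left_mono mult_pos_pos) (use e in auto)
    also have "\<dots> = fact (m + 2) * e ^ (m + 2)"
      by (simp add: power_divide)
    finally have "1 / exp (1 / e) \<le> fact (m + 2) * e ^ (m + 2)" .
    then have "exp (- 1 / e) \<le> fact (m + 2) * e ^ (m + 2)"
      by (simp add: exp_minus field_simps)
    then have "\<bar>poly p x\<bar> / e ^ m * exp (- 1 / e) \<le> B / e ^ m * (fact (m + 2) * e ^ (m + 2))"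
      using e B[of x] True by (intro mult_mono divide_right_mono) auto
    also have "\<dots> = C * e\<^sup>2" using e by (simp add: C_def power_add power2_eq_square)
    finally show ?thesis using True e by (simp add: bump_def e_def abs_mult)
  qed (use C0 in \<open>auto simp: bump_def\<close>)
  show ?thesis
  proof (intro exI[of _ C] allI conjI)
    fix x
    have b: "\<bar>bump p m x\<bar> = 0 \<or> 0 < x \<and> x < 1" by (auto simp: bump_def)
    show "\<bar>bump p m x\<bar> \<le> C * x\<^sup>2"
    proof (cases "0 < x \<and> x < 1")
      case True
      have "(x * (1 - x))\<^sup>2 \<le> x\<^sup>2" using True by (intro power_mono) (auto simp: mult_left_le)
      then show ?thesis using main[of x] C0 by (meson mult_left_mono order_trans)
    qed (use b C0 in auto)
    show "\<bar>bump p m x\<bar> \<le> C * (x - 1)\<^sup>2"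
    proof (cases "0 < x \<and> x < 1")
      case True
      have "(x * (1 - x))\<^sup>2 \<le> (1 - x)\<^sup>2"
        using True by (intro power_mono) (auto simp: mult_left_le_one_le)
      also have "\<dots> = (x - 1)\<^sup>2" by (rule power2_commute)
      finally show ?thesis using main[of x] C0 by (meson mult_left_mono order_trans)
    qed (use b C0 in auto)
  qed
qed

text \<open>Here \<open>[:0, 1, -1:]\<close> is \<open>e = x * (1 - x)\<close> and
  \<open>[:1, -2:]\<close> its derivative; the three terms come from p, from \<open>e ^ m\<close>
  and from the exponential. The exponent rises by 2 because the derivative of \<open>1 / e\<close>
  has \<open>e\<^sup>2\<close> in the denominator.\<close>

lemma bump_deriv:
  "(bump p m has_field_derivative
     bump (pderiv p * [:0, 1, -1:]\<^sup>2 - smult (real m) (p * [:1, -2:] * [:0, 1, -1:]) + p * [:1, -2:]) (m + 2) x) (at x)"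
  (is "(_ has_field_derivative bump ?q _ _) _")
proof -
  obtain C where C: "\<And>x. \<bar>bump p m x\<bar> \<le> C * (x - 0)\<^sup>2" "\<And>x. \<bar>bump p m x\<bar> \<le> C * (x - 1)\<^sup>2"
    using bump_quadratic[of p m] by auto
  consider "x = 0" | "x = 1" | "x < 0 \<or> 1 < x" | "0 < x" "x < 1" by linarith
  then show ?thesis
  proof cases
    case 1
    then have "bump ?q (m + 2) x = 0" by (simp add: bump_def)
    then show ?thesis using has_deriv_0_quadratic[OF C(1)] 1 by (simp only:)
  next
    case 2
    then have "bump ?q (m + 2) x = 0" by (simp add: bump_def)
    then show ?thesis using has_deriv_0_quadratic[OF C(2)] 2 by (simp only:)
  next
    case 3
    have "((\<lambda>_. 0) has_field_derivative 0) (at x)" by simp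
    then have "(bump p m has_field_derivative 0) (at x)"
      by (rule has_field_derivative_transform_within_open[where S="- {0..1}"])
         (use 3 in \<open>auto simp: bump_def open_Compl\<close>)
    then show ?thesis using 3 by (auto simp: bump_def)
  next
    case 4
    define e where "e = (\<lambda>x::real. x * (1 - x))"
    have e0: "e x \<noteq> 0" using 4 by (simp add: e_def)
    have de: "(e has_field_derivative 1 - 2 * x) (at x)"
      unfolding e_def by (auto intro!: derivative_eq_intros)
    have pe: "poly [:0, 1, -1:] x = e x" by (simp add: e_def algebra_simps)
    have pd: "poly [:1, -2:] x = 1 - 2 * x" by simp
    have q: "poly ?q x = poly (pderiv p) x * (e x)\<^sup>2 - real m * (poly p x * (1 - 2 * x) * e x) + poly p x * (1 - 2 * x)"
      by (simp only: poly_add poly_diff poly_mult poly_smult poly_power pe pd)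
    have eq: "(A' * inverse (t ^ m) + - (inverse (t ^ m) * (real m * (d * t ^ (m - Suc 0))) * inverse (t ^ m)) * A) * E
        + E * - (- (inverse t * d * inverse t)) * (A * inverse (t ^ m))
        = (A' * t\<^sup>2 - real m * (A * d * t) + A * d) / t ^ (m + 2) * E" if "t \<noteq> 0" for A A' t d E :: real
      using that by (cases m) (simp_all add: field_simps power2_eq_square)
    note D = DERIV_mult[OF DERIV_mult[OF poly_DERIV[of p] DERIV_inverse'[OF DERIV_power[OF de, of m]]]
        DERIV_chain2[OF DERIV_exp DERIV_minus[OF DERIV_inverse'[OF de]]]]
    have "((\<lambda>x. poly p x * inverse (e x ^ m) * exp (- inverse (e x))) has_field_derivative
        bump ?q (m + 2) x) (at x)"
    proof (rule DERIV_cong[OF D])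
      have "bump ?q (m + 2) x = poly ?q x / e x ^ (m + 2) * exp (- inverse (e x))"
        using 4 by (simp only: bump_def if_True simp_thms e_def inverse_eq_divide minus_divide_left)
      then show "(poly (pderiv p) x * inverse (e x ^ m) + - (inverse (e x ^ m) * (real m * ((1 - 2 * x) * e x ^ (m - Suc 0))) * inverse (e x ^ m)) * poly p x) * exp (- inverse (e x))
        + exp (- inverse (e x)) * - (- (inverse (e x) * (1 - 2 * x) * inverse (e x))) * (poly p x * inverse (e x ^ m))
        = bump ?q (m + 2) x"
        by (simp only: q eq[OF e0])
    qed (use e0 in auto)
    then show ?thesis
      by (rule has_field_derivative_transform_within_open[where S="{0<..<1}"])
         (use 4 in \<open>auto simp: bump_def e_def field_simps\<close>)
  qed
qed

lemma smooth_bump: "smooth_fun (bump p m)"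
  by (rule smooth_fun_coinduct[where F="{bump p m |p m. True}"]) (blast intro: bump_deriv)+

lemma antiderivative_exists:
  assumes "continuous_on UNIV (f :: real \<Rightarrow> real)"
  shows "\<exists>F. \<forall>x. (F has_field_derivative f x) (at x)"
proof -
  have "\<exists>F. \<forall>x. - \<infinity> < ereal x \<longrightarrow> ereal x < \<infinity> \<longrightarrow> (F has_vector_derivative f x) (at x)"
    by (rule einterval_antiderivative)
       (use assms in \<open>auto simp: continuous_on_eq_continuous_at\<close>)
  then show ?thesis by (auto simp: has_real_derivative_iff_has_vector_derivative)
qed

lemma smooth_fun_continuous: "smooth_fun f \<Longrightarrow> continuous_on A f"
  by (meson DERIV_continuous_on has_field_derivative_at_within smooth_fun_has_deriv)

lemma const_of_deriv_0:
  assumes "\<And>x. (F has_field_derivative f x) (at x)" "\<And>x. x \<in> S \<Longrightarrow> f x = (0::real)" "convex S"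
    "x \<in> S" "y \<in> S"
  shows "F x = F y"
proof -
  have "(F has_field_derivative 0) (at x within S)" if "x \<in> S" for x
    using assms(1)[of x] assms(2)[OF that] by (simp add: has_field_derivative_at_within)
  from has_field_derivative_zero_constant[OF assms(3) this] show ?thesis
    using assms(4,5) by metis
qed

text \<open>Scaling the argument of \<theta> approximates the indicator of the positive half line.
  The primitive \<Theta> is kept as well, with an unspecified offset c, because test functions are
  built from differences of shifted \<Theta>, in which c cancels.\<close>

definition smooth_step :: "(real \<Rightarrow> real) \<Rightarrow> (real \<Rightarrow> real) \<Rightarrow> real \<Rightarrow> bool" where
  "smooth_step \<theta> \<Theta> c \<longleftrightarrow> smooth_fun \<Theta> \<and> (\<forall>x. (\<Theta> has_field_derivative \<theta> x) (at x)) \<and>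
    (\<forall>x. 0 \<le> \<theta> x \<and> \<theta> x \<le> 1 \<and> (x \<le> 0 \<longrightarrow> \<theta> x = 0 \<and> \<Theta> x = 0) \<and>
      (1 \<le> x \<longrightarrow> \<theta> x = 1 \<and> \<Theta> x = x + c))"

lemma smooth_step_exists: "\<exists>\<theta> \<Theta> c. smooth_step \<theta> \<Theta> c"
proof -
  define \<beta> where "\<beta> = bump 1 0"
  have \<beta>: "smooth_fun \<beta>" "\<And>x. 0 \<le> \<beta> x" "\<And>x. x \<le> 0 \<or> 1 \<le> x \<Longrightarrow> \<beta> x = 0" "\<And>x. 0 < x \<Longrightarrow> x < 1 \<Longrightarrow> 0 < \<beta> x"
    by (auto simp: \<beta>_def smooth_bump bump_def)
  obtain F where F: "\<And>x. (F has_field_derivative \<beta> x) (at x)"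
    using antiderivative_exists[OF smooth_fun_continuous[OF \<beta>(1)]] by blast
  have F01: "F 0 < F 1"
  proof (rule DERIV_pos_imp_increasing_open[of 0 1])
    show "\<exists>y. (F has_real_derivative y) (at x) \<and> 0 < y" if "0 < x" "x < 1" for x
      using F[of x] \<beta>(4)[OF that] by blast
    show "continuous_on {0..1} F"
      using F by (auto intro: DERIV_isCont continuous_at_imp_continuous_on)
  qed simp
  have Fmono: "F x \<le> F y" if "x \<le> y" for x y
    by (rule DERIV_nonneg_imp_nondecreasing[OF that]) (use F \<beta> in blast)
  define \<theta> where "\<theta> = (\<lambda>x. (1 / (F 1 - F 0)) * F x + (- F 0 / (F 1 - F 0)) * 1)"
  have \<theta>_eq: "\<theta> x = (F x - F 0) / (F 1 - F 0)" for x
    by (simp add: \<theta>_def diff_divide_distrib)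
  have one: "smooth_fun (\<lambda>_. 1)"
  proof (rule smooth_fun_coinduct[where F="range (\<lambda>c _. c)"])
    fix g :: "real \<Rightarrow> real" assume "g \<in> range (\<lambda>c _. c)"
    then show "\<exists>g'\<in>range (\<lambda>c _. c). \<forall>x. (g has_field_derivative g' x) (at x)"
      by (intro bexI[of _ "\<lambda>_. 0"]) auto
  qed auto
  have smooth: "smooth_fun \<theta>"
    unfolding \<theta>_def by (intro smooth_fun_lin_comb one smooth_fun_antideriv[OF F \<beta>(1)])
  have Fneg: "F x = F 0" if "x \<le> 0" for x
    by (rule const_of_deriv_0[OF F, of "{..0}"]) (use \<beta> that in auto)
  have Fpos: "F x = F 1" if "1 \<le> x" for x
    by (rule const_of_deriv_0[OF F, of "{1..}"]) (use \<beta> that in auto)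
  have \<theta>0: "\<theta> x = 0" if "x \<le> 0" for x using Fneg[OF that] by (simp add: \<theta>_eq)
  have \<theta>1: "\<theta> x = 1" if "1 \<le> x" for x using Fpos[OF that] F01 by (simp add: \<theta>_eq)
  have \<theta>b: "0 \<le> \<theta> x" "\<theta> x \<le> 1" for x
  proof -
    have "F 0 \<le> F x" using Fneg[of x] Fmono[of 0 x] by (cases "x \<le> 0") auto
    moreover have "F x \<le> F 1" using Fpos[of x] Fmono[of x 1] by (cases "1 \<le> x") auto
    ultimately show "0 \<le> \<theta> x" "\<theta> x \<le> 1" using F01 by (auto simp: \<theta>_eq field_simps)
  qed
  obtain G where G: "\<And>x. (G has_field_derivative \<theta> x) (at x)"
    using antiderivative_exists[OF smooth_fun_continuous[OF smooth]] by blast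
  define \<Theta> where "\<Theta> = (\<lambda>x. G x - G 0)"
  have \<Theta>: "(\<Theta> has_field_derivative \<theta> x) (at x)" for x
    unfolding \<Theta>_def by (rule derivative_eq_intros G refl | simp)+
  have neg: "\<Theta> x = 0" if "x \<le> 0" for x
    using const_of_deriv_0[OF \<Theta>, of "{..0}" x 0] \<theta>0 that by (simp add: \<Theta>_def)
  have pos: "\<Theta> x = x + (\<Theta> 1 - 1)" if "1 \<le> x" for x
  proof -
    have "((\<lambda>x. \<Theta> x - x) has_field_derivative \<theta> x - 1) (at x)" for x
      by (rule derivative_eq_intros \<Theta> refl | simp)+
    from const_of_deriv_0[OF this, of "{1..}" x 1] \<theta>1 that show ?thesis by simp
  qed
  show ?thesis
    using smooth_fun_antideriv[OF \<Theta> smooth] \<Theta> \<theta>b \<theta>0 \<theta>1 neg pos unfolding smooth_step_def by blast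
qed


text \<open>Local absolute continuity, expressed through the fundamental theorem of calculus.\<close>

definition ac_deriv :: "(real \<Rightarrow> real) \<Rightarrow> (real \<Rightarrow> real) \<Rightarrow> bool" where
  "ac_deriv F g \<longleftrightarrow> (\<forall>s t. s \<le> t \<longrightarrow>
     set_integrable lborel {s..t} g \<and> F t - F s = (LBINT x:{s..t}. g x))"

lemma ac_deriv_exists:
  assumes g: "\<And>s t. set_integrable lborel {s..t} g"
  shows "\<exists>F. ac_deriv F g"
proof
  define F where "F = (\<lambda>x. if 0 \<le> x then integral {0..x} g else - integral {x..0} g)"
  have "F t - F s = integral {s..t} g" if "s \<le> t" for s t
  proof -
    have int: "g integrable_on {u..v}" for u v
      by (rule set_borel_integral_eq_integral[OF g])
    note comb = Henstock_Kurzweil_Integration.integral_combine[OF _ _ int]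
    consider "0 \<le> s" | "s < 0" "0 \<le> t" | "t < 0" by linarith
    then show ?thesis
      by cases (use that comb[of 0 s t] comb[of s 0 t] comb[of s t 0] in \<open>auto simp: F_def\<close>)
  qed
  then show "ac_deriv F g"
    using g by (simp add: ac_deriv_def set_borel_integral_eq_integral(2))
qed

lemma ac_deriv_continuous:
  assumes "ac_deriv F g"
  shows "continuous_on A F"
proof -
  have "isCont F x" for x
  proof -
    have g: "set_integrable lborel {s..t} g" if "s \<le> t" for s t
      using assms that by (simp add: ac_deriv_def)
    have eq: "F y = F (x - 1) + integral {x - 1..y} g" if "x - 1 \<le> y" for y
    proof -
      have "F y - F (x - 1) = (LBINT x:{x - 1..y}. g x)" using assms that by (simp add: ac_deriv_def)
      then show ?thesis using set_borel_integral_eq_integral(2)[OF g[OF that]] by simp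
    qed
    have "g integrable_on {x - 1..x + 1}"
      by (rule set_borel_integral_eq_integral(1)[OF g]) simp
    then have "continuous_on {x - 1..x + 1} (\<lambda>y. F (x - 1) + integral {x - 1..y} g)"
      by (intro continuous_intros indefinite_integral_continuous_1)
    then have "continuous_on {x - 1..x + 1} F"
      by (rule continuous_on_eq) (rule eq[symmetric], simp)
    then show ?thesis
      by (rule continuous_on_interior) simp
  qed
  then show ?thesis by (simp add: continuous_at_imp_continuous_on)
qed

lemma ac_deriv_measurable [measurable_dest]: "ac_deriv F g \<Longrightarrow> F \<in> borel_measurable borel"
  by (intro borel_measurable_continuous_onI ac_deriv_continuous)

lemma lborel_integrable_prod:
  fixes u v :: "real \<Rightarrow> real"
  assumes u: "integrable lborel u" and v: "integrable lborel v"
  shows "integrable (lborel \<Otimes>\<^sub>M lborel) (\<lambda>(x, y). u x * v y)"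
proof (rule lborel_pair.Fubini_integrable)
  have [measurable]: "u \<in> borel_measurable lborel" "v \<in> borel_measurable lborel"
    using u v by auto
  show "(\<lambda>(x, y). u x * v y) \<in> borel_measurable (lborel \<Otimes>\<^sub>M lborel)"
    by measurable
  show "integrable lborel (\<lambda>x. LINT y|lborel. norm (case (x, y) of (x, y) \<Rightarrow> u x * v y))"
    using u by (simp add: abs_mult)
  show "AE x in lborel. integrable lborel (\<lambda>y. case (x, y) of (x, y) \<Rightarrow> u x * v y)"
    using v by simp
qed

lemma deriv_eq_0_outside:
  fixes \<phi> :: "real \<Rightarrow> real"
  assumes "\<And>x. K < \<bar>x\<bar> \<Longrightarrow> \<phi> x = 0" "K < \<bar>x\<bar>"
  shows "deriv \<phi> x = 0"
proof (rule DERIV_imp_deriv)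
  have "((\<lambda>_. 0) has_field_derivative 0) (at x)" by simp
  then show "(\<phi> has_field_derivative 0) (at x)"
    by (rule has_field_derivative_transform_within_open[where S="- {-K..K}"])
       (use assms in \<open>auto simp: open_Compl abs_le_iff\<close>)
qed

text \<open>Integration by parts for a primitive that need not be differentiable everywhere: write F
  as \<open>F (-K)\<close> plus an integral of g and exchange the order of integration over
  \<open>t \<le> x\<close>. The constant \<open>F (-K)\<close> drops out because \<phi> vanishes at
  both ends.\<close>

lemma ac_deriv_test:
  assumes F: "ac_deriv F g" and \<phi>: "smooth_fun \<phi>" and K: "0 \<le> K"
    and supp: "\<And>x. K \<le> \<bar>x\<bar> \<Longrightarrow> \<phi> x = 0"
  shows "(\<integral>x. F x * deriv \<phi> x \<partial>lborel) = - (\<integral>x. g x * \<phi> x \<partial>lborel)"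
proof -
  have supp': "deriv \<phi> x = 0" if "K < \<bar>x\<bar>" for x
    by (rule deriv_eq_0_outside[OF _ that]) (use supp in auto)
  define u where "u = (\<lambda>x. indicator {-K..K} x * deriv \<phi> x)"
  define v where "v = (\<lambda>x. indicator {-K..K} x * g x)"
  have u: "integrable lborel u"
    using borel_integrable_atLeastAtMost'[OF smooth_fun_continuous[OF smooth_fun_deriv[OF \<phi>]], of "-K" K]
    by (simp add: u_def set_integrable_def)
  have v: "integrable lborel v"
    using F K by (simp add: v_def ac_deriv_def set_integrable_def)
  have [measurable]: "u \<in> borel_measurable lborel" "v \<in> borel_measurable lborel"
    using u v by auto
  have ftc: "(\<integral>x. indicator {t..K} x * deriv \<phi> x \<partial>lborel) = - \<phi> t" if "t \<le> K" for t
    using integral_FTC_atLeastAtMost[OF that, of \<phi> "deriv \<phi>"] \<phi> supp[of K] K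
      smooth_fun_continuous[OF smooth_fun_deriv[OF \<phi>]]
    by (simp add: has_real_derivative_iff_has_vector_derivative[symmetric]
        has_field_derivative_at_within smooth_fun_has_deriv)
  have u0: "(\<integral>x. u x \<partial>lborel) = 0"
    using ftc[of "-K"] K supp[of "-K"] by (simp add: u_def)
  have Fx: "F x * deriv \<phi> x = F (-K) * u x + (\<integral>t. u x * v t * indicator {..x} t \<partial>lborel)" for x
  proof (cases "x \<in> {-K..K}")
    case True
    have "F x - F (-K) = (\<integral>t. v t * indicator {..x} t \<partial>lborel)"
    proof -
      have "F x - F (-K) = (LBINT t:{-K..x}. g t)" using F True by (simp add: ac_deriv_def)
      also have "\<dots> = (\<integral>t. v t * indicator {..x} t \<partial>lborel)"
        unfolding set_lebesgue_integral_def v_def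
        by (intro Bochner_Integration.integral_cong) (use True in \<open>auto split: split_indicator\<close>)
      finally show ?thesis .
    qed
    then have "F x = F (-K) + (\<integral>t. v t * indicator {..x} t \<partial>lborel)" by simp
    then have "F x * u x = F (-K) * u x + u x * (\<integral>t. v t * indicator {..x} t \<partial>lborel)"
      by (simp add: algebra_simps)
    then show ?thesis using True by (simp add: u_def mult.assoc)
  next
    case False
    then have "K < \<bar>x\<bar>" by auto
    then show ?thesis using supp'[of x] False by (simp add: u_def)
  qed
  have I: "integrable (lborel \<Otimes>\<^sub>M lborel) (\<lambda>(x, t). u x * v t * indicator {..x} t)"
  proof (rule Bochner_Integration.integrable_bound[OF lborel_integrable_prod[OF u v]])
    have "(\<lambda>(x, t). u x * v t * (if t \<le> x then 1 else 0)) \<in> borel_measurable (lborel \<Otimes>\<^sub>M lborel)"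
      by measurable
    also have "(\<lambda>(x, t). u x * v t * (if t \<le> x then 1 else 0)) = (\<lambda>(x, t). u x * v t * indicator {..x} t)"
      by (auto simp: fun_eq_iff)
    finally show "(\<lambda>(x, t). u x * v t * indicator {..x} t) \<in> borel_measurable (lborel \<Otimes>\<^sub>M lborel)" .
  qed (auto simp: abs_mult split: split_indicator)
  \<comment> \<open>For fixed t the remaining integral is that of the derivative of \<phi> over
    \<open>{t..K}\<close>, that is \<open>- \<phi> t\<close>.\<close>
  have inner: "(\<integral>x. u x * v t * indicator {..x} t \<partial>lborel) = - (g t * \<phi> t)" for t
  proof (cases "t \<in> {-K..K}")
    case True
    have "(\<integral>x. u x * v t * indicator {..x} t \<partial>lborel) = (\<integral>x. g t * (indicator {t..K} x * deriv \<phi> x) \<partial>lborel)"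
      by (intro Bochner_Integration.integral_cong) (use True in \<open>auto simp: u_def v_def split: split_indicator\<close>)
    also have "\<dots> = g t * - \<phi> t" using ftc[of t] True by simp
    finally show ?thesis by simp
  next
    case False
    then have "K \<le> \<bar>t\<bar>" by auto
    then show ?thesis using supp[of t] False by (simp add: v_def)
  qed
  have I1: "integrable lborel (\<lambda>x. \<integral>t. u x * v t * indicator {..x} t \<partial>lborel)"
    using lborel_pair.integrable_fst'[OF I] by simp
  have "(\<integral>x. F x * deriv \<phi> x \<partial>lborel)
      = (\<integral>x. F (-K) * u x \<partial>lborel) + (\<integral>x. (\<integral>t. u x * v t * indicator {..x} t \<partial>lborel) \<partial>lborel)"
    unfolding Fx using u I1 by (intro Bochner_Integration.integral_add) auto
  also have "(\<integral>x. F (-K) * u x \<partial>lborel) = 0" using u0 by simp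
  also have "(\<integral>x. (\<integral>t. u x * v t * indicator {..x} t \<partial>lborel) \<partial>lborel)
      = (\<integral>t. (\<integral>x. u x * v t * indicator {..x} t \<partial>lborel) \<partial>lborel)"
    using lborel_pair.Fubini_integral[of "\<lambda>x t. u x * v t * indicator {..x} t"] I by simp
  also have "\<dots> = - (\<integral>x. g x * \<phi> x \<partial>lborel)"
    unfolding inner by simp
  finally show ?thesis by simp
qed

text \<open>The sets over which h integrates to 0 contain the intervals and are closed under
  complements and disjoint unions, so they are all Borel sets. The complement step needs an
  integrable function, hence the truncation to \<open>{-n..n}\<close>.\<close>

lemma AE_eq_0_of_interval_integrals:
  fixes h :: "real \<Rightarrow> real"
  assumes h: "\<And>s t. set_integrable lborel {s..t} h"
    and int: "\<And>s t. s \<le> t \<Longrightarrow> (LBINT x:{s..t}. h x) = 0"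
    and [measurable]: "h \<in> borel_measurable borel"
  shows "AE x in lborel. h x = 0"
proof -
  have "AE x in lborel. indicator {-real n..real n} x * h x = 0" for n
  proof (rule density_unique_real)
    let ?h = "\<lambda>x. indicator {-real n..real n} x * h x"
    show I: "integrable lborel ?h" using h[of "-real n" "real n"] by (simp add: set_integrable_def)
    have SI: "set_integrable lborel A ?h" if "A \<in> sets borel" for A
      using that I by (simp add: set_integrable_def integrable_mult_indicator del: real_scaleR_def)
    fix A :: "real set" assume "A \<in> sets lborel"
    then have "A \<in> sets borel" by simp
    then have "(LBINT x:A. ?h x) = 0"
    proof (induction A rule: borel_set_induct)
      case (interval a b)
      have "(LBINT x:{a..b}. ?h x) = (LBINT x:{max a (-real n)..min b (real n)}. h x)"
        unfolding set_lebesgue_integral_def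
        by (intro Bochner_Integration.integral_cong) (auto split: split_indicator)
      also have "\<dots> = 0"
        using int[of "max a (-real n)" "min b (real n)"]
        by (cases "max a (-real n) \<le> min b (real n)") (auto simp: set_lebesgue_integral_def)
      finally show ?case .
    next
      case (compl A)
      have "(LBINT x:UNIV. ?h x) = (LBINT x:{-real n..real n}. h x)"
        unfolding set_lebesgue_integral_def by simp
      then have "(LBINT x:UNIV. ?h x) = 0" using int[of "-real n" "real n"] by simp
      moreover have "(LBINT x:A \<union> -A. ?h x) = (LBINT x:A. ?h x) + (LBINT x:-A. ?h x)"
        by (rule set_integral_Un) (use compl SI in auto)
      ultimately show ?case using compl by simp
    next
      case (union f)
      have "(LBINT x:(\<Union>i. f i). ?h x) = (\<Sum>i. (LBINT x:f i. ?h x))"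
        by (rule lebesgue_integral_countable_add)
           (use union SI in \<open>auto simp: disjoint_family_on_def\<close>)
      then show ?case using union by simp
    qed (simp add: set_lebesgue_integral_def)
    then show "(LBINT x:A. ?h x) = (LBINT x:A. 0)" by simp
  qed simp
  then have "AE x in lborel. \<forall>n. indicator {-real n..real n} x * h x = 0"
    unfolding AE_all_countable by blast
  then show ?thesis
  proof eventually_elim
    case (elim x)
    obtain n where "\<bar>x\<bar> \<le> real n" using real_arch_simple by blast
    with elim[THEN spec, of n] show ?case by (auto simp: abs_le_iff split: split_indicator_asm)
  qed
qed

lemmas is_weak_deriv_locally_integrable =
  is_weak_deriv_def[THEN iffD1, THEN conjunct1]
  is_weak_deriv_def[THEN iffD1, THEN conjunct2, THEN conjunct1]

lemmas is_weak_deriv_test = is_weak_deriv_def[THEN iffD1, THEN conjunct2, THEN conjunct2, rule_format]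

lemma locally_integrable_measurable:
  assumes "locally_integrable f"
  shows "f \<in> borel_measurable lebesgue"
proof (rule borel_measurable_LIMSEQ_real)
  fix n :: nat
  have "set_integrable lebesgue {-real n..real n} f"
    using assms by (simp add: locally_integrable_def)
  then show "(\<lambda>x. indicator {-real n..real n} x * f x) \<in> borel_measurable lebesgue"
    by (auto simp: set_integrable_def)
next
  fix x
  obtain N where N: "\<bar>x\<bar> \<le> real N" using real_arch_simple by blast
  have "\<forall>\<^sub>F n in sequentially. indicator {-real n..real n} x * f x = f x"
    using eventually_ge_at_top[of N] by eventually_elim (use N in \<open>auto split: split_indicator\<close>)
  then show "(\<lambda>n. indicator {-real n..real n} x * f x) \<longlonglongrightarrow> f x"
    by (rule tendsto_eventually)
qed

text \<open>Weak derivatives are Lebesgue measurable, whereas Fubini's theorem is applied to Borel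
  functions; this is the passage between them.\<close>

lemma locally_integrable_borel_version:
  assumes "locally_integrable f"
  shows "\<exists>f'. f' \<in> borel_measurable borel \<and> (AE x in lborel. f x = f' x) \<and>
    (\<forall>s t. set_integrable lborel {s..t} f')"
proof -
  note fm = locally_integrable_measurable[OF assms]
  obtain f' where f': "f' \<in> borel_measurable lborel" "AE x in lborel. f x = f' x"
    using completion_ex_borel_measurable_real[OF fm] by blast
  have "set_integrable lborel {s..t} f'" for s t
  proof -
    have f'l: "f' \<in> borel_measurable lebesgue"
      using f'(1) by (auto intro: measurable_completion)
    have "set_integrable lebesgue {s..t} f" using assms by (simp add: locally_integrable_def)
    then have "integrable lebesgue (\<lambda>x. indicator {s..t} x * f' x)"
      unfolding set_integrable_def
    proof (rule integrable_cong_AE_imp)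
      show "AE x in lebesgue. indicator {s..t} x *\<^sub>R f x = indicator {s..t} x * f' x"
        using f'(2) by (auto simp: AE_completion_iff)
      show "(\<lambda>x. indicator {s..t} x * f' x) \<in> borel_measurable lebesgue"
        by (intro borel_measurable_times borel_measurable_indicator f'l) simp
    qed
    moreover have "(\<lambda>x. indicator {s..t} x * f' x) \<in> borel_measurable lborel" using f'(1) by measurable
    ultimately show ?thesis
      by (simp add: set_integrable_def integrable_completion)
  qed
  then show ?thesis using f' by auto
qed

lemma LINT_lebesgue_borel_version:
  assumes "f \<in> borel_measurable lebesgue" "f' \<in> borel_measurable borel" "AE x in lborel. f x = f' x"
    "h \<in> borel_measurable borel"
  shows "(LINT x|lebesgue. f x * h x) = (\<integral>x. f' x * h x \<partial>lborel :: real)"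
proof -
  have [measurable]: "h \<in> borel_measurable lebesgue" "f' \<in> borel_measurable lebesgue" "f \<in> borel_measurable lebesgue"
    using assms by (auto intro: measurable_completion)
  have "(LINT x|lebesgue. f x * h x) = (LINT x|lebesgue. f' x * h x)"
    by (rule integral_cong_AE) (use assms(3) in \<open>auto simp: AE_completion_iff\<close>)
  also have "\<dots> = (\<integral>x. f' x * h x \<partial>lborel)"
    by (rule integral_completion) (use assms in simp)
  finally show ?thesis .
qed

text \<open>The lemma of du Bois-Reymond: testing with differences of smooth approximations of the
  indicators of \<open>{c<..d}\<close> and \<open>{0<..1}\<close> shows that the average of \<open>f - \<integral>g\<close> over every
  interval is the same.\<close>

lemma weak_deriv_ac:
  assumes fg: "is_weak_deriv 1 f g"
  obtains F g' where "ac_deriv F g'" "g' \<in> borel_measurable borel"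
    "AE x in lborel. f x = F x" "AE x in lborel. g x = g' x"
proof -
  have fl: "locally_integrable f" and gl: "locally_integrable g"
    by (rule is_weak_deriv_locally_integrable[OF fg])+
  have weak: "(LINT x|lebesgue. f x * deriv \<phi> x) = - (LINT x|lebesgue. g x * \<phi> x)"
    if "test_function \<phi>" for \<phi>
  proof -
    have "(LINT x|lebesgue. f x * (deriv ^^ 1) \<phi> x) = (-1) ^ 1 * (LINT x|lebesgue. g x * \<phi> x)"
      by (rule is_weak_deriv_test[OF fg that])
    then show ?thesis by simp
  qed
  obtain f' where f'0: "f' \<in> borel_measurable borel \<and> (AE x in lborel. f x = f' x) \<and>
      (\<forall>s t. set_integrable lborel {s..t} f')"
    using locally_integrable_borel_version[OF fl] ..
  then have f': "f' \<in> borel_measurable borel" "AE x in lborel. f x = f' x"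
    "\<And>s t. set_integrable lborel {s..t} f'"
    by (simp_all only:)
  obtain g' where g'0: "g' \<in> borel_measurable borel \<and> (AE x in lborel. g x = g' x) \<and>
      (\<forall>s t. set_integrable lborel {s..t} g')"
    using locally_integrable_borel_version[OF gl] ..
  then have g': "g' \<in> borel_measurable borel" "AE x in lborel. g x = g' x"
    "\<And>s t. set_integrable lborel {s..t} g'"
    by (simp_all only:)
  obtain F where F: "ac_deriv F g'" using ac_deriv_exists[OF g'(3)] ..
  have Fint: "set_integrable lborel {s..t} F" for s t
    by (intro borel_integrable_atLeastAtMost' ac_deriv_continuous[OF F])
  \<comment> \<open>The aim is that h is constant almost everywhere, since f and F have the same
    weak derivative.\<close>
  define h where "h = (\<lambda>x. f' x - F x)"
  have [measurable]: "F \<in> borel_measurable borel" "h \<in> borel_measurable borel"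
    using f'(1) ac_deriv_measurable[OF F] by (auto simp: h_def)
  have hint: "set_integrable lborel {s..t} h" for s t
    unfolding h_def by (intro set_integral_diff f' Fint)
  obtain \<theta> \<Theta> z where st: "smooth_step \<theta> \<Theta> z"
    using smooth_step_exists by blast
  have step:
    "smooth_fun \<Theta>" "\<And>x. (\<Theta> has_field_derivative \<theta> x) (at x)"
    "\<And>x. 0 \<le> \<theta> x" "\<And>x. \<theta> x \<le> 1" "\<And>x. x \<le> 0 \<Longrightarrow> \<theta> x = 0" "\<And>x. 1 \<le> x \<Longrightarrow> \<theta> x = 1"
    "\<And>x. x \<le> 0 \<Longrightarrow> \<Theta> x = 0" "\<And>x. 1 \<le> x \<Longrightarrow> \<Theta> x = x + z"
    using st unfolding smooth_step_def by simp_all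
  have lim: "(\<lambda>n. \<theta> (real (Suc n) * y)) \<longlonglongrightarrow> indicator {0<..} y" for y
  proof (cases "0 < y")
    case True
    obtain N where "1 / y \<le> real N" using real_arch_simple by blast
    then have N: "1 \<le> real N * y" using True by (simp add: field_simps)
    have "\<forall>\<^sub>F n in sequentially. \<theta> (real (Suc n) * y) = 1"
      using eventually_ge_at_top[of N]
    proof eventually_elim
      case (elim n)
      have "real N * y \<le> real (Suc n) * y" using elim True by (intro mult_right_mono) auto
      then show ?case using N step(6) by simp
    qed
    then show ?thesis using True by (simp add: tendsto_eventually)
  next
    case False
    then have "\<theta> (real (Suc n) * y) = 0" for n
      by (intro step(5)) (simp add: mult_nonneg_nonpos del: of_nat_Suc)
    then show ?thesis using False by simp
  qed
  have \<theta>m [measurable]: "\<theta> \<in> borel_measurable borel"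
  proof -
    have "deriv \<Theta> = \<theta>" using step(2) by (auto intro: DERIV_imp_deriv)
    then show ?thesis using smooth_fun_continuous[OF smooth_fun_deriv[OF step(1)]]
      by (simp add: borel_measurable_continuous_onI)
  qed
  have avg: "(LBINT x:{c..d}. h x) = (d - c) * (LBINT x:{0..1}. h x)" if cd: "c \<le> d" for c d
  proof -
    define K where "K = \<bar>c\<bar> + \<bar>d\<bar> + 2"
    \<comment> \<open>For large x the first difference equals \<open>d - c\<close> and the second
      one 1, so the weight \<open>d - c\<close> makes \<phi> vanish there. The factors 1 and the
      summand 0 are written out to match the shapes of \<open>smooth_fun_lin_comb\<close> and
      \<open>smooth_fun_affine\<close>.\<close>
    define \<phi> where "\<phi> n = (\<lambda>x. 1 * (1 * (1 / real (Suc n) * \<Theta> (real (Suc n) * x + - real (Suc n) * c))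
        + (-1) * (1 / real (Suc n) * \<Theta> (real (Suc n) * x + - real (Suc n) * d)))
      + - (d - c) * (1 * (1 / real (Suc n) * \<Theta> (real (Suc n) * x + 0))
        + (-1) * (1 / real (Suc n) * \<Theta> (real (Suc n) * x + - real (Suc n)))))" for n :: nat
    define \<psi> where "\<psi> n x = \<theta> (real (Suc n) * (x - c)) - \<theta> (real (Suc n) * (x - d))
      - (d - c) * (\<theta> (real (Suc n) * x) - \<theta> (real (Suc n) * (x - 1)))" for n x
    have smooth: "smooth_fun (\<phi> n)" for n
      unfolding \<phi>_def by (intro smooth_fun_lin_comb smooth_fun_affine step(1))
    have d\<Theta>: "((\<lambda>x. 1 / m * \<Theta> (m * x + e)) has_field_derivative \<theta> (m * x + e)) (at x)"
      if "0 < m" for m e x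
    proof -
      have "((\<lambda>x. m * x + e) has_field_derivative m) (at x)"
        by (auto intro!: derivative_eq_intros)
      from DERIV_cmult[OF DERIV_chain2[OF step(2) this], of "1 / m"] show ?thesis using that by simp
    qed
    have d\<phi>: "deriv (\<phi> n) x = \<psi> n x" for n x
    proof -
      have "(\<phi> n has_field_derivative
         1 * (1 * \<theta> (real (Suc n) * x + - real (Suc n) * c) + (-1) * \<theta> (real (Suc n) * x + - real (Suc n) * d))
       + - (d - c) * (1 * \<theta> (real (Suc n) * x + 0) + (-1) * \<theta> (real (Suc n) * x + - real (Suc n)))) (at x)"
        unfolding \<phi>_def by (intro DERIV_add DERIV_cmult d\<Theta>) auto
      then show ?thesis by (intro DERIV_imp_deriv) (simp add: \<psi>_def algebra_simps)
    qed
    have big: "1 \<le> real (Suc n) * y" if "1 \<le> y" for n y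
    proof -
      have "1 * 1 \<le> real (Suc n) * y" using that by (intro mult_mono) auto
      then show ?thesis by simp
    qed
    have neg: "real (Suc n) * y \<le> 0" if "y \<le> 0" for n y
      using that by (simp add: mult_nonneg_nonpos del: of_nat_Suc)
    have arg: "real (Suc n) * x + - real (Suc n) * e = real (Suc n) * (x - e)"
      "real (Suc n) * x + - real (Suc n) = real (Suc n) * (x - 1)" for n x e
      by (simp_all add: algebra_simps)
    have arg0: "real (Suc n) * x + 0 = real (Suc n) * (x - 0)" for n x
      by simp
    have supp: "\<phi> n x = 0" if "K \<le> \<bar>x\<bar>" for n x
    proof (cases "0 \<le> x")
      case True
      then have x: "1 \<le> x - c" "1 \<le> x - d" "1 \<le> x" "1 \<le> x - 1" using that by (auto simp: K_def)
      have E: "1 / real (Suc n) * \<Theta> (real (Suc n) * (x - e)) = x - e + z / real (Suc n)" if "1 \<le> x - e" for e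
        unfolding step(8)[OF big[OF that]] by (simp add: field_simps)
      have x0: "1 \<le> x - 0" using x by simp
      show ?thesis unfolding \<phi>_def arg arg0 E[OF x(1)] E[OF x(2)] E[OF x0] E[OF x(4)]
        by (simp add: algebra_simps)
    next
      case False
      then have x: "x - c \<le> 0" "x - d \<le> 0" "x \<le> 0" "x - 1 \<le> 0" using that by (auto simp: K_def)
      show ?thesis unfolding \<phi>_def arg
        using x by (simp add: step(7)[OF neg] del: of_nat_Suc)
    qed
    have \<psi>supp: "\<psi> n x = 0" if "K \<le> \<bar>x\<bar>" for n x
    proof (cases "0 \<le> x")
      case True
      then have "1 \<le> x - c" "1 \<le> x - d" "1 \<le> x" "1 \<le> x - 1" using that by (auto simp: K_def)
      then show ?thesis unfolding \<psi>_def by (simp add: step(6)[OF big] del: of_nat_Suc)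
    next
      case False
      then have "x - c \<le> 0" "x - d \<le> 0" "x \<le> 0" "x - 1 \<le> 0" using that by (auto simp: K_def)
      then show ?thesis unfolding \<psi>_def by (simp add: step(5)[OF neg] del: of_nat_Suc)
    qed
    have test: "test_function (\<phi> n)" for n
    proof -
      have "{x. \<phi> n x \<noteq> 0} \<subseteq> {-K..K}" using supp[of _ n] by (force simp: abs_le_iff)
      then have "bounded {x. \<phi> n x \<noteq> 0}" by (rule bounded_subset[rotated]) simp
      then show ?thesis using smooth[of n] by (simp add: test_function_def smooth_fun_def)
    qed
    have K0: "0 \<le> K" by (simp add: K_def)
    have [measurable]: "\<psi> n \<in> borel_measurable borel" for n unfolding \<psi>_def by measurable
    have [measurable]: "\<phi> n \<in> borel_measurable borel" for n
      by (intro borel_measurable_continuous_onI smooth_fun_continuous smooth)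
    have \<psi>b: "\<bar>\<psi> n x\<bar> \<le> 1 + (d - c)" for n x
    proof -
      have "\<bar>\<theta> u - \<theta> v\<bar> \<le> 1" for u v using step(3)[of u] step(3)[of v] step(4)[of u] step(4)[of v] by linarith
      note b = this
      have "\<bar>\<psi> n x\<bar> \<le> \<bar>\<theta> (real (Suc n) * (x - c)) - \<theta> (real (Suc n) * (x - d))\<bar>
          + \<bar>(d - c) * (\<theta> (real (Suc n) * x) - \<theta> (real (Suc n) * (x - 1)))\<bar>"
        unfolding \<psi>_def by (rule abs_triangle_ineq4)
      also have "\<dots> \<le> 1 + (d - c) * 1"
        unfolding abs_mult using cd by (intro add_mono mult_mono b) auto
      finally show ?thesis by simp
    qed
    have \<psi>ind: "u x * \<psi> n x = indicator {-K..K} x * u x * \<psi> n x" for u :: "real \<Rightarrow> real" and n x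
      using \<psi>supp[of x n] by (auto split: split_indicator simp: abs_le_iff)
    have dom: "integrable lborel (\<lambda>x. u x * \<psi> n x)"
      if "\<And>s t. set_integrable lborel {s..t} u" and [measurable]: "u \<in> borel_measurable borel" for u n
    proof (rule Bochner_Integration.integrable_bound[where f="\<lambda>x. (1 + (d - c)) * (indicator {-K..K} x * u x)"])
      show "integrable lborel (\<lambda>x. (1 + (d - c)) * (indicator {-K..K} x * u x))"
        using that(1)[of "-K" K] by (simp add: set_integrable_def)
      show "AE x in lborel. norm (u x * \<psi> n x) \<le> norm ((1 + (d - c)) * (indicator {-K..K} x * u x))"
      proof (rule AE_I2)
        fix x
        have "norm (u x * \<psi> n x) = \<bar>indicator {-K..K} x * u x\<bar> * \<bar>\<psi> n x\<bar>" by (subst \<psi>ind) (simp add: abs_mult)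
        also have "\<dots> \<le> \<bar>indicator {-K..K} x * u x\<bar> * (1 + (d - c))" by (intro mult_left_mono \<psi>b) auto
        finally show "norm (u x * \<psi> n x) \<le> norm ((1 + (d - c)) * (indicator {-K..K} x * u x))"
          using cd by (simp add: abs_mult mult.commute)
      qed
    qed measurable
    have zero: "(\<integral>x. h x * \<psi> n x \<partial>lborel) = 0" for n
    proof -
      have "(\<integral>x. f' x * \<psi> n x \<partial>lborel) = (LINT x|lebesgue. f x * \<psi> n x)"
        by (rule LINT_lebesgue_borel_version[symmetric])
           (use f' locally_integrable_measurable[OF fl] in auto)
      also have "\<dots> = - (LINT x|lebesgue. g x * \<phi> n x)"
        using weak[OF test[of n]] by (simp add: d\<phi>)
      also have "(LINT x|lebesgue. g x * \<phi> n x) = (\<integral>x. g' x * \<phi> n x \<partial>lborel)"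
        by (rule LINT_lebesgue_borel_version)
           (use g' locally_integrable_measurable[OF gl] in auto)
      also have "- \<dots> = (\<integral>x. F x * \<psi> n x \<partial>lborel)"
        using ac_deriv_test[OF F smooth K0 supp, of n] by (simp add: d\<phi>)
      finally have eq: "(\<integral>x. f' x * \<psi> n x \<partial>lborel) = (\<integral>x. F x * \<psi> n x \<partial>lborel)" .
      have "(\<integral>x. h x * \<psi> n x \<partial>lborel) = (\<integral>x. f' x * \<psi> n x \<partial>lborel) - (\<integral>x. F x * \<psi> n x \<partial>lborel)"
        unfolding h_def left_diff_distrib
        by (intro Bochner_Integration.integral_diff dom f' Fint) auto
      then show ?thesis using eq by simp
    qed
    \<comment> \<open>The pointwise limit of \<psi>. Off the points c and 0 it is the indicator of
      \<open>{c..d}\<close> minus \<open>d - c\<close> times that of \<open>{0..1}\<close>.\<close>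
    define \<iota> where "\<iota> x = indicator {0<..} (x - c) - indicator {0<..} (x - d)
      - (d - c) * (indicator {0<..} x - indicator {0<..} (x - 1))" for x :: real
    have "(\<lambda>n. \<integral>x. h x * \<psi> n x \<partial>lborel) \<longlonglongrightarrow> (\<integral>x. h x * \<iota> x \<partial>lborel)"
    proof (rule integral_dominated_convergence[where w="\<lambda>x. (1 + (d - c)) * \<bar>indicator {-K..K} x * h x\<bar>"])
      show "integrable lborel (\<lambda>x. (1 + (d - c)) * \<bar>indicator {-K..K} x * h x\<bar>)"
        using hint[of "-K" K] by (simp add: set_integrable_def)
      show "AE x in lborel. (\<lambda>n. h x * \<psi> n x) \<longlonglongrightarrow> h x * \<iota> x"
        unfolding \<psi>_def \<iota>_def by (intro AE_I2 tendsto_intros lim)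
      show "AE x in lborel. norm (h x * \<psi> n x) \<le> (1 + (d - c)) * \<bar>indicator {-K..K} x * h x\<bar>" for n
      proof (rule AE_I2)
        fix x
        have "norm (h x * \<psi> n x) = \<bar>indicator {-K..K} x * h x\<bar> * \<bar>\<psi> n x\<bar>" by (subst \<psi>ind) (simp add: abs_mult)
        also have "\<dots> \<le> \<bar>indicator {-K..K} x * h x\<bar> * (1 + (d - c))" by (intro mult_left_mono \<psi>b) auto
        finally show "norm (h x * \<psi> n x) \<le> (1 + (d - c)) * \<bar>indicator {-K..K} x * h x\<bar>"
          by (simp add: mult.commute)
      qed
      show "(\<lambda>x. h x * \<iota> x) \<in> borel_measurable lborel" unfolding \<iota>_def by measurable
    qed measurable
    then have "(\<integral>x. h x * \<iota> x \<partial>lborel) = 0" by (simp add: zero LIMSEQ_const_iff)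
    moreover have "(\<integral>x. h x * \<iota> x \<partial>lborel) = (LBINT x:{c..d}. h x) - (d - c) * (LBINT x:{0..1}. h x)"
    proof -
      have "(\<integral>x. h x * \<iota> x \<partial>lborel)
          = (\<integral>x. indicator {c..d} x * h x - (d - c) * (indicator {0..1} x * h x) \<partial>lborel)"
      proof (rule integral_cong_AE)
        have "AE x in lborel. x \<noteq> c \<and> x \<noteq> 0"
          by (simp add: AE_lborel_singleton)
        then show "AE x in lborel. h x * \<iota> x = indicator {c..d} x * h x - (d - c) * (indicator {0..1} x * h x)"
        proof eventually_elim
          case (elim x)
          have *: "\<iota> x = indicator {c..d} x - (d - c) * indicator {0..1} x"
            using elim cd by (auto simp: \<iota>_def split: split_indicator)
          show ?case unfolding * by (simp add: algebra_simps)
        qed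
      qed (auto simp: \<iota>_def)
      also have "\<dots> = (LBINT x:{c..d}. h x) - (d - c) * (LBINT x:{0..1}. h x)"
        using hint[of c d] hint[of 0 1]
        by (simp add: set_integrable_def set_lebesgue_integral_def)
      finally show ?thesis .
    qed
    ultimately show ?thesis by simp
  qed
  \<comment> \<open>By \<open>avg\<close>, subtracting the mean over \<open>{0..1}\<close> leaves a
    function all of whose interval integrals vanish.\<close>
  define \<kappa> where "\<kappa> = (LBINT x:{0..1}. h x)"
  have "AE x in lborel. h x - \<kappa> = 0"
  proof (rule AE_eq_0_of_interval_integrals)
    have c: "set_integrable lborel {s..t} (\<lambda>_. \<kappa>)" for s t :: real
      by (intro borel_integrable_atLeastAtMost' continuous_intros)
    show "set_integrable lborel {s..t} (\<lambda>x. h x - \<kappa>)" for s t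
      by (rule set_integral_diff(1)[OF hint c])
    show "(LBINT x:{s..t}. h x - \<kappa>) = 0" if "s \<le> t" for s t
    proof -
      have "(LBINT x:{s..t}. h x - \<kappa>) = (LBINT x:{s..t}. h x) - (LBINT x:{s..t}. \<kappa>)"
        by (rule set_integral_diff(2)[OF hint c])
      also have "(LBINT x:{s..t}. \<kappa>) = (t - s) * \<kappa>"
        using that by (simp add: set_lebesgue_integral_def)
      finally show ?thesis using avg[OF that] by (simp add: \<kappa>_def)
    qed
  qed measurable
  then have A: "AE x in lborel. f x = F x + \<kappa>"
    using f'(2) by eventually_elim (simp add: h_def)
  have B: "ac_deriv (\<lambda>x. F x + \<kappa>) g'"
    using F by (simp add: ac_deriv_def)
  show ?thesis
    by (rule that[OF B g'(1) A g'(2)])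
qed

text \<open>The definition relates each weak derivative to f only. As the derivative of a test
  function is a test function, testing order k with \<open>deriv \<phi>\<close> and order
  \<open>Suc k\<close> with \<phi> compares the two directly.\<close>

lemma is_weak_deriv_step:
  assumes "is_weak_deriv k f g" "is_weak_deriv (Suc k) f g'"
  shows "is_weak_deriv 1 g g'"
  unfolding is_weak_deriv_def
proof (intro conjI allI impI)
  show "locally_integrable g" "locally_integrable g'"
    by (rule is_weak_deriv_locally_integrable[OF assms(1)] is_weak_deriv_locally_integrable[OF assms(2)])+
  fix \<phi> assume \<phi>: "test_function \<phi>"
  have "test_function (deriv \<phi>)"
    unfolding test_function_def
  proof (intro conjI allI)
    have sm: "smooth_fun \<phi>" using \<phi> by (simp add: test_function_def smooth_fun_def)
    show "(deriv ^^ j) (deriv \<phi>) field_differentiable at x" for j x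
      using smooth_fun_deriv[OF sm] unfolding smooth_fun_def by blast
    have "bounded {x. \<phi> x \<noteq> 0}" using \<phi> by (simp add: test_function_def)
    then obtain K where K: "\<forall>x\<in>{x. \<phi> x \<noteq> 0}. norm x \<le> K" unfolding bounded_iff ..
    have "deriv \<phi> x = 0" if "K < \<bar>x\<bar>" for x
      by (rule deriv_eq_0_outside[OF _ that]) (use K in \<open>force simp: not_le\<close>)
    then have "\<forall>x\<in>{x. deriv \<phi> x \<noteq> 0}. norm x \<le> K" by (auto simp: not_less[symmetric])
    then have "bounded {x. deriv \<phi> x \<noteq> 0}" unfolding bounded_iff ..
    then show "compact (closure {x. deriv \<phi> x \<noteq> 0})" by simp
  qed
  note 1 = is_weak_deriv_test[OF assms(1) this]
  have "(LINT x|lebesgue. f x * (deriv ^^ Suc k) \<phi> x) = (-1) ^ Suc k * (LINT x|lebesgue. g' x * \<phi> x)"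
    by (rule is_weak_deriv_test[OF assms(2) \<phi>])
  then have 2: "(LINT x|lebesgue. f x * (deriv ^^ k) (deriv \<phi>) x) = (-1) ^ Suc k * (LINT x|lebesgue. g' x * \<phi> x)"
    by (simp add: funpow_swap1)
  show "(LINT x|lebesgue. g x * (deriv ^^ 1) \<phi> x) = (-1) ^ 1 * (LINT x|lebesgue. g' x * \<phi> x)"
    using trans[OF 1[symmetric] 2] by (cases "even k") auto
qed

subsection \<open>Polynomials on the real line\<close>

text \<open>Induction on N, removing the leading coefficient with \<open>B N\<close>. Degree 0 does
  not exclude the zero polynomial, hence the assumption on \<open>B 0\<close>.\<close>

lemma graded_basis_span:
  fixes B :: "nat \<Rightarrow> real poly"
  assumes B: "\<And>k. degree (B k) = k" and "B 0 \<noteq> 0" and P: "degree P \<le> N"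
  shows "\<exists>b. P = (\<Sum>k\<le>N. smult (b k) (B k))"
  using P
proof (induction N arbitrary: P)
  case 0
  then have "degree P = 0" by simp
  then obtain c where c: "P = [:c:]" by (rule degree_eq_zeroE)
  obtain d where d: "B 0 = [:d:]" using B[of 0] by (rule degree_eq_zeroE)
  then have "d \<noteq> 0" using assms(2) by auto
  then have "P = smult (c / d) (B 0)" by (simp add: c d)
  then show ?case by (intro exI[of _ "\<lambda>_. c / d"]) simp
next
  case (Suc N)
  define c where "c = coeff P (Suc N) / coeff (B (Suc N)) (Suc N)"
  have "coeff (B (Suc N)) (Suc N) \<noteq> 0"
    using B[of "Suc N"] by (metis degree_0 leading_coeff_0_iff nat.distinct(1))
  then have "coeff (P - smult c (B (Suc N))) (Suc N) = 0" by (simp add: c_def)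
  moreover have "degree (P - smult c (B (Suc N))) \<le> Suc N"
    using Suc.prems B[of "Suc N"] by (intro degree_diff_le) auto
  ultimately have "degree (P - smult c (B (Suc N))) \<le> N"
    by (metis coeff_eq_0 degree_le le_degree le_neq_implies_less not_less_eq_eq nat_less_le leading_coeff_0_iff le_SucE degree_0 zero_le)
  from Suc.IH[OF this] obtain b where b: "P - smult c (B (Suc N)) = (\<Sum>k\<le>N. smult (b k) (B k))" ..
  have "P = (P - smult c (B (Suc N))) + smult c (B (Suc N))" by simp
  also have "\<dots> = (\<Sum>k\<le>Suc N. smult ((b(Suc N := c)) k) (B k))"
    unfolding b by simp
  finally show ?case by blast
qed

section \<open>Chebyshev expansions and polynomial inequalities on \<open>{-1..1}\<close>\<close>

text \<open>Chebyshev polynomials of the second kind. Times \<open>sin t\<close> they become sines,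
  which makes them orthogonal, and at 0, the point where values are estimated, they are bounded by
  1.\<close>

fun cheb_U :: "nat \<Rightarrow> real poly" where
  "cheb_U 0 = 1"
| "cheb_U (Suc 0) = [:0, 2:]"
| "cheb_U (Suc (Suc k)) = [:0, 2:] * cheb_U (Suc k) - cheb_U k"

lemma degree_cheb_U: "degree (cheb_U k) = k \<and> coeff (cheb_U k) k = 2 ^ k"
proof (induction k rule: cheb_U.induct)
  case (3 k)
  have eq: "cheb_U (Suc (Suc k)) = pCons 0 (smult 2 (cheb_U (Suc k))) - cheb_U k" by simp
  have c: "coeff (cheb_U (Suc (Suc k))) (Suc (Suc k)) = 2 ^ Suc (Suc k)"
    unfolding eq using 3 by (simp add: coeff_eq_0 del: cheb_U.simps)
  have "degree (cheb_U (Suc (Suc k))) \<le> Suc (Suc k)"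
    unfolding eq using 3 by (intro degree_diff_le) (auto simp: degree_pCons_eq_if simp del: cheb_U.simps)
  moreover have "Suc (Suc k) \<le> degree (cheb_U (Suc (Suc k)))"
    by (rule le_degree) (simp add: c del: cheb_U.simps)
  ultimately show ?case using c by (simp del: cheb_U.simps)
qed auto

lemma cheb_U_cos: "poly (cheb_U k) (cos t) * sin t = sin (real (Suc k) * t)"
proof (induction k rule: cheb_U.induct)
  case 2
  show ?case by (simp add: sin_double)
next
  case (3 k)
  have "poly (cheb_U (Suc (Suc k))) (cos t) * sin t
      = 2 * cos t * (poly (cheb_U (Suc k)) (cos t) * sin t) - poly (cheb_U k) (cos t) * sin t"
    by (simp add: algebra_simps)
  also have "\<dots> = 2 * cos t * sin (real (Suc (Suc k)) * t) - sin (real (Suc k) * t)"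
    by (simp only: 3)
  also have "\<dots> = sin (real (Suc (Suc (Suc k))) * t)"
  proof -
    have "sin (real (Suc (Suc k)) * t + t) + sin (real (Suc (Suc k)) * t - t) = 2 * cos t * sin (real (Suc (Suc k)) * t)"
      by (simp add: sin_add sin_diff)
    moreover have "real (Suc (Suc k)) * t + t = real (Suc (Suc (Suc k))) * t"
      "real (Suc (Suc k)) * t - t = real (Suc k) * t" by (simp_all add: algebra_simps)
    ultimately show ?thesis by simp
  qed
  finally show ?case .
qed simp

lemma cheb_U_0: "\<bar>poly (cheb_U k) 0\<bar> \<le> 1"
  using cheb_U_cos[of k "pi / 2"] by (simp del: of_nat_Suc)

lemma cheb_U_growth:
  assumes "1 \<le> \<bar>x\<bar>"
  shows "\<bar>poly (cheb_U k) x\<bar> \<le> (3 * \<bar>x\<bar>) ^ k"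
proof (induction k rule: cheb_U.induct)
  case 2
  show ?case using assms by simp
next
  case (3 k)
  let ?y = "3 * \<bar>x\<bar>"
  have y: "1 \<le> ?y" using assms by simp
  have "\<bar>poly (cheb_U (Suc (Suc k))) x\<bar> = \<bar>2 * x * poly (cheb_U (Suc k)) x - poly (cheb_U k) x\<bar>"
    by (simp add: algebra_simps)
  also have "\<dots> \<le> \<bar>2 * x * poly (cheb_U (Suc k)) x\<bar> + \<bar>poly (cheb_U k) x\<bar>"
    by (rule abs_triangle_ineq4)
  also have "\<dots> \<le> 2 * \<bar>x\<bar> * ?y ^ Suc k + ?y ^ k"
    unfolding abs_mult using 3 by (intro add_mono mult_mono) auto
  also have "?y ^ k \<le> \<bar>x\<bar> * ?y ^ Suc k"
  proof -
    have "?y ^ k \<le> ?y ^ Suc k" using y by (intro power_increasing) auto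
    also have "\<dots> \<le> \<bar>x\<bar> * ?y ^ Suc k" using mult_right_mono[OF assms, of "?y ^ Suc k"] by simp
    finally show ?thesis .
  qed
  finally show ?case by (simp add: algebra_simps)
qed simp

lemma has_integral_cos_int:
  assumes "n \<noteq> (0::int)"
  shows "((\<lambda>t. cos (of_int n * t)) has_integral 0) {0..pi}"
proof -
  have "((\<lambda>t. cos (of_int n * t)) has_integral (sin (of_int n * pi) / of_int n - sin (of_int n * 0) / of_int n)) {0..pi}"
    by (rule fundamental_theorem_of_calculus)
       (use assms in \<open>auto intro!: derivative_eq_intros simp: has_real_derivative_iff_has_vector_derivative[symmetric]\<close>)
  then show ?thesis by (simp add: sin_npi_int mult.commute)
qed

lemma has_integral_sin_sin:
  "((\<lambda>t. sin (real (Suc j) * t) * sin (real (Suc k) * t)) has_integral (if j = k then pi / 2 else 0)) {0..pi}"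
proof -
  define d where "d = int j - int k"
  define s where "s = int j + int k + 2"
  have eq: "sin (real (Suc j) * t) * sin (real (Suc k) * t) = (1/2) * cos (of_int d * t) - (1/2) * cos (of_int s * t)" for t
  proof -
    have a: "of_int d * t = real (Suc j) * t - real (Suc k) * t" "of_int s * t = real (Suc j) * t + real (Suc k) * t"
      by (simp_all add: d_def s_def algebra_simps)
    show ?thesis unfolding sin_times_sin a by (simp add: diff_divide_distrib)
  qed
  have S: "((\<lambda>t. (1/2) * cos (of_int s * t)) has_integral (1/2) * 0) {0..pi}"
    by (intro has_integral_mult_right has_integral_cos_int) (simp add: s_def)
  have D: "((\<lambda>t. (1/2) * cos (of_int d * t)) has_integral (if j = k then pi / 2 else 0)) {0..pi}"
  proof (cases "j = k")
    case True
    have "((\<lambda>t. 1 / 2 :: real) has_integral (pi - 0) *\<^sub>R (1 / 2)) {0..pi}"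
      using has_integral_const_real[of "1/2::real" 0 pi] by simp
    then show ?thesis using True by (simp add: d_def)
  next
    case False
    then have "((\<lambda>t. (1/2) * cos (of_int d * t)) has_integral (1/2) * 0) {0..pi}"
      by (intro has_integral_mult_right has_integral_cos_int) (simp add: d_def)
    then show ?thesis using False by simp
  qed
  show ?thesis unfolding eq using has_integral_diff[OF D S] by simp
qed

text \<open>The substitution is made with \<open>- cos\<close>, which increases on
  \<open>{0..pi}\<close>, and the reflection is undone afterwards.\<close>

lemma has_integral_cos_subst:
  fixes f :: "real \<Rightarrow> real"
  assumes "continuous_on {-1..1} f"
  shows "((\<lambda>t. sin t * f (cos t)) has_integral integral {-1..1} f) {0..pi}"
proof -
  have "((\<lambda>t. sin t *\<^sub>R (\<lambda>u. f (- u)) (- cos t)) has_integral integral {- cos 0..- cos pi} (\<lambda>u. f (- u))) {0..pi}"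
  proof (rule has_integral_substitution[where c="-1" and d=1])
    show "continuous_on {-1..1} (\<lambda>u. f (- u))"
      by (rule continuous_on_compose2[OF assms]) (auto intro!: continuous_intros)
  qed (auto intro!: derivative_eq_intros)
  moreover have "integral {-1..1} (\<lambda>u. f (- u)) = integral {-1..1} f"
    using Henstock_Kurzweil_Integration.integral_reflect_real[where a="-1" and b=1 and f=f] by simp
  ultimately show ?thesis by simp
qed

lemma nn_integral_interval_HK:
  fixes f :: "real \<Rightarrow> real"
  assumes f: "continuous_on UNIV f" and nonneg: "\<And>x. 0 \<le> f x"
  shows "(\<integral>\<^sup>+x. ennreal (f x) * indicator {s..t} x \<partial>lborel) = ennreal (integral {s..t} f)"
proof -
  have f': "continuous_on {s..t} f" using f continuous_on_subset by blast
  have I: "set_integrable lborel {s..t} f" by (rule borel_integrable_atLeastAtMost'[OF f'])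
  have "(\<integral>\<^sup>+x. ennreal (f x) * indicator {s..t} x \<partial>lborel) = (\<integral>\<^sup>+x. ennreal (indicator {s..t} x * f x) \<partial>lborel)"
    by (intro nn_integral_cong) (auto split: split_indicator)
  also have "\<dots> = ennreal (\<integral>x. indicator {s..t} x * f x \<partial>lborel)"
    by (rule nn_integral_eq_integral) (use I nonneg in \<open>auto simp: set_integrable_def\<close>)
  also have "(\<integral>x. indicator {s..t} x * f x \<partial>lborel) = integral {s..t} f"
    using set_borel_integral_eq_integral(2)[OF I] by (simp add: set_lebesgue_integral_def)
  finally show ?thesis .
qed

text \<open>With \<open>x = cos t\<close>, R times \<open>sin t\<close> becomes a sine polynomial,
  to which orthogonality and Parseval's identity apply. Returning to the unweighted integral costs
  nothing: \<open>(sin t)\<^sup>2 \<le> sin t\<close>, and \<open>pi / 2\<close> is at least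
  1.\<close>

lemma cheb_U_coeffs:
  assumes "degree R \<le> N"
  shows "\<exists>b. (\<forall>x. poly R x = (\<Sum>k\<le>N. b k * poly (cheb_U k) x)) \<and>
    (\<Sum>k\<le>N. (b k)\<^sup>2) \<le> integral {-1..1} (\<lambda>x. (poly R x)\<^sup>2) \<and>
    (\<forall>k\<le>N. \<bar>b k\<bar> \<le> integral {-1..1} (\<lambda>x. \<bar>poly R x\<bar>))"
proof -
  obtain b where b: "R = (\<Sum>k\<le>N. smult (b k) (cheb_U k))"
    using graded_basis_span[OF _ _ assms, of cheb_U] degree_cheb_U by auto
  have R: "poly R x = (\<Sum>k\<le>N. b k * poly (cheb_U k) x)" for x
    by (simp add: b poly_sum)
  have Rsin: "poly R (cos t) * sin t = (\<Sum>k\<le>N. b k * sin (real (Suc k) * t))" for t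
    unfolding R sum_distrib_right by (intro sum.cong refl) (simp add: mult.assoc cheb_U_cos del: of_nat_Suc)
  have coef: "((\<lambda>t. poly R (cos t) * sin t * sin (real (Suc k) * t)) has_integral b k * (pi / 2)) {0..pi}"
    if "k \<le> N" for k
  proof -
    have "((\<lambda>t. \<Sum>j\<le>N. b j * (sin (real (Suc j) * t) * sin (real (Suc k) * t))) has_integral
        (\<Sum>j\<le>N. b j * (if j = k then pi / 2 else 0))) {0..pi}"
      by (intro has_integral_sum has_integral_mult_right has_integral_sin_sin) auto
    moreover have "(\<Sum>j\<le>N. b j * (if j = k then pi / 2 else 0)) = b k * (pi / 2)"
      using that by (simp add: if_distrib sum.delta cong: if_cong)
    ultimately show ?thesis unfolding Rsin by (simp add: sum_distrib_right mult.assoc)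
  qed
  have pi2: "1 \<le> pi / 2" using pi_ge_two by simp
  have cont: "continuous_on A (poly R)" for A by (intro continuous_intros)
  have sq: "((\<lambda>t. (poly R (cos t) * sin t)\<^sup>2) has_integral (\<Sum>k\<le>N. (b k)\<^sup>2) * (pi / 2)) {0..pi}"
  proof -
    have "((\<lambda>t. \<Sum>k\<le>N. b k * (poly R (cos t) * sin t * sin (real (Suc k) * t))) has_integral
        (\<Sum>k\<le>N. b k * (b k * (pi / 2)))) {0..pi}"
      by (intro has_integral_sum has_integral_mult_right coef) auto
    moreover have "(\<Sum>k\<le>N. b k * (poly R (cos t) * sin t * sin (real (Suc k) * t))) = (poly R (cos t) * sin t)\<^sup>2" for t
    proof -
      have "(\<Sum>k\<le>N. b k * (poly R (cos t) * sin t * sin (real (Suc k) * t)))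
          = (poly R (cos t) * sin t) * (\<Sum>k\<le>N. b k * sin (real (Suc k) * t))"
        by (simp add: sum_distrib_left ac_simps)
      also have "\<dots> = (poly R (cos t) * sin t)\<^sup>2"
        unfolding Rsin[symmetric] by (simp add: power2_eq_square)
      finally show ?thesis .
    qed
    moreover have "(\<Sum>k\<le>N. b k * (b k * (pi / 2))) = (\<Sum>k\<le>N. (b k)\<^sup>2) * (pi / 2)"
      by (simp only: sum_distrib_right power2_eq_square mult.assoc)
    ultimately show ?thesis by (simp only:)
  qed
  have "(\<Sum>k\<le>N. (b k)\<^sup>2) * 1 \<le> (\<Sum>k\<le>N. (b k)\<^sup>2) * (pi / 2)"
    using pi2 by (intro mult_left_mono sum_nonneg) auto
  also have "\<dots> \<le> integral {-1..1} (\<lambda>x. (poly R x)\<^sup>2)"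
  proof (rule has_integral_le[OF sq has_integral_cos_subst])
    show "continuous_on {-1..1} (\<lambda>x. (poly R x)\<^sup>2)" by (intro continuous_intros)
    fix t assume t: "t \<in> {0..pi}"
    have "(sin t)\<^sup>2 \<le> sin t"
      using sin_ge_zero[of t] sin_le_one[of t] t by (simp add: power2_eq_square mult_left_le)
    then show "(poly R (cos t) * sin t)\<^sup>2 \<le> sin t * (poly R (cos t))\<^sup>2"
      by (simp add: power_mult_distrib mult.commute mult_right_mono)
  qed
  finally have B: "(\<Sum>k\<le>N. (b k)\<^sup>2) \<le> integral {-1..1} (\<lambda>x. (poly R x)\<^sup>2)" by simp
  have C: "\<bar>b k\<bar> \<le> integral {-1..1} (\<lambda>x. \<bar>poly R x\<bar>)" if k: "k \<le> N" for k
  proof -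
    have sub: "((\<lambda>t. sin t * \<bar>poly R (cos t)\<bar>) has_integral integral {-1..1} (\<lambda>x. \<bar>poly R x\<bar>)) {0..pi}"
      by (rule has_integral_cos_subst) (intro continuous_intros)
    have bd: "\<bar>poly R (cos t) * sin t * sin (real (Suc k) * t)\<bar> \<le> sin t * \<bar>poly R (cos t)\<bar>" if "t \<in> {0..pi}" for t
    proof -
      have "\<bar>poly R (cos t) * sin t\<bar> * \<bar>sin (real (Suc k) * t)\<bar> \<le> \<bar>poly R (cos t) * sin t\<bar> * 1"
        by (intro mult_left_mono abs_sin_le_one) auto
      then show ?thesis using sin_ge_zero[of t] that by (simp add: abs_mult mult.commute)
    qed
    have "\<bar>b k\<bar> * 1 \<le> \<bar>b k\<bar> * (pi / 2)" using pi2 by (intro mult_left_mono) auto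
    also have "\<bar>b k\<bar> * (pi / 2) = \<bar>b k * (pi / 2)\<bar>" by (simp add: abs_mult)
    also have "\<dots> \<le> integral {-1..1} (\<lambda>x. \<bar>poly R x\<bar>)"
    proof (rule abs_leI)
      show "b k * (pi / 2) \<le> integral {-1..1} (\<lambda>x. \<bar>poly R x\<bar>)"
        by (rule has_integral_le[OF coef[OF k] sub]) (rule abs_le_D1[OF bd])
      show "- (b k * (pi / 2)) \<le> integral {-1..1} (\<lambda>x. \<bar>poly R x\<bar>)"
        by (rule has_integral_le[OF has_integral_neg[OF coef[OF k]] sub]) (rule abs_le_D2[OF bd])
    qed
    finally show ?thesis by simp
  qed
  show ?thesis using R B C by blast
qed

text \<open>The Christoffel bound without weight, by the Cauchy-Schwarz inequality. The factor is
  linear in N because 0 is an interior point, where every \<open>cheb_U k\<close> is at most 1 in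
  modulus.\<close>

lemma poly_at_0_sq_le:
  assumes "degree R \<le> N"
  shows "(poly R 0)\<^sup>2 \<le> real (N + 1) * integral {-1..1} (\<lambda>x. (poly R x)\<^sup>2)"
proof -
  obtain b where "\<forall>x. poly R x = (\<Sum>k\<le>N. b k * poly (cheb_U k) x)"
    and b2: "(\<Sum>k\<le>N. (b k)\<^sup>2) \<le> integral {-1..1} (\<lambda>x. (poly R x)\<^sup>2)"
    using cheb_U_coeffs[OF assms] by blast
  then have b: "poly R x = (\<Sum>k\<le>N. b k * poly (cheb_U k) x)" for x
    by blast
  have "(poly R 0)\<^sup>2 \<le> (\<Sum>k\<le>N. (b k)\<^sup>2) * (\<Sum>k\<le>N. (poly (cheb_U k) 0)\<^sup>2)"
    unfolding b[of 0] by (rule Cauchy_Schwarz_ineq_sum)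
  also have "\<dots> \<le> integral {-1..1} (\<lambda>x. (poly R x)\<^sup>2) * (\<Sum>k\<le>N. 1)"
  proof (intro mult_mono b2 sum_mono)
    show "(poly (cheb_U k) 0)\<^sup>2 \<le> 1" for k using cheb_U_0[of k] by (simp add: abs_square_le_1)
    show "0 \<le> integral {-1..1} (\<lambda>x. (poly R x)\<^sup>2)" by (rule order_trans[OF sum_nonneg b2]) auto
  qed (auto intro: sum_nonneg)
  finally show ?thesis by (simp add: mult.commute)
qed

lemma poly_growth:
  assumes R: "degree R \<le> N" and x: "1 \<le> \<bar>x\<bar>"
  shows "\<bar>poly R x\<bar> \<le> real (N + 1) * (3 * \<bar>x\<bar>) ^ N * integral {-1..1} (\<lambda>x. \<bar>poly R x\<bar>)"
proof -
  obtain b where b0: "\<forall>x. poly R x = (\<Sum>k\<le>N. b k * poly (cheb_U k) x)"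
    "\<forall>k\<le>N. \<bar>b k\<bar> \<le> integral {-1..1} (\<lambda>x. \<bar>poly R x\<bar>)"
    using cheb_U_coeffs[OF R] by blast
  have b: "poly R x = (\<Sum>k\<le>N. b k * poly (cheb_U k) x)"
    "k \<le> N \<Longrightarrow> \<bar>b k\<bar> \<le> integral {-1..1} (\<lambda>x. \<bar>poly R x\<bar>)" for x k
    using b0 by blast+
  have I0: "0 \<le> integral {-1..1} (\<lambda>x. \<bar>poly R x\<bar>)" using b(2)[of 0] by auto
  have "\<bar>poly R x\<bar> \<le> (\<Sum>k\<le>N. \<bar>b k * poly (cheb_U k) x\<bar>)" unfolding b(1)[of x] by (rule sum_abs)
  also have "\<dots> \<le> (\<Sum>k\<le>N. integral {-1..1} (\<lambda>x. \<bar>poly R x\<bar>) * (3 * \<bar>x\<bar>) ^ N)"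
  proof (rule sum_mono)
    fix k assume k: "k \<in> {..N}"
    have "\<bar>poly (cheb_U k) x\<bar> \<le> (3 * \<bar>x\<bar>) ^ k" by (rule cheb_U_growth[OF x])
    also have "\<dots> \<le> (3 * \<bar>x\<bar>) ^ N" using x k by (intro power_increasing) auto
    finally show "\<bar>b k * poly (cheb_U k) x\<bar> \<le> integral {-1..1} (\<lambda>x. \<bar>poly R x\<bar>) * (3 * \<bar>x\<bar>) ^ N"
      unfolding abs_mult using b(2)[of k] k I0 by (intro mult_mono) auto
  qed
  finally show ?thesis by (simp add: mult_ac)
qed

text \<open>\<open>sine_quot m\<close> is the polynomial \<open>D\<close> with \<open>D (sin t) = sin ((2 * m + 1) * t) / sin t\<close>.\<close>

fun sine_quot :: "nat \<Rightarrow> real poly" where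
  "sine_quot 0 = 1"
| "sine_quot (Suc 0) = [:3, 0, -4:]"
| "sine_quot (Suc (Suc m)) = [:2, 0, -4:] * sine_quot (Suc m) - sine_quot m"

lemma degree_sine_quot: "degree (sine_quot m) \<le> 2 * m"
proof (induction m rule: sine_quot.induct)
  case (3 m)
  have "degree ([:2, 0, -4:] * sine_quot (Suc m)) \<le> degree [:2, 0, -4 :: real:] + degree (sine_quot (Suc m))"
    by (rule degree_mult_le)
  also have "\<dots> \<le> 2 * Suc (Suc m)" using 3 by simp
  finally show ?case using 3 by (simp only: sine_quot.simps) (intro degree_diff_le, auto)
qed auto

lemma sine_quot_sin: "poly (sine_quot m) (sin t) * sin t = sin (real (2 * m + 1) * t)"
proof (induction m rule: sine_quot.induct)
  case 2
  have "sin (3 * t) = sin (2 * t + t)" by (simp add: algebra_simps)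
  also have "\<dots> = 3 * sin t - 4 * sin t ^ 3"
  proof -
    have "2 * sin t * cos t * cos t = 2 * sin t * (1 - (sin t)\<^sup>2)"
    proof -
      have "cos t * cos t = 1 - (sin t)\<^sup>2"
        using cos_squared_eq[of t] by (simp only: power2_eq_square)
      then show ?thesis by (simp only: mult.assoc)
    qed
    then show ?thesis unfolding sin_add sin_double cos_double_sin
      by (simp add: power3_eq_cube power2_eq_square algebra_simps)
  qed
  finally show ?case by (simp add: power3_eq_cube algebra_simps)
next
  case (3 m)
  have "poly (sine_quot (Suc (Suc m))) (sin t) * sin t
     = 2 * (1 - 2 * (sin t)\<^sup>2) * (poly (sine_quot (Suc m)) (sin t) * sin t) - poly (sine_quot m) (sin t) * sin t"
    by (simp add: algebra_simps power2_eq_square)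
  also have "\<dots> = 2 * cos (2 * t) * sin (real (2 * Suc m + 1) * t) - sin (real (2 * m + 1) * t)"
    by (simp only: 3 cos_double_sin)
  also have "\<dots> = sin (real (2 * Suc (Suc m) + 1) * t)"
  proof -
    have "sin (real (2 * Suc m + 1) * t + 2 * t) + sin (real (2 * Suc m + 1) * t - 2 * t)
        = 2 * cos (2 * t) * sin (real (2 * Suc m + 1) * t)"
      unfolding sin_add sin_diff by simp
    moreover have "real (2 * Suc m + 1) * t + 2 * t = real (2 * Suc (Suc m) + 1) * t"
      "real (2 * Suc m + 1) * t - 2 * t = real (2 * m + 1) * t" by (simp_all add: algebra_simps)
    ultimately show ?thesis by (simp only:)
  qed
  finally show ?case .
qed simp

lemma abs_sin_mult_le: "\<bar>sin (real n * t)\<bar> \<le> real n * \<bar>sin t\<bar>"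
proof (induction n)
  case (Suc n)
  have "\<bar>sin (real (Suc n) * t)\<bar> = \<bar>sin (real n * t) * cos t + cos (real n * t) * sin t\<bar>"
  proof -
    have "real (Suc n) * t = real n * t + t" by (simp add: algebra_simps)
    then show ?thesis by (simp only: sin_add)
  qed
  also have "\<dots> \<le> \<bar>sin (real n * t)\<bar> * \<bar>cos t\<bar> + \<bar>cos (real n * t)\<bar> * \<bar>sin t\<bar>"
    by (metis abs_mult abs_triangle_ineq)
  also have "\<dots> \<le> \<bar>sin (real n * t)\<bar> * 1 + 1 * \<bar>sin t\<bar>"
    by (intro add_mono mult_mono abs_cos_le_one) auto
  finally show ?case using Suc by (simp add: algebra_simps)
qed simp

lemma sine_quot_0: "poly (sine_quot m) 0 = real (2 * m + 1)"
  by (induction m rule: sine_quot.induct) auto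

lemma sine_quot_bounds:
  assumes "\<bar>u\<bar> \<le> 1"
  shows "\<bar>u\<bar> * \<bar>poly (sine_quot m) u\<bar> \<le> 1" "\<bar>poly (sine_quot m) u\<bar> \<le> real (2 * m + 1)"
proof -
  define t where "t = arcsin u"
  have t: "sin t = u" using assms by (simp add: t_def abs_le_iff)
  have eq: "poly (sine_quot m) u * u = sin (real (2 * m + 1) * t)"
    using sine_quot_sin[of m t] t by simp
  have "\<bar>poly (sine_quot m) u * u\<bar> \<le> 1" unfolding eq by (rule abs_sin_le_one)
  then show "\<bar>u\<bar> * \<bar>poly (sine_quot m) u\<bar> \<le> 1" by (simp add: abs_mult mult.commute)
  show "\<bar>poly (sine_quot m) u\<bar> \<le> real (2 * m + 1)"
  proof (cases "u = 0")
    case False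
    have "\<bar>poly (sine_quot m) u\<bar> * \<bar>u\<bar> \<le> real (2 * m + 1) * \<bar>u\<bar>"
      using abs_sin_mult_le[of "2 * m + 1" t] unfolding eq[symmetric] t by (simp add: abs_mult)
    then show ?thesis using False by (simp add: mult_le_cancel_right)
  qed (simp add: sine_quot_0)
qed

text \<open>\<open>poly_at_0_sq_le\<close> for the square of \<open>sine_quot m\<close>, read
  backwards: the value \<open>2 * m + 1\<close> at 0 forces a large integral.\<close>

lemma jackson_kernel_mass:
  "real (2 * m + 1) ^ 3 / 2 \<le> integral {-1..1} (\<lambda>u. poly (sine_quot m) u ^ 4)"
proof -
  let ?M = "real (2 * m + 1)"
  have "degree (sine_quot m ^ 2) \<le> 4 * m"
    using degree_power_le[of "sine_quot m" 2] degree_sine_quot[of m] by simp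
  from poly_at_0_sq_le[OF this]
  have "?M ^ 4 \<le> real (4 * m + 1) * integral {-1..1} (\<lambda>u. poly (sine_quot m) u ^ 4)"
    by (simp add: sine_quot_0 power_mult[symmetric] del: of_nat_Suc of_nat_add of_nat_mult)
  also have "\<dots> \<le> (2 * ?M) * integral {-1..1} (\<lambda>u. poly (sine_quot m) u ^ 4)"
    by (intro mult_right_mono integral_nonneg integrable_continuous_interval continuous_intros) auto
  finally have "?M * (?M ^ 3 / 2) \<le> ?M * integral {-1..1} (\<lambda>u. poly (sine_quot m) u ^ 4)"
  proof -
    assume *: "?M ^ 4 \<le> 2 * ?M * integral {-1..1} (\<lambda>u. poly (sine_quot m) u ^ 4)"
    have "?M * (?M ^ 3 / 2) = ?M ^ 4 / 2" by (simp add: eval_nat_numeral)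
    with * show ?thesis by (simp only: mult.assoc)
  qed
  then show ?thesis by (rule mult_left_le_imp_le) simp
qed

text \<open>From \<open>\<bar>D\<bar> \<le> M\<close> and \<open>\<bar>u * D\<bar> \<le> 1\<close>
  follows \<open>D\<^sup>2 \<le> 2 * M\<^sup>2 / (1 + M\<^sup>2 * u\<^sup>2)\<close>; the square of
  this majorant times u has the primitive G. Relative to the mass, of order \<open>M ^ 3\<close>,
  the moment gains a factor M.\<close>

lemma jackson_kernel_moment:
  "integral {-1..1} (\<lambda>u. \<bar>u\<bar> * poly (sine_quot m) u ^ 4) \<le> 4 * real (2 * m + 1) ^ 2"
proof -
  let ?M = "real (2 * m + 1)"
  let ?D = "poly (sine_quot m)"
  define G where "G = (\<lambda>u. - 2 * ?M\<^sup>2 / (1 + ?M\<^sup>2 * u\<^sup>2))"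
  have pos: "0 < 1 + ?M\<^sup>2 * u\<^sup>2" for u :: real
    by (metis add_pos_nonneg power_mult_distrib zero_le_power2 zero_less_one)
  have dG: "(G has_field_derivative 4 * ?M ^ 4 * u / (1 + ?M\<^sup>2 * u\<^sup>2)\<^sup>2) (at u within S)" for u S
    unfolding G_def using pos[of u]
    by (auto intro!: derivative_eq_intros simp: power2_eq_square power_numeral_reduce)
  have pw: "\<bar>u\<bar> * ?D u ^ 4 \<le> \<bar>u\<bar> * (4 * ?M ^ 4 / (1 + ?M\<^sup>2 * u\<^sup>2)\<^sup>2)" if "\<bar>u\<bar> \<le> 1" for u
  proof -
    have a: "(?D u)\<^sup>2 \<le> ?M\<^sup>2" using sine_quot_bounds(2)[OF that, of m] by (intro power2_le_iff_abs_le[THEN iffD2]) auto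
    have "(\<bar>u\<bar> * \<bar>?D u\<bar>)\<^sup>2 \<le> 1\<^sup>2" using sine_quot_bounds(1)[OF that, of m] by (intro power_mono) auto
    then have b: "u\<^sup>2 * (?D u)\<^sup>2 \<le> 1" by (simp add: power_mult_distrib)
    have "(?D u)\<^sup>2 * (1 + ?M\<^sup>2 * u\<^sup>2) = (?D u)\<^sup>2 + ?M\<^sup>2 * (u\<^sup>2 * (?D u)\<^sup>2)" by (simp add: algebra_simps)
    also have "\<dots> \<le> ?M\<^sup>2 + ?M\<^sup>2 * 1" using a b by (intro add_mono mult_left_mono) auto
    finally have "(?D u)\<^sup>2 \<le> 2 * ?M\<^sup>2 / (1 + ?M\<^sup>2 * u\<^sup>2)" using pos[of u] by (simp add: pos_le_divide_eq)
    then have "((?D u)\<^sup>2)\<^sup>2 \<le> (2 * ?M\<^sup>2 / (1 + ?M\<^sup>2 * u\<^sup>2))\<^sup>2" by (intro power_mono) auto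
    then have "?D u ^ 4 \<le> 4 * ?M ^ 4 / (1 + ?M\<^sup>2 * u\<^sup>2)\<^sup>2"
      by (simp add: power_divide power_mult_distrib power_mult[symmetric] del: of_nat_Suc of_nat_add of_nat_mult)
    then show ?thesis by (intro mult_left_mono) auto
  qed
  have i1: "((\<lambda>u. \<bar>u\<bar> * (4 * ?M ^ 4 / (1 + ?M\<^sup>2 * u\<^sup>2)\<^sup>2)) has_integral (G 1 - G 0)) {0..1}"
  proof (rule has_integral_eq)
    show "((\<lambda>u. 4 * ?M ^ 4 * u / (1 + ?M\<^sup>2 * u\<^sup>2)\<^sup>2) has_integral (G 1 - G 0)) {0..1}"
      by (rule fundamental_theorem_of_calculus) (use dG in \<open>auto simp: has_real_derivative_iff_has_vector_derivative[symmetric]\<close>)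
  qed auto
  have i2: "((\<lambda>u. \<bar>u\<bar> * (4 * ?M ^ 4 / (1 + ?M\<^sup>2 * u\<^sup>2)\<^sup>2)) has_integral (- (G 0 - G (-1)))) {-1..0}"
  proof (rule has_integral_eq)
    show "((\<lambda>u. - (4 * ?M ^ 4 * u / (1 + ?M\<^sup>2 * u\<^sup>2)\<^sup>2)) has_integral (- (G 0 - G (-1)))) {-1..0}"
      by (rule has_integral_neg, rule fundamental_theorem_of_calculus)
         (use dG in \<open>auto simp: has_real_derivative_iff_has_vector_derivative[symmetric]\<close>)
  qed auto
  have "((\<lambda>u. \<bar>u\<bar> * (4 * ?M ^ 4 / (1 + ?M\<^sup>2 * u\<^sup>2)\<^sup>2)) has_integral (- (G 0 - G (-1)) + (G 1 - G 0))) {-1..1}"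
    by (rule has_integral_combine[OF _ _ i2 i1]) auto
  then have "integral {-1..1} (\<lambda>u. \<bar>u\<bar> * ?D u ^ 4) \<le> - (G 0 - G (-1)) + (G 1 - G 0)"
    using pw by (intro has_integral_le[OF integrable_integral] integrable_continuous_interval continuous_intros) auto
  also have "\<dots> \<le> 4 * ?M\<^sup>2"
  proof -
    have "G 1 \<le> 0" "G (-1) \<le> 0" using pos[of 1] by (auto simp: G_def divide_le_0_iff)
    then show ?thesis by (simp add: G_def)
  qed
  finally show ?thesis .
qed

section \<open>Taylor polynomials of the exponential function\<close>

lemma exp_partial_le: "0 \<le> y \<Longrightarrow> (\<Sum>j\<le>m. y ^ j / fact j) \<le> exp (y :: real)"
proof -
  assume y: "0 \<le> y"
  have "(\<Sum>j\<in>{..m}. inverse (fact j) * y ^ j) \<le> (\<Sum>n. inverse (fact n) * y ^ n)"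
    by (rule sum_le_suminf) (use y summable_exp in auto)
  then show ?thesis by (simp add: exp_def divide_inverse mult.commute)
qed

text \<open>In the remainder \<open>A ^ (j + m) \<le> (2 * A) ^ (j + m) / 2 ^ m\<close>: doubling A
  buys the denominator while the series still sums to at most \<open>exp (2 * A)\<close>.\<close>

lemma exp_partial_error:
  fixes y :: real
  assumes y: "\<bar>y\<bar> \<le> A"
  shows "\<bar>exp y - (\<Sum>j<m. y ^ j / fact j)\<bar> \<le> exp (2 * A) / 2 ^ m"
proof -
  have A: "0 \<le> A" using y by linarith
  have s: "summable (\<lambda>j. z ^ j / fact j)" for z :: real
    using summable_exp[of z] by (simp add: divide_inverse mult.commute)
  have e: "exp z = (\<Sum>j. z ^ j / fact j)" for z :: real
    by (simp add: exp_def divide_inverse mult.commute)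
  have st: "summable (\<lambda>j. z ^ (j + m) / fact (j + m))" for z :: real
    using s[of z] by (subst summable_iff_shift)
  have bd: "norm (y ^ (j + m) / fact (j + m)) \<le> ((2 * A) ^ (j + m) / fact (j + m)) / 2 ^ m" for j
  proof -
    have "\<bar>y\<bar> ^ (j + m) \<le> A ^ (j + m)" using y by (intro power_mono) auto
    also have "\<dots> \<le> A ^ (j + m) * 2 ^ j"
      using mult_left_mono[of 1 "2 ^ j" "A ^ (j + m)"] A by simp
    also have "\<dots> = (2 * A) ^ (j + m) / 2 ^ m" by (simp add: power_add power_mult_distrib)
    finally have "\<bar>y\<bar> ^ (j + m) / fact (j + m) \<le> ((2 * A) ^ (j + m) / 2 ^ m) / fact (j + m)"
      by (intro divide_right_mono) auto
    then show ?thesis by (simp add: power_abs ac_simps)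
  qed
  have "exp y - (\<Sum>j<m. y ^ j / fact j) = (\<Sum>j. y ^ (j + m) / fact (j + m))"
    using suminf_split_initial_segment[OF s[of y], of m] by (simp add: e)
  also have "norm \<dots> \<le> (\<Sum>j. ((2 * A) ^ (j + m) / fact (j + m)) / 2 ^ m)"
    by (rule norm_suminf_le[OF bd summable_divide[OF st]])
  also have "\<dots> = (\<Sum>j. (2 * A) ^ (j + m) / fact (j + m)) / 2 ^ m"
    by (rule suminf_divide[OF st])
  also have "\<dots> \<le> exp (2 * A) / 2 ^ m"
  proof (rule divide_right_mono)
    have "exp (2 * A) = (\<Sum>j. (2 * A) ^ (j + m) / fact (j + m)) + (\<Sum>j<m. (2 * A) ^ j / fact j)"
      using suminf_split_initial_segment[OF s[of "2 * A"], of m] by (simp add: e)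
    moreover have "0 \<le> (\<Sum>j<m. (2 * A) ^ j / fact j)" using A by (intro sum_nonneg) auto
    ultimately show "(\<Sum>j. (2 * A) ^ (j + m) / fact (j + m)) \<le> exp (2 * A)" by linarith
  qed simp
  finally show ?thesis by simp
qed

lemma exp_le_4_power: "0 \<le> y \<Longrightarrow> real m \<ge> 2 * y \<Longrightarrow> exp y \<le> 2 ^ m"
proof -
  assume y: "0 \<le> y" "real m \<ge> 2 * y"
  have "ln 2 \<ge> (1 / 2 :: real)" using ln2_ge_two_thirds by simp
  then have "y \<le> real m * ln 2" using y mult_mono[of "2 * y" "real m" "1/2" "ln 2"] by simp
  then have "exp y \<le> exp (real m * ln 2)" by simp
  also have "\<dots> = 2 ^ m" by (simp add: exp_of_nat_mult)
  finally show ?thesis .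
qed

definition exp_poly :: "real \<Rightarrow> nat \<Rightarrow> real poly" where
  "exp_poly q m = (\<Sum>j<m. monom (q ^ j / fact j) j)"

text \<open>With \<open>6 * A \<le> m\<close> the Taylor error is at most \<open>exp (- A)\<close>,
  hence at most \<open>exp (q * u)\<close> itself. A degree proportional to A thus gives a relative
  error of at most 1.\<close>

lemma exp_poly:
  assumes q: "\<bar>q\<bar> \<le> A" and u: "\<bar>u\<bar> \<le> 1" and m: "real m \<ge> 6 * A" "0 < m"
  shows "\<bar>poly (exp_poly q m) u\<bar> \<le> 2 * exp (q * u)" "poly (exp_poly q m) 0 = 1"
    "degree (exp_poly q m) \<le> m"
proof -
  have eq: "poly (exp_poly q m) u = (\<Sum>j<m. (q * u) ^ j / fact j)" for u
    by (simp add: exp_poly_def poly_sum poly_monom power_mult_distrib)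
  have A: "0 \<le> A" using q by linarith
  have qu: "\<bar>q * u\<bar> \<le> A" using mult_mono[OF q u] A by (simp add: abs_mult)
  have "\<bar>exp (q * u) - poly (exp_poly q m) u\<bar> \<le> exp (2 * A) / 2 ^ m"
    unfolding eq by (rule exp_partial_error[OF qu])
  also have "\<dots> \<le> exp (2 * A) / exp (3 * A)"
    using A m by (intro divide_left_mono exp_le_4_power) auto
  also have "\<dots> = exp (- A)" by (simp add: exp_diff[symmetric])
  also have "\<dots> \<le> exp (q * u)" using qu by (simp add: abs_le_iff)
  finally show "\<bar>poly (exp_poly q m) u\<bar> \<le> 2 * exp (q * u)" by linarith
  show "poly (exp_poly q m) 0 = 1"
    unfolding eq using m(2) by (cases m) (auto simp: sum.lessThan_Suc_shift simp del: sum.lessThan_Suc)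
  show "degree (exp_poly q m) \<le> m"
    unfolding exp_poly_def by (intro degree_sum_le) (auto intro: order_trans[OF degree_monom_le])
qed

text \<open>A polynomial of degree \<open>O(n)\<close> that decays like \<open>exp (- B n \<bar>u\<bar>\<^sup>\<mu>)\<close> exists since
  \<open>\<bar>u\<bar> powr (\<mu> - 2)\<close> is integrable at \<open>0\<close>: multiply powers of normalised \<open>sine_quot\<close> for the
  dyadic scales \<open>\<bar>u\<bar> \<approx> 2\<^sup>-\<^sup>j\<close>.\<close>

lemma fast_decreasing_poly:
  fixes B \<mu> :: real
  assumes B: "0 \<le> B" and \<mu>: "1 < \<mu>"
  shows "\<exists>C>0. \<forall>n\<ge>1. \<exists>\<tau>. real (degree \<tau>) \<le> C * real n \<and> poly \<tau> 0 = 1 \<and>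
    (\<forall>u. \<bar>u\<bar> \<le> 1 \<longrightarrow> \<bar>poly \<tau> u\<bar> \<le> C * exp (- B * real n * \<bar>u\<bar> powr \<mu>))"
proof -
  \<comment> \<open>The factor of scale j has degree of order \<open>2 ^ j\<close> and is raised to
    a power of order \<open>n * 2 powr (- j * \<mu>)\<close>. Since \<mu> > 1, these degrees
    decrease geometrically with ratio \<rho>.\<close>
  define \<rho> where "\<rho> = 2 powr (1 - \<mu>)"
  have \<rho>: "0 < \<rho>" "\<rho> < 1" using \<mu> powr_less_mono[of "1 - \<mu>" 0 2] by (auto simp: \<rho>_def)
  define G where "G = 4 * (2 powr \<mu> * B) / (1 - \<rho>)"
  have G: "0 \<le> G" using \<rho> B by (simp add: G_def)
  define C where "C = 8 + G + exp (2 * B)"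
  have C: "0 < C" "exp (2 * B) \<le> C" "1 \<le> C" using G by (auto simp: C_def add_nonneg_pos)
  show ?thesis
  proof (intro exI[of _ C] conjI C allI impI)
    fix n :: nat assume n: "1 \<le> n"
    \<comment> \<open>Before rounding, this is the largest value of
      \<open>B * n * \<bar>u\<bar> powr \<mu>\<close> for
      \<open>\<bar>u\<bar> \<le> 2 / 2 ^ j\<close>.\<close>
    define k where "k j = nat \<lceil>2 powr \<mu> * B * real n * 2 powr (- real j * \<mu>)\<rceil>" for j :: nat
    have k: "2 powr \<mu> * B * real n * 2 powr (- real j * \<mu>) \<le> real (k j)"
      "real (k j) \<le> 2 powr \<mu> * B * real n * 2 powr (- real j * \<mu>) + 1" for j
      using B by (auto simp: k_def real_nat_ceiling_ge intro: of_nat_ceiling)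
    \<comment> \<open>The finest scale is \<open>1 / n\<close> up to a factor 2. Below it
      \<open>B * n * \<bar>u\<bar> powr \<mu>\<close> is at most \<open>2 * B\<close>, which C
      absorbs, and the degrees added by rounding up \<open>k j\<close> still sum to O(n).\<close>
    define J where "J = nat \<lfloor>log 2 (real n)\<rfloor>"
    have J: "2 ^ J \<le> real n" "real n < 2 ^ Suc J"
    proof -
      have l: "0 \<le> log 2 (real n)" using n by simp
      have "real J \<le> log 2 (real n)" "log 2 (real n) < real J + 1"
        using l unfolding J_def by linarith+
      then have "2 powr real J \<le> real n" "real n < 2 powr (real J + 1)"
        using n by (simp_all add: le_log_iff log_less_iff)
      then show "2 ^ J \<le> real n" "real n < 2 ^ Suc J"
        by (simp_all add: powr_realpow[symmetric] powr_add mult.commute)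
    qed
    \<comment> \<open>The index \<open>2 * 2 ^ j\<close> makes the value at 0 exceed four times
      \<open>2 ^ j\<close>, so after normalisation D is at most \<open>1 / 4 \<le> exp (-1)\<close>
      once \<open>1 / 2 ^ j \<le> \<bar>u\<bar>\<close>.\<close>
    define D where "D j = smult (1 / real (4 * 2 ^ j + 1)) (sine_quot (2 * 2 ^ j))" for j :: nat
    define \<tau> where "\<tau> = (\<Prod>j\<le>J. D j ^ k j)"
    have degD: "degree (D j) \<le> 4 * 2 ^ j" for j
      using degree_sine_quot[of "2 * 2 ^ j"] degree_smult_le[of "1 / real (4 * 2 ^ j + 1)" "sine_quot (2 * 2 ^ j)"]
      unfolding D_def by linarith
    have pos: "0 < 1 + 4 * (2::real) ^ j" for j :: nat by (simp add: add_pos_pos)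
    have D0: "poly (D j) 0 = 1" for j using pos[of j] by (simp add: D_def sine_quot_0)
    have D1: "\<bar>poly (D j) u\<bar> \<le> 1" if "\<bar>u\<bar> \<le> 1" for u j
      using sine_quot_bounds(2)[OF that, of "2 * 2 ^ j"] pos[of j] by (simp add: D_def abs_mult)
    have De: "\<bar>poly (D j) u\<bar> \<le> exp (-1)" if "\<bar>u\<bar> \<le> 1" "1 / 2 ^ j \<le> \<bar>u\<bar>" for u j
    proof -
      have u0: "0 < \<bar>u\<bar>" using that(2) by (meson less_le_trans zero_less_divide_1_iff zero_less_numeral zero_less_power)
      have "\<bar>poly (sine_quot (2 * 2 ^ j)) u\<bar> \<le> 1 / \<bar>u\<bar>"
        using sine_quot_bounds(1)[OF that(1), of "2 * 2 ^ j"] u0 by (simp add: pos_le_divide_eq mult.commute)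
      also have "\<dots> \<le> 2 ^ j" using that(2) u0 by (simp add: field_simps)
      finally have "\<bar>poly (D j) u\<bar> \<le> 2 ^ j / real (4 * 2 ^ j + 1)"
        unfolding D_def by (simp add: abs_mult divide_right_mono)
      also have "\<dots> \<le> 1 / 4" using pos[of j] by (simp add: divide_simps)
      also have "1 / 4 \<le> exp (-1 :: real)" using exp_le by (simp add: exp_minus field_simps)
      finally show ?thesis .
    qed
    have "degree \<tau> \<le> (\<Sum>j\<le>J. degree (D j ^ k j))"
      unfolding \<tau>_def by (rule order_trans[OF degree_prod_sum_le]) auto
    also have "\<dots> \<le> (\<Sum>j\<le>J. 4 * 2 ^ j * k j)"
      by (intro sum_mono order_trans[OF degree_power_le] mult_right_mono degD) auto
    finally have "real (degree \<tau>) \<le> (\<Sum>j\<le>J. 4 * 2 ^ j * real (k j))"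
      by (metis (mono_tags, lifting) of_nat_le_iff of_nat_sum of_nat_mult of_nat_power of_nat_numeral sum.cong)
    also have "\<dots> \<le> (\<Sum>j\<le>J. 4 * 2 ^ j * (2 powr \<mu> * B * real n * 2 powr (- real j * \<mu>) + 1))"
      by (intro sum_mono mult_left_mono k) auto
    also have "\<dots> = (\<Sum>j\<le>J. 4 * (2 powr \<mu> * B) * real n * \<rho> ^ j) + (\<Sum>j\<le>J. 4 * (2::real) ^ j)"
    proof -
      have "\<rho> ^ j = 2 ^ j * 2 powr (- real j * \<mu>)" for j
        unfolding \<rho>_def by (simp add: powr_realpow[symmetric] powr_powr powr_add[symmetric] algebra_simps)
      then show ?thesis by (simp add: sum.distrib[symmetric] algebra_simps)
    qed
    also have "(\<Sum>j\<le>J. 4 * (2 powr \<mu> * B) * real n * \<rho> ^ j) \<le> G * real n"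
    proof -
      have "(\<Sum>j\<le>J. \<rho> ^ j) \<le> 1 / (1 - \<rho>)"
        using \<rho> by (simp add: sum_gp0 divide_right_mono)
      then have "4 * (2 powr \<mu> * B) * real n * (\<Sum>j\<le>J. \<rho> ^ j) \<le> 4 * (2 powr \<mu> * B) * real n * (1 / (1 - \<rho>))"
        using B by (intro mult_left_mono) auto
      then show ?thesis by (simp add: sum_distrib_left G_def)
    qed
    also have "(\<Sum>j\<le>J. 4 * (2::real) ^ j) \<le> 8 * real n"
    proof -
      have eq: "(\<Sum>j\<le>J. 4 * (2::real) ^ j) = 4 * (2 * 2 ^ J - 1)"
        by (simp add: sum_distrib_left[symmetric] sum_gp0)
      have "4 * (2 * (2::real) ^ J - 1) \<le> 8 * 2 ^ J" by simp
      also have "\<dots> \<le> 8 * real n" by (rule mult_left_mono[OF J(1)]) simp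
      finally show ?thesis unfolding eq .
    qed
    finally have *: "real (degree \<tau>) \<le> G * real n + 8 * real n" by simp
    have "0 \<le> exp (2 * B) * real n" by simp
    with * have deg: "real (degree \<tau>) \<le> C * real n" unfolding C_def distrib_right by linarith
    have val0: "poly \<tau> 0 = 1" by (simp add: \<tau>_def poly_prod poly_power D0)
    have bound: "\<bar>poly \<tau> u\<bar> \<le> C * exp (- B * real n * \<bar>u\<bar> powr \<mu>)" if u: "\<bar>u\<bar> \<le> 1" for u
    proof (cases "1 / 2 ^ J \<le> \<bar>u\<bar>")
      case False
      have "\<bar>poly \<tau> u\<bar> = (\<Prod>j\<le>J. \<bar>poly (D j) u\<bar> ^ k j)"
        by (simp add: \<tau>_def poly_prod poly_power abs_prod power_abs)
      also have "\<dots> \<le> 1" by (intro prod_le_1 conjI power_le_one zero_le_power D1 u) auto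
      finally have a: "\<bar>poly \<tau> u\<bar> \<le> 1" .
      have "\<bar>u\<bar> powr \<mu> \<le> \<bar>u\<bar> powr 1" using u \<mu> by (intro powr_mono') auto
      also have "\<dots> \<le> 1 / 2 ^ J" using False by (cases "u = 0") auto
      finally have "real n * \<bar>u\<bar> powr \<mu> \<le> 2 ^ Suc J * (1 / 2 ^ J)"
        using J by (intro mult_mono) auto
      then have "B * (real n * \<bar>u\<bar> powr \<mu>) \<le> B * 2" using B by (intro mult_left_mono) auto
      then have "1 \<le> exp (2 * B) * exp (- B * real n * \<bar>u\<bar> powr \<mu>)"
        by (simp add: exp_add[symmetric] algebra_simps)
      also have "\<dots> \<le> C * exp (- B * real n * \<bar>u\<bar> powr \<mu>)" using C by (intro mult_right_mono) auto
      finally show ?thesis using a by linarith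
    next
      case True
      \<comment> \<open>The first scale reached by \<bar>u\<bar> supplies the whole decay; the other
        factors are bounded by 1.\<close>
      define i where "i = (LEAST j. 1 / 2 ^ j \<le> \<bar>u\<bar>)"
      have i: "1 / 2 ^ i \<le> \<bar>u\<bar>" unfolding i_def by (rule LeastI[of _ J]) (rule True)
      have iJ: "i \<le> J" unfolding i_def by (rule Least_le) (rule True)
      have i2: "\<bar>u\<bar> \<le> 2 * (1 / 2 ^ i)"
      proof (cases i)
        case 0
        then show ?thesis using u by simp
      next
        case (Suc i')
        then have "\<not> 1 / 2 ^ i' \<le> \<bar>u\<bar>" using not_less_Least[of i' "\<lambda>j. 1 / 2 ^ j \<le> \<bar>u\<bar>"] by (simp add: i_def)
        then show ?thesis using Suc by simp
      qed
      have "\<bar>poly \<tau> u\<bar> = (\<Prod>j\<le>J. \<bar>poly (D j) u\<bar> ^ k j)"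
        by (simp add: \<tau>_def poly_prod poly_power abs_prod power_abs)
      also have "\<dots> = \<bar>poly (D i) u\<bar> ^ k i * (\<Prod>j\<in>{..J} - {i}. \<bar>poly (D j) u\<bar> ^ k j)"
        using iJ by (intro prod.remove) auto
      also have "\<dots> \<le> exp (-1) ^ k i * 1"
        by (intro mult_mono power_mono De[OF u i] prod_le_1 conjI power_le_one zero_le_power D1 u prod_nonneg) auto
      also have "\<dots> = exp (- real (k i))" by (simp add: exp_of_nat_mult[symmetric])
      also have "\<dots> \<le> exp (- B * real n * \<bar>u\<bar> powr \<mu>)"
      proof -
        have "\<bar>u\<bar> powr \<mu> \<le> (2 * (1 / 2 ^ i)) powr \<mu>" using i2 \<mu> by (intro powr_mono2) auto
        also have "\<dots> = 2 powr \<mu> * 2 powr (- real i * \<mu>)"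
        proof -
          have "(1 / 2 ^ i :: real) = 2 powr (- real i)" by (simp add: powr_minus powr_realpow divide_inverse)
          then show ?thesis by (simp add: powr_mult powr_powr)
        qed
        finally have "B * real n * \<bar>u\<bar> powr \<mu> \<le> B * real n * (2 powr \<mu> * 2 powr (- real i * \<mu>))"
          using B by (intro mult_left_mono) auto
        also have "\<dots> \<le> real (k i)" using k(1)[of i] by (simp add: ac_simps)
        finally show ?thesis by simp
      qed
      also have "\<dots> \<le> C * exp (- B * real n * \<bar>u\<bar> powr \<mu>)" using C by simp
      finally show ?thesis .
    qed
    show "\<exists>\<tau>. real (degree \<tau>) \<le> C * real n \<and> poly \<tau> 0 = 1 \<and>
        (\<forall>u. \<bar>u\<bar> \<le> 1 \<longrightarrow> \<bar>poly \<tau> u\<bar> \<le> C * exp (- B * real n * \<bar>u\<bar> powr \<mu>))"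
      using deg val0 bound by blast
  qed
qed

section \<open>First order expansion of \<open>\<bar>x\<bar> powr l\<close>\<close>

definition signed_powr :: "real \<Rightarrow> real \<Rightarrow> real" where
  "signed_powr s v = sgn v * \<bar>v\<bar> powr s"

lemma DERIV_abs_powr:
  assumes l: "1 < l"
  shows "((\<lambda>v. \<bar>v\<bar> powr l) has_field_derivative l * signed_powr (l - 1) v) (at v)"
proof (cases v "0::real" rule: linorder_cases)
  case equal
  have "((\<lambda>h. \<bar>h\<bar> powr (l - 1) * sgn h) \<longlongrightarrow> 0) (at 0)"
  proof (rule Lim_null_comparison)
    show "\<forall>\<^sub>F h in at 0. norm (\<bar>h\<bar> powr (l - 1) * sgn h) \<le> \<bar>h\<bar> powr (l - 1)"
      by (auto simp: abs_mult sgn_if intro!: always_eventually)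
    have "((\<lambda>h::real. \<bar>h\<bar> powr (l - 1)) \<longlongrightarrow> \<bar>0\<bar> powr (l - 1)) (at 0)"
      using l by (intro tendsto_powr' tendsto_intros) auto
    then show "((\<lambda>h::real. \<bar>h\<bar> powr (l - 1)) \<longlongrightarrow> 0) (at 0)" using l by simp
  qed
  moreover have "(\<bar>h\<bar> powr l - 0) / h = \<bar>h\<bar> powr (l - 1) * sgn h" if "h \<noteq> 0" for h :: real
    using that by (cases "0 < h") (auto simp: powr_diff sgn_if)
  ultimately have "((\<lambda>h. (\<bar>0 + h\<bar> powr l - \<bar>0\<bar> powr l) / h) \<longlongrightarrow> 0) (at 0)"
    using l by (subst tendsto_cong[where g="\<lambda>h. \<bar>h\<bar> powr (l - 1) * sgn h"])
      (auto simp: eventually_at_filter)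
  then show ?thesis using equal by (simp add: DERIV_def signed_powr_def)
next
  case greater
  have "((\<lambda>v. v powr l) has_field_derivative l * v powr (l - 1)) (at v)"
    using greater by (auto intro!: derivative_eq_intros)
  then have "((\<lambda>v. \<bar>v\<bar> powr l) has_field_derivative l * v powr (l - 1)) (at v)"
    by (rule has_field_derivative_transform_within_open[where S="{0<..}"]) (use greater in auto)
  then show ?thesis using greater by (simp add: signed_powr_def)
next
  case less
  have "((\<lambda>v. (- v) powr l) has_field_derivative - (l * (- v) powr (l - 1))) (at v)"
    using less by (auto intro!: derivative_eq_intros)
  then have "((\<lambda>v. \<bar>v\<bar> powr l) has_field_derivative - (l * (- v) powr (l - 1))) (at v)"
    by (rule has_field_derivative_transform_within_open[where S="{..<0}"]) (use less in auto)
  then show ?thesis using less by (simp add: signed_powr_def)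
qed

text \<open>For \<open>s \<le> 1\<close> the power is subadditive, otherwise the mean value theorem
  applies; the exponent \<open>min s 1\<close> and a common constant unite both cases.\<close>

lemma powr_diff_le:
  fixes s x y K :: real
  assumes s: "0 < s" and xy: "0 \<le> x" "x \<le> y" "y \<le> K"
  shows "y powr s - x powr s \<le> (1 + s * K powr (s - 1)) * (y - x) powr (min s 1)"
proof (cases "s \<le> 1")
  case True
  have "y powr s \<le> x powr s + (y - x) powr s"
  proof (cases "y = 0")
    case False
    then have y: "0 < y" using xy by simp
    have a: "z \<le> z powr s" if "0 \<le> z" "z \<le> 1" for z
      using powr_mono'[of s 1 z] that True by (cases "z = 0") auto
    have "1 = x / y + (y - x) / y" using y by (simp add: field_simps)
    also have "\<dots> \<le> (x / y) powr s + ((y - x) / y) powr s" using xy y by (intro add_mono a) auto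
    also have "\<dots> = (x powr s + (y - x) powr s) / y powr s" using xy y by (simp add: powr_divide add_divide_distrib)
    finally show ?thesis using y by (simp add: pos_le_divide_eq)
  qed (use xy in auto)
  also have "(y - x) powr s \<le> (1 + s * K powr (s - 1)) * (y - x) powr s"
    using s by (simp add: mult_le_cancel_right1)
  finally show ?thesis using True by simp
next
  case False
  show ?thesis
  proof (cases "x = y")
    case False
    then have "x < y" using xy by simp
    have "continuous_on {x..y} (\<lambda>z. z powr s)" using s xy by (intro continuous_on_powr' continuous_intros) auto
    moreover have "((\<lambda>z. z powr s) has_field_derivative s * z powr (s - 1)) (at z)" if "x < z" "z < y" for z
      using that xy by (auto intro!: derivative_eq_intros)
    ultimately obtain z where z: "x < z" "z < y" "y powr s - x powr s = (y - x) * (s * z powr (s - 1))"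
      using MVT2[OF \<open>x < y\<close>] MVT[OF \<open>x < y\<close>, of "\<lambda>z. z powr s"]
      by (smt (verit, ccfv_threshold) DERIV_unique real_differentiable_def)
    have "z powr (s - 1) \<le> K powr (s - 1)" using z xy \<open>\<not> s \<le> 1\<close> by (intro powr_mono2) auto
    then have "y powr s - x powr s \<le> (y - x) * (s * K powr (s - 1))"
      unfolding z(3) using s xy by (intro mult_left_mono) auto
    also have "\<dots> \<le> (1 + s * K powr (s - 1)) * (y - x)"
      using xy by (simp add: algebra_simps)
    finally show ?thesis using \<open>\<not> s \<le> 1\<close> xy by simp
  qed simp
qed

text \<open>For equal signs this is \<open>powr_diff_le\<close>; for opposite signs the two powers
  are bounded separately, hence the factor 2.\<close>

lemma signed_powr_hoelder:
  assumes s: "0 < s" and xy: "\<bar>x\<bar> \<le> K" "\<bar>y\<bar> \<le> K"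
  shows "\<bar>signed_powr s y - signed_powr s x\<bar> \<le> 2 * ((1 + s * K powr (s - 1)) * \<bar>y - x\<bar> powr (min s 1))"
proof -
  let ?H = "1 + s * K powr (s - 1)"
  have H: "0 \<le> ?H" using s by (simp add: add_nonneg_nonneg)
  have base: "signed_powr s v - signed_powr s u \<le> 2 * (?H * (v - u) powr (min s 1)) \<and> 0 \<le> signed_powr s v - signed_powr s u"
    if "u \<le> v" "\<bar>u\<bar> \<le> K" "\<bar>v\<bar> \<le> K" for u v
  proof -
    consider "0 \<le> u" | "v \<le> 0" | "u < 0" "0 < v" by linarith
    then show ?thesis
    proof cases
      case 1
      then have e: "signed_powr s v - signed_powr s u = v powr s - u powr s"
        using that s by (auto simp: signed_powr_def sgn_if)
      have "0 \<le> ?H * (v - u) powr (min s 1)" using H by simp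
      moreover have "v powr s - u powr s \<le> ?H * (v - u) powr (min s 1)"
        using powr_diff_le[OF s 1, of v K] that by simp
      moreover have "u powr s \<le> v powr s" using powr_mono2[of s u v] s 1 that by simp
      ultimately show ?thesis unfolding e by linarith
    next
      case 2
      then have e: "signed_powr s v - signed_powr s u = (- u) powr s - (- v) powr s"
        using that s by (auto simp: signed_powr_def sgn_if)
      have "0 \<le> ?H * (v - u) powr (min s 1)" using H by simp
      moreover have "(- u) powr s - (- v) powr s \<le> ?H * (v - u) powr (min s 1)"
        using powr_diff_le[OF s, of "- v" "- u" K] that 2 by simp
      moreover have "(- v) powr s \<le> (- u) powr s" using powr_mono2[of s "- v" "- u"] s 2 that by simp
      ultimately show ?thesis unfolding e by linarith
    next
      case 3
      then have e: "signed_powr s v - signed_powr s u = v powr s + (- u) powr s"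
        by (auto simp: signed_powr_def sgn_if)
      have b: "z powr s \<le> ?H * (v - u) powr (min s 1)" if "0 \<le> z" "z \<le> v - u" "z \<le> K" for z
      proof -
        have "z powr s - 0 powr s \<le> ?H * (z - 0) powr (min s 1)" by (rule powr_diff_le[OF s]) (use that in auto)
        also have "\<dots> \<le> ?H * (v - u) powr (min s 1)"
          using H that s by (intro mult_left_mono powr_mono2) auto
        finally show ?thesis by simp
      qed
      have "v powr s \<le> ?H * (v - u) powr (min s 1)" "(- u) powr s \<le> ?H * (v - u) powr (min s 1)"
        using b[of v] b[of "- u"] 3 that by simp_all
      moreover have "0 \<le> v powr s" "0 \<le> (- u) powr s" by simp_all
      ultimately show ?thesis unfolding e by linarith
    qed
  qed
  show ?thesis
  proof (cases "x \<le> y")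
    case True
    then show ?thesis using base[of x y] xy by (simp only: abs_of_nonneg diff_ge_0_iff_ge)
  next
    case False
    then have "\<bar>signed_powr s y - signed_powr s x\<bar> = signed_powr s x - signed_powr s y" "\<bar>y - x\<bar> = x - y"
      using base[of y x] xy by linarith+
    then show ?thesis using base[of y x] xy False by (simp only:)
  qed
qed

text \<open>The derivative is Hoelder continuous of order \<open>min (l - 1) 1\<close>, so the
  remainder has order \<open>min l 2\<close>, which exceeds 1 as \<open>fast_decreasing_poly\<close>
  requires. The upper bound becomes a lower bound for the weight.\<close>

lemma abs_powr_taylor:
  assumes l: "1 < l" and K: "0 \<le> K"
  shows "\<exists>C>0. \<forall>x u. \<bar>x\<bar> \<le> K \<longrightarrow> \<bar>u\<bar> \<le> 1 \<longrightarrow>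
    \<bar>x + u\<bar> powr l \<le> \<bar>x\<bar> powr l + l * signed_powr (l - 1) x * u + C * \<bar>u\<bar> powr (min l 2)"
proof -
  define C where "C = l * (2 * (1 + (l - 1) * (K + 1) powr (l - 1 - 1)))"
  have C: "0 < C" using l by (auto simp: C_def intro!: mult_pos_pos add_pos_nonneg)
  show ?thesis
  proof (intro exI[of _ C] conjI C allI impI)
    fix x u :: real assume x: "\<bar>x\<bar> \<le> K" and u: "\<bar>u\<bar> \<le> 1"
    define f where "f = (\<lambda>t. \<bar>x + t * u\<bar> powr l)"
    have df: "(f has_field_derivative l * signed_powr (l - 1) (x + t * u) * u) (at t)" for t
    proof -
      have "((\<lambda>t. x + t * u) has_field_derivative u) (at t)" by (auto intro!: derivative_eq_intros)
      from DERIV_chain2[OF DERIV_abs_powr[OF l] this] show ?thesis by (simp add: f_def)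
    qed
    obtain t where t: "0 < t" "t < 1" "f 1 - f 0 = (1 - 0) * (l * signed_powr (l - 1) (x + t * u) * u)"
      using MVT2[of 0 1 f "\<lambda>t. l * signed_powr (l - 1) (x + t * u) * u"] df by auto
    have tu: "\<bar>t * u\<bar> \<le> \<bar>u\<bar>" using t mult_right_mono[of t 1 "\<bar>u\<bar>"] by (simp add: abs_mult)
    have "\<bar>signed_powr (l - 1) (x + t * u) - signed_powr (l - 1) x\<bar>
        \<le> 2 * ((1 + (l - 1) * (K + 1) powr (l - 1 - 1)) * \<bar>(x + t * u) - x\<bar> powr (min (l - 1) 1))"
      by (rule signed_powr_hoelder) (use l x u tu in linarith)+
    also have "\<dots> \<le> 2 * ((1 + (l - 1) * (K + 1) powr (l - 1 - 1)) * \<bar>u\<bar> powr (min (l - 1) 1))"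
      using l tu by (intro mult_left_mono powr_mono2) (auto simp: add_nonneg_nonneg)
    finally have h: "\<bar>signed_powr (l - 1) (x + t * u) - signed_powr (l - 1) x\<bar>
        \<le> 2 * ((1 + (l - 1) * (K + 1) powr (l - 1 - 1)) * \<bar>u\<bar> powr (min (l - 1) 1))" .
    have "f 1 - f 0 - l * signed_powr (l - 1) x * u
        = l * ((signed_powr (l - 1) (x + t * u) - signed_powr (l - 1) x) * u)"
      using t by (simp add: algebra_simps)
    also have "\<dots> \<le> l * (\<bar>signed_powr (l - 1) (x + t * u) - signed_powr (l - 1) x\<bar> * \<bar>u\<bar>)"
      using l by (intro mult_left_mono) (auto simp: abs_mult[symmetric])
    also have "\<dots> \<le> l * (2 * ((1 + (l - 1) * (K + 1) powr (l - 1 - 1)) * \<bar>u\<bar> powr (min (l - 1) 1)) * \<bar>u\<bar>)"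
      using l h by (intro mult_left_mono mult_right_mono) auto
    also have "\<dots> = C * (\<bar>u\<bar> powr (min (l - 1) 1) * \<bar>u\<bar> powr 1)" by (simp add: C_def)
    also have "\<bar>u\<bar> powr (min (l - 1) 1) * \<bar>u\<bar> powr 1 = \<bar>u\<bar> powr (min l 2)"
    proof -
      have "min (l - 1) 1 + 1 = min l 2" by simp
      then show ?thesis by (simp only: powr_add[symmetric])
    qed
    finally show "\<bar>x + u\<bar> powr l \<le> \<bar>x\<bar> powr l + l * signed_powr (l - 1) x * u + C * \<bar>u\<bar> powr (min l 2)"
      by (simp add: f_def)
  qed
qed

subsection \<open>Polynomial substitutes for the reciprocal weight\<close>

lemma pderiv_sum: "pderiv (sum f A) = (\<Sum>x\<in>A. pderiv (f x))"
  by (induction A rule: infinite_finite_induct) (auto simp: pderiv_add)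

lemma poisson_shift:
  fixes y :: real
  shows "(\<Sum>j\<le>m. real j * g j * (y ^ j / fact j)) = y * (\<Sum>j<m. g (Suc j) * (y ^ j / fact j))"
proof (induction m)
  case (Suc m)
  have "real (Suc m) * g (Suc m) * (y ^ Suc m / fact (Suc m)) = y * (g (Suc m) * (y ^ m / fact m))"
    unfolding fact_Suc power_Suc by (simp del: of_nat_Suc)
  then show ?case using Suc by (simp only: sum.atMost_Suc sum.lessThan_Suc distrib_left)
qed simp

text \<open>Up to the factor \<open>exp y\<close> these are moments of the Poisson distribution with
  mean y, each obtained from the preceding ones by \<open>poisson_shift\<close>. The third serves
  the derivative of \<open>weight_poly\<close>, where one more factor j appears.\<close>

lemma poisson_moments:
  fixes y :: real
  assumes y: "0 \<le> y"
  shows "(\<Sum>j\<le>m. y ^ j / fact j) \<le> exp y"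
    "(\<Sum>j\<le>m. real j * (y ^ j / fact j)) \<le> y * exp y"
    "(\<Sum>j\<le>m. (real j)\<^sup>2 * (y ^ j / fact j)) \<le> (y\<^sup>2 + y) * exp y"
    "(\<Sum>j\<le>m. (real j) ^ 3 * (y ^ j / fact j)) \<le> (y ^ 3 + 3 * y\<^sup>2 + y) * exp y"
proof -
  define t where "t j = y ^ j / fact j" for j
  have t0: "0 \<le> t j" for j using y by (simp add: t_def)
  have less: "(\<Sum>j<m. f j * t j) \<le> (\<Sum>j\<le>m. f j * t j)" if "\<And>j. 0 \<le> f j" for f
    using that t0 by (intro sum_mono2) auto
  have m0: "(\<Sum>j\<le>m. t j) \<le> exp y" unfolding t_def by (rule exp_partial_le[OF y])
  have l0: "(\<Sum>j<m. t j) \<le> exp y" using less[of "\<lambda>_. 1"] m0 by simp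
  have "(\<Sum>j\<le>m. real j * t j) = y * (\<Sum>j<m. t j)"
    using poisson_shift[of "\<lambda>_. 1" y m] by (simp add: t_def)
  also have "\<dots> \<le> y * exp y" by (intro mult_left_mono l0 y)
  finally have m1: "(\<Sum>j\<le>m. real j * t j) \<le> y * exp y" .
  have l1: "(\<Sum>j<m. real j * t j) \<le> y * exp y" using less[of real] m1 by simp
  have "(\<Sum>j\<le>m. (real j)\<^sup>2 * t j) = y * (\<Sum>j<m. real (Suc j) * t j)"
    using poisson_shift[of real y m] by (simp add: t_def power2_eq_square)
  also have "(\<Sum>j<m. real (Suc j) * t j) = (\<Sum>j<m. real j * t j) + (\<Sum>j<m. t j)"
    by (simp add: sum.distrib[symmetric] algebra_simps)
  also have "y * \<dots> \<le> y * (y * exp y + exp y)" by (intro mult_left_mono add_mono l0 l1 y)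
  finally have m2: "(\<Sum>j\<le>m. (real j)\<^sup>2 * t j) \<le> (y\<^sup>2 + y) * exp y"
    by (simp add: algebra_simps power2_eq_square)
  have l2: "(\<Sum>j<m. (real j)\<^sup>2 * t j) \<le> (y\<^sup>2 + y) * exp y" using less[of "\<lambda>j. (real j)\<^sup>2"] m2 by simp
  have "(\<Sum>j\<le>m. (real j) ^ 3 * t j) = y * (\<Sum>j<m. (real (Suc j))\<^sup>2 * t j)"
    using poisson_shift[of "\<lambda>j. (real j)\<^sup>2" y m] by (simp add: t_def power3_eq_cube power2_eq_square mult.assoc)
  also have "(\<Sum>j<m. (real (Suc j))\<^sup>2 * t j) = (\<Sum>j<m. (real j)\<^sup>2 * t j) + 2 * (\<Sum>j<m. real j * t j) + (\<Sum>j<m. t j)"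
    by (simp add: sum.distrib[symmetric] sum_distrib_left power2_eq_square algebra_simps)
  also have "y * \<dots> \<le> y * ((y\<^sup>2 + y) * exp y + 2 * (y * exp y) + exp y)"
    by (intro mult_left_mono add_mono l0 l1 l2 y) auto
  finally have m3: "(\<Sum>j\<le>m. (real j) ^ 3 * t j) \<le> (y ^ 3 + 3 * y\<^sup>2 + y) * exp y"
    by (simp add: algebra_simps power2_eq_square power3_eq_cube)
  show "(\<Sum>j\<le>m. y ^ j / fact j) \<le> exp y"
    "(\<Sum>j\<le>m. real j * (y ^ j / fact j)) \<le> y * exp y"
    "(\<Sum>j\<le>m. (real j)\<^sup>2 * (y ^ j / fact j)) \<le> (y\<^sup>2 + y) * exp y"
    "(\<Sum>j\<le>m. (real j) ^ 3 * (y ^ j / fact j)) \<le> (y ^ 3 + 3 * y\<^sup>2 + y) * exp y"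
    using m0 m1 m2 m3 by (simp_all only: t_def)
qed

text \<open>The polynomials \<open>weight_poly l a m\<close> are partial sums of an even entire function with
  nonnegative coefficients that is comparable to \<open>exp (a \<bar>x\<bar> powr l) = \<Sum> y\<^sup>j / j!\<close>, where
  \<open>y = a \<bar>x\<bar> powr l\<close>. In the \<open>j\<close>-th term \<open>y\<^sup>j\<close> the exponent \<open>l j\<close> of \<open>\<bar>x\<bar>\<close> is lowered to the even
  integer \<open>2 * wp_idx l j\<close>; this changes the term by the factor \<open>(j / y) powr wp_off l j\<close>, which is
  harmless because the Poisson weights concentrate around \<open>j \<approx> y\<close>.\<close>

definition wp_idx :: "real \<Rightarrow> nat \<Rightarrow> nat" where
  "wp_idx l j = nat \<lfloor>l * real j / 2\<rfloor>"

definition wp_off :: "real \<Rightarrow> nat \<Rightarrow> real" where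
  "wp_off l j = (l * real j - 2 * real (wp_idx l j)) / l"

definition wp_coeff :: "real \<Rightarrow> real \<Rightarrow> nat \<Rightarrow> real" where
  "wp_coeff l a j = (if j = 0 then 1 else a ^ j / fact j * (real j / a) powr wp_off l j)"

definition weight_poly :: "real \<Rightarrow> real \<Rightarrow> nat \<Rightarrow> real poly" where
  "weight_poly l a m = (\<Sum>j\<le>m. monom (wp_coeff l a j) (2 * wp_idx l j))"

context
  fixes l a :: real
  assumes l: "1 < l" and a: "0 < a"
begin

lemma wp_idx_le: "2 * real (wp_idx l j) \<le> l * real j"
  using l unfolding wp_idx_def by (simp add: le_divide_eq floor_le_iff of_nat_nat) linarith

lemma wp_off_bounds: "0 \<le> wp_off l j" "wp_off l j \<le> 2"
proof -
  show "0 \<le> wp_off l j" using wp_idx_le[of j] l by (simp add: wp_off_def)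
  have "l * real j / 2 < real (wp_idx l j) + 1"
    using l unfolding wp_idx_def by (simp add: of_nat_nat)
  then have "l * real j - 2 * real (wp_idx l j) \<le> 2 * l" using l by simp
  then show "wp_off l j \<le> 2" using l by (simp add: wp_off_def pos_divide_le_eq)
qed

lemma wp_coeff_nonneg: "0 \<le> wp_coeff l a j"
  using a by (simp add: wp_coeff_def)

lemma wp_term:
  assumes x: "0 < x" and y: "y = a * x powr l"
  shows "wp_coeff l a j * x ^ (2 * wp_idx l j) = y ^ j / fact j * (if j = 0 then 1 else (real j / y) powr wp_off l j)"
proof (cases "j = 0")
  case True
  then show ?thesis by (simp add: wp_coeff_def wp_idx_def)
next
  case False
  define \<theta> where "\<theta> = wp_off l j"
  have "2 * real (wp_idx l j) = l * real j - l * \<theta>"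
    using l by (simp add: \<theta>_def wp_off_def)
  then have "x ^ (2 * wp_idx l j) = x powr (l * real j - l * \<theta>)"
    using x by (simp add: powr_realpow[symmetric])
  also have "\<dots> = (x powr l) ^ j / (x powr l) powr \<theta>"
    using x by (simp add: powr_diff powr_powr powr_realpow[symmetric])
  finally have 1: "x ^ (2 * wp_idx l j) = (x powr l) ^ j / (x powr l) powr \<theta>" .
  have 2: "(real j / y) powr \<theta> = (real j / a) powr \<theta> / (x powr l) powr \<theta>"
    using x a by (simp add: y powr_divide powr_mult)
  show ?thesis using False unfolding wp_coeff_def 1 \<theta>_def[symmetric] 2
    by (simp add: y power_mult_distrib)
qed

text \<open>The exponent lies between 0 and 2, so the distortion is at most quadratic in
  \<open>j / y\<close> and Poisson moments bound the sum.\<close>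

lemma wp_factor_le:
  assumes "0 < y" shows "(if j = 0 then 1 else (real j / y) powr wp_off l j) \<le> 1 + (real j)\<^sup>2 / y\<^sup>2"
proof (cases "real j \<le> y")
  case True
  then have "(real j / y) powr wp_off l j \<le> 1" if "j \<noteq> 0"
    using assms that wp_off_bounds by (intro powr_le1) auto
  then show ?thesis by (auto intro: order_trans)
next
  case False
  then have "(real j / y) powr wp_off l j \<le> (real j / y) powr 2"
    using assms wp_off_bounds by (intro powr_mono) auto
  also have "\<dots> = (real j)\<^sup>2 / y\<^sup>2" using assms by (simp add: power_divide)
  finally show ?thesis by (auto intro: order_trans)
qed

text \<open>With \<open>z = j / y\<close>, both 1 and \<open>z\<^sup>2\<close> lie above this
  concave parabola. Its Poisson mean is \<open>3 / 4 - 4 / y\<close>, which is positive for large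
  y.\<close>

lemma wp_factor_ge:
  assumes "0 < y"
  shows "3 / 4 - 4 * (real j / y - 1)\<^sup>2 \<le> (if j = 0 then 1 else (real j / y) powr wp_off l j)"
proof (cases "j = 0")
  case False
  define z where "z = real j / y"
  have z: "0 < z" using False assms by (simp add: z_def)
  have min: "min 1 (z\<^sup>2) \<le> z powr wp_off l j"
  proof (cases "z \<le> 1")
    case True
    then have "z powr 2 \<le> z powr wp_off l j" using z wp_off_bounds by (intro powr_mono') auto
    then show ?thesis using z by simp
  next
    case F: False
    then have "1 \<le> z powr wp_off l j" using wp_off_bounds by (intro ge_one_powr_ge_zero) auto
    then show ?thesis by simp
  qed
  have "3 / 4 - 4 * (z - 1)\<^sup>2 \<le> z\<^sup>2"
  proof -
    \<comment> \<open>\<open>z\<^sup>2\<close> minus the parabola, with the square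
      completed.\<close>
    have "0 \<le> 5 * (z - 4 / 5)\<^sup>2 + 1 / 20" by simp
    then show ?thesis by (simp add: power2_eq_square algebra_simps)
  qed
  moreover have "3 / 4 - 4 * (z - 1)\<^sup>2 \<le> 1"
    using zero_le_power2[of "z - 1"] by linarith
  ultimately show ?thesis using min False unfolding z_def[symmetric] by simp
next
  case True
  then show ?thesis by simp
qed

lemma poly_weight_poly: "poly (weight_poly l a m) x = (\<Sum>j\<le>m. wp_coeff l a j * \<bar>x\<bar> ^ (2 * wp_idx l j))"
  by (simp add: weight_poly_def poly_sum poly_monom power_mult)

lemma poly_weight_poly_eq:
  assumes "x \<noteq> 0" "y = a * \<bar>x\<bar> powr l"
  shows "poly (weight_poly l a m) x = (\<Sum>j\<le>m. y ^ j / fact j * (if j = 0 then 1 else (real j / y) powr wp_off l j))"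
  unfolding poly_weight_poly using assms by (intro sum.cong wp_term refl) auto

lemma degree_weight_poly: "real (degree (weight_poly l a m)) \<le> l * real m"
proof -
  have "degree (weight_poly l a m) \<le> nat \<lfloor>l * real m\<rfloor>"
    unfolding weight_poly_def
  proof (intro degree_sum_le order_trans[OF degree_monom_le])
    fix j assume j: "j \<in> {..m}"
    have "real (2 * wp_idx l j) \<le> l * real m"
    proof -
      have "l * real j \<le> l * real m" using j l by (intro mult_left_mono) auto
      then show ?thesis using wp_idx_le[of j] by simp
    qed
    then show "2 * wp_idx l j \<le> nat \<lfloor>l * real m\<rfloor>" by (simp add: le_nat_floor)
  qed simp
  then have "real (degree (weight_poly l a m)) \<le> real (nat \<lfloor>l * real m\<rfloor>)" by simp
  also have "\<dots> \<le> l * real m" using l by simp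
  finally show ?thesis .
qed

lemma weight_poly_upper_large:
  assumes x: "x \<noteq> 0" and y: "y = a * \<bar>x\<bar> powr l" "1 \<le> y"
  shows "poly (weight_poly l a m) x \<le> 3 * exp y"
proof -
  have "poly (weight_poly l a m) x \<le> (\<Sum>j\<le>m. y ^ j / fact j * (1 + (real j)\<^sup>2 / y\<^sup>2))"
    unfolding poly_weight_poly_eq[OF x y(1)] using y(2)
    by (intro sum_mono mult_left_mono wp_factor_le) auto
  also have "\<dots> = (\<Sum>j\<le>m. y ^ j / fact j) + (\<Sum>j\<le>m. (real j)\<^sup>2 * (y ^ j / fact j)) / y\<^sup>2"
    by (simp add: sum.distrib[symmetric] sum_divide_distrib distrib_left mult.commute)
  also have "\<dots> \<le> exp y + (y\<^sup>2 + y) * exp y / y\<^sup>2"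
    using y(2) by (intro add_mono divide_right_mono poisson_moments) auto
  also have "(y\<^sup>2 + y) * exp y / y\<^sup>2 = exp y + exp y / y"
    using y(2) by (simp add: field_simps power2_eq_square)
  also have "exp y / y \<le> exp y / 1" using y(2) by (intro divide_left_mono) auto
  finally show ?thesis by simp
qed

lemma wp_sum_deriv_large:
  assumes x: "0 < x" and y: "y = a * x powr l" "1 \<le> y"
  shows "(\<Sum>j\<le>m. wp_coeff l a j * real (2 * wp_idx l j) * x ^ (2 * wp_idx l j)) \<le> 6 * l * y * exp y"
proof -
  have "(\<Sum>j\<le>m. wp_coeff l a j * real (2 * wp_idx l j) * x ^ (2 * wp_idx l j))
      \<le> (\<Sum>j\<le>m. (l * real j) * (y ^ j / fact j * (1 + (real j)\<^sup>2 / y\<^sup>2)))"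
  proof (rule sum_mono)
    fix j
    have "wp_coeff l a j * real (2 * wp_idx l j) * x ^ (2 * wp_idx l j)
        = real (2 * wp_idx l j) * (y ^ j / fact j * (if j = 0 then 1 else (real j / y) powr wp_off l j))"
      unfolding wp_term[OF x y(1), of j, symmetric] by simp
    also have "\<dots> \<le> (l * real j) * (y ^ j / fact j * (1 + (real j)\<^sup>2 / y\<^sup>2))"
      using y(2) l wp_idx_le[of j] by (intro mult_mono mult_left_mono wp_factor_le) auto
    finally show "wp_coeff l a j * real (2 * wp_idx l j) * x ^ (2 * wp_idx l j)
      \<le> (l * real j) * (y ^ j / fact j * (1 + (real j)\<^sup>2 / y\<^sup>2))" .
  qed
  also have "\<dots> = l * ((\<Sum>j\<le>m. real j * (y ^ j / fact j)) + (\<Sum>j\<le>m. (real j) ^ 3 * (y ^ j / fact j)) / y\<^sup>2)"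
    by (simp add: sum.distrib[symmetric] sum_divide_distrib sum_distrib_left power3_eq_cube power2_eq_square
        distrib_left mult_ac)
  also have "\<dots> \<le> l * (y * exp y + (y ^ 3 + 3 * y\<^sup>2 + y) * exp y / y\<^sup>2)"
    using y(2) l by (intro mult_left_mono add_mono divide_right_mono poisson_moments) auto
  also have "(y ^ 3 + 3 * y\<^sup>2 + y) * exp y / y\<^sup>2 = (y + 3 + 1 / y) * exp y"
    using y(2) by (simp add: field_simps power2_eq_square power3_eq_cube)
  also have "\<dots> \<le> (5 * y) * exp y"
  proof (rule mult_right_mono)
    have "1 / y \<le> 1" using y(2) by simp
    then show "y + 3 + 1 / y \<le> 5 * y" using y(2) by linarith
  qed simp
  finally show ?thesis using l by (simp add: algebra_simps)
qed

text \<open>If \<open>a * \<bar>x\<bar> powr l < 1\<close>, use that even powers with nonnegative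
  coefficients increase in \<bar>x\<bar> and compare with the point x1, where the value is at most
  \<open>3 * exp 1 \<le> 9\<close>.\<close>

lemma weight_poly_upper: "poly (weight_poly l a m) x \<le> 9 * exp (a * \<bar>x\<bar> powr l)"
proof (cases "1 \<le> a * \<bar>x\<bar> powr l")
  case True
  then have "x \<noteq> 0" using l by auto
  from weight_poly_upper_large[OF this refl True]
  have "poly (weight_poly l a m) x \<le> 3 * exp (a * \<bar>x\<bar> powr l)" .
  also have "\<dots> \<le> 9 * exp (a * \<bar>x\<bar> powr l)" by simp
  finally show ?thesis .
next
  case False
  define x1 where "x1 = (1 / a) powr (1 / l)"
  have x1: "0 < x1" "a * x1 powr l = 1" using a l by (auto simp: x1_def powr_powr)
  have le: "\<bar>x\<bar> \<le> x1"
  proof (rule ccontr)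
    assume "\<not> \<bar>x\<bar> \<le> x1"
    then have "a * x1 powr l \<le> a * \<bar>x\<bar> powr l" using x1 l a by (intro mult_left_mono powr_mono2) auto
    then show False using x1 False by simp
  qed
  have "poly (weight_poly l a m) x \<le> poly (weight_poly l a m) x1"
    unfolding poly_weight_poly using le x1 by (intro sum_mono mult_left_mono power_mono wp_coeff_nonneg) auto
  also have "\<dots> \<le> 3 * exp 1"
    using weight_poly_upper_large[of x1 1 m] x1 by simp
  also have "\<dots> \<le> 9 * 1" using exp_le by simp
  also have "\<dots> \<le> 9 * exp (a * \<bar>x\<bar> powr l)" using a by (intro mult_left_mono) auto
  finally show ?thesis .
qed

text \<open>Multiplying the derivative by x restores the powers of the original sum, which
  \<open>wp_sum_deriv_large\<close> bounds; then divide by \<bar>x\<bar>. For small x compare with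
  x1 by monotonicity, since division by \<bar>x\<bar> would not be bounded.\<close>

lemma weight_poly_deriv:
  obtains C where "0 < C"
    "\<And>m x. \<bar>poly (pderiv (weight_poly l a m)) x\<bar> \<le> C * (1 + \<bar>x\<bar> powr (l - 1)) * exp (a * \<bar>x\<bar> powr l)"
proof -
  define x1 where "x1 = (1 / a) powr (1 / l)"
  have x1: "0 < x1" "a * x1 powr l = 1" using a l by (auto simp: x1_def powr_powr)
  define C where "C = 6 * l * a + 18 * l / x1"
  have C: "0 < C" "6 * l * a \<le> C" "18 * l / x1 \<le> C" using l a x1 by (auto simp: C_def add_pos_pos)
  have deriv: "\<bar>poly (pderiv (weight_poly l a m)) x\<bar> \<le> (\<Sum>j\<le>m. wp_coeff l a j * real (2 * wp_idx l j) * \<bar>x\<bar> ^ (2 * wp_idx l j - 1))" for m x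
  proof -
    have "poly (pderiv (weight_poly l a m)) x = (\<Sum>j\<le>m. wp_coeff l a j * real (2 * wp_idx l j) * x ^ (2 * wp_idx l j - 1))"
      by (simp add: weight_poly_def pderiv_sum pderiv_monom poly_sum poly_monom mult_ac)
    also have "\<bar>\<dots>\<bar> \<le> (\<Sum>j\<le>m. \<bar>wp_coeff l a j * real (2 * wp_idx l j) * x ^ (2 * wp_idx l j - 1)\<bar>)" by (rule sum_abs)
    also have "\<dots> = (\<Sum>j\<le>m. wp_coeff l a j * real (2 * wp_idx l j) * \<bar>x\<bar> ^ (2 * wp_idx l j - 1))"
      by (intro sum.cong refl) (simp add: abs_mult power_abs wp_coeff_nonneg)
    finally show ?thesis .
  qed
  have shift: "u * (\<Sum>j\<le>m. wp_coeff l a j * real (2 * wp_idx l j) * u ^ (2 * wp_idx l j - 1))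
      = (\<Sum>j\<le>m. wp_coeff l a j * real (2 * wp_idx l j) * u ^ (2 * wp_idx l j))" for u m
    unfolding sum_distrib_left
  proof (intro sum.cong refl)
    fix j
    show "u * (wp_coeff l a j * real (2 * wp_idx l j) * u ^ (2 * wp_idx l j - 1))
      = wp_coeff l a j * real (2 * wp_idx l j) * u ^ (2 * wp_idx l j)"
      by (cases "wp_idx l j") auto
  qed
  show ?thesis
  proof (rule that[OF C(1)])
    fix m x
    let ?y = "a * \<bar>x\<bar> powr l"
    show "\<bar>poly (pderiv (weight_poly l a m)) x\<bar> \<le> C * (1 + \<bar>x\<bar> powr (l - 1)) * exp ?y"
    proof (cases "1 \<le> ?y")
      case True
      then have x: "0 < \<bar>x\<bar>" using l by auto
      have "\<bar>x\<bar> * \<bar>poly (pderiv (weight_poly l a m)) x\<bar> \<le> 6 * l * ?y * exp ?y"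
        using mult_left_mono[OF deriv[of m x], of "\<bar>x\<bar>"] wp_sum_deriv_large[OF x refl True, of m]
        unfolding shift by linarith
      also have "\<dots> = \<bar>x\<bar> * (6 * l * a * \<bar>x\<bar> powr (l - 1) * exp ?y)"
        using x by (simp add: powr_diff)
      finally have "\<bar>poly (pderiv (weight_poly l a m)) x\<bar> \<le> 6 * l * a * \<bar>x\<bar> powr (l - 1) * exp ?y"
        using x by (simp only: mult_le_cancel_left_pos)
      also have "\<dots> \<le> C * (1 + \<bar>x\<bar> powr (l - 1)) * exp ?y"
        using C by (intro mult_right_mono mult_mono) auto
      finally show ?thesis .
    next
      case False
      have le: "\<bar>x\<bar> \<le> x1"
      proof (rule ccontr)
        assume "\<not> \<bar>x\<bar> \<le> x1"
        then have "a * x1 powr l \<le> a * \<bar>x\<bar> powr l" using x1 l a by (intro mult_left_mono powr_mono2) auto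
        then show False using x1 False by simp
      qed
      have "\<bar>poly (pderiv (weight_poly l a m)) x\<bar> \<le> (\<Sum>j\<le>m. wp_coeff l a j * real (2 * wp_idx l j) * x1 ^ (2 * wp_idx l j - 1))"
        by (rule order_trans[OF deriv]) (use le x1 in \<open>intro sum_mono mult_left_mono power_mono mult_nonneg_nonneg wp_coeff_nonneg, auto\<close>)
      also have "\<dots> = (\<Sum>j\<le>m. wp_coeff l a j * real (2 * wp_idx l j) * x1 ^ (2 * wp_idx l j)) / x1"
        unfolding shift[symmetric] using x1 by simp
      also have "\<dots> \<le> 6 * l * 1 * exp 1 / x1"
        using wp_sum_deriv_large[of x1 1 m] x1 by (intro divide_right_mono) auto
      also have "\<dots> \<le> 18 * l / x1"
        using exp_le l x1 by (intro divide_right_mono) auto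
      also have "\<dots> \<le> C * 1 * 1" using C by simp
      also have "\<dots> \<le> C * (1 + \<bar>x\<bar> powr (l - 1)) * exp ?y"
        using C a by (intro mult_mono) auto
      finally show ?thesis .
    qed
  qed
qed

text \<open>Large arguments use the parabola of \<open>wp_factor_ge\<close>; for
  \<open>a * \<bar>x\<bar> powr l < 16\<close> the constant term 1 suffices, whence
  \<open>exp (- 16)\<close>. The condition on m limits the mass lost by truncating the Poisson sum
  to \<open>1 / 32\<close>.\<close>

lemma weight_poly_lower:
  assumes m: "2 * (a * \<bar>x\<bar> powr l) + 6 \<le> real m"
  shows "exp (- 16) * exp (a * \<bar>x\<bar> powr l) \<le> poly (weight_poly l a m) x"
proof (cases "16 \<le> a * \<bar>x\<bar> powr l")
  case True
  define y where "y = a * \<bar>x\<bar> powr l"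
  have y: "16 \<le> y" using True by (simp add: y_def)
  have x: "x \<noteq> 0" using True l by auto
  define t where "t j = y ^ j / fact j" for j
  have t0: "0 \<le> t j" for j using y by (simp add: t_def)
  have "(\<Sum>j\<le>m. t j * (3 / 4 - 4 * (real j / y - 1)\<^sup>2)) \<le> poly (weight_poly l a m) x"
    unfolding poly_weight_poly_eq[OF x y_def] t_def using y
    by (intro sum_mono mult_left_mono wp_factor_ge) auto
  \<comment> \<open>In powers of j only the first moment has a positive coefficient. It alone needs
    a lower bound, and \<open>poisson_shift\<close> reduces that to the truncated exponential
    series.\<close>
  moreover have "(\<Sum>j\<le>m. t j * (3 / 4 - 4 * (real j / y - 1)\<^sup>2))
      = 8 * (\<Sum>j\<le>m. real j * t j) / y - 4 * (\<Sum>j\<le>m. (real j)\<^sup>2 * t j) / y\<^sup>2 - 13 / 4 * (\<Sum>j\<le>m. t j)"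
  proof -
    have "t j * (3 / 4 - 4 * (real j / y - 1)\<^sup>2) = 8 * (real j * t j) / y - 4 * ((real j)\<^sup>2 * t j) / y\<^sup>2 - 13 / 4 * t j" for j
      using y by (simp add: field_simps power2_eq_square)
    then show ?thesis by (simp only: sum_subtractf sum_distrib_left sum_divide_distrib)
  qed
  moreover have "(\<Sum>j\<le>m. t j) \<le> exp y" "(\<Sum>j\<le>m. (real j)\<^sup>2 * t j) \<le> (y\<^sup>2 + y) * exp y"
    unfolding t_def using y by (intro poisson_moments, simp)+
  moreover have "(\<Sum>j\<le>m. real j * t j) = y * (\<Sum>j<m. t j)"
    using poisson_shift[of "\<lambda>_. 1" y m] by (simp add: t_def)
  moreover have "31 / 32 * exp y \<le> (\<Sum>j<m. t j)"
  proof -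
    have m5: "6 \<le> m"
    proof -
      have "0 \<le> a * \<bar>x\<bar> powr l" using a by simp
      then have "6 \<le> real m" using m by linarith
      then show ?thesis by simp
    qed
    have "exp y \<le> 2 ^ (m - 5)"
      by (rule exp_le_4_power) (use m m5 y in \<open>auto simp: y_def of_nat_diff\<close>)
    then have "exp y * 2 ^ 5 \<le> 2 ^ (m - 5) * 2 ^ 5" by (rule mult_right_mono) simp
    also have "\<dots> = 2 ^ m" using m5 by (simp only: power_add[symmetric]) simp
    finally have "exp (2 * y) * 32 \<le> exp y * 2 ^ m" by (simp add: exp_double power2_eq_square)
    then have "exp (2 * y) / 2 ^ m \<le> exp y / 32" by (simp add: field_simps)
    moreover have "\<bar>exp y - (\<Sum>j<m. t j)\<bar> \<le> exp (2 * y) / 2 ^ m"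
      unfolding t_def by (rule exp_partial_error) (use y in simp)
    ultimately show ?thesis by linarith
  qed
  ultimately have "exp y / 4 \<le> poly (weight_poly l a m) x"
  proof -
    assume 1: "(\<Sum>j\<le>m. t j * (3 / 4 - 4 * (real j / y - 1)\<^sup>2)) \<le> poly (weight_poly l a m) x"
      and 2: "(\<Sum>j\<le>m. t j * (3 / 4 - 4 * (real j / y - 1)\<^sup>2))
        = 8 * (\<Sum>j\<le>m. real j * t j) / y - 4 * (\<Sum>j\<le>m. (real j)\<^sup>2 * t j) / y\<^sup>2 - 13 / 4 * (\<Sum>j\<le>m. t j)"
      and 3: "(\<Sum>j\<le>m. t j) \<le> exp y" "(\<Sum>j\<le>m. (real j)\<^sup>2 * t j) \<le> (y\<^sup>2 + y) * exp y"
      and 4: "(\<Sum>j\<le>m. real j * t j) = y * (\<Sum>j<m. t j)" "31 / 32 * exp y \<le> (\<Sum>j<m. t j)"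
    have "(\<Sum>j\<le>m. (real j)\<^sup>2 * t j) / y\<^sup>2 \<le> (y\<^sup>2 + y) * exp y / y\<^sup>2"
      using 3 by (intro divide_right_mono) auto
    also have "\<dots> = exp y + exp y / y" using y by (simp add: field_simps power2_eq_square)
    also have "exp y / y \<le> exp y / 16" using y by (intro divide_left_mono) auto
    finally have "(\<Sum>j\<le>m. (real j)\<^sup>2 * t j) / y\<^sup>2 \<le> exp y + exp y / 16" by simp
    then have A: "4 * (\<Sum>j\<le>m. (real j)\<^sup>2 * t j) / y\<^sup>2 \<le> 4 * (exp y + exp y / 16)"
      by (simp only: times_divide_eq_right[symmetric] mult_le_cancel_left_pos zero_less_numeral)
    have B: "8 * (\<Sum>j\<le>m. real j * t j) / y = 8 * (\<Sum>j<m. t j)" using 4 y by simp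
    have "exp y / 4 = 8 * (31 / 32 * exp y) - 4 * (exp y + exp y / 16) - 13 / 4 * exp y" by simp
    also have "\<dots> \<le> 8 * (\<Sum>j<m. t j) - 4 * (\<Sum>j\<le>m. (real j)\<^sup>2 * t j) / y\<^sup>2 - 13 / 4 * (\<Sum>j\<le>m. t j)"
      by (intro diff_mono A mult_left_mono 3(1) 4(2)) auto
    also have "\<dots> \<le> poly (weight_poly l a m) x" using 1 unfolding 2 B .
    finally show ?thesis .
  qed
  moreover have "exp (- 16) * exp y \<le> 1 / 4 * exp y"
  proof (rule mult_right_mono)
    have "exp (-16 :: real) \<le> exp (- 2)" by simp
    also have "\<dots> \<le> 1 / 4"
    proof -
      have "(2::real) * 2 \<le> exp 1 * exp 1" using exp_ge_add_one_self[of 1] by (intro mult_mono) auto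
      then have "4 \<le> exp (2::real)" by (simp add: exp_add[symmetric])
      then show ?thesis by (simp add: exp_minus field_simps)
    qed
    finally show "exp (-16 :: real) \<le> 1 / 4" .
  qed simp
  ultimately show ?thesis unfolding y_def[symmetric] by linarith
next
  case False
  have "exp (- 16) * exp (a * \<bar>x\<bar> powr l) = exp (a * \<bar>x\<bar> powr l - 16)" by (simp add: exp_diff exp_minus divide_inverse)
  also have "\<dots> \<le> 1" using False by simp
  also have "1 = wp_coeff l a 0 * \<bar>x\<bar> ^ (2 * wp_idx l 0)" by (simp add: wp_coeff_def wp_idx_def)
  also have "\<dots> \<le> poly (weight_poly l a m) x"
    unfolding poly_weight_poly
    by (rule member_le_sum) (auto intro!: mult_nonneg_nonneg wp_coeff_nonneg)
  finally show ?thesis .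
qed

end

subsection \<open>Freud weights\<close>

lemma nn_integral_Lorentz: "(\<integral>\<^sup>+x. ennreal (1 / (1 + x\<^sup>2)) \<partial>lborel) = ennreal pi"
proof -
  have pos: "0 < 1 + x\<^sup>2" for x :: real by (simp add: add_pos_nonneg)
  have half: "(\<integral>\<^sup>+x. ennreal (1 / (1 + x\<^sup>2)) * indicator {0..} x \<partial>lborel) = ennreal (pi / 2 - arctan 0)"
  proof (rule nn_integral_FTC_atLeast)
    show "DERIV arctan x :> 1 / (1 + x\<^sup>2)" for x
      using DERIV_arctan[of x] by (simp add: inverse_eq_divide)
  qed (use pos tendsto_arctan_at_top in \<open>auto intro: less_imp_le\<close>)
  have "(\<integral>\<^sup>+x. ennreal (1 / (1 + x\<^sup>2)) * indicator {..0} x \<partial>lborel)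
      = (\<integral>\<^sup>+x. ennreal (1 / (1 + x\<^sup>2)) * indicator {0..} x \<partial>lborel)"
    by (subst nn_integral_real_affine[where c="-1" and t=0])
       (auto intro!: nn_integral_cong split: split_indicator)
  moreover have "(\<integral>\<^sup>+x. ennreal (1 / (1 + x\<^sup>2)) \<partial>lborel)
      = (\<integral>\<^sup>+x. ennreal (1 / (1 + x\<^sup>2)) * indicator {0..} x + ennreal (1 / (1 + x\<^sup>2)) * indicator {..0} x \<partial>lborel)"
  proof (rule nn_integral_cong_AE)
    have "AE x in lborel. x \<noteq> (0::real)" by (rule AE_lborel_singleton)
    then show "AE x in lborel. ennreal (1 / (1 + x\<^sup>2)) = ennreal (1 / (1 + x\<^sup>2)) * indicator {0..} x + ennreal (1 / (1 + x\<^sup>2)) * indicator {..0} (x::real)"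
      by eventually_elim (auto split: split_indicator)
  qed
  ultimately show ?thesis
    using half by (simp add: nn_integral_add ennreal_plus[symmetric] del: ennreal_plus)
qed

lemma nn_integral_affine_ball:
  fixes f :: "real \<Rightarrow> ennreal"
  assumes [measurable]: "f \<in> borel_measurable borel" and A: "0 < A"
  shows "(\<integral>\<^sup>+u. f (x + A * u) * indicator {-1..1} u \<partial>lborel)
    = ennreal (1 / A) * (\<integral>\<^sup>+t. f t * indicator {x - A..x + A} t \<partial>lborel)"
proof -
  have "(\<integral>\<^sup>+t. f t * indicator {x - A..x + A} t \<partial>lborel)
      = ennreal A * (\<integral>\<^sup>+u. f (x + A * u) * indicator {x - A..x + A} (x + A * u) \<partial>lborel)"
    using A by (subst nn_integral_real_affine[where c=A and t=x]) auto
  also have "(\<integral>\<^sup>+u. f (x + A * u) * indicator {x - A..x + A} (x + A * u) \<partial>lborel)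
      = (\<integral>\<^sup>+u. f (x + A * u) * indicator {-1..1} u \<partial>lborel)"
  proof (intro nn_integral_cong arg_cong2[where f="(*)"] refl)
    fix u
    have "- A \<le> A * u \<longleftrightarrow> - 1 \<le> u" using mult_le_cancel_left_pos[OF A, of "-1" u] by simp
    moreover have "A * u \<le> A \<longleftrightarrow> u \<le> 1" using mult_le_cancel_left_pos[OF A, of u 1] by simp
    ultimately show "indicator {x - A..x + A} (x + A * u) = (indicator {-1..1} u :: ennreal)"
      by (auto split: split_indicator)
  qed
  finally show ?thesis
    using A by (simp add: mult.assoc[symmetric] ennreal_mult[symmetric])
qed

locale freud =
  fixes l a b :: real
  assumes l: "1 < l" and a: "0 < a"
begin

abbreviation "w \<equiv> freud_weight l a b"

lemma w_eq: "w x = exp b * exp (- a * \<bar>x\<bar> powr l)"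
  unfolding freud_weight_def exp_add by (rule mult.commute)

lemma w_pos: "0 < w x" "0 \<le> w x" "w x \<noteq> 0" "\<bar>w x\<bar> = w x"
  by (simp_all add: freud_weight_def)

lemma continuous_w: "continuous_on A w"
  unfolding freud_weight_def using l by (intro continuous_intros continuous_on_powr') auto

lemma measurable_w [measurable]: "w \<in> borel_measurable borel"
  by (intro borel_measurable_continuous_onI continuous_w)

lemma measurable_poly [measurable (raw)]:
  "f \<in> borel_measurable M \<Longrightarrow> (\<lambda>x. poly P (f x) :: real) \<in> borel_measurable M"
  by (rule measurable_compose[of f M borel "poly P"])
     (auto intro!: borel_measurable_continuous_onI continuous_intros)

text \<open>Since \<open>\<bar>x\<bar> powr l \<ge> \<bar>x\<bar> - 1\<close>, it suffices to
  compare with \<open>exp (- c * \<bar>x\<bar>)\<close>, and each power is bounded by one term of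
  the exponential series.\<close>

lemma poly_decay:
  assumes c: "0 < c"
  shows "\<exists>C>0. \<forall>x. \<bar>poly R x\<bar> * exp (- c * \<bar>x\<bar> powr l) \<le> C"
proof -
  have le: "\<bar>x\<bar> - 1 \<le> \<bar>x\<bar> powr l" for x :: real
  proof (cases "1 \<le> \<bar>x\<bar>")
    case True
    then have "\<bar>x\<bar> powr 1 \<le> \<bar>x\<bar> powr l" using l by (intro powr_mono) auto
    then show ?thesis using True by simp
  next
    case False
    have "0 \<le> \<bar>x\<bar> powr l" by simp
    then show ?thesis using False by linarith
  qed
  have monom: "\<bar>x\<bar> ^ k * exp (- c * \<bar>x\<bar> powr l) \<le> exp c * fact k / c ^ k" for k and x :: real
  proof -
    have "(c * \<bar>x\<bar>) ^ k / fact k \<le> exp (c * \<bar>x\<bar>)" by (rule power_le_exp) (use c in simp)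
    then have 1: "\<bar>x\<bar> ^ k \<le> fact k / c ^ k * exp (c * \<bar>x\<bar>)"
      using c by (simp add: power_mult_distrib field_simps)
    have "c * (\<bar>x\<bar> - 1) \<le> c * \<bar>x\<bar> powr l" using le[of x] c by (intro mult_left_mono) auto
    then have 2: "exp (- c * \<bar>x\<bar> powr l) \<le> exp c * exp (- (c * \<bar>x\<bar>))"
      by (simp add: exp_add[symmetric] algebra_simps)
    have "\<bar>x\<bar> ^ k * exp (- c * \<bar>x\<bar> powr l) \<le> (fact k / c ^ k * exp (c * \<bar>x\<bar>)) * (exp c * exp (- (c * \<bar>x\<bar>)))"
      using c by (intro mult_mono 1 2) auto
    also have "\<dots> = exp c * fact k / c ^ k" by (simp add: exp_minus)
    finally show ?thesis .
  qed
  define C where "C = 1 + (\<Sum>i\<le>degree R. \<bar>coeff R i\<bar> * (exp c * fact i / c ^ i))"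
  have C: "0 < C" unfolding C_def using c by (intro add_pos_nonneg sum_nonneg) auto
  have "\<bar>poly R x\<bar> * exp (- c * \<bar>x\<bar> powr l) \<le> C" for x
  proof -
    have "\<bar>poly R x\<bar> \<le> (\<Sum>i\<le>degree R. \<bar>coeff R i\<bar> * \<bar>x\<bar> ^ i)"
      unfolding poly_altdef by (rule order_trans[OF sum_abs]) (simp add: abs_mult power_abs)
    then have "\<bar>poly R x\<bar> * exp (- c * \<bar>x\<bar> powr l) \<le> (\<Sum>i\<le>degree R. \<bar>coeff R i\<bar> * \<bar>x\<bar> ^ i) * exp (- c * \<bar>x\<bar> powr l)"
      by (rule mult_right_mono) simp
    also have "\<dots> = (\<Sum>i\<le>degree R. \<bar>coeff R i\<bar> * (\<bar>x\<bar> ^ i * exp (- c * \<bar>x\<bar> powr l)))"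
      by (simp add: sum_distrib_right mult.assoc)
    also have "\<dots> \<le> (\<Sum>i\<le>degree R. \<bar>coeff R i\<bar> * (exp c * fact i / c ^ i))"
      by (intro sum_mono mult_left_mono monom) auto
    finally show ?thesis by (simp add: C_def)
  qed
  then show ?thesis using C by blast
qed

text \<open>Apply \<open>poly_decay\<close> to R times \<open>1 + x\<^sup>2\<close>; the integrable
  factor \<open>1 / (1 + x\<^sup>2)\<close> remains.\<close>

lemma poly_exp_nn_integral:
  assumes c: "0 < c"
  shows "\<exists>C>0. (\<integral>\<^sup>+x. ennreal (\<bar>poly R x\<bar> * exp (- c * \<bar>x\<bar> powr l)) \<partial>lborel) \<le> ennreal C"
proof -
  obtain C where C: "0 < C" "\<And>x. \<bar>poly (R * [:1, 0, 1:]) x\<bar> * exp (- c * \<bar>x\<bar> powr l) \<le> C"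
    using poly_decay[OF c, of "R * [:1, 0, 1:]"] by blast
  have "\<bar>poly R x\<bar> * exp (- c * \<bar>x\<bar> powr l) \<le> C * (1 / (1 + x\<^sup>2))" for x
  proof -
    have pos: "0 < 1 + x\<^sup>2" by (simp add: add_pos_nonneg)
    have "poly (R * [:1, 0, 1:]) x = poly R x * (1 + x\<^sup>2)"
      by (simp add: power2_eq_square algebra_simps)
    then have "\<bar>poly R x\<bar> * exp (- c * \<bar>x\<bar> powr l) * (1 + x\<^sup>2) \<le> C"
      using C(2)[of x] pos by (simp add: abs_mult mult_ac)
    then show ?thesis using pos by (simp add: pos_le_divide_eq)
  qed
  then have "(\<integral>\<^sup>+x. ennreal (\<bar>poly R x\<bar> * exp (- c * \<bar>x\<bar> powr l)) \<partial>lborel)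
      \<le> (\<integral>\<^sup>+x. ennreal C * ennreal (1 / (1 + x\<^sup>2)) \<partial>lborel)"
    using C(1) by (intro nn_integral_mono) (simp add: ennreal_mult'[symmetric] ennreal_leI)
  also have "\<dots> = ennreal (C * pi)"
    using C(1) by (simp add: nn_integral_cmult nn_integral_Lorentz ennreal_mult)
  finally show ?thesis using C(1) by (intro exI[of _ "C * pi"]) auto
qed

lemma w_power_eq: "w x ^ k = exp (real k * b) * exp (- (real k * a) * \<bar>x\<bar> powr l)"
  by (simp add: w_eq power_mult_distrib exp_of_nat_mult[symmetric] mult.assoc)

lemma poly_w_bounded: "\<exists>C>0. \<forall>x. \<bar>poly R x * w x\<bar> \<le> C"
proof -
  obtain C where C: "0 < C" "\<And>x. \<bar>poly R x\<bar> * exp (- a * \<bar>x\<bar> powr l) \<le> C"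
    using poly_decay[OF a, of R] by blast
  have "\<bar>poly R x * w x\<bar> \<le> exp b * C" for x
    using mult_left_mono[OF C(2)[of x], of "exp b"] by (simp add: w_eq abs_mult mult_ac)
  then show ?thesis using C(1) by (intro exI[of _ "exp b * C"]) auto
qed

lemma integrable_poly_w_power:
  assumes "0 < k" shows "integrable lborel (\<lambda>x. poly R x * w x ^ k)"
proof (rule integrableI_bounded)
  obtain C where "(\<integral>\<^sup>+x. ennreal (\<bar>poly R x\<bar> * exp (- (real k * a) * \<bar>x\<bar> powr l)) \<partial>lborel) \<le> ennreal C"
    using poly_exp_nn_integral[of "real k * a" R] a assms by auto
  then have "(\<integral>\<^sup>+x. ennreal (exp (real k * b)) * ennreal (\<bar>poly R x\<bar> * exp (- (real k * a) * \<bar>x\<bar> powr l)) \<partial>lborel)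
      \<le> ennreal (exp (real k * b)) * ennreal C"
    by (simp add: nn_integral_cmult mult_left_mono)
  also have "\<dots> < \<infinity>" by (simp add: ennreal_mult_less_top)
  also have "(\<integral>\<^sup>+x. ennreal (exp (real k * b)) * ennreal (\<bar>poly R x\<bar> * exp (- (real k * a) * \<bar>x\<bar> powr l)) \<partial>lborel)
      = (\<integral>\<^sup>+x. ennreal (norm (poly R x * w x ^ k)) \<partial>lborel)"
    by (intro nn_integral_cong) (simp add: ennreal_mult'[symmetric] w_power_eq abs_mult mult_ac)
  finally show "(\<integral>\<^sup>+x. ennreal (norm (poly R x * w x ^ k)) \<partial>lborel) < \<infinity>" .
qed measurable

text \<open>One constant serves all p: the function is at most 1, so its powers are at most itself,
  and \<open>1 + C\<close> does not exceed its own s-th power.\<close>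

lemma Lp_le_exp_decay:
  assumes "0 < c"
  shows "\<exists>C>0. \<forall>p\<ge>1. Lp_le p (\<lambda>x. ennreal (exp (- c * \<bar>x\<bar> powr l))) C"
proof -
  obtain C where C: "0 < C" "(\<integral>\<^sup>+x. ennreal (exp (- c * \<bar>x\<bar> powr l)) \<partial>lborel) \<le> ennreal C"
    using poly_exp_nn_integral[OF assms, of 1] by auto
  have "Lp_le p (\<lambda>x. ennreal (exp (- c * \<bar>x\<bar> powr l))) (1 + C)" if p: "1 \<le> p" for p
  proof (cases rule: exponent_cases[OF p])
    case 1
    have "exp (- c * \<bar>x\<bar> powr l) \<le> 1 + C" for x using assms C by (simp add: add_increasing2)
    then show ?thesis using 1 by (simp add: Lp_le_def ennreal_leI)
  next
    case (2 s)
    have "(\<integral>\<^sup>+x. ennpowr (ennreal (exp (- c * \<bar>x\<bar> powr l))) s \<partial>lborel)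
        \<le> (\<integral>\<^sup>+x. ennreal (exp (- c * \<bar>x\<bar> powr l)) \<partial>lborel)"
    proof (rule nn_integral_mono)
      fix x
      have "exp (- c * \<bar>x\<bar> powr l) powr s \<le> exp (- c * \<bar>x\<bar> powr l) powr 1"
        using 2 assms by (intro powr_mono') auto
      then show "ennpowr (ennreal (exp (- c * \<bar>x\<bar> powr l))) s \<le> ennreal (exp (- c * \<bar>x\<bar> powr l))"
        by (simp add: ennreal_leI)
    qed
    also have "\<dots> \<le> ennreal C" by (rule C(2))
    also have "\<dots> \<le> ennreal ((1 + C) powr s)"
    proof (rule ennreal_leI)
      have "(1 + C) powr 1 \<le> (1 + C) powr s" using C 2 by (intro powr_mono) auto
      then show "C \<le> (1 + C) powr s" using C by simp
    qed
    finally show ?thesis using 2 by (simp add: Lp_le_def)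
  qed
  then show ?thesis using C by (intro exI[of _ "1 + C"]) auto
qed

text \<open>The Mhaskar-Rakhmanov-Saff number of \<open>w\<close>, up to a constant factor.\<close>

definition width :: "nat \<Rightarrow> real" where
  "width n = real n powr (1 / l)"

lemma width: "1 \<le> n \<Longrightarrow> 1 \<le> width n" "1 \<le> n \<Longrightarrow> width n powr l = real n"
  "1 \<le> n \<Longrightarrow> 0 < width n" "n \<le> m \<Longrightarrow> width n \<le> width m"
proof -
  show "1 \<le> n \<Longrightarrow> 1 \<le> width n" using l by (simp add: width_def ge_one_powr_ge_zero)
  then show "1 \<le> n \<Longrightarrow> 0 < width n" by simp
  show "1 \<le> n \<Longrightarrow> width n powr l = real n" using l by (simp add: width_def powr_powr)
  show "n \<le> m \<Longrightarrow> width n \<le> width m" using l by (simp add: width_def powr_mono2)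
qed

text \<open>A polynomial of degree \<open>n\<close> grows outside \<open>{- width n..width n}\<close> at most like
  \<open>(C \<bar>x\<bar> / width n)\<^sup>n\<close>, which \<open>w\<close> beats from \<open>B * width n\<close> on.\<close>

definition range_const :: "real \<Rightarrow> real \<Rightarrow> bool" where
  "range_const B \<kappa> \<longleftrightarrow> 1 \<le> B \<and> 0 < \<kappa> \<and> (\<forall>n P p c x. 1 \<le> n \<longrightarrow> degree P \<le> n \<longrightarrow> 1 \<le> p \<longrightarrow> 0 \<le> c \<longrightarrow>
      Lp_le p (\<lambda>x. ennreal \<bar>poly P x * w x\<bar> * indicator {- width n..width n} x) c \<longrightarrow>
      B * width n \<le> \<bar>x\<bar> \<longrightarrow>
      \<bar>poly P x * w x\<bar> \<le> 2 * c * exp (- \<kappa> * real n) * exp (- \<kappa> * \<bar>x\<bar> powr l))"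

lemma range_constD:
  assumes "range_const B \<kappa>"
  shows "1 \<le> B" "0 < \<kappa>"
    "1 \<le> n \<Longrightarrow> degree P \<le> n \<Longrightarrow> 1 \<le> p \<Longrightarrow> 0 \<le> c \<Longrightarrow>
      Lp_le p (\<lambda>x. ennreal \<bar>poly P x * w x\<bar> * indicator {- width n..width n} x) c \<Longrightarrow>
      B * width n \<le> \<bar>x\<bar> \<Longrightarrow>
      \<bar>poly P x * w x\<bar> \<le> 2 * c * exp (- \<kappa> * real n) * exp (- \<kappa> * \<bar>x\<bar> powr l)"
  using assms unfolding range_const_def by blast+

text \<open>Rescale to \<open>{-1..1}\<close>, bound the \<open>L\<^sub>1\<close> norm by the
  \<open>L\<^sub>p\<close> norm at the cost \<open>exp (a * n)\<close> of removing the weight, and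
  apply \<open>poly_growth\<close>. With \<open>y = x / width n\<close> all factors become
  exponentials of n times a function of y, in which \<open>\<bar>y\<bar> powr l\<close> wins since l
  > 1.\<close>

lemma restricted_range: "\<exists>B \<kappa>. range_const B \<kappa>"
proof -
  \<comment> \<open>Three quarters of the exponent of w beat the growth and supply the decay in n;
    one quarter is kept as decay in x.\<close>
  define \<kappa> where "\<kappa> = a / 4"
  have \<kappa>: "0 < \<kappa>" using a by (simp add: \<kappa>_def)
  \<comment> \<open>Obtained by cancelling y in
    \<open>y * (4 + 5 * a / 4) \<le> (3 * a / 4) * y powr l\<close>; B turns the resulting bound on
    \<open>y powr (l - 1)\<close> into one on y.\<close>
  define B0 where "B0 = (4 + 5 * a / 4) * 4 / (3 * a)"
  have B0: "0 < B0" using a by (simp add: B0_def add_pos_pos)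
  define B where "B = max 1 (B0 powr (1 / (l - 1)))"
  have B: "1 \<le> B" by (simp add: B_def)
  have key: "1 + 3 * y + a \<le> a * y powr l - \<kappa> - \<kappa> * y powr l" if "B \<le> y" for y
  proof -
    have y: "1 \<le> y" "B0 powr (1 / (l - 1)) \<le> y" using that by (auto simp: B_def)
    then have "(B0 powr (1 / (l - 1))) powr (l - 1) \<le> y powr (l - 1)" using l by (intro powr_mono2) auto
    then have "B0 \<le> y powr (l - 1)" using l B0 by (simp add: powr_powr)
    then have "(3 * a / 4) * (y * B0) \<le> (3 * a / 4) * (y * y powr (l - 1))"
      using y a by (intro mult_left_mono) auto
    also have "y * y powr (l - 1) = y powr l" using y by (simp add: powr_diff)
    also have "(3 * a / 4) * (y * B0) = y * (4 + 5 * a / 4)" using a by (simp add: B0_def)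
    finally have "y * (4 + 5 * a / 4) \<le> (3 * a / 4) * y powr l" .
    moreover have "1 * (1 + 5 * a / 4) \<le> y * (1 + 5 * a / 4)" using y a by (intro mult_right_mono) auto
    ultimately show ?thesis by (simp add: \<kappa>_def algebra_simps)
  qed
  show ?thesis
    unfolding range_const_def
  proof (rule exI[of _ B], rule exI[of _ \<kappa>], intro conjI B \<kappa> allI impI)
    fix n P p c x
    assume n: "1 \<le> n" and P: "degree P \<le> n" and p: "1 \<le> p" and c: "0 \<le> c"
      and Lp: "Lp_le p (\<lambda>x. ennreal \<bar>poly P x * w x\<bar> * indicator {- width n..width n} x) c"
      and x: "B * width n \<le> \<bar>x\<bar>"
    define A where "A = width n"
    have A: "1 \<le> A" "0 < A" "A powr l = real n" using width[OF n] by (auto simp: A_def)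
    define R where "R = pcompose P [:0, A:]"
    have R: "poly R u = poly P (A * u)" for u by (simp add: R_def poly_pcompose mult.commute)
    have degR: "degree R \<le> n"
      using degree_pcompose_le[of P "[:0, A:]"] P A by (simp add: R_def)
    define y where "y = x / A"
    have xy: "x = A * y" using A by (simp add: y_def)
    have y: "B \<le> \<bar>y\<bar>" using x A by (simp add: y_def A_def[symmetric] pos_le_divide_eq)
    then have y1: "1 \<le> \<bar>y\<bar>" using B by simp
    have xl: "\<bar>x\<bar> powr l = real n * \<bar>y\<bar> powr l"
      using A by (simp add: xy abs_mult powr_mult)
    have I: "integral {-1..1} (\<lambda>u. \<bar>poly R u\<bar>) \<le> 2 * exp (a * real n - b) * c"
    proof -
      have "ennreal (integral {-1..1} (\<lambda>u. \<bar>poly R u\<bar>)) = (\<integral>\<^sup>+u. ennreal \<bar>poly R u\<bar> * indicator {-1..1} u \<partial>lborel)"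
        by (rule nn_integral_interval_HK[symmetric]) (auto intro!: continuous_intros)
      also have "\<dots> = (\<integral>\<^sup>+u. ennreal \<bar>poly P (0 + A * u)\<bar> * indicator {-1..1} u \<partial>lborel)"
        by (simp add: R)
      also have "\<dots> = ennreal (1 / A) * (\<integral>\<^sup>+t. ennreal \<bar>poly P t\<bar> * indicator {0 - A..0 + A} t \<partial>lborel)"
        using A by (intro nn_integral_affine_ball[where f="\<lambda>t. ennreal \<bar>poly P t\<bar>"]) auto
      also have "\<dots> \<le> ennreal (1 / A) * (\<integral>\<^sup>+t. ennreal (exp (a * real n - b)) *
          (ennreal \<bar>poly P t * w t\<bar> * indicator {- A..A} t * indicator {- A..A} t) \<partial>lborel)"
      proof (intro mult_left_mono nn_integral_mono)
        fix t
        show "ennreal \<bar>poly P t\<bar> * indicator {0 - A..0 + A} t \<le> ennreal (exp (a * real n - b)) *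
          (ennreal \<bar>poly P t * w t\<bar> * indicator {- A..A} t * indicator {- A..A} t)"
        proof (cases "t \<in> {-A..A}")
          case True
          have "\<bar>t\<bar> powr l \<le> A powr l" using True l by (intro powr_mono2) auto
          then have "a * \<bar>t\<bar> powr l \<le> a * real n" using A a by (intro mult_left_mono) auto
          then have "1 \<le> exp (a * real n - b) * w t"
            by (simp add: freud_weight_def exp_add[symmetric])
          then have "\<bar>poly P t\<bar> * 1 \<le> \<bar>poly P t\<bar> * (exp (a * real n - b) * w t)" by (intro mult_left_mono) auto
          then show ?thesis using True w_pos
            by (simp add: ennreal_mult'[symmetric] abs_mult mult_ac ennreal_leI)
        qed auto
      qed simp
      also have "\<dots> = ennreal (1 / A) * (ennreal (exp (a * real n - b)) *
          (\<integral>\<^sup>+t. ennreal \<bar>poly P t * w t\<bar> * indicator {- A..A} t * indicator {- A..A} t \<partial>lborel))"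
        by (subst nn_integral_cmult) auto
      also have "\<dots> \<le> ennreal (1 / A) * (ennreal (exp (a * real n - b)) * ennreal (2 * A * c))"
        using A c p Lp by (intro mult_left_mono nn_integral_interval_le) (auto simp: A_def)
      also have "\<dots> = ennreal (2 * exp (a * real n - b) * c)"
        using A c by (simp add: ennreal_mult[symmetric])
      finally show ?thesis using c by simp
    qed
    have "\<bar>poly P x\<bar> = \<bar>poly R y\<bar>" by (simp add: R xy)
    also have "\<dots> \<le> real (n + 1) * (3 * \<bar>y\<bar>) ^ n * integral {-1..1} (\<lambda>u. \<bar>poly R u\<bar>)"
      by (rule poly_growth[OF degR y1])
    also have "\<dots> \<le> exp (real n) * exp (real n * (3 * \<bar>y\<bar>)) * (2 * exp (a * real n - b) * c)"
    proof (intro mult_mono I)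
      show "real (n + 1) \<le> exp (real n)" using exp_ge_add_one_self[of "real n"] by simp
      have "3 * \<bar>y\<bar> \<le> exp (3 * \<bar>y\<bar>)" using exp_ge_add_one_self[of "3 * \<bar>y\<bar>"] by linarith
      then have "(3 * \<bar>y\<bar>) ^ n \<le> exp (3 * \<bar>y\<bar>) ^ n" by (intro power_mono) auto
      then show "(3 * \<bar>y\<bar>) ^ n \<le> exp (real n * (3 * \<bar>y\<bar>))" by (simp add: exp_of_nat_mult)
    qed (auto intro!: integral_nonneg integrable_continuous_interval continuous_intros)
    finally have "\<bar>poly P x\<bar> * w x \<le> exp (real n) * exp (real n * (3 * \<bar>y\<bar>)) * (2 * exp (a * real n - b) * c) * w x"
      using w_pos by (intro mult_right_mono) auto
    also have "\<dots> = 2 * c * exp (real n * (1 + 3 * \<bar>y\<bar> + a) - a * (real n * \<bar>y\<bar> powr l))"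
    proof -
      have "exp (real n) * exp (real n * (3 * \<bar>y\<bar>)) * exp (a * real n - b) * exp (- a * (real n * \<bar>y\<bar> powr l) + b)
          = exp (real n * (1 + 3 * \<bar>y\<bar> + a) - a * (real n * \<bar>y\<bar> powr l))"
        by (simp add: mult_exp_exp algebra_simps)
      then show ?thesis unfolding freud_weight_def xl by (simp only: mult_ac)
    qed
    also have "\<dots> \<le> 2 * c * exp (real n * (- \<kappa> - \<kappa> * \<bar>y\<bar> powr l))"
    proof -
      have "real n * (1 + 3 * \<bar>y\<bar> + a) \<le> real n * (a * \<bar>y\<bar> powr l - \<kappa> - \<kappa> * \<bar>y\<bar> powr l)"
        using key[OF y] by (intro mult_left_mono) auto
      then show ?thesis using c by (intro mult_left_mono) (auto simp: algebra_simps)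
    qed
    also have "\<dots> = 2 * c * exp (- \<kappa> * real n) * exp (- \<kappa> * \<bar>x\<bar> powr l)"
      by (simp add: xl exp_add[symmetric] algebra_simps)
    finally show "\<bar>poly P x * w x\<bar> \<le> 2 * c * exp (- \<kappa> * real n) * exp (- \<kappa> * \<bar>x\<bar> powr l)"
      using w_pos by (simp add: abs_mult)
  qed
qed

lemma Lp_le_2_iff:
  assumes "0 \<le> c"
  shows "Lp_le 2 (\<lambda>x. ennreal \<bar>f x\<bar>) c \<longleftrightarrow> (\<integral>\<^sup>+x. ennreal ((f x)\<^sup>2) \<partial>lborel) \<le> ennreal (c\<^sup>2)"
proof -
  have "\<bar>y\<bar> powr 2 = y\<^sup>2" for y :: real by (cases "y = 0") (auto simp: powr_numeral)
  then show ?thesis using assms by (simp add: Lp_le_def)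
qed

text \<open>Near \<open>x\<close> the weight is bounded below by \<open>w x\<close> times an exponential times
  \<open>exp (- C n \<bar>u\<bar> powr min l 2)\<close>, where \<open>t = x + width n * u\<close>; both factors are replaced by polynomials of degree \<open>O(n)\<close>, which reduces
  the claim to the unweighted one on \<open>{-1..1}\<close>.\<close>

lemma christoffel_bound:
  "\<exists>C>0. \<forall>n\<ge>1. \<forall>P c x. degree P \<le> n \<longrightarrow> 0 \<le> c \<longrightarrow>
     (\<integral>\<^sup>+x. ennreal ((poly P x * w x)\<^sup>2) \<partial>lborel) \<le> ennreal c \<longrightarrow>
     (poly P x * w x)\<^sup>2 \<le> C * real n powr (1 - 1 / l) * c"
proof -
  obtain B \<kappa> where "range_const B \<kappa>" using restricted_range by blast
  note B = range_constD(1,2)[OF this] and RR = range_constD(3)[OF this]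
  obtain C1 where C1: "0 < C1" and taylor: "\<And>x u. \<bar>x\<bar> \<le> B \<Longrightarrow> \<bar>u\<bar> \<le> 1 \<Longrightarrow>
      \<bar>x + u\<bar> powr l \<le> \<bar>x\<bar> powr l + l * signed_powr (l - 1) x * u + C1 * \<bar>u\<bar> powr (min l 2)"
    using abs_powr_taylor[OF l, of B] B by auto
  have aC1: "0 \<le> a * C1" using a C1 by simp
  have \<mu>: "1 < min l 2" using l by simp
  obtain Cf where Cf: "0 < Cf" and fast: "\<And>n. 1 \<le> n \<Longrightarrow> \<exists>\<tau>. real (degree \<tau>) \<le> Cf * real n \<and> poly \<tau> 0 = 1 \<and>
    (\<forall>u. \<bar>u\<bar> \<le> 1 \<longrightarrow> \<bar>poly \<tau> u\<bar> \<le> Cf * exp (- (a * C1) * real n * \<bar>u\<bar> powr (min l 2)))"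
    using fast_decreasing_poly[OF aC1 \<mu>] by blast
  define L where "L = a * (l * B powr (l - 1))"
  have L: "0 \<le> L" using a l by (simp add: L_def)
  define C2 where "C2 = 1 + (6 * L + 2) + Cf"
  have C2: "0 < C2" using L Cf by (simp add: C2_def)
  define C where "C = 4 + (C2 + 1) * (4 * Cf\<^sup>2)"
  have C: "4 \<le> C" "0 < C" "(C2 + 1) * (4 * Cf\<^sup>2) \<le> C" using C2 by (auto simp: C_def add_pos_nonneg)
  show ?thesis
  proof (intro exI[of _ C] conjI C(2) allI impI)
    fix n :: nat and P c x
    assume n: "1 \<le> n" and P: "degree P \<le> n" and c: "0 \<le> c"
      and int: "(\<integral>\<^sup>+x. ennreal ((poly P x * w x)\<^sup>2) \<partial>lborel) \<le> ennreal c"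
    define A where "A = width n"
    have A: "1 \<le> A" "0 < A" "A powr l = real n" using width[OF n] by (auto simp: A_def)
    have nA: "real n / A = real n powr (1 - 1 / l)" using n by (simp add: A_def width_def powr_diff)
    have nA1: "1 \<le> real n powr (1 - 1 / l)" using n l by (intro ge_one_powr_ge_zero) auto
    show "(poly P x * w x)\<^sup>2 \<le> C * real n powr (1 - 1 / l) * c"
    \<comment> \<open>Beyond \<open>B * A\<close> the restricted range inequality gives more than is
      claimed. Hence the Taylor expansion is needed only for bounded \<open>v = x / A\<close>, where
      its constant is uniform.\<close>
    proof (cases "B * A \<le> \<bar>x\<bar>")
      case True
      have "Lp_le 2 (\<lambda>x. ennreal \<bar>poly P x * w x\<bar>) (sqrt c)"
        using c int by (simp add: Lp_le_2_iff)
      then have "Lp_le 2 (\<lambda>x. ennreal \<bar>poly P x * w x\<bar> * indicator {- width n..width n} x) (sqrt c)"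
        by (rule Lp_le_mono) (use c in \<open>auto split: split_indicator\<close>)
      from RR[OF n P _ _ this, of x] have "\<bar>poly P x * w x\<bar> \<le> 2 * sqrt c * exp (- \<kappa> * real n) * exp (- \<kappa> * \<bar>x\<bar> powr l)"
        using c True by (simp add: A_def)
      also have "\<dots> \<le> 2 * sqrt c * 1 * 1" using c B by (intro mult_mono) auto
      finally have "\<bar>poly P x * w x\<bar>\<^sup>2 \<le> (2 * sqrt c)\<^sup>2" by (intro power_mono) auto
      then have "(poly P x * w x)\<^sup>2 \<le> 4 * 1 * c" using c by (simp add: power_mult_distrib)
      also have "\<dots> \<le> C * real n powr (1 - 1 / l) * c" using c C nA1 by (intro mult_right_mono mult_mono) auto
      finally show ?thesis .
    next
      case False
      define v where "v = x / A"
      have xv: "x = A * v" using A by (simp add: v_def)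
      have v: "\<bar>v\<bar> \<le> B" using False A by (simp add: v_def pos_divide_le_eq)
      \<comment> \<open>The slope of \<open>\<bar>x\<bar> powr l\<close> at v. In the scaled
        variable the exponent of w has the linear part \<open>a * n * q * u\<close>, at most
        \<open>L * n\<close> in size, so \<open>exp_poly\<close> needs only degree O(n).\<close>
      define q where "q = l * signed_powr (l - 1) v"
      have "\<bar>signed_powr (l - 1) v\<bar> \<le> B powr (l - 1)"
      proof -
        have "\<bar>v\<bar> powr (l - 1) \<le> B powr (l - 1)" using v l by (intro powr_mono2) auto
        then show ?thesis by (auto simp: signed_powr_def abs_mult sgn_if)
      qed
      then have "(a * real n * l) * \<bar>signed_powr (l - 1) v\<bar> \<le> (a * real n * l) * B powr (l - 1)"
        using a l by (intro mult_left_mono) auto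
      then have q: "\<bar>- (a * real n * q)\<bar> \<le> L * real n"
        using a l by (simp add: q_def L_def abs_mult mult_ac)
      define m where "m = nat \<lceil>6 * (L * real n)\<rceil> + 1"
      have m: "6 * (L * real n) \<le> real m" "0 < m" "real m \<le> (6 * L + 2) * real n"
      proof -
        have "0 \<le> 6 * (L * real n)" using L by simp
        then show "6 * (L * real n) \<le> real m" "real m \<le> (6 * L + 2) * real n"
          using n unfolding m_def by (simp_all add: of_nat_nat algebra_simps) linarith+
      qed (simp add: m_def)
      define E where "E = exp_poly (- (a * real n * q)) m"
      note E = exp_poly[OF q _ m(1) m(2), folded E_def]
      obtain \<tau> where \<tau>: "real (degree \<tau>) \<le> Cf * real n" "poly \<tau> 0 = 1"
        "\<And>u. \<bar>u\<bar> \<le> 1 \<Longrightarrow> \<bar>poly \<tau> u\<bar> \<le> Cf * exp (- (a * C1) * real n * \<bar>u\<bar> powr (min l 2))"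
        using fast[OF n] by blast
      \<comment> \<open>Both additional factors equal 1 at u = 0, so R has the value
        \<open>poly P x\<close> there; on \<open>{-1..1}\<close> they compensate for replacing
        \<open>w (x + A * u)\<close> by the constant \<open>w x\<close>.\<close>
      define R where "R = pcompose P [:x, A:] * E * \<tau>"
      have R: "poly R u = poly P (x + A * u) * poly E u * poly \<tau> u" for u
        by (simp add: R_def poly_pcompose mult.commute)
      have R0: "poly R 0 = poly P x" using E(2)[of 0] \<tau>(2) by (simp add: R)
      have dP: "degree (pcompose P [:x, A:]) \<le> n"
        using degree_pcompose_le[of P "[:x, A:]"] P A by simp
      have "degree R \<le> degree (pcompose P [:x, A:]) + degree E + degree \<tau>"
        unfolding R_def by (rule order_trans[OF degree_mult_le]) (simp add: degree_mult_le)
      then have "degree R \<le> n + m + degree \<tau>" using dP E(3)[of 0] by simp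
      then have "real (degree R) \<le> real n + real m + real (degree \<tau>)" by linarith
      also have "\<dots> \<le> real n + (6 * L + 2) * real n + Cf * real n" using m \<tau> by (intro add_mono) auto
      also have "\<dots> = C2 * real n" by (simp add: C2_def algebra_simps)
      finally have degR: "real (degree R) + 1 \<le> (C2 + 1) * real n" using n by (simp add: algebra_simps)
      have bnd: "\<bar>poly R u\<bar> * w x \<le> 2 * Cf * \<bar>poly P (x + A * u) * w (x + A * u)\<bar>" if u: "\<bar>u\<bar> \<le> 1" for u
      proof -
        have "\<bar>x + A * u\<bar> powr l = real n * \<bar>v + u\<bar> powr l"
        proof -
          have "x + A * u = A * (v + u)" by (simp add: xv algebra_simps)
          then show ?thesis using A by (simp add: abs_mult powr_mult)
        qed
        moreover have "\<bar>x\<bar> powr l = real n * \<bar>v\<bar> powr l" using A by (simp add: xv abs_mult powr_mult)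
        moreover have "real n * \<bar>v + u\<bar> powr l \<le> real n * (\<bar>v\<bar> powr l + q * u + C1 * \<bar>u\<bar> powr (min l 2))"
          using taylor[OF v u] by (intro mult_left_mono) (auto simp: q_def)
        ultimately have "a * \<bar>x + A * u\<bar> powr l \<le> a * (\<bar>x\<bar> powr l + real n * (q * u) + real n * (C1 * \<bar>u\<bar> powr (min l 2)))"
          using a by (intro mult_left_mono) (auto simp: algebra_simps)
        then have "- (a * real n * q) * u + - (a * C1) * real n * \<bar>u\<bar> powr (min l 2) + (- a * \<bar>x\<bar> powr l + b) \<le> - a * \<bar>x + A * u\<bar> powr l + b"
          by (simp add: algebra_simps)
        then have w: "exp (- (a * real n * q) * u) * exp (- (a * C1) * real n * \<bar>u\<bar> powr (min l 2)) * w x \<le> w (x + A * u)"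
          by (simp only: freud_weight_def exp_add[symmetric] exp_le_cancel_iff)
        have "\<bar>poly R u\<bar> * w x = \<bar>poly P (x + A * u)\<bar> * (\<bar>poly E u\<bar> * \<bar>poly \<tau> u\<bar> * w x)"
          by (simp add: R abs_mult)
        also have "\<dots> \<le> \<bar>poly P (x + A * u)\<bar> * ((2 * exp (- (a * real n * q) * u)) * (Cf * exp (- (a * C1) * real n * \<bar>u\<bar> powr (min l 2))) * w x)"
          using E(1)[OF u] \<tau>(3)[OF u] w_pos by (intro mult_left_mono mult_right_mono mult_mono) auto
        also have "\<dots> = \<bar>poly P (x + A * u)\<bar> * (2 * Cf * (exp (- (a * real n * q) * u) * exp (- (a * C1) * real n * \<bar>u\<bar> powr (min l 2)) * w x))"
          by (simp add: mult_ac)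
        also have "\<dots> \<le> \<bar>poly P (x + A * u)\<bar> * (2 * Cf * w (x + A * u))"
          using w Cf by (intro mult_left_mono) auto
        finally show ?thesis using w_pos by (simp add: abs_mult mult_ac)
      qed
      have I: "integral {-1..1} (\<lambda>u. (poly R u)\<^sup>2) \<le> 4 * Cf\<^sup>2 / (w x)\<^sup>2 * (1 / A) * c"
      proof -
        have "ennreal (integral {-1..1} (\<lambda>u. (poly R u)\<^sup>2)) = (\<integral>\<^sup>+u. ennreal ((poly R u)\<^sup>2) * indicator {-1..1} u \<partial>lborel)"
          by (rule nn_integral_interval_HK[symmetric]) (auto intro!: continuous_intros)
        also have "\<dots> \<le> (\<integral>\<^sup>+u. ennreal (4 * Cf\<^sup>2 / (w x)\<^sup>2) * (ennreal ((poly P (x + A * u) * w (x + A * u))\<^sup>2) * indicator {-1..1} u) \<partial>lborel)"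
        proof (rule nn_integral_mono)
          fix u
          show "ennreal ((poly R u)\<^sup>2) * indicator {-1..1} u
            \<le> ennreal (4 * Cf\<^sup>2 / (w x)\<^sup>2) * (ennreal ((poly P (x + A * u) * w (x + A * u))\<^sup>2) * indicator {-1..1} u)"
          proof (cases "u \<in> {-1..1}")
            case True
            then have "\<bar>u\<bar> \<le> 1" by auto
            from bnd[OF this] have "(\<bar>poly R u\<bar> * w x)\<^sup>2 \<le> (2 * Cf * \<bar>poly P (x + A * u) * w (x + A * u)\<bar>)\<^sup>2"
              using w_pos by (intro power_mono) auto
            then have "(poly R u)\<^sup>2 * (w x)\<^sup>2 \<le> 4 * Cf\<^sup>2 * (poly P (x + A * u) * w (x + A * u))\<^sup>2"
              by (simp add: power_mult_distrib mult_ac)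
            then have "(poly R u)\<^sup>2 \<le> 4 * Cf\<^sup>2 / (w x)\<^sup>2 * (poly P (x + A * u) * w (x + A * u))\<^sup>2"
              using w_pos(1)[of x] by (simp add: pos_le_divide_eq)
            then show ?thesis using True by (simp add: ennreal_mult'[symmetric] ennreal_leI)
          qed simp
        qed
        also have "\<dots> = ennreal (4 * Cf\<^sup>2 / (w x)\<^sup>2) * (\<integral>\<^sup>+u. ennreal ((poly P (x + A * u) * w (x + A * u))\<^sup>2) * indicator {-1..1} u \<partial>lborel)"
          by (rule nn_integral_cmult) measurable
        also have "(\<integral>\<^sup>+u. ennreal ((poly P (x + A * u) * w (x + A * u))\<^sup>2) * indicator {-1..1} u \<partial>lborel)
            = ennreal (1 / A) * (\<integral>\<^sup>+t. ennreal ((poly P t * w t)\<^sup>2) * indicator {x - A..x + A} t \<partial>lborel)"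
          by (rule nn_integral_affine_ball[where f="\<lambda>t. ennreal ((poly P t * w t)\<^sup>2)"]) (use A in auto)
        also have "(\<integral>\<^sup>+t. ennreal ((poly P t * w t)\<^sup>2) * indicator {x - A..x + A} t \<partial>lborel) \<le> ennreal c"
          by (rule order_trans[OF nn_integral_mono int]) (auto split: split_indicator)
        finally have "ennreal (integral {-1..1} (\<lambda>u. (poly R u)\<^sup>2)) \<le> ennreal (4 * Cf\<^sup>2 / (w x)\<^sup>2) * (ennreal (1 / A) * ennreal c)"
          by (simp add: mult_left_mono)
        also have "\<dots> = ennreal (4 * Cf\<^sup>2 / (w x)\<^sup>2 * (1 / A) * c)"
          using A c by (simp add: ennreal_mult'[symmetric] mult_ac)
        finally show ?thesis using A c by (subst (asm) ennreal_le_iff) auto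
      qed
      \<comment> \<open>The degree contributes a factor n and the substitution
        \<open>t = x + A * u\<close> a factor \<open>1 / A\<close>; together
        \<open>n powr (1 - 1 / l)\<close>.\<close>
      have "(poly P x)\<^sup>2 \<le> real (degree R + 1) * integral {-1..1} (\<lambda>u. (poly R u)\<^sup>2)"
        using poly_at_0_sq_le[of R "degree R"] R0 by simp
      also have "\<dots> \<le> ((C2 + 1) * real n) * (4 * Cf\<^sup>2 / (w x)\<^sup>2 * (1 / A) * c)"
        using degR I C2 by (intro mult_mono) (auto intro!: integral_nonneg integrable_continuous_interval continuous_intros)
      also have "\<dots> = (C2 + 1) * (4 * Cf\<^sup>2) * (real n / A) * c / (w x)\<^sup>2" by (simp add: mult_ac)
      finally have "(poly P x)\<^sup>2 * (w x)\<^sup>2 \<le> (C2 + 1) * (4 * Cf\<^sup>2) * real n powr (1 - 1 / l) * c"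
        using w_pos(1)[of x] unfolding nA by (simp add: pos_le_divide_eq)
      also have "\<dots> \<le> C * real n powr (1 - 1 / l) * c"
        using C c by (intro mult_right_mono) auto
      finally show ?thesis by (simp add: power_mult_distrib)
    qed
  qed
qed

end

subsection \<open>Orthonormal polynomials and de la Vallee Poussin sums\<close>

lemma half_ennreal: "inverse 2 * ennreal x = ennreal (x / 2)"
proof -
  have "ennreal (1 / 2) * ennreal x = ennreal (1 / 2 * x)" by (rule ennreal_mult'[symmetric]) simp
  then show ?thesis by simp
qed

lemma numeral_ennreal: "numeral n * ennreal x = ennreal (numeral n * x)"
  by (subst ennreal_mult') simp_all

context freud
begin

text \<open>The moment functional of \<open>w\<^sup>2\<close>; it reduces orthogonality to linear
  algebra of polynomials.\<close>

definition Lw :: "real poly \<Rightarrow> real" where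
  "Lw R = (\<integral>x. poly R x * (w x)\<^sup>2 \<partial>lborel)"

lemma integrable_poly_w2: "integrable lborel (\<lambda>x. poly R x * (w x)\<^sup>2)"
  using integrable_poly_w_power[of 2 R] by simp

lemma Lw_add: "Lw (R + S) = Lw R + Lw S"
  by (simp add: Lw_def distrib_right integrable_poly_w2)

lemma Lw_smult: "Lw (smult c R) = c * Lw R"
  by (simp add: Lw_def mult.assoc)

lemma Lw_0: "Lw 0 = 0"
  by (simp add: Lw_def)

lemma Lw_sum: "Lw (\<Sum>i\<in>I. R i) = (\<Sum>i\<in>I. Lw (R i))"
  by (induction I rule: infinite_finite_induct) (auto simp: Lw_add Lw_0)

lemma Lw_mono: "(\<And>x. poly R x \<le> poly S x) \<Longrightarrow> Lw R \<le> Lw S"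
  unfolding Lw_def by (intro integral_mono integrable_poly_w2 mult_right_mono) auto

lemma Lw_square_nonneg: "0 \<le> Lw (R * R)"
  unfolding Lw_def by (intro Bochner_Integration.integral_nonneg) auto

lemma nn_integral_square: "(\<integral>\<^sup>+x. ennreal ((poly R x * w x)\<^sup>2) \<partial>lborel) = ennreal (Lw (R * R))"
proof -
  have "(\<integral>\<^sup>+x. ennreal ((poly R x * w x)\<^sup>2) \<partial>lborel) = (\<integral>\<^sup>+x. ennreal (poly (R * R) x * (w x)\<^sup>2) \<partial>lborel)"
    by (intro nn_integral_cong) (simp add: power2_eq_square mult_ac)
  also have "\<dots> = ennreal (Lw (R * R))"
    unfolding Lw_def by (rule nn_integral_eq_integral[OF integrable_poly_w2]) auto
  finally show ?thesis .
qed

abbreviation "orth P \<equiv> orthonormal_polys w P"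

lemma orth_degree: "orth P \<Longrightarrow> degree (P k) = k"
  by (simp add: orthonormal_polys_def)

lemma orth_Lw:
  assumes "orth P"
  shows "Lw (P j * P k) = (if j = k then 1 else 0)"
proof -
  have "(LINT x|lebesgue. poly (P j) x * poly (P k) x * (w x)\<^sup>2) = Lw (P j * P k)"
    unfolding Lw_def poly_mult by (rule integral_completion) simp
  then show ?thesis using assms by (simp add: orthonormal_polys_def)
qed

lemma orth_span:
  assumes P: "orth P" and R: "degree R < n"
  shows "R = (\<Sum>k<n. smult (Lw (R * P k)) (P k))"
proof -
  have "P 0 \<noteq> 0" using orth_Lw[OF P, of 0 0] by (auto simp: Lw_0)
  moreover have "degree R \<le> n - 1" using R by simp
  ultimately obtain b where "R = (\<Sum>k\<le>n - 1. smult (b k) (P k))"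
    using graded_basis_span[of P R "n - 1"] orth_degree[OF P] by auto
  moreover have "{..n - 1} = {..<n}" using R by auto
  ultimately have b: "R = (\<Sum>k<n. smult (b k) (P k))" by simp
  have "Lw (R * P k) = b k" if "k < n" for k
  proof -
    have "Lw (R * P k) = (\<Sum>j<n. b j * (if j = k then 1 else 0))"
      by (simp add: b sum_distrib_right Lw_sum Lw_smult orth_Lw[OF P])
    also have "\<dots> = b k" using that by (simp add: if_distrib cong: if_cong)
    finally show ?thesis .
  qed
  then have "(\<Sum>k<n. smult (Lw (R * P k)) (P k)) = (\<Sum>k<n. smult (b k) (P k))"
    by (intro sum.cong) auto
  then show ?thesis using b by simp
qed

lemma orth_expand:
  assumes "orth P" "degree R < n"
  shows "poly R x = (\<Sum>k<n. Lw (R * P k) * poly (P k) x)"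
  using arg_cong[OF orth_span[OF assms], of "\<lambda>S. poly S x"] by (simp add: poly_sum)

lemma orth_low_degree:
  assumes P: "orth P" and R: "degree R < k"
  shows "Lw (R * P k) = 0"
proof -
  have "Lw (R * P k) = Lw ((\<Sum>j<k. smult (Lw (R * P j)) (P j)) * P k)"
    using orth_span[OF assms] by simp
  also have "\<dots> = (\<Sum>j<k. Lw (R * P j) * (if j = k then 1 else 0))"
    by (simp add: sum_distrib_right Lw_sum Lw_smult orth_Lw[OF P])
  finally show ?thesis by simp
qed

text \<open>Parseval's identity. The index map h admits the shifted sums of the Christoffel-Darboux
  formula.\<close>

lemma Lw_square_sum:
  assumes P: "orth P" and h: "inj_on h S" and "finite S"
  shows "Lw ((\<Sum>k\<in>S. smult (d k) (P (h k))) * (\<Sum>k\<in>S. smult (d k) (P (h k)))) = (\<Sum>k\<in>S. (d k)\<^sup>2)"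
proof -
  have "Lw ((\<Sum>k\<in>S. smult (d k) (P (h k))) * (\<Sum>k\<in>S. smult (d k) (P (h k))))
      = (\<Sum>j\<in>S. \<Sum>k\<in>S. d j * (d k * (if h j = h k then 1 else 0)))"
    by (simp add: sum_product Lw_sum Lw_smult orth_Lw[OF P] mult_ac)
  also have "\<dots> = (\<Sum>j\<in>S. \<Sum>k\<in>S. if k = j then d j * d k else 0)"
    using h by (intro sum.cong refl) (auto simp: inj_on_def)
  also have "\<dots> = (\<Sum>j\<in>S. (d j)\<^sup>2)"
    using \<open>finite S\<close> by (intro sum.cong refl) (simp add: power2_eq_square)
  finally show ?thesis .
qed

section \<open>Christoffel-Darboux kernels and the kernel of the de la Vallee Poussin sum\<close>

text \<open>The reproducing kernel of the polynomials of degree below n, as a polynomial in its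
  second variable.\<close>

definition kern :: "(nat \<Rightarrow> real poly) \<Rightarrow> nat \<Rightarrow> real \<Rightarrow> real poly" where
  "kern P n x = (\<Sum>k<n. smult (poly (P k) x) (P k))"

lemma poly_kern: "poly (kern P n x) t = (\<Sum>k<n. poly (P k) x * poly (P k) t)"
  by (simp add: kern_def poly_sum)

lemma Lw_kern: "orth P \<Longrightarrow> Lw (kern P n x * kern P n x) = poly (kern P n x) x"
  using Lw_square_sum[of P "\<lambda>k. k" "{..<n}" "\<lambda>k. poly (P k) x"]
  by (simp add: kern_def[symmetric] poly_kern power2_eq_square)

lemma kern_diag_nonneg: "0 \<le> poly (kern P n x) x"
  by (simp add: poly_kern sum_nonneg)

lemma kern_diag_mono: "n \<le> m \<Longrightarrow> poly (kern P n x) x \<le> poly (kern P m x) x"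
  unfolding poly_kern by (intro sum_mono2) auto

lemma degree_kern:
  assumes "orth P" shows "degree (kern P n x) \<le> n"
  unfolding kern_def
  by (intro degree_sum_le order_trans[OF degree_smult_le]) (auto simp: orth_degree[OF assms])

text \<open>Chosen so that \<open>n powr \<beta>\<close> is \<open>n / width n\<close>.\<close>

definition \<beta> :: real where "\<beta> = 1 - 1 / l"

lemma \<beta>: "0 < \<beta>" "\<beta> < 1"
  using l by (auto simp: \<beta>_def)

text \<open>The polynomial \<open>kern P n x\<close> has at x the value K and also squared norm K,
  so the Christoffel bound reads \<open>(K * w x)\<^sup>2 \<le> C * n powr \<beta> * K\<close>;
  divide by K.\<close>

lemma kern_diag_bound:
  "\<exists>C>0. \<forall>P. orth P \<longrightarrow> (\<forall>n\<ge>1. \<forall>x. poly (kern P n x) x * (w x)\<^sup>2 \<le> C * real n powr \<beta>)"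
proof -
  obtain C where C: "0 < C" and chr: "\<And>n P c x. 1 \<le> n \<Longrightarrow> degree P \<le> n \<Longrightarrow> 0 \<le> c \<Longrightarrow>
     (\<integral>\<^sup>+x. ennreal ((poly P x * w x)\<^sup>2) \<partial>lborel) \<le> ennreal c \<Longrightarrow>
     (poly P x * w x)\<^sup>2 \<le> C * real n powr \<beta> * c"
    using christoffel_bound unfolding \<beta>_def by blast
  show ?thesis
  proof (intro exI[of _ C] conjI C allI impI)
    fix P n x assume P: "orth P" and n: "1 \<le> (n::nat)"
    define K where "K = poly (kern P n x) x"
    have K: "0 \<le> K" unfolding K_def by (rule kern_diag_nonneg)
    have "(K * w x)\<^sup>2 \<le> C * real n powr \<beta> * K"
      unfolding K_def
      by (rule chr[OF n degree_kern[OF P] kern_diag_nonneg]) (simp add: nn_integral_square Lw_kern[OF P])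
    then have "(K * (w x)\<^sup>2) * K \<le> (C * real n powr \<beta>) * K" by (simp add: power2_eq_square mult_ac)
    then have "K * (w x)\<^sup>2 \<le> C * real n powr \<beta> \<or> K = 0" using K by (auto simp: mult_le_cancel_right)
    then show "poly (kern P n x) x * (w x)\<^sup>2 \<le> C * real n powr \<beta>"
      using C unfolding K_def[symmetric] by auto
  qed
qed

text \<open>Up to \<open>B * width n\<close> bound \<bar>x\<bar> itself; beyond, the restricted
  range inequality leaves an integrable exponential.\<close>

lemma abs_moment_bound:
  "\<exists>C>0. \<forall>n\<ge>1. \<forall>R. degree R \<le> n \<longrightarrow> Lw (R * R) \<le> 1 \<longrightarrow>
    (\<integral>\<^sup>+x. ennreal (\<bar>x\<bar> * (poly R x * w x)\<^sup>2) \<partial>lborel) \<le> ennreal (C * width n)"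
proof -
  obtain B \<kappa> where "range_const B \<kappa>" using restricted_range by blast
  note B = range_constD(1,2)[OF this] and RR = range_constD(3)[OF this]
  obtain D where D: "0 < D" "(\<integral>\<^sup>+x. ennreal (\<bar>poly [:0, 1:] x\<bar> * exp (- (2 * \<kappa>) * \<bar>x\<bar> powr l)) \<partial>lborel) \<le> ennreal D"
    using poly_exp_nn_integral[of "2 * \<kappa>" "[:0, 1:]"] B by auto
  show ?thesis
  proof (intro exI[of _ "B + 4 * D"] conjI allI impI)
    show "0 < B + 4 * D" using B D by simp
    fix n R assume n: "1 \<le> (n::nat)" and R: "degree R \<le> n" "Lw (R * R) \<le> 1"
    have A: "1 \<le> width n" using width(1)[OF n] .
    have sq: "(\<integral>\<^sup>+x. ennreal ((poly R x * w x)\<^sup>2) \<partial>lborel) \<le> 1"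
      using R by (simp add: nn_integral_square)
    then have "Lp_le 2 (\<lambda>x. ennreal \<bar>poly R x * w x\<bar>) 1" by (simp add: Lp_le_2_iff)
    then have Lp: "Lp_le 2 (\<lambda>x. ennreal \<bar>poly R x * w x\<bar> * indicator {- width n..width n} x) 1"
      by (rule Lp_le_mono) (auto split: split_indicator)
    have pw: "ennreal (\<bar>x\<bar> * (poly R x * w x)\<^sup>2) \<le> ennreal (B * width n) * ennreal ((poly R x * w x)\<^sup>2)
        + ennreal 4 * ennreal (\<bar>poly [:0, 1:] x\<bar> * exp (- (2 * \<kappa>) * \<bar>x\<bar> powr l))" for x
    proof (cases "B * width n \<le> \<bar>x\<bar>")
      case True
      have "\<bar>poly R x * w x\<bar> \<le> 2 * 1 * exp (- \<kappa> * real n) * exp (- \<kappa> * \<bar>x\<bar> powr l)"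
        by (rule RR[OF n R(1) _ _ Lp True]) auto
      also have "\<dots> \<le> 2 * 1 * 1 * exp (- \<kappa> * \<bar>x\<bar> powr l)"
        using B by (intro mult_mono) auto
      finally have "\<bar>poly R x * w x\<bar>\<^sup>2 \<le> (2 * exp (- \<kappa> * \<bar>x\<bar> powr l))\<^sup>2" by (intro power_mono) auto
      also have "\<dots> = 4 * exp (- (2 * \<kappa>) * \<bar>x\<bar> powr l)"
        by (simp add: power2_eq_square mult_exp_exp)
      finally have "(poly R x * w x)\<^sup>2 \<le> 4 * exp (- (2 * \<kappa>) * \<bar>x\<bar> powr l)" by simp
      then have "\<bar>x\<bar> * (poly R x * w x)\<^sup>2 \<le> \<bar>x\<bar> * (4 * exp (- (2 * \<kappa>) * \<bar>x\<bar> powr l))"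
        by (rule mult_left_mono) simp
      then have "ennreal (\<bar>x\<bar> * (poly R x * w x)\<^sup>2) \<le> ennreal (4 * (\<bar>poly [:0, 1:] x\<bar> * exp (- (2 * \<kappa>) * \<bar>x\<bar> powr l)))"
        by (intro ennreal_leI) (simp add: mult_ac)
      also have "\<dots> = ennreal 4 * ennreal (\<bar>poly [:0, 1:] x\<bar> * exp (- (2 * \<kappa>) * \<bar>x\<bar> powr l))"
        by (rule ennreal_mult) auto
      also have "\<dots> \<le> ennreal (B * width n) * ennreal ((poly R x * w x)\<^sup>2) + \<dots>" by simp
      finally show ?thesis .
    next
      case False
      have "ennreal (\<bar>x\<bar> * (poly R x * w x)\<^sup>2) \<le> ennreal (B * width n * (poly R x * w x)\<^sup>2)"
        using False by (intro ennreal_leI mult_right_mono) auto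
      also have "\<dots> = ennreal (B * width n) * ennreal ((poly R x * w x)\<^sup>2)"
        using A B by (intro ennreal_mult) auto
      also have "\<dots> \<le> \<dots> + ennreal 4 * ennreal (\<bar>poly [:0, 1:] x\<bar> * exp (- (2 * \<kappa>) * \<bar>x\<bar> powr l))" by simp
      finally show ?thesis .
    qed
    have "(\<integral>\<^sup>+x. ennreal (\<bar>x\<bar> * (poly R x * w x)\<^sup>2) \<partial>lborel) \<le>
        (\<integral>\<^sup>+x. ennreal (B * width n) * ennreal ((poly R x * w x)\<^sup>2)
        + ennreal 4 * ennreal (\<bar>poly [:0, 1:] x\<bar> * exp (- (2 * \<kappa>) * \<bar>x\<bar> powr l)) \<partial>lborel)"
      by (rule nn_integral_mono) (rule pw)
    also have "\<dots> = ennreal (B * width n) * (\<integral>\<^sup>+x. ennreal ((poly R x * w x)\<^sup>2) \<partial>lborel)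
        + ennreal 4 * (\<integral>\<^sup>+x. ennreal (\<bar>poly [:0, 1:] x\<bar> * exp (- (2 * \<kappa>) * \<bar>x\<bar> powr l)) \<partial>lborel)"
      by (subst nn_integral_add) (auto simp: nn_integral_cmult simp del: poly_pCons)
    also have "\<dots> \<le> ennreal (B * width n) * 1 + ennreal 4 * ennreal D"
      by (intro add_mono mult_left_mono sq D) auto
    also have "\<dots> = ennreal (B * width n + 4 * D)"
      using A B D by (simp add: numeral_ennreal ennreal_plus[symmetric] del: ennreal_plus)
    also have "\<dots> \<le> ennreal ((B + 4 * D) * width n)"
      using A B D by (intro ennreal_leI) (simp add: distrib_right)
    finally show "(\<integral>\<^sup>+x. ennreal (\<bar>x\<bar> * (poly R x * w x)\<^sup>2) \<partial>lborel) \<le> ennreal ((B + 4 * D) * width n)" .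
  qed
qed

text \<open>The off-diagonal entries of the Jacobi matrix of \<open>w\<^sup>2\<close>.\<close>

definition rec_coeff :: "(nat \<Rightarrow> real poly) \<Rightarrow> nat \<Rightarrow> real" where
  "rec_coeff P k = Lw ([:0, 1:] * P k * P (Suc k))"

text \<open>By \<open>2 * u * v \<le> u\<^sup>2 + v\<^sup>2\<close> the integral reduces to the
  absolute moments of \<open>P k\<close> and \<open>P (Suc k)\<close>, both of degree at most
  \<open>Suc k\<close>.\<close>

lemma rec_coeff_bound:
  "\<exists>C>0. \<forall>P. orth P \<longrightarrow> (\<forall>k. \<bar>rec_coeff P k\<bar> \<le> C * width (Suc k))"
proof -
  obtain C where C: "0 < C" and mom: "\<And>n R. 1 \<le> n \<Longrightarrow> degree R \<le> n \<Longrightarrow> Lw (R * R) \<le> 1 \<Longrightarrow>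
    (\<integral>\<^sup>+x. ennreal (\<bar>x\<bar> * (poly R x * w x)\<^sup>2) \<partial>lborel) \<le> ennreal (C * width n)"
    using abs_moment_bound by blast
  show ?thesis
  proof (intro exI[of _ C] conjI C allI impI)
    fix P k assume P: "orth P"
    let ?f = "\<lambda>x. poly ([:0, 1:] * P k * P (Suc k)) x * (w x)\<^sup>2"
    have m: "(\<integral>\<^sup>+x. ennreal (\<bar>x\<bar> * (poly (P j) x * w x)\<^sup>2) \<partial>lborel) \<le> ennreal (C * width (Suc k))" if "j \<le> Suc k" for j
      by (rule mom) (use that orth_degree[OF P] orth_Lw[OF P] in auto)
    have W: "0 \<le> C * width (Suc k)" using C width(3)[of "Suc k"] by simp
    have "ennreal (norm (rec_coeff P k)) \<le> (\<integral>\<^sup>+x. ennreal (norm (?f x)) \<partial>lborel)"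
      unfolding rec_coeff_def Lw_def by (rule integral_norm_bound_ennreal[OF integrable_poly_w2])
    also have "\<dots> \<le> (\<integral>\<^sup>+x. ennreal (1/2) * (ennreal (\<bar>x\<bar> * (poly (P k) x * w x)\<^sup>2) + ennreal (\<bar>x\<bar> * (poly (P (Suc k)) x * w x)\<^sup>2)) \<partial>lborel)"
    proof (rule nn_integral_mono)
      fix x
      let ?u = "\<bar>poly (P k) x * w x\<bar>" and ?v = "\<bar>poly (P (Suc k)) x * w x\<bar>"
      have "2 * (?u * ?v) \<le> ?u\<^sup>2 + ?v\<^sup>2" using zero_le_power2[of "?u - ?v"] by (simp add: power2_diff)
      then have "\<bar>x\<bar> * (?u * ?v) \<le> \<bar>x\<bar> * (1 / 2 * (?u\<^sup>2 + ?v\<^sup>2))" by (intro mult_left_mono) auto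
      moreover have "norm (?f x) = \<bar>x\<bar> * (?u * ?v)"
        by (simp add: abs_mult power2_eq_square mult_ac)
      ultimately have "norm (?f x) \<le> 1 / 2 * (\<bar>x\<bar> * (poly (P k) x * w x)\<^sup>2 + \<bar>x\<bar> * (poly (P (Suc k)) x * w x)\<^sup>2)"
        by (simp add: distrib_left)
      then show "ennreal (norm (?f x)) \<le> ennreal (1/2) * (ennreal (\<bar>x\<bar> * (poly (P k) x * w x)\<^sup>2) + ennreal (\<bar>x\<bar> * (poly (P (Suc k)) x * w x)\<^sup>2))"
        by (simp only: ennreal_plus[symmetric] ennreal_mult'[symmetric] ennreal_leI zero_le_mult_iff abs_ge_zero zero_le_power2 simp_thms)
    qed
    also have "\<dots> = ennreal (1/2) * ((\<integral>\<^sup>+x. ennreal (\<bar>x\<bar> * (poly (P k) x * w x)\<^sup>2) \<partial>lborel) + (\<integral>\<^sup>+x. ennreal (\<bar>x\<bar> * (poly (P (Suc k)) x * w x)\<^sup>2) \<partial>lborel))"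
      by (subst nn_integral_cmult) (auto simp: nn_integral_add)
    also have "\<dots> \<le> ennreal (1/2) * (ennreal (C * width (Suc k)) + ennreal (C * width (Suc k)))"
      by (intro mult_left_mono add_mono m) auto
    also have "\<dots> = ennreal (C * width (Suc k))"
      using W by (simp add: half_ennreal ennreal_plus[symmetric] del: ennreal_plus)
    finally show "\<bar>rec_coeff P k\<bar> \<le> C * width (Suc k)" using W by simp
  qed
qed

text \<open>Multiplication by x is symmetric for \<open>Lw\<close> and raises degrees by one, so
  only k and its neighbours survive. The diagonal coefficient cancels in the Christoffel-Darboux
  formula.\<close>

lemma three_term:
  assumes P: "orth P"
  shows "x * poly (P k) x = rec_coeff P k * poly (P (Suc k)) x + Lw ([:0, 1:] * P k * P k) * poly (P k) x
     + (if k = 0 then 0 else rec_coeff P (k - 1) * poly (P (k - 1)) x)"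
proof -
  have deg: "degree ([:0, 1:] * P j) < Suc (Suc j)" for j
    using degree_mult_le[of "[:0, 1:]" "P j"] orth_degree[OF P, of j] by simp
  have "x * poly (P k) x = poly ([:0, 1:] * P k) x" by simp
  also have "\<dots> = (\<Sum>j<Suc (Suc k). Lw ([:0, 1:] * P k * P j) * poly (P j) x)"
    by (rule orth_expand[OF P deg])
  also have "\<dots> = rec_coeff P k * poly (P (Suc k)) x + Lw ([:0, 1:] * P k * P k) * poly (P k) x
      + (\<Sum>j<k. Lw ([:0, 1:] * P k * P j) * poly (P j) x)"
    by (simp add: rec_coeff_def del: poly_pCons mult_pCons_left)
  also have "(\<Sum>j<k. Lw ([:0, 1:] * P k * P j) * poly (P j) x) = (if k = 0 then 0 else rec_coeff P (k - 1) * poly (P (k - 1)) x)"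
  proof (cases k)
    case (Suc i)
    have comm: "[:0, 1:] * P k * P j = [:0, 1:] * P j * P k" for j by (simp only: mult_ac)
    have z: "Lw ([:0, 1:] * P k * P j) = 0" if "j < i" for j
      unfolding comm by (rule orth_low_degree[OF P]) (use deg[of j] that Suc in linarith)
    have "(\<Sum>j<k. Lw ([:0, 1:] * P k * P j) * poly (P j) x) = Lw ([:0, 1:] * P k * P i) * poly (P i) x"
      using z unfolding Suc by (simp del: poly_pCons mult_pCons_left)
    then show ?thesis unfolding comm using Suc by (simp add: rec_coeff_def del: poly_pCons mult_pCons_left)
  qed simp
  finally show ?thesis .
qed

lemma christoffel_darboux:
  assumes P: "orth P"
  shows "(x - t) * poly (kern P (Suc n) x) t
    = rec_coeff P n * (poly (P (Suc n)) x * poly (P n) t - poly (P n) x * poly (P (Suc n)) t)"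
proof (induction n)
  case 0
  have "(x - t) * poly (kern P (Suc 0) x) t = (x * poly (P 0) x) * poly (P 0) t - poly (P 0) x * (t * poly (P 0) t)"
    by (simp add: poly_kern algebra_simps)
  then show ?case unfolding three_term[OF P] by (simp add: algebra_simps)
next
  case (Suc n)
  have "(x - t) * poly (kern P (Suc (Suc n)) x) t = (x - t) * poly (kern P (Suc n) x) t
      + ((x * poly (P (Suc n)) x) * poly (P (Suc n)) t - poly (P (Suc n)) x * (t * poly (P (Suc n)) t))"
    by (simp add: poly_kern algebra_simps)
  then show ?case unfolding three_term[OF P] Suc by (simp add: algebra_simps)
qed

text \<open>The mean of the kernels of orders \<open>n + 1\<close> to \<open>2 * n\<close>, indexed
  so that the Christoffel-Darboux formula, stated for \<open>Suc n\<close>, applies to each.\<close>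

definition vp_kern :: "(nat \<Rightarrow> real poly) \<Rightarrow> nat \<Rightarrow> real \<Rightarrow> real poly" where
  "vp_kern P n x = smult (1 / real n) (\<Sum>k\<in>{n..<2 * n}. kern P (Suc k) x)"

lemma poly_vp_kern:
  "poly (vp_kern P n x) t = 1 / real n * (\<Sum>k\<in>{n..<2 * n}. poly (kern P (Suc k) x) t)"
  by (simp add: vp_kern_def poly_sum)

lemma vp_kern_sym: "poly (vp_kern P n x) t = poly (vp_kern P n t) x"
  by (simp add: poly_vp_kern poly_kern mult.commute)

text \<open>The weights \<open>1 / (\<delta> (1 + ((x - t) / \<delta>)\<^sup>2))\<close> with \<open>\<delta> = n powr - \<beta>\<close> split the \<open>L\<^sub>1\<close> norm of the
  kernel into \<open>L\<^sub>2\<close> norms of \<open>v\<close> and of \<open>(x - t) v\<close>; by the Christoffel-Darboux formula the latter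
  gains a factor \<open>width n / n\<close> from averaging.\<close>

lemma vp_kern_bounds:
  "\<exists>C\<ge>1. \<forall>P. orth P \<longrightarrow> (\<forall>n\<ge>1. \<forall>x.
     (\<integral>\<^sup>+t. ennreal (\<bar>poly (vp_kern P n x) t\<bar> * w x * w t) \<partial>lborel) \<le> ennreal C \<and>
     (\<forall>t. \<bar>poly (vp_kern P n x) t\<bar> * w x * w t \<le> C * real n powr \<beta>))"
proof -
  obtain Ck where Ck: "0 < Ck" and diag: "\<And>P n x. orth P \<Longrightarrow> 1 \<le> n \<Longrightarrow> poly (kern P n x) x * (w x)\<^sup>2 \<le> Ck * real n powr \<beta>"
    using kern_diag_bound by blast
  obtain Cr where Cr: "0 < Cr" and rec: "\<And>P k. orth P \<Longrightarrow> \<bar>rec_coeff P k\<bar> \<le> Cr * width (Suc k)"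
    using rec_coeff_bound by blast
  define C where "C = 1 + pi + 3 * Ck * (1 + 16 * Cr\<^sup>2)"
  have C: "1 \<le> C" "3 * Ck \<le> C" "1 / 2 * (pi + 3 * Ck * (1 + 16 * Cr\<^sup>2)) \<le> C"
    using Ck Cr by (auto simp: C_def algebra_simps add_nonneg_nonneg) (simp add: field_simps)
  show ?thesis
  proof (intro exI[of _ C] conjI C(1) allI impI)
    fix P and n :: nat and x assume P: "orth P" and n: "1 \<le> n"
    define nb where "nb = real n powr \<beta>"
    have nb: "0 < nb" using n by (simp add: nb_def)
    \<comment> \<open>One bound for all orders occurring below, by
      \<open>2 * n + 1 \<le> 3 * n\<close> and \<open>3 powr \<beta> \<le> 3\<close>.\<close>
    have K3: "poly (kern P m y) y * (w y)\<^sup>2 \<le> 3 * Ck * nb" if "m \<le> Suc (2 * n)" for m y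
    proof -
      have "poly (kern P m y) y * (w y)\<^sup>2 \<le> poly (kern P (Suc (2 * n)) y) y * (w y)\<^sup>2"
        by (intro mult_right_mono kern_diag_mono that) auto
      also have "\<dots> \<le> Ck * real (Suc (2 * n)) powr \<beta>" by (rule diag[OF P]) simp
      also have "real (Suc (2 * n)) powr \<beta> \<le> (3 * real n) powr \<beta>"
        using n \<beta> by (intro powr_mono2) auto
      also have "\<dots> = 3 powr \<beta> * nb" using n by (simp add: powr_mult nb_def)
      also have "3 powr \<beta> \<le> 3 powr (1::real)" using \<beta> by (intro powr_mono) auto
      finally show ?thesis using Ck nb by (simp add: mult_right_mono mult_left_mono mult.assoc)
    qed
    have amgm: "\<bar>poly (kern P m y) t\<bar> * w y * w t \<le> 3 * Ck * nb" if m: "m \<le> Suc (2 * n)" for m y t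
    proof -
      have "\<bar>poly (kern P m y) t\<bar> \<le> (\<Sum>k<m. \<bar>poly (P k) y\<bar> * \<bar>poly (P k) t\<bar>)"
        unfolding poly_kern by (rule order_trans[OF sum_abs]) (simp add: abs_mult)
      then have "\<bar>poly (kern P m y) t\<bar> * w y * w t \<le> (\<Sum>k<m. \<bar>poly (P k) y\<bar> * \<bar>poly (P k) t\<bar>) * w y * w t"
        using w_pos by (intro mult_right_mono) auto
      also have "\<dots> = (\<Sum>k<m. (\<bar>poly (P k) y\<bar> * w y) * (\<bar>poly (P k) t\<bar> * w t))"
        by (simp add: sum_distrib_left mult_ac)
      also have "\<dots> \<le> (\<Sum>k<m. 1 / 2 * ((poly (P k) y)\<^sup>2 * (w y)\<^sup>2 + (poly (P k) t)\<^sup>2 * (w t)\<^sup>2))"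
      proof (rule sum_mono)
        fix k
        let ?u = "\<bar>poly (P k) y\<bar> * w y" and ?v = "\<bar>poly (P k) t\<bar> * w t"
        have "2 * (?u * ?v) \<le> ?u\<^sup>2 + ?v\<^sup>2" using zero_le_power2[of "?u - ?v"] by (simp add: power2_diff)
        then show "?u * ?v \<le> 1 / 2 * ((poly (P k) y)\<^sup>2 * (w y)\<^sup>2 + (poly (P k) t)\<^sup>2 * (w t)\<^sup>2)"
          by (simp add: power_mult_distrib)
      qed
      also have "\<dots> = 1 / 2 * (poly (kern P m y) y * (w y)\<^sup>2 + poly (kern P m t) t * (w t)\<^sup>2)"
        by (simp add: poly_kern sum_distrib_left sum_distrib_right sum.distrib power2_eq_square distrib_left)
      also have "\<dots> \<le> 1 / 2 * (3 * Ck * nb + 3 * Ck * nb)"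
        by (intro mult_left_mono add_mono K3 m) auto
      finally show ?thesis by simp
    qed
    define v where "v = vp_kern P n x"
    show "\<bar>poly (vp_kern P n x) t\<bar> * w x * w t \<le> C * real n powr \<beta>" for t
    proof -
      have "\<bar>poly (vp_kern P n x) t\<bar> * w x * w t
          \<le> (1 / real n * (\<Sum>k\<in>{n..<2 * n}. \<bar>poly (kern P (Suc k) x) t\<bar>)) * w x * w t"
        unfolding poly_vp_kern abs_mult using w_pos
        by (intro mult_right_mono mult_mono sum_abs) auto
      also have "\<dots> = 1 / real n * (\<Sum>k\<in>{n..<2 * n}. \<bar>poly (kern P (Suc k) x) t\<bar> * w x * w t)"
        by (simp add: sum_distrib_right[symmetric] mult.assoc)
      also have "\<dots> \<le> 1 / real n * (\<Sum>k\<in>{n..<2 * n}. 3 * Ck * nb)"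
        by (intro mult_left_mono sum_mono amgm) auto
      also have "\<dots> = 3 * Ck * nb" using n by simp
      also have "\<dots> \<le> C * nb" using C nb by (intro mult_right_mono) auto
      finally show ?thesis by (simp add: nb_def)
    qed
    \<comment> \<open>The order \<open>2 * n + 1\<close> lets K majorise also the sum of the squares
      of \<open>P (Suc k)\<close> for \<open>k < 2 * n\<close>.\<close>
    define K where "K = poly (kern P (Suc (2 * n)) x) x"
    have K: "0 \<le> K" "K * (w x)\<^sup>2 \<le> 3 * Ck * nb" using K3 kern_diag_nonneg by (auto simp: K_def)
    have v2: "Lw (v * v) \<le> K"
    proof -
      have "Lw (v * v) \<le> Lw (smult (1 / real n) (\<Sum>k\<in>{n..<2 * n}. kern P (Suc k) x * kern P (Suc k) x))"
      proof (rule Lw_mono)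
        fix t
        have "(\<Sum>k\<in>{n..<2 * n}. poly (kern P (Suc k) x) t * 1)\<^sup>2
            \<le> (\<Sum>k\<in>{n..<2 * n}. (poly (kern P (Suc k) x) t)\<^sup>2) * (\<Sum>k\<in>{n..<2 * n}. 1\<^sup>2)"
          by (rule Cauchy_Schwarz_ineq_sum)
        then have "1 / (real n)\<^sup>2 * (\<Sum>k\<in>{n..<2 * n}. poly (kern P (Suc k) x) t)\<^sup>2
            \<le> 1 / (real n)\<^sup>2 * ((\<Sum>k\<in>{n..<2 * n}. (poly (kern P (Suc k) x) t)\<^sup>2) * real n)"
          by (intro mult_left_mono) auto
        then show "poly (v * v) t \<le> poly (smult (1 / real n) (\<Sum>k\<in>{n..<2 * n}. kern P (Suc k) x * kern P (Suc k) x)) t"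
          using n by (simp add: v_def poly_vp_kern poly_sum power2_eq_square)
      qed
      also have "\<dots> = 1 / real n * (\<Sum>k\<in>{n..<2 * n}. poly (kern P (Suc k) x) x)"
        by (simp add: Lw_smult Lw_sum Lw_kern[OF P])
      also have "\<dots> \<le> 1 / real n * (\<Sum>k\<in>{n..<2 * n}. K)"
        unfolding K_def by (intro mult_left_mono sum_mono kern_diag_mono) auto
      also have "\<dots> = K" using n by simp
      finally show ?thesis .
    qed
    \<comment> \<open>U and V are the two halves of the summed Christoffel-Darboux formula. In t
      each is an orthogonal sum, so its squared norm is a single sum over k, of order
      \<open>(width n)\<^sup>2 * K\<close>, and the prefactor \<open>1 / n\<close> of the mean is a
      genuine gain.\<close>
    define U where "U = (\<Sum>k\<in>{n..<2 * n}. smult (rec_coeff P k * poly (P (Suc k)) x) (P k))"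
    define V where "V = (\<Sum>k\<in>{n..<2 * n}. smult (rec_coeff P k * poly (P k) x) (P (Suc k)))"
    have W: "(rec_coeff P k)\<^sup>2 \<le> 4 * Cr\<^sup>2 * (width n)\<^sup>2" if "k \<in> {n..<2 * n}" for k
    proof -
      have "width (Suc k) \<le> (2 * real n) powr (1 / l)"
        using that l unfolding width_def by (intro powr_mono2) auto
      also have "\<dots> = 2 powr (1 / l) * width n" by (simp add: powr_mult width_def)
      also have "\<dots> \<le> 2 powr 1 * width n" using l width(3)[OF n] by (intro mult_right_mono powr_mono) auto
      finally have "width (Suc k) \<le> 2 * width n" by simp
      then have "Cr * width (Suc k) \<le> Cr * (2 * width n)" using Cr by (intro mult_left_mono) auto
      then have "\<bar>rec_coeff P k\<bar> \<le> Cr * (2 * width n)" using rec[OF P, of k] by linarith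
      then have "\<bar>rec_coeff P k\<bar>\<^sup>2 \<le> (Cr * (2 * width n))\<^sup>2" by (intro power_mono) auto
      then show ?thesis by (simp add: power_mult_distrib mult_ac)
    qed
    have UV: "Lw (U * U) \<le> 4 * Cr\<^sup>2 * (width n)\<^sup>2 * K" "Lw (V * V) \<le> 4 * Cr\<^sup>2 * (width n)\<^sup>2 * K"
    proof -
      have "Lw (U * U) = (\<Sum>k\<in>{n..<2 * n}. (rec_coeff P k * poly (P (Suc k)) x)\<^sup>2)"
        unfolding U_def by (rule Lw_square_sum[OF P, where h="\<lambda>k. k"]) auto
      also have "\<dots> \<le> (\<Sum>k\<in>{n..<2 * n}. (4 * Cr\<^sup>2 * (width n)\<^sup>2) * (poly (P (Suc k)) x)\<^sup>2)"
        unfolding power_mult_distrib by (intro sum_mono mult_right_mono W) auto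
      also have "\<dots> = (4 * Cr\<^sup>2 * (width n)\<^sup>2) * (\<Sum>k\<in>{n..<2 * n}. (poly (P (Suc k)) x)\<^sup>2)"
        by (simp add: sum_distrib_left)
      also have "(\<Sum>k\<in>{n..<2 * n}. (poly (P (Suc k)) x)\<^sup>2) = (\<Sum>k\<in>Suc ` {n..<2 * n}. (poly (P k) x)\<^sup>2)"
        by (subst sum.reindex) auto
      also have "\<dots> \<le> K" unfolding K_def poly_kern power2_eq_square by (intro sum_mono2) auto
      finally show "Lw (U * U) \<le> 4 * Cr\<^sup>2 * (width n)\<^sup>2 * K" by (simp add: mult_left_mono)
      have "Lw (V * V) = (\<Sum>k\<in>{n..<2 * n}. (rec_coeff P k * poly (P k) x)\<^sup>2)"
        unfolding V_def by (rule Lw_square_sum[OF P, where h=Suc]) auto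
      also have "\<dots> \<le> (\<Sum>k\<in>{n..<2 * n}. (4 * Cr\<^sup>2 * (width n)\<^sup>2) * (poly (P k) x)\<^sup>2)"
        unfolding power_mult_distrib by (intro sum_mono mult_right_mono W) auto
      also have "\<dots> = (4 * Cr\<^sup>2 * (width n)\<^sup>2) * (\<Sum>k\<in>{n..<2 * n}. (poly (P k) x)\<^sup>2)"
        by (simp add: sum_distrib_left)
      also have "(\<Sum>k\<in>{n..<2 * n}. (poly (P k) x)\<^sup>2) \<le> K"
        unfolding K_def poly_kern power2_eq_square by (intro sum_mono2) auto
      finally show "Lw (V * V) \<le> 4 * Cr\<^sup>2 * (width n)\<^sup>2 * K" by (simp add: mult_left_mono)
    qed
    define X where "X = [:x, -1:] * v"
    have polyX: "poly X t = 1 / real n * (poly U t - poly V t)" for t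
    proof -
      have "poly X t = 1 / real n * (\<Sum>k\<in>{n..<2 * n}. (x - t) * poly (kern P (Suc k) x) t)"
      proof -
        have "poly X t = (x - t) * poly v t" by (simp add: X_def algebra_simps)
        then show ?thesis unfolding v_def poly_vp_kern sum_distrib_left[symmetric] by simp
      qed
      also have "(\<Sum>k\<in>{n..<2 * n}. (x - t) * poly (kern P (Suc k) x) t) = poly U t - poly V t"
        unfolding christoffel_darboux[OF P] U_def V_def
        by (simp add: poly_sum sum_subtractf[symmetric] algebra_simps)
      finally show ?thesis .
    qed
    have X2: "Lw (X * X) \<le> 16 * Cr\<^sup>2 * ((width n)\<^sup>2 / (real n)\<^sup>2) * K"
    proof -
      have "Lw (X * X) \<le> Lw (smult (2 / (real n)\<^sup>2) (U * U + V * V))"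
      proof (rule Lw_mono)
        fix t
        have "(poly U t - poly V t)\<^sup>2 \<le> 2 * ((poly U t)\<^sup>2 + (poly V t)\<^sup>2)"
          using zero_le_power2[of "poly U t + poly V t"] by (simp add: power2_sum power2_diff)
        then have "1 / (real n)\<^sup>2 * (poly U t - poly V t)\<^sup>2 \<le> 1 / (real n)\<^sup>2 * (2 * ((poly U t)\<^sup>2 + (poly V t)\<^sup>2))"
          by (intro mult_left_mono) auto
        then show "poly (X * X) t \<le> poly (smult (2 / (real n)\<^sup>2) (U * U + V * V)) t"
          by (simp add: polyX power2_eq_square)
      qed
      also have "\<dots> = 2 / (real n)\<^sup>2 * (Lw (U * U) + Lw (V * V))" by (simp add: Lw_smult Lw_add)
      also have "\<dots> \<le> 2 / (real n)\<^sup>2 * (4 * Cr\<^sup>2 * (width n)\<^sup>2 * K + 4 * Cr\<^sup>2 * (width n)\<^sup>2 * K)"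
        by (intro mult_left_mono add_mono UV) auto
      finally show ?thesis by (simp add: mult_ac)
    qed
    have wn: "(width n)\<^sup>2 / (real n)\<^sup>2 = 1 / nb\<^sup>2"
    proof -
      have "width n / real n = 1 / nb"
        using n by (simp add: width_def nb_def \<beta>_def powr_diff)
      then show ?thesis by (metis power_divide power_one)
    qed
    have pw: "ennreal (\<bar>poly v t\<bar> * w x * w t) \<le> ennreal (1 / 2) * (ennreal (nb * (1 / (1 + (nb * (t - x))\<^sup>2)))
        + (ennreal (1 / nb * (w x)\<^sup>2) * ennreal ((poly v t * w t)\<^sup>2) + ennreal (nb * (w x)\<^sup>2) * ennreal ((poly X t * w t)\<^sup>2)))" for t
    proof -
      define s where "s = 1 + (nb * (t - x))\<^sup>2"
      have s: "0 < s" by (simp add: s_def add_pos_nonneg)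
      define D where "D = \<bar>poly v t\<bar> * w x * w t"
      \<comment> \<open>A pointwise form of the Cauchy-Schwarz inequality: the first term integrates
        to pi, the second to the two squared norms.\<close>
      have "2 * D = 2 * sqrt (nb / s) * (sqrt (s / nb) * D)"
        using s nb by (simp add: real_sqrt_mult[symmetric] real_sqrt_divide)
      also have "\<dots> \<le> (sqrt (nb / s))\<^sup>2 + (sqrt (s / nb) * D)\<^sup>2"
        using zero_le_power2[of "sqrt (nb / s) - sqrt (s / nb) * D"] by (simp only: power2_diff)
      also have "\<dots> = nb / s + s / nb * D\<^sup>2" using s nb by (simp add: power_mult_distrib)
      also have "s / nb * D\<^sup>2 = 1 / nb * (w x)\<^sup>2 * (poly v t * w t)\<^sup>2 + nb * (w x)\<^sup>2 * (poly X t * w t)\<^sup>2"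
      proof -
        have X: "poly X t = (t - x) * (- poly v t)" by (simp add: X_def algebra_simps)
        have D2: "D\<^sup>2 = (poly v t)\<^sup>2 * (w x)\<^sup>2 * (w t)\<^sup>2" by (simp add: D_def power_mult_distrib)
        have "s / nb = 1 / nb + nb * (t - x)\<^sup>2"
          using nb by (simp add: s_def power_mult_distrib add_divide_distrib power2_eq_square)
        then show ?thesis unfolding X D2 by (simp add: power_mult_distrib distrib_left distrib_right mult_ac)
      qed
      finally have "D \<le> 1 / 2 * (nb * (1 / s) + (1 / nb * (w x)\<^sup>2 * (poly v t * w t)\<^sup>2 + nb * (w x)\<^sup>2 * (poly X t * w t)\<^sup>2))"
        by simp
      then have "ennreal D \<le> ennreal (1 / 2 * (nb * (1 / s) + (1 / nb * (w x)\<^sup>2 * (poly v t * w t)\<^sup>2 + nb * (w x)\<^sup>2 * (poly X t * w t)\<^sup>2)))"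
        by (rule ennreal_leI)
      also have "\<dots> = ennreal (1 / 2) * (ennreal (nb * (1 / s))
        + (ennreal (1 / nb * (w x)\<^sup>2) * ennreal ((poly v t * w t)\<^sup>2) + ennreal (nb * (w x)\<^sup>2) * ennreal ((poly X t * w t)\<^sup>2)))"
        using s nb by (simp add: half_ennreal ennreal_mult'[symmetric] ennreal_plus[symmetric] del: ennreal_plus)
      finally show ?thesis unfolding D_def s_def .
    qed
    have I0: "(\<integral>\<^sup>+t. ennreal (nb * (1 / (1 + (nb * (t - x))\<^sup>2))) \<partial>lborel) = ennreal pi"
    proof -
      have "(\<integral>\<^sup>+t. ennreal (nb * (1 / (1 + (nb * (t - x))\<^sup>2))) \<partial>lborel)
          = ennreal (1 / nb) * (\<integral>\<^sup>+u. ennreal (nb * (1 / (1 + u\<^sup>2))) \<partial>lborel)"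
        using nb by (subst nn_integral_real_affine[where c="1 / nb" and t=x]) auto
      also have "(\<integral>\<^sup>+u. ennreal (nb * (1 / (1 + u\<^sup>2))) \<partial>lborel) = ennreal nb * ennreal pi"
      proof -
        have "(\<integral>\<^sup>+u. ennreal (nb * (1 / (1 + u\<^sup>2))) \<partial>lborel) = (\<integral>\<^sup>+u. ennreal nb * ennreal (1 / (1 + u\<^sup>2)) \<partial>lborel)"
          by (intro nn_integral_cong ennreal_mult') (use nb in simp)
        also have "\<dots> = ennreal nb * (\<integral>\<^sup>+u. ennreal (1 / (1 + u\<^sup>2)) \<partial>lborel)"
          by (rule nn_integral_cmult) measurable
        finally show ?thesis by (simp only: nn_integral_Lorentz)
      qed
      finally show ?thesis using nb by (simp add: mult.assoc[symmetric] ennreal_mult'[symmetric])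
    qed
    have "(\<integral>\<^sup>+t. ennreal (\<bar>poly v t\<bar> * w x * w t) \<partial>lborel) \<le>
       (\<integral>\<^sup>+t. ennreal (1 / 2) * (ennreal (nb * (1 / (1 + (nb * (t - x))\<^sup>2)))
        + (ennreal (1 / nb * (w x)\<^sup>2) * ennreal ((poly v t * w t)\<^sup>2) + ennreal (nb * (w x)\<^sup>2) * ennreal ((poly X t * w t)\<^sup>2))) \<partial>lborel)"
      by (rule nn_integral_mono) (rule pw)
    also have "\<dots> = ennreal (1 / 2) * (ennreal pi + (ennreal (1 / nb * (w x)\<^sup>2) * ennreal (Lw (v * v))
        + ennreal (nb * (w x)\<^sup>2) * ennreal (Lw (X * X))))"
      unfolding I0[symmetric] nn_integral_square[symmetric]
      by (subst nn_integral_cmult, measurable, subst nn_integral_add, measurable, subst nn_integral_add, measurable)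
         (simp add: nn_integral_cmult)
    also have "\<dots> = ennreal (1 / 2 * (pi + (1 / nb * (w x)\<^sup>2 * Lw (v * v) + nb * (w x)\<^sup>2 * Lw (X * X))))"
      using nb Lw_square_nonneg[of v] Lw_square_nonneg[of X]
      by (simp add: half_ennreal ennreal_mult'[symmetric] ennreal_plus[symmetric] del: ennreal_plus)
    also have "\<dots> \<le> ennreal C"
    proof (rule ennreal_leI)
      have "1 / nb * (w x)\<^sup>2 * Lw (v * v) \<le> 1 / nb * (w x)\<^sup>2 * K" using nb v2 by (intro mult_left_mono) auto
      also have "\<dots> \<le> 1 / nb * (3 * Ck * nb)" using nb K by (simp only: mult.assoc) (intro mult_left_mono, auto simp: mult.commute)
      also have "\<dots> = 3 * Ck" using nb by simp
      finally have 1: "1 / nb * (w x)\<^sup>2 * Lw (v * v) \<le> 3 * Ck" .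
      have "nb * (w x)\<^sup>2 * Lw (X * X) \<le> nb * (w x)\<^sup>2 * (16 * Cr\<^sup>2 * (1 / nb\<^sup>2) * K)"
        using nb X2 unfolding wn by (intro mult_left_mono) auto
      also have "\<dots> = 16 * Cr\<^sup>2 * (1 / nb) * (K * (w x)\<^sup>2)" using nb by (simp add: power2_eq_square)
      also have "\<dots> \<le> 16 * Cr\<^sup>2 * (1 / nb) * (3 * Ck * nb)" using nb K by (intro mult_left_mono) auto
      also have "\<dots> = 3 * Ck * (16 * Cr\<^sup>2)" using nb by simp
      finally have 2: "nb * (w x)\<^sup>2 * Lw (X * X) \<le> 3 * Ck * (16 * Cr\<^sup>2)" .
      have "1 / 2 * (pi + (1 / nb * (w x)\<^sup>2 * Lw (v * v) + nb * (w x)\<^sup>2 * Lw (X * X)))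
          \<le> 1 / 2 * (pi + (3 * Ck + 3 * Ck * (16 * Cr\<^sup>2)))"
        by (intro mult_left_mono add_mono 1 2) auto
      also have "\<dots> = 1 / 2 * (pi + 3 * Ck * (1 + 16 * Cr\<^sup>2))" by (simp add: distrib_left)
      also have "\<dots> \<le> C" by (rule C)
      finally show "1 / 2 * (pi + (1 / nb * (w x)\<^sup>2 * Lw (v * v) + nb * (w x)\<^sup>2 * Lw (X * X))) \<le> C" .
    qed
    finally show "(\<integral>\<^sup>+t. ennreal (\<bar>poly (vp_kern P n x) t\<bar> * w x * w t) \<partial>lborel) \<le> ennreal C"
      unfolding v_def .
  qed
qed


section \<open>The de la Vallee Poussin operator\<close>

text \<open>A polynomial times w is bounded by some C and integrable. For finite p,
  \<open>y \<le> 1\<close> or \<open>y \<le> y powr s\<close> gives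
  \<open>y * z \<le> z + C * y powr s\<close> for \<open>0 \<le> z \<le> C\<close>, which replaces a
  conjugate exponent.\<close>

lemma integrable_times_poly:
  assumes f: "Lp_le p (\<lambda>x. ennreal \<bar>f x * w x\<bar>) c" and p: "1 \<le> p"
    and [measurable]: "f \<in> borel_measurable borel"
  shows "integrable lborel (\<lambda>x. f x * poly R x * (w x)\<^sup>2)"
proof (rule integrableI_bounded)
  obtain C where C: "0 < C" "\<And>x. \<bar>poly R x * w x\<bar> \<le> C"
    using poly_w_bounded by blast
  have R: "integrable lborel (\<lambda>x. poly R x * w x)"
    using integrable_poly_w_power[of 1 R] by simp
  have Rf: "(\<integral>\<^sup>+x. ennreal \<bar>poly R x * w x\<bar> \<partial>lborel) < \<infinity>"
    using R by (simp add: integrable_iff_bounded)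
  have eq: "ennreal (norm (f x * poly R x * (w x)\<^sup>2)) = ennreal \<bar>f x * w x\<bar> * ennreal \<bar>poly R x * w x\<bar>" for x
    by (simp add: ennreal_mult'[symmetric] abs_mult power2_eq_square mult_ac)
  show "(\<integral>\<^sup>+x. ennreal (norm (f x * poly R x * (w x)\<^sup>2)) \<partial>lborel) < \<infinity>"
    unfolding eq
  proof (cases rule: exponent_cases[OF p])
    case 1
    have "AE x in lborel. ennreal \<bar>f x * w x\<bar> \<le> ennreal c" using f 1 by (simp add: Lp_le_def)
    then have "(\<integral>\<^sup>+x. ennreal \<bar>f x * w x\<bar> * ennreal \<bar>poly R x * w x\<bar> \<partial>lborel)
        \<le> (\<integral>\<^sup>+x. ennreal c * ennreal \<bar>poly R x * w x\<bar> \<partial>lborel)"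
      by (intro nn_integral_mono_AE) (auto elim!: eventually_mono intro!: mult_right_mono)
    also have "\<dots> < \<infinity>" using Rf by (simp add: nn_integral_cmult ennreal_mult_less_top)
    finally show "(\<integral>\<^sup>+x. ennreal \<bar>f x * w x\<bar> * ennreal \<bar>poly R x * w x\<bar> \<partial>lborel) < \<infinity>" .
  next
    case (2 s)
    have "(\<integral>\<^sup>+x. ennreal \<bar>f x * w x\<bar> * ennreal \<bar>poly R x * w x\<bar> \<partial>lborel)
        \<le> (\<integral>\<^sup>+x. ennreal \<bar>poly R x * w x\<bar> + ennreal C * ennpowr (ennreal \<bar>f x * w x\<bar>) s \<partial>lborel)"
    proof (rule nn_integral_mono)
      fix x
      have "\<bar>f x * w x\<bar> * \<bar>poly R x * w x\<bar> \<le> \<bar>poly R x * w x\<bar> + C * \<bar>f x * w x\<bar> powr s"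
      proof (cases "\<bar>f x * w x\<bar> \<le> 1")
        case True
        have "\<bar>f x * w x\<bar> * \<bar>poly R x * w x\<bar> \<le> 1 * \<bar>poly R x * w x\<bar>"
          using True by (intro mult_right_mono) auto
        moreover have "0 \<le> C * \<bar>f x * w x\<bar> powr s" using C by simp
        ultimately show ?thesis by linarith
      next
        case False
        have "\<bar>f x * w x\<bar> powr 1 \<le> \<bar>f x * w x\<bar> powr s" using False 2 by (intro powr_mono) auto
        then have "\<bar>f x * w x\<bar> * \<bar>poly R x * w x\<bar> \<le> \<bar>f x * w x\<bar> powr s * C"
          using C by (intro mult_mono) auto
        then show ?thesis by (simp add: mult.commute add_increasing)
      qed
      then have "ennreal (\<bar>f x * w x\<bar> * \<bar>poly R x * w x\<bar>) \<le> ennreal (\<bar>poly R x * w x\<bar> + C * \<bar>f x * w x\<bar> powr s)"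
        by (rule ennreal_leI)
      then show "ennreal \<bar>f x * w x\<bar> * ennreal \<bar>poly R x * w x\<bar>
          \<le> ennreal \<bar>poly R x * w x\<bar> + ennreal C * ennpowr (ennreal \<bar>f x * w x\<bar>) s"
        using C by (simp add: ennreal_mult'[symmetric])
    qed
    also have "\<dots> = (\<integral>\<^sup>+x. ennreal \<bar>poly R x * w x\<bar> \<partial>lborel) + ennreal C * (\<integral>\<^sup>+x. ennpowr (ennreal \<bar>f x * w x\<bar>) s \<partial>lborel)"
      by (subst nn_integral_add) (auto simp: nn_integral_cmult simp del: ennpowr_ennreal)
    also have "\<dots> \<le> (\<integral>\<^sup>+x. ennreal \<bar>poly R x * w x\<bar> \<partial>lborel) + ennreal C * ennreal (c powr s)"
      using f 2 by (intro add_mono mult_left_mono) (auto simp: Lp_le_def)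
    also have "\<dots> < \<infinity>" using Rf by (simp add: ennreal_mult_less_top)
    finally show "(\<integral>\<^sup>+x. ennreal \<bar>f x * w x\<bar> * ennreal \<bar>poly R x * w x\<bar> \<partial>lborel) < \<infinity>" .
  qed
qed measurable

abbreviation "vp P n f \<equiv> vallee_poussin w P n f"

lemma measurable_vp [measurable]: "vp P n f \<in> borel_measurable borel"
  unfolding vallee_poussin_def fourier_sum_def by measurable

lemma fourier_coeff_lborel:
  assumes [measurable]: "f \<in> borel_measurable borel"
  shows "fourier_coeff w P f k = (\<integral>x. f x * poly (P k) x * (w x)\<^sup>2 \<partial>lborel)"
  unfolding fourier_coeff_def by (rule integral_completion) simp

lemma vp_kernel:
  assumes f: "Lp_le p (\<lambda>x. ennreal \<bar>f x * w x\<bar>) c" "1 \<le> p"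
    and [measurable]: "f \<in> borel_measurable borel"
  shows "vp P n f x = (\<integral>t. f t * poly (vp_kern P n x) t * (w t)\<^sup>2 \<partial>lborel)"
proof -
  have S: "fourier_sum w P m f x = (\<integral>t. f t * poly (kern P m x) t * (w t)\<^sup>2 \<partial>lborel)" for m
  proof -
    have "(\<integral>t. f t * poly (kern P m x) t * (w t)\<^sup>2 \<partial>lborel)
        = (\<integral>t. (\<Sum>k<m. poly (P k) x * (f t * poly (P k) t * (w t)\<^sup>2)) \<partial>lborel)"
      by (simp add: poly_kern sum_distrib_left sum_distrib_right mult_ac)
    also have "\<dots> = (\<Sum>k<m. poly (P k) x * (\<integral>t. f t * poly (P k) t * (w t)\<^sup>2 \<partial>lborel))"
      by (subst Bochner_Integration.integral_sum) (auto intro: integrable_times_poly[OF f])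
    finally show ?thesis by (simp add: fourier_sum_def fourier_coeff_lborel mult.commute)
  qed
  have "(\<integral>t. f t * poly (vp_kern P n x) t * (w t)\<^sup>2 \<partial>lborel)
      = (\<integral>t. (\<Sum>k\<in>{n..<2 * n}. 1 / real n * (f t * poly (kern P (Suc k) x) t * (w t)\<^sup>2)) \<partial>lborel)"
    by (simp add: poly_vp_kern sum_distrib_left sum_distrib_right mult_ac)
  also have "\<dots> = (\<Sum>k\<in>{n..<2 * n}. 1 / real n * (\<integral>t. f t * poly (kern P (Suc k) x) t * (w t)\<^sup>2 \<partial>lborel))"
    by (subst Bochner_Integration.integral_sum) (auto intro!: integrable_times_poly[OF f])
  also have "\<dots> = 1 / real n * (\<Sum>k\<in>{n..<2 * n}. fourier_sum w P (Suc k) f x)"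
    by (simp add: S sum_distrib_left)
  also have "(\<Sum>k\<in>{n..<2 * n}. fourier_sum w P (Suc k) f x) = (\<Sum>k\<in>Suc ` {n..<2 * n}. fourier_sum w P k f x)"
    by (subst sum.reindex) auto
  also have "Suc ` {n..<2 * n} = {n + 1..2 * n}"
    by (auto simp: image_Suc_atLeastLessThan)
  finally show ?thesis by (simp add: vallee_poussin_def)
qed

text \<open>Every partial sum in the mean has order at least \<open>n + 1\<close> and so reproduces
  R.\<close>

lemma vp_polynomial:
  assumes P: "orth P" and R: "degree R \<le> n" and n: "1 \<le> n"
  shows "vp P n (poly R) x = poly R x"
proof -
  have "fourier_sum w P k (poly R) x = poly R x" if "k \<in> {n + 1..2 * n}" for k
  proof -
    have "fourier_coeff w P (poly R) j = Lw (R * P j)" for j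
      by (simp add: fourier_coeff_lborel Lw_def)
    then show ?thesis using orth_expand[OF P, of R k x] R that by (simp add: fourier_sum_def)
  qed
  then show ?thesis using n by (simp add: vallee_poussin_def)
qed

lemma vp_is_poly:
  assumes P: "orth P"
  shows "\<exists>R. degree R \<le> 2 * n \<and> vp P n f = poly R"
proof (intro exI conjI)
  let ?R = "smult (1 / real n) (\<Sum>k = n + 1..2 * n. \<Sum>j<k. smult (fourier_coeff w P f j) (P j))"
  show "degree ?R \<le> 2 * n"
    by (intro order_trans[OF degree_smult_le] degree_sum_le) (auto simp: orth_degree[OF P])
  show "vp P n f = poly ?R"
    by (auto simp: vallee_poussin_def fourier_sum_def poly_sum)
qed

lemma measurable_vp_kern [measurable]:
  "(\<lambda>(x, t). ennreal (\<bar>poly (vp_kern P n x) t\<bar> * w x * w t)) \<in> borel_measurable (borel \<Otimes>\<^sub>M borel)"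
  unfolding poly_vp_kern poly_kern by measurable

lemma vp_pointwise:
  assumes f: "Lp_le p (\<lambda>x. ennreal \<bar>f x * w x\<bar>) c" "1 \<le> p"
    and [measurable]: "f \<in> borel_measurable borel"
  shows "ennreal \<bar>vp P n f x * w x\<bar>
    \<le> (\<integral>\<^sup>+t. ennreal (\<bar>poly (vp_kern P n x) t\<bar> * w x * w t) * ennreal \<bar>f t * w t\<bar> \<partial>lborel)"
proof -
  have "ennreal \<bar>vp P n f x * w x\<bar> = ennreal (w x) * ennreal (norm (vp P n f x))"
    using w_pos by (simp add: ennreal_mult'[symmetric] abs_mult mult.commute)
  also have "\<dots> \<le> ennreal (w x) * (\<integral>\<^sup>+t. ennreal (norm (f t * poly (vp_kern P n x) t * (w t)\<^sup>2)) \<partial>lborel)"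
    unfolding vp_kernel[OF f assms(3)]
    by (intro mult_left_mono integral_norm_bound_ennreal integrable_times_poly[OF f]) auto
  also have "\<dots> = (\<integral>\<^sup>+t. ennreal (w x) * ennreal (norm (f t * poly (vp_kern P n x) t * (w t)\<^sup>2)) \<partial>lborel)"
    by (rule nn_integral_cmult[symmetric]) measurable
  also have "\<dots> = (\<integral>\<^sup>+t. ennreal (\<bar>poly (vp_kern P n x) t\<bar> * w x * w t) * ennreal \<bar>f t * w t\<bar> \<partial>lborel)"
    using w_pos by (intro nn_integral_cong) (simp add: ennreal_mult'[symmetric] abs_mult power2_eq_square mult_ac)
  finally show ?thesis .
qed

text \<open>The weighted kernel is symmetric, so the bound on its rows is also one on its columns,
  and Schur's test gives a constant independent of p and P.\<close>

lemma vp_bounded: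
  "\<exists>C\<ge>1. \<forall>P. orth P \<longrightarrow> (\<forall>n\<ge>1. \<forall>p\<ge>1. \<forall>f c. f \<in> borel_measurable borel \<longrightarrow> 0 \<le> c \<longrightarrow>
     Lp_le p (\<lambda>x. ennreal \<bar>f x * w x\<bar>) c \<longrightarrow> Lp_le p (\<lambda>x. ennreal \<bar>vp P n f x * w x\<bar>) (C * c))"
proof -
  obtain C where C: "1 \<le> C" and row: "\<And>P n x. orth P \<Longrightarrow> 1 \<le> n \<Longrightarrow>
     (\<integral>\<^sup>+t. ennreal (\<bar>poly (vp_kern P n x) t\<bar> * w x * w t) \<partial>lborel) \<le> ennreal C"
    using vp_kern_bounds by blast
  show ?thesis
  proof (intro exI[of _ C] conjI C allI impI)
    fix P n p f c
    assume P: "orth P" and n: "1 \<le> (n::nat)" and p: "(1::ennreal) \<le> p" and c: "0 \<le> (c::real)"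
      and [measurable]: "f \<in> borel_measurable borel"
      and f: "Lp_le p (\<lambda>x. ennreal \<bar>f x * w x\<bar>) c"
    have col: "(\<integral>\<^sup>+x. ennreal (\<bar>poly (vp_kern P n x) t\<bar> * w x * w t) \<partial>lborel) \<le> ennreal C" for t
      using row[OF P n, of t] by (simp add: vp_kern_sym[of P n _ t] mult_ac)
    have "Lp_le p (\<lambda>x. \<integral>\<^sup>+t. ennreal (\<bar>poly (vp_kern P n x) t\<bar> * w x * w t) * ennreal \<bar>f t * w t\<bar> \<partial>lborel) (C * c)"
      by (rule schur_test) (use row[OF P n] col C p c f in auto)
    then show "Lp_le p (\<lambda>x. ennreal \<bar>vp P n f x * w x\<bar>) (C * c)"
      by (rule Lp_le_mono) (use vp_pointwise[OF f p] C c p in auto)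
  qed
qed

text \<open>For \<open>p \<le> q\<close> the kernel of \<open>vp\<close> reproduces R and is bounded
  by a multiple of \<open>n powr \<beta>\<close>. For \<open>p > q\<close> Hoelder's inequality on
  an interval of length O(\<open>width n\<close>) gives the factor, and the restricted range
  inequality handles the tail. This is the origin of the two forms of
  \<open>delta_exponent\<close>.\<close>

lemma nikolskii:
  assumes p: "1 \<le> p" and q: "1 \<le> q"
  shows "\<exists>C>0. \<forall>P. orth P \<longrightarrow> (\<forall>n\<ge>1. \<forall>R c. degree R \<le> n \<longrightarrow> 0 < c \<longrightarrow>
     Lp_le p (\<lambda>x. ennreal \<bar>poly R x * w x\<bar>) c \<longrightarrow>
     Lp_le q (\<lambda>x. ennreal \<bar>poly R x * w x\<bar>) (C * real n powr delta_exponent l p q * c))"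
proof (cases "p \<le> q")
  case True
  obtain C where C: "1 \<le> C" and bounds: "\<And>P n x. orth P \<Longrightarrow> 1 \<le> n \<Longrightarrow>
     (\<integral>\<^sup>+t. ennreal (\<bar>poly (vp_kern P n x) t\<bar> * w x * w t) \<partial>lborel) \<le> ennreal C \<and>
     (\<forall>t. \<bar>poly (vp_kern P n x) t\<bar> * w x * w t \<le> C * real n powr \<beta>)"
    using vp_kern_bounds by blast
  have e: "0 \<le> recip p - recip q" "recip p - recip q \<le> 1"
    using recip_antimono[OF p True] recip_bounds[OF p] recip_bounds[OF q] by auto
  show ?thesis
  proof (intro exI[of _ "C * C"] conjI allI impI)
    show "0 < C * C" using C by simp
    fix P n R c
    assume P: "orth P" and n: "1 \<le> (n::nat)" and R: "degree R \<le> n" and c: "0 < (c::real)"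
      and f: "Lp_le p (\<lambda>x. ennreal \<bar>poly R x * w x\<bar>) c"
    have nb: "0 < real n powr \<beta>" using n by simp
    have 1: "Lp_le q (\<lambda>x. ennreal \<bar>poly R x * w x\<bar>) (C * (C * real n powr \<beta>) powr (recip p - recip q) * c)"
    proof (rule Lp_le_reproducing[where k="\<lambda>x t. ennreal (\<bar>poly (vp_kern P n x) t\<bar> * w x * w t)"])
      show "ennreal \<bar>poly R x * w x\<bar>
          \<le> (\<integral>\<^sup>+t. ennreal (\<bar>poly (vp_kern P n x) t\<bar> * w x * w t) * ennreal \<bar>poly R t * w t\<bar> \<partial>lborel)" for x
        using vp_pointwise[OF f p, of P n x] vp_polynomial[OF P R n, of x] by simp
    qed (use bounds[OF P n] C nb c p True f in \<open>auto intro: ennreal_leI\<close>)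
    have 2: "C * (C * real n powr \<beta>) powr (recip p - recip q) * c \<le> C * C * real n powr delta_exponent l p q * c"
    proof -
      have "(C * real n powr \<beta>) powr (recip p - recip q) = C powr (recip p - recip q) * real n powr (\<beta> * (recip p - recip q))"
        using C by (simp add: powr_mult powr_powr)
      also have "C powr (recip p - recip q) \<le> C powr 1" using C e by (intro powr_mono) auto
      also have "\<beta> * (recip p - recip q) = delta_exponent l p q"
        using True by (simp add: delta_exponent_def \<beta>_def)
      finally have "(C * real n powr \<beta>) powr (recip p - recip q) \<le> C * real n powr delta_exponent l p q"
        using C by (simp add: mult_right_mono)
      then show ?thesis using C c by (simp add: mult.assoc mult_left_mono mult_right_mono)
    qed
    show "Lp_le q (\<lambda>x. ennreal \<bar>poly R x * w x\<bar>) (C * C * real n powr delta_exponent l p q * c)"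
      by (rule Lp_le_mono[OF 1 _ q _ 2]) (use C c in auto)
  qed
next
  case False
  then have qp: "q \<le> p" by simp
  have e: "0 \<le> recip q - recip p" "recip q - recip p \<le> 1"
    using recip_antimono[OF q qp] recip_bounds[OF p] recip_bounds[OF q] by auto
  obtain B \<kappa> where "range_const B \<kappa>" using restricted_range by blast
  note B = range_constD(1,2)[OF this] and RR = range_constD(3)[OF this]
  obtain D where D: "0 < D" "\<And>p. 1 \<le> p \<Longrightarrow> Lp_le p (\<lambda>x. ennreal (exp (- \<kappa> * \<bar>x\<bar> powr l))) D"
    using Lp_le_exp_decay[OF B(2)] by blast
  show ?thesis
  proof (intro exI[of _ "2 * B + 2 * D"] conjI allI impI)
    show "0 < 2 * B + 2 * D" using B D by simp
    fix P n R c
    assume P: "orth P" and n: "1 \<le> (n::nat)" and R: "degree R \<le> n" and c: "0 < (c::real)"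
      and f: "Lp_le p (\<lambda>x. ennreal \<bar>poly R x * w x\<bar>) c"
    define A where "A = width n"
    have A: "1 \<le> A" using width[OF n] by (simp add: A_def)
    have BA: "0 < B * A" using B A by simp
    define h where "h = (\<lambda>x. ennreal \<bar>poly R x * w x\<bar>)"
    have [measurable]: "h \<in> borel_measurable borel" unfolding h_def by measurable
    have ind: "Lp_le p (\<lambda>x. ennreal \<bar>poly R x * w x\<bar> * indicator {- width n..width n} x) c"
      by (rule Lp_le_mono[OF f]) (use p c in \<open>auto split: split_indicator\<close>)
    have 1: "Lp_le q (\<lambda>x. h x * indicator {- (B * A)..B * A} x) ((2 * (B * A)) powr (recip q - recip p) * c)"
      unfolding h_def by (rule Lp_le_interval) (use f q qp BA c in auto)
    have 2: "Lp_le q (\<lambda>x. ennreal (2 * c) * ennreal (exp (- \<kappa> * \<bar>x\<bar> powr l))) (2 * c * D)"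
      by (rule Lp_le_cmult) (use D q c in \<open>auto intro: less_imp_le\<close>)
    have 3: "Lp_le q (\<lambda>x. h x * indicator {- (B * A)..B * A} x + ennreal (2 * c) * ennreal (exp (- \<kappa> * \<bar>x\<bar> powr l)))
        ((2 * (B * A)) powr (recip q - recip p) * c + 2 * c * D)"
      by (rule Lp_le_add[OF 1 2 q]) (use B A c D in auto)
    have "h x \<le> h x * indicator {- (B * A)..B * A} x + ennreal (2 * c) * ennreal (exp (- \<kappa> * \<bar>x\<bar> powr l))" for x
    proof (cases "x \<in> {- (B * A)..B * A}")
      case False
      then have x: "B * width n \<le> \<bar>x\<bar>" by (auto simp: A_def)
      have "\<bar>poly R x * w x\<bar> \<le> 2 * c * exp (- \<kappa> * real n) * exp (- \<kappa> * \<bar>x\<bar> powr l)"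
        by (rule RR[OF n R p _ ind x]) (use c in simp)
      also have "\<dots> \<le> 2 * c * 1 * exp (- \<kappa> * \<bar>x\<bar> powr l)" using c B by (intro mult_mono) auto
      finally have "h x \<le> ennreal (2 * c * exp (- \<kappa> * \<bar>x\<bar> powr l))" unfolding h_def by (intro ennreal_leI) simp
      then show ?thesis using c by (simp add: ennreal_mult add_increasing)
    qed auto
    then have 3: "Lp_le q h ((2 * (B * A)) powr (recip q - recip p) * c + 2 * c * D)"
      by (intro Lp_le_mono[OF 3 _ q]) (use c D in auto)
    have delta: "real n powr delta_exponent l p q = A powr (recip q - recip p)"
      using False by (simp add: delta_exponent_def A_def width_def powr_powr)
    have "(2 * (B * A)) powr (recip q - recip p) = (2 * B) powr (recip q - recip p) * A powr (recip q - recip p)"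
      using B A by (simp add: powr_mult)
    also have "(2 * B) powr (recip q - recip p) \<le> (2 * B) powr 1" using B e by (intro powr_mono) auto
    finally have "(2 * (B * A)) powr (recip q - recip p) * c \<le> 2 * B * A powr (recip q - recip p) * c"
      using B c by (intro mult_right_mono) (auto simp: mult_right_mono)
    moreover have "2 * c * D * 1 \<le> 2 * c * D * A powr (recip q - recip p)"
      using c D A e by (intro mult_left_mono ge_one_powr_ge_zero) auto
    ultimately have "(2 * (B * A)) powr (recip q - recip p) * c + 2 * c * D
        \<le> (2 * B + 2 * D) * real n powr delta_exponent l p q * c"
      unfolding delta by (simp add: algebra_simps)
    then show "Lp_le q (\<lambda>x. ennreal \<bar>poly R x * w x\<bar>) ((2 * B + 2 * D) * real n powr delta_exponent l p q * c)"
      unfolding h_def[symmetric] by (intro Lp_le_mono[OF 3 _ q]) (use c D in auto)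
  qed
qed

end

subsection \<open>Jackson estimates\<close>

text \<open>The order of x and y is left open, so that bounds on increments are symmetric in the two
  points.\<close>

definition seg :: "real \<Rightarrow> real \<Rightarrow> real \<Rightarrow> ennreal" where
  "seg x y s = (if min x y \<le> s \<and> s \<le> max x y then 1 else 0)"

lemma measurable_seg [measurable (raw)]:
  assumes [measurable]: "f \<in> borel_measurable M" "g \<in> borel_measurable M" "h \<in> borel_measurable M"
  shows "(\<lambda>x. seg (f x) (g x) (h x)) \<in> borel_measurable M"
  unfolding seg_def by measurable

lemma seg_eq_indicator: "seg x y s = indicator {min x y..max x y} s"
  by (simp add: seg_def split: split_indicator)

lemma nn_integral_seg: "(\<integral>\<^sup>+s. seg x y s \<partial>lborel) = ennreal \<bar>x - y\<bar>"
  by (simp add: seg_eq_indicator max_def min_def)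

lemma seg_commute: "seg x y s = seg y x s"
  by (simp add: seg_def min.commute max.commute)

text \<open>Exchanges the roles of x and s, which turns column integrals of the smoothing kernel
  into row integrals.\<close>

lemma seg_shift: "seg x (x - u) s = seg s (s + u) x"
  by (auto simp: seg_def min_def max_def)

lemma ac_deriv_bound:
  assumes F: "ac_deriv F g"
  shows "ennreal \<bar>F x - F y\<bar> \<le> (\<integral>\<^sup>+s. seg x y s * ennreal \<bar>g s\<bar> \<partial>lborel)"
proof -
  have *: "ennreal \<bar>F t - F s\<bar> \<le> (\<integral>\<^sup>+x. seg s t x * ennreal \<bar>g x\<bar> \<partial>lborel)" if "s \<le> t" for s t
  proof -
    have g: "set_integrable lborel {s..t} g" and e: "F t - F s = (LBINT x:{s..t}. g x)"
      using F that by (auto simp: ac_deriv_def)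
    have "ennreal \<bar>F t - F s\<bar> = ennreal (norm (\<integral>x. indicator {s..t} x *\<^sub>R g x \<partial>lborel))"
      by (simp add: e set_lebesgue_integral_def)
    also have "\<dots> \<le> (\<integral>\<^sup>+x. ennreal (norm (indicator {s..t} x *\<^sub>R g x)) \<partial>lborel)"
      using g by (intro integral_norm_bound_ennreal) (simp add: set_integrable_def)
    also have "\<dots> = (\<integral>\<^sup>+x. seg s t x * ennreal \<bar>g x\<bar> \<partial>lborel)"
      using that by (intro nn_integral_cong) (auto simp: seg_eq_indicator split: split_indicator)
    finally show ?thesis .
  qed
  show ?thesis
  proof (cases "x \<le> y")
    case True
    then show ?thesis using *[of x y] by (simp add: abs_minus_commute)
  next
    case False
    then show ?thesis using *[of y x] by (simp add: seg_commute)
  qed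
qed

lemma ac_deriv_C1:
  assumes "\<And>x. (F has_field_derivative g x) (at x)" "continuous_on UNIV g"
  shows "ac_deriv F g"
  unfolding ac_deriv_def
proof (intro allI impI conjI)
  fix s t :: real assume st: "s \<le> t"
  have c: "continuous_on {s..t} g" using assms(2) continuous_on_subset by blast
  show "set_integrable lborel {s..t} g" by (rule borel_integrable_atLeastAtMost'[OF c])
  have "(\<integral>x. indicator {s..t} x *\<^sub>R g x \<partial>lborel) = F t - F s"
    by (rule integral_FTC_atLeastAtMost[OF st _ c])
       (use assms(1) in \<open>simp add: has_real_derivative_iff_has_vector_derivative[symmetric] has_field_derivative_at_within\<close>)
  then show "F t - F s = (LBINT x:{s..t}. g x)" by (simp add: set_lebesgue_integral_def)
qed

lemma nn_integral_Lorentz_affine: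
  assumes c: "0 < c"
  shows "(\<integral>\<^sup>+t. ennreal (1 / (1 + (c * (t - x))\<^sup>2)) \<partial>lborel) = ennreal (pi / c)"
proof -
  have "(\<integral>\<^sup>+t. ennreal (1 / (1 + (c * (t - x))\<^sup>2)) \<partial>lborel) = ennreal (1 / c) * (\<integral>\<^sup>+u. ennreal (1 / (1 + u\<^sup>2)) \<partial>lborel)"
    using c by (subst nn_integral_real_affine[where c="1 / c" and t=x]) auto
  also have "\<dots> = ennreal (1 / c * pi)" using c by (simp only: nn_integral_Lorentz) (simp add: ennreal_mult'[symmetric])
  finally show ?thesis by simp
qed

text \<open>Trades exponential decay for a function whose integral over the whole line is
  known.\<close>

lemma exp_le_Lorentz: "0 \<le> (s::real) \<Longrightarrow> exp (- s) \<le> 2 * (1 / (1 + s\<^sup>2))"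
proof -
  assume s: "0 \<le> s"
  have pos: "0 < 1 + s\<^sup>2" by (simp add: add_pos_nonneg)
  have "1 + s + s\<^sup>2 / 2 \<le> exp s" by (rule exp_lower_Taylor_quadratic[OF s])
  then have "(1 + s\<^sup>2) / 2 \<le> exp s" using s by (simp add: field_simps)
  then have "1 / exp s \<le> 1 / ((1 + s\<^sup>2) / 2)" using pos by (intro divide_left_mono mult_pos_pos) auto
  then show ?thesis by (simp add: exp_minus inverse_eq_divide)
qed

context freud
begin

section \<open>The weighted Hardy inequality\<close>

text \<open>Comparable to 1 plus the modulus of the logarithmic derivative of w.\<close>

definition \<Omega> :: "real \<Rightarrow> real" where "\<Omega> x = 1 + \<bar>x\<bar> powr (l - 1)"

lemma \<Omega>_ge_1: "1 \<le> \<Omega> x" "0 \<le> \<Omega> x"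
  by (simp_all add: \<Omega>_def add_nonneg_nonneg)

lemma measurable_\<Omega> [measurable]: "\<Omega> \<in> borel_measurable borel"
  unfolding \<Omega>_def by measurable

text \<open>For a primitive F of g with \<open>F 0 = 0\<close> it dominates \<bar>F x\<bar>, and it
  increases with the distance from 0 on either side.\<close>

definition total_var :: "(real \<Rightarrow> real) \<Rightarrow> real \<Rightarrow> ennreal" where
  "total_var g x = (\<integral>\<^sup>+t. seg 0 x t * ennreal \<bar>g t\<bar> \<partial>lborel)"

lemma measurable_total_var [measurable]:
  assumes [measurable]: "g \<in> borel_measurable borel"
  shows "total_var g \<in> borel_measurable borel"
  unfolding total_var_def by measurable

text \<open>For \<bar>x\<bar> > 1, convexity gives \<open>\<bar>t\<bar> powr l \<le> \<bar>t\<bar> *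
  \<bar>x\<bar> powr (l - 1)\<close> on the segment, so \<open>w x / w t\<close> decays in \<bar>x -
  t\<bar> at the rate \<open>\<psi> = a * \<bar>x\<bar> powr (l - 1)\<close>. The integral is of
  order \<open>1 / \<psi>\<close>, which cancels \<Omega>.\<close>

lemma hardy_row:
  "(\<integral>\<^sup>+t. ennreal (\<Omega> x * w x / w t) * seg 0 x t \<partial>lborel) \<le> ennreal (4 + 8 * pi / a)"
proof (cases "\<bar>x\<bar> \<le> 1")
  case True
  have "(\<integral>\<^sup>+t. ennreal (\<Omega> x * w x / w t) * seg 0 x t \<partial>lborel) \<le> (\<integral>\<^sup>+t. ennreal 2 * seg 0 x t \<partial>lborel)"
  proof (rule nn_integral_mono)
    fix t
    show "ennreal (\<Omega> x * w x / w t) * seg 0 x t \<le> ennreal 2 * seg 0 x t"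
    proof (cases "min 0 x \<le> t \<and> t \<le> max 0 x")
      case t: True
      then have "\<bar>t\<bar> \<le> \<bar>x\<bar>" by (auto simp: min_def max_def split: if_splits)
      then have "a * \<bar>t\<bar> powr l \<le> a * \<bar>x\<bar> powr l" using l a by (intro mult_left_mono powr_mono2) auto
      then have "w x \<le> w t" by (simp add: freud_weight_def)
      then have "w x / w t \<le> 1" using w_pos[of t] by (simp add: pos_divide_le_eq)
      moreover have "\<Omega> x \<le> 2" using True l by (simp add: \<Omega>_def powr_le1)
      ultimately have "\<Omega> x * (w x / w t) \<le> 2 * 1" using \<Omega>_ge_1 w_pos by (intro mult_mono) auto
      then show ?thesis by (intro mult_right_mono ennreal_leI) auto
    qed (auto simp: seg_def)
  qed
  also have "\<dots> = ennreal 2 * ennreal \<bar>0 - x\<bar>"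
    by (subst nn_integral_cmult, measurable) (simp only: nn_integral_seg)
  also have "\<dots> = ennreal (2 * \<bar>x\<bar>)" by (subst ennreal_mult') auto
  also have "\<dots> \<le> ennreal (4 + 8 * pi / a)"
    using True a by (intro ennreal_leI) (simp add: add_increasing2)
  finally show ?thesis .
next
  case False
  define X where "X = \<bar>x\<bar>"
  have X: "1 < X" using False by (simp add: X_def)
  define \<psi> where "\<psi> = a * X powr (l - 1)"
  have \<psi>: "0 < \<psi>" using a X by (simp add: \<psi>_def)
  have pw: "ennreal (\<Omega> x * w x / w t) * seg 0 x t \<le> ennreal (4 * \<psi> / a) * ennreal (1 / (1 + (\<psi> * (t - x))\<^sup>2))" for t
  proof (cases "min 0 x \<le> t \<and> t \<le> max 0 x")
    case t: True
    then have tx: "\<bar>t\<bar> \<le> X" "\<bar>t - x\<bar> = X - \<bar>t\<bar>" by (auto simp: X_def min_def max_def split: if_splits)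
    have "\<bar>t\<bar> powr l \<le> (\<bar>t\<bar> / X) * X powr l"
    proof (cases "t = 0")
      case False
      have "(\<bar>t\<bar> / X) powr l \<le> (\<bar>t\<bar> / X) powr 1" using tx X l by (intro powr_mono') auto
      then have "\<bar>t\<bar> powr l / X powr l \<le> \<bar>t\<bar> / X" using X by (simp add: powr_divide)
      then show ?thesis using X by (simp add: pos_divide_le_eq)
    qed simp
    then have "a * \<bar>t\<bar> powr l \<le> a * ((\<bar>t\<bar> / X) * X powr l)" using a by (intro mult_left_mono) auto
    also have "\<dots> = \<psi> * \<bar>t\<bar>" using X by (simp add: \<psi>_def powr_diff)
    finally have q1: "a * \<bar>t\<bar> powr l \<le> \<psi> * \<bar>t\<bar>" .
    have q2: "a * \<bar>x\<bar> powr l = \<psi> * X" using X by (simp add: \<psi>_def powr_diff X_def)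
    have "w x / w t = exp (a * \<bar>t\<bar> powr l - a * \<bar>x\<bar> powr l)"
      by (simp add: freud_weight_def exp_diff[symmetric])
    also have "\<dots> \<le> exp (- (\<psi> * (X - \<bar>t\<bar>)))" using q1 q2 by (simp add: algebra_simps)
    also have "\<dots> \<le> 2 * (1 / (1 + (\<psi> * (X - \<bar>t\<bar>))\<^sup>2))" using \<psi> tx by (intro exp_le_Lorentz) auto
    also have "(\<psi> * (X - \<bar>t\<bar>))\<^sup>2 = (\<psi> * (t - x))\<^sup>2"
      unfolding tx(2)[symmetric] by (simp add: power_mult_distrib)
    finally have 1: "w x / w t \<le> 2 * (1 / (1 + (\<psi> * (t - x))\<^sup>2))" .
    have 2: "\<Omega> x \<le> 2 * \<psi> / a"
    proof -
      have "1 \<le> X powr (l - 1)" using X l by (intro ge_one_powr_ge_zero) auto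
      then show ?thesis using a by (simp add: \<Omega>_def \<psi>_def X_def)
    qed
    have "\<Omega> x * (w x / w t) \<le> 2 * \<psi> / a * (2 * (1 / (1 + (\<psi> * (t - x))\<^sup>2)))"
      using \<psi> a w_pos by (intro mult_mono 1 2) auto
    then have "ennreal (\<Omega> x * w x / w t) \<le> ennreal (4 * \<psi> / a * (1 / (1 + (\<psi> * (t - x))\<^sup>2)))"
      by (intro ennreal_leI) (simp add: mult_ac)
    also have "\<dots> = ennreal (4 * \<psi> / a) * ennreal (1 / (1 + (\<psi> * (t - x))\<^sup>2))"
      using \<psi> a by (intro ennreal_mult') auto
    finally show ?thesis using t by (simp add: seg_def)
  qed (auto simp: seg_def)
  have "(\<integral>\<^sup>+t. ennreal (\<Omega> x * w x / w t) * seg 0 x t \<partial>lborel)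
      \<le> (\<integral>\<^sup>+t. ennreal (4 * \<psi> / a) * ennreal (1 / (1 + (\<psi> * (t - x))\<^sup>2)) \<partial>lborel)"
    by (rule nn_integral_mono) (rule pw)
  also have "\<dots> = ennreal (4 * \<psi> / a) * ennreal (pi / \<psi>)"
    by (subst nn_integral_cmult, measurable) (simp only: nn_integral_Lorentz_affine[OF \<psi>])
  also have "\<dots> = ennreal (4 * \<psi> / a * (pi / \<psi>))"
    using \<psi> a by (intro ennreal_mult'[symmetric]) auto
  also have "\<dots> \<le> ennreal (4 + 8 * pi / a)"
  proof (rule ennreal_leI)
    have "4 * \<psi> / a * (pi / \<psi>) = 4 * pi / a" using \<psi> by simp
    also have "\<dots> \<le> 8 * pi / a" using a by (intro divide_right_mono) auto
    finally show "4 * \<psi> / a * (pi / \<psi>) \<le> 4 + 8 * pi / a" by simp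
  qed
  finally show ?thesis .
qed

text \<open>Up to the factor \<open>- (a * l)\<close> the integrand is the derivative of its
  exponential factor.\<close>

lemma hardy_tail:
  assumes T: "0 \<le> T"
  shows "(\<integral>\<^sup>+x. ennreal (signed_powr (l - 1) x * exp (a * T powr l - a * \<bar>x\<bar> powr l)) * indicator {T..} x \<partial>lborel)
    = ennreal (1 / (a * l))"
proof -
  define F where "F = (\<lambda>x. - (1 / (a * l)) * exp (a * T powr l - a * \<bar>x\<bar> powr l))"
  have "(\<integral>\<^sup>+x. ennreal (signed_powr (l - 1) x * exp (a * T powr l - a * \<bar>x\<bar> powr l)) * indicator {T..} x \<partial>lborel)
    = ennreal (0 - F T)"
  proof (rule nn_integral_FTC_atLeast)
    show "(\<lambda>x. signed_powr (l - 1) x * exp (a * T powr l - a * \<bar>x\<bar> powr l)) \<in> borel_measurable borel"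
      unfolding signed_powr_def by measurable
    show "DERIV F x :> signed_powr (l - 1) x * exp (a * T powr l - a * \<bar>x\<bar> powr l)" for x
    proof -
      have "((\<lambda>x. a * T powr l - a * \<bar>x\<bar> powr l) has_field_derivative 0 - a * (l * signed_powr (l - 1) x)) (at x)"
        by (intro DERIV_diff DERIV_const DERIV_cmult DERIV_abs_powr l)
      from DERIV_cmult[OF DERIV_chain2[OF DERIV_exp this], of "- (1 / (a * l))"]
      show ?thesis unfolding F_def using a l by (simp add: mult_ac)
    qed
    show "0 \<le> signed_powr (l - 1) x * exp (a * T powr l - a * \<bar>x\<bar> powr l)" if "T \<le> x" for x
      using that T by (simp add: signed_powr_def sgn_if)
    have "filterlim (\<lambda>x::real. \<bar>x\<bar> powr l) at_top at_top"
    proof (rule filterlim_at_top_mono[OF filterlim_ident])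
      show "\<forall>\<^sub>F x in at_top. x \<le> \<bar>x\<bar> powr l"
        using eventually_ge_at_top[of "1::real"]
      proof eventually_elim
        case (elim x)
        then show ?case using powr_mono[of 1 l x] l by simp
      qed
    qed
    then have "filterlim (\<lambda>x. a * \<bar>x\<bar> powr l) at_top at_top"
      using a by (intro filterlim_tendsto_pos_mult_at_top[OF tendsto_const])
    then have "filterlim (\<lambda>x. - (a * T powr l) + a * \<bar>x\<bar> powr l) at_top at_top"
      by (rule filterlim_tendsto_add_at_top[OF tendsto_const])
    then have "filterlim (\<lambda>x. - (- (a * T powr l) + a * \<bar>x\<bar> powr l)) at_bot at_top"
      by (simp only: filterlim_uminus_at_bot minus_minus)
    then have "((\<lambda>x. exp (- (- (a * T powr l) + a * \<bar>x\<bar> powr l))) \<longlongrightarrow> 0) at_top"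
      by (rule filterlim_compose[OF exp_at_bot])
    then have "((\<lambda>x. - (1 / (a * l)) * exp (- (- (a * T powr l) + a * \<bar>x\<bar> powr l))) \<longlongrightarrow> - (1 / (a * l)) * 0) at_top"
      by (intro tendsto_mult tendsto_const)
    then show "(F \<longlongrightarrow> 0) at_top" by (simp add: F_def)
  qed
  also have "0 - F T = 1 / (a * l)" using T by (simp add: F_def)
  finally show ?thesis .
qed

text \<open>For \<bar>x\<bar> > 1, \<Omega> is at most twice
  \<open>\<bar>x\<bar> powr (l - 1)\<close>, and \<open>hardy_tail\<close> evaluates the integral;
  \<open>e x\<close> and \<open>e (- x)\<close> cover the two half lines, and \<open>{-1..1}\<close>
  adds a bounded term.\<close>

lemma hardy_col:
  "(\<integral>\<^sup>+x. ennreal (\<Omega> x * w x / w t) * seg 0 x t \<partial>lborel) \<le> ennreal (4 + 4 / (a * l))"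
proof -
  define T where "T = \<bar>t\<bar>"
  define e where "e x = ennreal (signed_powr (l - 1) x * exp (a * T powr l - a * \<bar>x\<bar> powr l)) * indicator {T..} x" for x
  have [measurable]: "e \<in> borel_measurable borel" unfolding e_def signed_powr_def by measurable
  have E: "(\<integral>\<^sup>+x. e x \<partial>lborel) = ennreal (1 / (a * l))" unfolding e_def by (rule hardy_tail) (simp add: T_def)
  have E': "(\<integral>\<^sup>+x. e (- x) \<partial>lborel) = ennreal (1 / (a * l))"
    using nn_integral_real_affine[of e "-1" 0] E by simp
  have pw: "ennreal (\<Omega> x * w x / w t) * seg 0 x t \<le> ennreal 2 * seg (-1) 1 x + (ennreal 2 * e x + ennreal 2 * e (- x))" for x
  proof (cases "min 0 x \<le> t \<and> t \<le> max 0 x")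
    case t: True
    then have tx: "T \<le> \<bar>x\<bar>" by (auto simp: T_def min_def max_def split: if_splits)
    define r where "r = exp (a * T powr l - a * \<bar>x\<bar> powr l)"
    have wr: "w x / w t = r" by (simp add: freud_weight_def exp_diff[symmetric] r_def T_def)
    have "a * T powr l \<le> a * \<bar>x\<bar> powr l" using tx l a by (intro mult_left_mono powr_mono2) (auto simp: T_def)
    then have r1: "r \<le> 1" "0 < r" by (auto simp: r_def)
    have L: "ennreal (\<Omega> x * w x / w t) * seg 0 x t = ennreal (\<Omega> x * r)"
      unfolding wr[symmetric] using t by (simp add: seg_def)
    show ?thesis
    proof (cases "\<bar>x\<bar> \<le> 1")
      case True
      have "\<Omega> x \<le> 2" using True l by (simp add: \<Omega>_def powr_le1)
      then have "\<Omega> x * r \<le> 2 * 1" using r1 \<Omega>_ge_1 by (intro mult_mono) auto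
      then have "ennreal (\<Omega> x * r) \<le> ennreal 2 * seg (-1) 1 x"
        using True ennreal_leI[of "\<Omega> x * r" 2] by (auto simp: seg_def abs_le_iff)
      then show ?thesis unfolding L by (simp add: add_increasing2)
    next
      case False
      have "1 \<le> \<bar>x\<bar> powr (l - 1)" using False l by (intro ge_one_powr_ge_zero) auto
      then have "\<Omega> x * r \<le> 2 * (\<bar>x\<bar> powr (l - 1) * r)" using r1 by (simp add: \<Omega>_def mult_right_mono)
      then have "ennreal (\<Omega> x * r) \<le> ennreal 2 * ennreal (\<bar>x\<bar> powr (l - 1) * r)"
        by (subst ennreal_mult'[symmetric]) (auto intro: ennreal_leI)
      also have "ennreal (\<bar>x\<bar> powr (l - 1) * r) \<le> e x + e (- x)"
        using False tx by (cases "0 \<le> x") (auto simp: e_def signed_powr_def r_def sgn_if)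
      finally have "ennreal (\<Omega> x * r) \<le> ennreal 2 * e x + ennreal 2 * e (- x)" by (simp add: distrib_left mult_left_mono)
      then show ?thesis unfolding L by (simp add: add_increasing)
    qed
  qed (auto simp: seg_def)
  have "(\<integral>\<^sup>+x. ennreal (\<Omega> x * w x / w t) * seg 0 x t \<partial>lborel)
      \<le> (\<integral>\<^sup>+x. ennreal 2 * seg (-1) 1 x + (ennreal 2 * e x + ennreal 2 * e (- x)) \<partial>lborel)"
    by (rule nn_integral_mono) (rule pw)
  also have "\<dots> = ennreal 2 * ennreal \<bar>-1 - 1\<bar> + (ennreal 2 * ennreal (1 / (a * l)) + ennreal 2 * ennreal (1 / (a * l)))"
    by (subst nn_integral_add, measurable, subst nn_integral_add, measurable)
       (subst nn_integral_cmult, measurable, subst nn_integral_cmult, measurable, subst nn_integral_cmult, measurable,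
        simp only: E E' nn_integral_seg)
  also have "\<dots> = ennreal (4 + 4 / (a * l))"
  proof -
    have "ennreal 2 * ennreal u + (ennreal 2 * ennreal v + ennreal 2 * ennreal v) = ennreal (2 * u + (2 * v + 2 * v))"
      if "0 \<le> u" "0 \<le> v" for u v
      using that by (simp only: ennreal_mult'[symmetric] ennreal_plus[symmetric] zero_le_numeral mult_nonneg_nonneg add_nonneg_nonneg)
    from this[of "\<bar>-1 - 1\<bar>" "1 / (a * l)"] show ?thesis using a l by simp
  qed
  finally show ?thesis .
qed

text \<open>As a map of \<open>g * w\<close> this is an integral operator with kernel
  \<open>\<Omega> x * w x / w t\<close> on the segment from 0 to x, so Schur's test applies for all
  p at once.\<close>

lemma hardy:
  "\<exists>C>0. \<forall>p\<ge>1. \<forall>g c. g \<in> borel_measurable borel \<longrightarrow> 0 \<le> c \<longrightarrow> Lp_le p (\<lambda>x. ennreal \<bar>g x * w x\<bar>) c \<longrightarrow>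
     Lp_le p (\<lambda>x. ennreal (\<Omega> x * w x) * total_var g x) (C * c)"
proof -
  define C where "C = 4 + 8 * pi / a + 4 / (a * l)"
  have C: "0 < C" "4 + 8 * pi / a \<le> C" "4 + 4 / (a * l) \<le> C"
    using a l by (auto simp: C_def add_pos_nonneg)
  show ?thesis
  proof (intro exI[of _ C] conjI C(1) allI impI)
    fix p g c
    assume p: "(1::ennreal) \<le> p" and [measurable]: "g \<in> borel_measurable borel" and c: "0 \<le> (c::real)"
      and g: "Lp_le p (\<lambda>x. ennreal \<bar>g x * w x\<bar>) c"
    have "Lp_le p (\<lambda>x. \<integral>\<^sup>+t. (ennreal (\<Omega> x * w x / w t) * seg 0 x t) * ennreal \<bar>g t * w t\<bar> \<partial>lborel) (C * c)"
    proof (rule schur_test)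
      show "(\<integral>\<^sup>+t. ennreal (\<Omega> x * w x / w t) * seg 0 x t \<partial>lborel) \<le> ennreal C" for x
        by (rule order_trans[OF hardy_row]) (use C in \<open>auto intro: ennreal_leI\<close>)
      show "(\<integral>\<^sup>+x. ennreal (\<Omega> x * w x / w t) * seg 0 x t \<partial>lborel) \<le> ennreal C" for t
        by (rule order_trans[OF hardy_col]) (use C in \<open>auto intro: ennreal_leI\<close>)
    qed (use C p c g in auto)
    moreover have "(\<integral>\<^sup>+t. (ennreal (\<Omega> x * w x / w t) * seg 0 x t) * ennreal \<bar>g t * w t\<bar> \<partial>lborel)
        = ennreal (\<Omega> x * w x) * total_var g x" for x
    proof -
      have "ennreal (\<Omega> x * w x) * total_var g x = (\<integral>\<^sup>+t. ennreal (\<Omega> x * w x) * (seg 0 x t * ennreal \<bar>g t\<bar>) \<partial>lborel)"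
        unfolding total_var_def by (rule nn_integral_cmult[symmetric]) measurable
      also have "\<dots> = (\<integral>\<^sup>+t. (ennreal (\<Omega> x * w x / w t) * seg 0 x t) * ennreal \<bar>g t * w t\<bar> \<partial>lborel)"
      proof (rule nn_integral_cong)
        fix t
        have "ennreal (\<Omega> x * w x / w t) * ennreal \<bar>g t * w t\<bar> = ennreal (\<Omega> x * w x) * ennreal \<bar>g t\<bar>"
          using \<Omega>_ge_1[of x] w_pos[of t] w_pos[of x] by (simp add: ennreal_mult'[symmetric] abs_mult)
        then show "ennreal (\<Omega> x * w x) * (seg 0 x t * ennreal \<bar>g t\<bar>)
            = (ennreal (\<Omega> x * w x / w t) * seg 0 x t) * ennreal \<bar>g t * w t\<bar>"
          by (simp add: seg_def)
      qed
      finally show ?thesis by simp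
    qed
    ultimately show "Lp_le p (\<lambda>x. ennreal (\<Omega> x * w x) * total_var g x) (C * c)" by simp
  qed
qed

end

section \<open>Smoothing by polynomial kernels\<close>

lemma convolution_poly:
  fixes G :: "real \<Rightarrow> real"
  assumes G: "\<And>q. integrable lborel (\<lambda>y. G y * poly q y)"
  shows "\<exists>R. degree R \<le> degree k \<and> (\<forall>x. poly R x = (\<integral>y. G y * poly k (x - y) \<partial>lborel))"
proof (intro exI conjI allI)
  define I where "I m = (\<integral>y. G y * (- y) ^ m \<partial>lborel)" for m
  have Gm: "integrable lborel (\<lambda>y. G y * (- y) ^ m)" for m
    using G[of "[:0, -1:] ^ m"] by (simp add: poly_power)
  let ?R = "\<Sum>i\<le>degree k. \<Sum>j\<le>i. monom (coeff k i * (of_nat (i choose j) * I (i - j))) j"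
  show "degree ?R \<le> degree k"
    by (intro degree_sum_le order_trans[OF degree_monom_le]) auto
  fix x
  have "(\<integral>y. G y * poly k (x - y) \<partial>lborel)
      = (\<integral>y. (\<Sum>i\<le>degree k. \<Sum>j\<le>i. coeff k i * (of_nat (i choose j) * (x ^ j * (G y * (- y) ^ (i - j))))) \<partial>lborel)"
  proof (intro Bochner_Integration.integral_cong refl)
    fix y
    have "poly k (x - y) = (\<Sum>i\<le>degree k. coeff k i * (\<Sum>j\<le>i. of_nat (i choose j) * x ^ j * (- y) ^ (i - j)))"
      unfolding poly_altdef using binomial_ring[of x "- y"] by simp
    then show "G y * poly k (x - y) = (\<Sum>i\<le>degree k. \<Sum>j\<le>i. coeff k i * (of_nat (i choose j) * (x ^ j * (G y * (- y) ^ (i - j)))))"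
      by (simp add: sum_distrib_left mult_ac)
  qed
  also have "\<dots> = (\<Sum>i\<le>degree k. \<Sum>j\<le>i. coeff k i * (of_nat (i choose j) * (x ^ j * I (i - j))))"
    unfolding I_def using Gm by (simp add: Bochner_Integration.integral_sum)
  also have "\<dots> = poly ?R x"
    by (simp add: poly_sum poly_monom mult_ac)
  finally show "poly ?R x = (\<integral>y. G y * poly k (x - y) \<partial>lborel)" ..
qed

lemma nn_integral_scale:
  fixes f :: "real \<Rightarrow> ennreal"
  assumes [measurable]: "f \<in> borel_measurable borel" and L: "0 < L"
  shows "(\<integral>\<^sup>+t. f t * indicator {-L..L} t \<partial>lborel) = ennreal L * (\<integral>\<^sup>+u. f (L * u) * indicator {-1..1} u \<partial>lborel)"
proof -
  have "ennreal L * (\<integral>\<^sup>+u. f (0 + L * u) * indicator {-1..1} u \<partial>lborel)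
      = ennreal L * (ennreal (1 / L) * (\<integral>\<^sup>+t. f t * indicator {0 - L..0 + L} t \<partial>lborel))"
    by (subst nn_integral_affine_ball) (use L in auto)
  then show ?thesis using L by (simp add: mult.assoc[symmetric] ennreal_mult'[symmetric])
qed

text \<open>Jackson's kernel: the fourth power of \<open>sine_quot n\<close>, scaled to
  \<open>{-L..L}\<close> and normalised there. The quotient of moment and mass gives the mean
  distance \<open>4 * L / n\<close>; the second power would leave a logarithm in the moment.\<close>

lemma jackson_kernel_exists:
  assumes n: "1 \<le> n" and L: "0 < L"
  obtains k :: "real poly" where "degree k \<le> 8 * n" "\<And>u. 0 \<le> poly k u"
    "(\<integral>\<^sup>+u. ennreal (poly k u) * indicator {-L..L} u \<partial>lborel) = 1"
    "(\<integral>\<^sup>+u. ennreal (\<bar>u\<bar> * poly k u) * indicator {-L..L} u \<partial>lborel) \<le> ennreal (4 * L / real n)"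
proof -
  define M where "M = real (2 * n + 1)"
  have M: "0 < M" "2 * real n \<le> M" by (auto simp: M_def)
  define D where "D = poly (sine_quot n)"
  define J where "J = integral {-1..1} (\<lambda>u. D u ^ 4)"
  have J: "M ^ 3 / 2 \<le> J" unfolding J_def D_def M_def by (rule jackson_kernel_mass)
  have J0: "0 < J" using J M by (meson divide_pos_pos less_le_trans zero_less_numeral zero_less_power)
  have cD: "continuous_on A D" for A unfolding D_def by (intro continuous_intros)
  define k where "k = smult (1 / (L * J)) (pcompose (sine_quot n ^ 4) [:0, 1 / L:])"
  have k: "poly k u = 1 / (L * J) * D (u / L) ^ 4" for u
    by (simp add: k_def poly_pcompose poly_power D_def mult.commute)
  have kL: "poly k (L * u) = 1 / (L * J) * D u ^ 4" for u using L by (simp add: k)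
  have LJ: "0 < L * J" using L J0 by simp
  have [measurable]: "poly k \<in> borel_measurable borel"
    by (intro borel_measurable_continuous_onI continuous_intros)
  have nonneg: "0 \<le> poly k u" for u using LJ by (simp add: k)
  have deg: "degree k \<le> 8 * n"
  proof -
    have "degree k \<le> degree (sine_quot n ^ 4) * degree [:0, 1 / L:]"
      unfolding k_def by (rule order_trans[OF degree_smult_le degree_pcompose_le])
    also have "\<dots> \<le> degree (sine_quot n ^ 4) * 1" by (intro mult_left_mono) auto
    also have "\<dots> \<le> 8 * n" using degree_power_le[of "sine_quot n" 4] degree_sine_quot[of n] by simp
    finally show ?thesis .
  qed
  have mass: "(\<integral>\<^sup>+u. ennreal (poly k u) * indicator {-L..L} u \<partial>lborel) = 1"
  proof -
    have "(\<integral>\<^sup>+u. ennreal (poly k u) * indicator {-L..L} u \<partial>lborel)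
        = ennreal L * (\<integral>\<^sup>+u. ennreal (poly k (L * u)) * indicator {-1..1} u \<partial>lborel)"
      by (rule nn_integral_scale[OF _ L]) measurable
    also have "(\<integral>\<^sup>+u. ennreal (poly k (L * u)) * indicator {-1..1} u \<partial>lborel)
        = ennreal (integral {-1..1} (\<lambda>u. 1 / (L * J) * D u ^ 4))"
      unfolding kL by (rule nn_integral_interval_HK) (use LJ in \<open>auto intro!: continuous_intros cD\<close>)
    also have "integral {-1..1} (\<lambda>u. 1 / (L * J) * D u ^ 4) = 1 / (L * J) * J"
      unfolding J_def by (rule integral_mult_right)
    also have "ennreal L * ennreal (1 / (L * J) * J) = ennreal (L * (1 / (L * J) * J))"
      using L by (intro ennreal_mult'[symmetric]) auto
    also have "L * (1 / (L * J) * J) = 1" using L J0 by simp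
    finally show ?thesis by simp
  qed
  have moment: "(\<integral>\<^sup>+u. ennreal (\<bar>u\<bar> * poly k u) * indicator {-L..L} u \<partial>lborel) \<le> ennreal (4 * L / real n)"
  proof -
    have "(\<integral>\<^sup>+u. ennreal (\<bar>u\<bar> * poly k u) * indicator {-L..L} u \<partial>lborel)
        = ennreal L * (\<integral>\<^sup>+u. ennreal (\<bar>L * u\<bar> * poly k (L * u)) * indicator {-1..1} u \<partial>lborel)"
      by (rule nn_integral_scale[OF _ L]) measurable
    also have "(\<integral>\<^sup>+u. ennreal (\<bar>L * u\<bar> * poly k (L * u)) * indicator {-1..1} u \<partial>lborel)
        = (\<integral>\<^sup>+u. ennreal (1 / J * (\<bar>u\<bar> * D u ^ 4)) * indicator {-1..1} u \<partial>lborel)"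
      using L by (intro nn_integral_cong) (simp add: kL abs_mult)
    also have "\<dots> = ennreal (integral {-1..1} (\<lambda>u. 1 / J * (\<bar>u\<bar> * D u ^ 4)))"
      by (rule nn_integral_interval_HK) (use J0 in \<open>auto intro!: continuous_intros cD\<close>)
    also have "integral {-1..1} (\<lambda>u. 1 / J * (\<bar>u\<bar> * D u ^ 4)) = 1 / J * integral {-1..1} (\<lambda>u. \<bar>u\<bar> * D u ^ 4)"
      by (rule integral_mult_right)
    also have "ennreal L * ennreal \<dots> = ennreal (L * (1 / J * integral {-1..1} (\<lambda>u. \<bar>u\<bar> * D u ^ 4)))"
      using L by (intro ennreal_mult'[symmetric]) auto
    also have "\<dots> \<le> ennreal (4 * L / real n)"
    proof (rule ennreal_leI)
      have "1 / J * integral {-1..1} (\<lambda>u. \<bar>u\<bar> * D u ^ 4) \<le> 1 / J * (4 * M\<^sup>2)"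
        unfolding D_def M_def using J0 by (intro mult_left_mono jackson_kernel_moment) auto
      also have "\<dots> \<le> 1 / (M ^ 3 / 2) * (4 * M\<^sup>2)"
        using J J0 M by (intro mult_right_mono divide_left_mono) auto
      also have "\<dots> = 8 / M" using M by (simp add: power3_eq_cube power2_eq_square)
      also have "\<dots> \<le> 8 / (2 * real n)" using M n by (intro divide_left_mono) auto
      finally have "1 / J * integral {-1..1} (\<lambda>u. \<bar>u\<bar> * D u ^ 4) \<le> 4 / real n" by simp
      then have "L * (1 / J * integral {-1..1} (\<lambda>u. \<bar>u\<bar> * D u ^ 4)) \<le> L * (4 / real n)"
        using L by (intro mult_left_mono) auto
      also have "L * (4 / real n) = 4 * L / real n" by simp
      finally show "L * (1 / J * integral {-1..1} (\<lambda>u. \<bar>u\<bar> * D u ^ 4)) \<le> 4 * L / real n" .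
    qed
    finally show ?thesis .
  qed
  show ?thesis by (rule that[OF deg nonneg mass moment])
qed

text \<open>Convolve G with Jackson's kernel k. As G vanishes outside
  \<open>{-\<rho>..\<rho>}\<close>, for \<bar>x\<bar> \<le> X only \<bar>u\<bar> \<le> L contributes
  to the integral of \<open>G (x - u) * poly k u\<close>, so k may be replaced by its truncation
  \<kappa>. The error is then an average of increments, and the rows and columns of the resulting
  kernel integrate to the first moment of \<kappa>.\<close>

lemma jackson_smoothing:
  fixes G :: "real \<Rightarrow> real" and h :: "real \<Rightarrow> ennreal"
  assumes n: "1 \<le> n" and X: "0 \<le> X" and \<rho>: "0 < \<rho>" and p: "1 \<le> p" and c: "0 \<le> c"
    and Gint: "\<And>q. integrable lborel (\<lambda>y. G y * poly q y)"
    and Gm [measurable]: "G \<in> borel_measurable borel" and hm [measurable]: "h \<in> borel_measurable borel"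
    and supp: "\<And>x. \<rho> < \<bar>x\<bar> \<Longrightarrow> G x = 0"
    and inc: "\<And>x y. ennreal \<bar>G x - G y\<bar> \<le> (\<integral>\<^sup>+s. seg x y s * h s \<partial>lborel)"
    and h: "Lp_le p h c"
  shows "\<exists>R. degree R \<le> 8 * n \<and>
    Lp_le p (\<lambda>x. ennreal \<bar>G x - poly R x\<bar> * indicator {-X..X} x) (4 * (X + \<rho>) / real n * c)"
proof -
  define L where "L = X + \<rho>"
  have L: "0 < L" using X \<rho> by (simp add: L_def)
  obtain k where k: "degree k \<le> 8 * n" "\<And>u. 0 \<le> poly k u"
    and mass: "(\<integral>\<^sup>+u. ennreal (poly k u) * indicator {-L..L} u \<partial>lborel) = 1"
    and moment: "(\<integral>\<^sup>+u. ennreal (\<bar>u\<bar> * poly k u) * indicator {-L..L} u \<partial>lborel) \<le> ennreal (4 * L / real n)"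
    using jackson_kernel_exists[OF n L] by blast
  have [measurable]: "poly k \<in> borel_measurable borel"
    by (auto intro!: borel_measurable_continuous_onI continuous_intros)
  obtain R where R: "degree R \<le> degree k" "\<And>x. poly R x = (\<integral>y. G y * poly k (x - y) \<partial>lborel)"
    using convolution_poly[OF Gint] by blast
  define \<kappa> where "\<kappa> u = indicator {-L..L} u * poly k u" for u
  have [measurable]: "\<kappa> \<in> borel_measurable borel" unfolding \<kappa>_def by measurable
  have \<kappa>0: "0 \<le> \<kappa> u" for u using k(2) by (simp add: \<kappa>_def)
  have \<kappa>e: "ennreal (\<kappa> u) = ennreal (poly k u) * indicator {-L..L} u" for u
    by (simp add: \<kappa>_def split: split_indicator)
  have \<kappa>int: "integrable lborel \<kappa>" "(\<integral>u. \<kappa> u \<partial>lborel) = 1"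
  proof -
    have m: "(\<integral>\<^sup>+u. ennreal (\<kappa> u) \<partial>lborel) = 1" unfolding \<kappa>e by (rule mass)
    then show "integrable lborel \<kappa>" using \<kappa>0 by (intro integrableI_nonneg) auto
    show "(\<integral>u. \<kappa> u \<partial>lborel) = 1" using m \<kappa>0 by (subst integral_eq_nn_integral) auto
  qed
  define K where "K x s = (\<integral>\<^sup>+u. ennreal (\<kappa> u) * seg x (x - u) s \<partial>lborel)" for x s
  have Km: "case_prod K \<in> borel_measurable (borel \<Otimes>\<^sub>M borel)"
    unfolding K_def by measurable
  have mu: "(\<integral>\<^sup>+u. ennreal (\<kappa> u) * ennreal \<bar>u\<bar> \<partial>lborel) \<le> ennreal (4 * L / real n)"
  proof -
    have "(\<integral>\<^sup>+u. ennreal (\<kappa> u) * ennreal \<bar>u\<bar> \<partial>lborel) = (\<integral>\<^sup>+u. ennreal (\<bar>u\<bar> * poly k u) * indicator {-L..L} u \<partial>lborel)"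
      by (intro nn_integral_cong) (simp add: \<kappa>e ennreal_mult' mult_ac)
    then show ?thesis using moment by simp
  qed
  have row: "(\<integral>\<^sup>+s. K x s \<partial>lborel) \<le> ennreal (4 * L / real n)" for x
  proof -
    have "(\<integral>\<^sup>+s. K x s \<partial>lborel) = (\<integral>\<^sup>+u. \<integral>\<^sup>+s. ennreal (\<kappa> u) * seg x (x - u) s \<partial>lborel \<partial>lborel)"
      unfolding K_def by (rule lborel_pair.Fubini') measurable
    also have "\<dots> = (\<integral>\<^sup>+u. ennreal (\<kappa> u) * ennreal \<bar>u\<bar> \<partial>lborel)"
      by (simp add: nn_integral_cmult nn_integral_seg)
    finally show ?thesis using mu by simp
  qed
  have col: "(\<integral>\<^sup>+x. K x s \<partial>lborel) \<le> ennreal (4 * L / real n)" for s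
  proof -
    have "(\<integral>\<^sup>+x. K x s \<partial>lborel) = (\<integral>\<^sup>+u. \<integral>\<^sup>+x. ennreal (\<kappa> u) * seg s (s + u) x \<partial>lborel \<partial>lborel)"
      unfolding K_def seg_shift by (rule lborel_pair.Fubini') measurable
    also have "\<dots> = (\<integral>\<^sup>+u. ennreal (\<kappa> u) * ennreal \<bar>u\<bar> \<partial>lborel)"
      by (simp add: nn_integral_cmult nn_integral_seg)
    finally show ?thesis using mu by simp
  qed
  have A: "0 < 4 * L / real n" using L n by simp
  have main: "Lp_le p (\<lambda>x. \<integral>\<^sup>+s. K x s * h s \<partial>lborel) (4 * L / real n * c)"
    by (rule schur_test[OF Km row col A p c h hm])
  have pw: "ennreal \<bar>G x - poly R x\<bar> * indicator {-X..X} x \<le> (\<integral>\<^sup>+s. K x s * h s \<partial>lborel)" for x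
  proof (cases "x \<in> {-X..X}")
    case True
    have Gk: "integrable lborel (\<lambda>y. G y * poly k (x - y))"
      using Gint[of "pcompose k [:x, -1:]"] by (simp add: poly_pcompose)
    have i1: "integrable lborel (\<lambda>u. G (x - u) * poly k u)"
      using lborel_integrable_real_affine[OF Gk, of "-1" x] by simp
    have e1: "poly R x = (\<integral>u. G (x - u) * poly k u \<partial>lborel)"
      unfolding R(2) by (subst lborel_integral_real_affine[where c="-1" and t=x]) auto
    have "G x - poly R x = (\<integral>u. G x * \<kappa> u \<partial>lborel) - (\<integral>u. G (x - u) * poly k u \<partial>lborel)"
      using \<kappa>int by (simp add: e1)
    also have "\<dots> = (\<integral>u. G x * \<kappa> u - G (x - u) * poly k u \<partial>lborel)"
      using i1 \<kappa>int by (intro Bochner_Integration.integral_diff[symmetric]) auto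
    also have "\<dots> = (\<integral>u. \<kappa> u * (G x - G (x - u)) \<partial>lborel)"
    proof (intro Bochner_Integration.integral_cong refl)
      fix u
      have "G (x - u) = 0" if "u \<notin> {-L..L}"
        by (rule supp) (use that True in \<open>auto simp: L_def\<close>)
      then show "G x * \<kappa> u - G (x - u) * poly k u = \<kappa> u * (G x - G (x - u))"
        by (cases "u \<in> {-L..L}") (auto simp: \<kappa>_def algebra_simps)
    qed
    finally have e2: "G x - poly R x = (\<integral>u. \<kappa> u * (G x - G (x - u)) \<partial>lborel)" .
    have i2: "integrable lborel (\<lambda>u. \<kappa> u * (G x - G (x - u)))"
    proof -
      have "integrable lborel (\<lambda>u. G x * \<kappa> u - G (x - u) * poly k u)" using i1 \<kappa>int by auto
      moreover have "(\<lambda>u. G x * \<kappa> u - G (x - u) * poly k u) = (\<lambda>u. \<kappa> u * (G x - G (x - u)))"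
      proof
        fix u
        have "G (x - u) = 0" if "u \<notin> {-L..L}"
          by (rule supp) (use that True in \<open>auto simp: L_def\<close>)
        then show "G x * \<kappa> u - G (x - u) * poly k u = \<kappa> u * (G x - G (x - u))"
          by (cases "u \<in> {-L..L}") (auto simp: \<kappa>_def algebra_simps)
      qed
      ultimately show ?thesis by simp
    qed
    have "ennreal \<bar>G x - poly R x\<bar> \<le> (\<integral>\<^sup>+u. ennreal (norm (\<kappa> u * (G x - G (x - u)))) \<partial>lborel)"
      unfolding e2 using integral_norm_bound_ennreal[OF i2] by simp
    also have "\<dots> \<le> (\<integral>\<^sup>+u. \<integral>\<^sup>+s. ennreal (\<kappa> u) * (seg x (x - u) s * h s) \<partial>lborel \<partial>lborel)"
    proof (rule nn_integral_mono)
      fix u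
      have "ennreal (norm (\<kappa> u * (G x - G (x - u)))) = ennreal (\<kappa> u) * ennreal \<bar>G x - G (x - u)\<bar>"
        using \<kappa>0[of u] by (simp add: abs_mult ennreal_mult')
      also have "\<dots> \<le> ennreal (\<kappa> u) * (\<integral>\<^sup>+s. seg x (x - u) s * h s \<partial>lborel)"
        by (intro mult_left_mono inc) auto
      also have "\<dots> = (\<integral>\<^sup>+s. ennreal (\<kappa> u) * (seg x (x - u) s * h s) \<partial>lborel)"
        by (rule nn_integral_cmult[symmetric]) measurable
      finally show "ennreal (norm (\<kappa> u * (G x - G (x - u)))) \<le> (\<integral>\<^sup>+s. ennreal (\<kappa> u) * (seg x (x - u) s * h s) \<partial>lborel)" .
    qed
    also have "\<dots> = (\<integral>\<^sup>+s. \<integral>\<^sup>+u. ennreal (\<kappa> u) * (seg x (x - u) s * h s) \<partial>lborel \<partial>lborel)"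
      by (rule lborel_pair.Fubini') measurable
    also have "\<dots> = (\<integral>\<^sup>+s. K x s * h s \<partial>lborel)"
      unfolding K_def by (subst nn_integral_multc[symmetric]) (simp_all add: mult.assoc)
    finally show ?thesis using True by simp
  qed simp
  have "Lp_le p (\<lambda>x. ennreal \<bar>G x - poly R x\<bar> * indicator {-X..X} x) (4 * L / real n * c)"
    by (rule Lp_le_mono[OF main _ p]) (use pw A c mult_nonneg_nonneg[of "4 * L / real n" c] in auto)
  then show ?thesis using R(1) k(1) unfolding L_def by (intro exI[of _ R]) auto
qed

context freud
begin

section \<open>The weighted Jackson estimate\<close>

lemma weight_poly_ge_1: "1 \<le> poly (weight_poly l a m) x"
proof -
  have "wp_coeff l a 0 * \<bar>x\<bar> ^ (2 * wp_idx l 0) \<le> (\<Sum>j\<le>m. wp_coeff l a j * \<bar>x\<bar> ^ (2 * wp_idx l j))"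
    by (rule member_le_sum) (auto intro!: mult_nonneg_nonneg wp_coeff_nonneg[OF l a])
  then show ?thesis by (simp add: poly_weight_poly[OF l a] wp_coeff_def wp_idx_def)
qed

lemma weight_poly_mono: "\<bar>s\<bar> \<le> \<bar>x\<bar> \<Longrightarrow> poly (weight_poly l a m) s \<le> poly (weight_poly l a m) x"
  unfolding poly_weight_poly[OF l a]
  by (intro sum_mono mult_left_mono power_mono wp_coeff_nonneg[OF l a]) auto

definition cutoff :: "real \<Rightarrow> real \<Rightarrow> real" where
  "cutoff A x = max 0 (min 1 (2 - \<bar>x\<bar> / A))"

lemma cutoff:
  assumes A: "1 \<le> A"
  shows "0 \<le> cutoff A x" "cutoff A x \<le> 1" "\<bar>x\<bar> \<le> A \<Longrightarrow> cutoff A x = 1" "2 * A \<le> \<bar>x\<bar> \<Longrightarrow> cutoff A x = 0"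
    "\<bar>cutoff A x - cutoff A y\<bar> \<le> \<bar>x - y\<bar>" "continuous_on S (cutoff A)"
proof -
  show "0 \<le> cutoff A x" "cutoff A x \<le> 1" by (auto simp: cutoff_def)
  show "\<bar>x\<bar> \<le> A \<Longrightarrow> cutoff A x = 1" "2 * A \<le> \<bar>x\<bar> \<Longrightarrow> cutoff A x = 0"
    using A by (auto simp: cutoff_def min_def max_def field_simps)
  have "\<bar>cutoff A x - cutoff A y\<bar> \<le> \<bar>\<bar>x\<bar> / A - \<bar>y\<bar> / A\<bar>"
    unfolding cutoff_def by linarith
  also have "\<dots> = \<bar>\<bar>x\<bar> - \<bar>y\<bar>\<bar> / A" using A by (simp add: diff_divide_distrib[symmetric])
  also have "\<dots> \<le> \<bar>\<bar>x\<bar> - \<bar>y\<bar>\<bar> / 1" using A by (intro divide_left_mono) auto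
  also have "\<dots> \<le> \<bar>x - y\<bar>" by simp
  finally show "\<bar>cutoff A x - cutoff A y\<bar> \<le> \<bar>x - y\<bar>" .
  show "continuous_on S (cutoff A)" unfolding cutoff_def using A by (intro continuous_intros) auto
qed

text \<open>The polynomial \<open>weight_poly l a m\<close> stands in for \<open>1 / w\<close>, so that the weighted function \<open>F w\<close> can be
  approximated without a weight.\<close>

lemma weighted_variation:
  "\<exists>C>0. \<forall>A m F g x y. 1 \<le> A \<longrightarrow> 2 * (a * (2 * A) powr l) + 6 \<le> real m \<longrightarrow> ac_deriv F g \<longrightarrow>
     g \<in> borel_measurable borel \<longrightarrow> F 0 = 0 \<longrightarrow>
     ennreal \<bar>F x * cutoff A x / poly (weight_poly l a m) x - F y * cutoff A y / poly (weight_poly l a m) y\<bar>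
     \<le> (\<integral>\<^sup>+s. seg x y s * (ennreal C * (ennreal \<bar>g s * w s\<bar> + ennreal (\<Omega> s * w s) * total_var g s)) \<partial>lborel)"
proof -
  obtain Cd where Cd: "0 < Cd"
    "\<And>m x. \<bar>poly (pderiv (weight_poly l a m)) x\<bar> \<le> Cd * (1 + \<bar>x\<bar> powr (l - 1)) * exp (a * \<bar>x\<bar> powr l)"
    using weight_poly_deriv[OF l a] by blast
  \<comment> \<open>Gives \<open>1 / S \<le> c1 * w\<close> for \<bar>s\<bar> at most
    \<open>2 * A\<close>, where m is large enough: 16 comes from \<open>weight_poly_lower\<close>, b
    from the normalisation of w.\<close>
  define c1 where "c1 = exp (16 - b)"
  define c2 where "c2 = Cd * exp (32 - b) + c1"
  have c1: "0 < c1" "c1 \<le> c2" and c2: "0 < c2" using Cd by (auto simp: c1_def c2_def add_pos_pos)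
  show ?thesis
  proof (intro exI[of _ c2] conjI c2 allI impI)
    fix A m F g x y
    assume A: "1 \<le> A" and m: "2 * (a * (2 * A) powr l) + 6 \<le> real m" and F: "ac_deriv F g"
      and [measurable]: "g \<in> borel_measurable borel" and F0: "F 0 = 0"
    define S where "S = poly (weight_poly l a m)"
    define G where "G = (\<lambda>x. F x * cutoff A x / S x)"
    define h where "h = (\<lambda>s. ennreal c2 * (ennreal \<bar>g s * w s\<bar> + ennreal (\<Omega> s * w s) * total_var g s))"
    have [measurable]: "h \<in> borel_measurable borel" unfolding h_def by measurable
    have S1: "1 \<le> S x" for x unfolding S_def by (rule weight_poly_ge_1)
    have S0: "0 < S x" for x using S1[of x] by simp
    have Smono: "S s \<le> S x" if "\<bar>s\<bar> \<le> \<bar>x\<bar>" for s x unfolding S_def by (rule weight_poly_mono[OF that])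
    have inv: "1 / S s \<le> c1 * w s" if "\<bar>s\<bar> \<le> 2 * A" for s
    proof -
      have "\<bar>s\<bar> powr l \<le> (2 * A) powr l" using that l by (intro powr_mono2) auto
      then have "2 * (a * \<bar>s\<bar> powr l) + 6 \<le> real m" using m mult_left_mono[of "\<bar>s\<bar> powr l" "(2 * A) powr l" a] a by linarith
      then have "exp (- 16) * exp (a * \<bar>s\<bar> powr l) \<le> S s" unfolding S_def by (rule weight_poly_lower[OF l a])
      then have "1 / S s \<le> 1 / (exp (- 16) * exp (a * \<bar>s\<bar> powr l))"
        using S0 by (intro divide_left_mono mult_pos_pos) auto
      also have "\<dots> = c1 * w s" by (simp add: c1_def freud_weight_def exp_add[symmetric] exp_diff exp_minus field_simps)
      finally show ?thesis .
    qed
    \<comment> \<open>The derivative of S costs \<open>\<Omega> / w\<close> and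
      \<open>1 / S\<^sup>2\<close> gives \<open>w\<^sup>2\<close>, up to constants.\<close>
    have dinv: "\<bar>- (poly (pderiv (weight_poly l a m)) s) / (S s)\<^sup>2\<bar> \<le> Cd * exp (32 - b) * (\<Omega> s * w s)" if "\<bar>s\<bar> \<le> 2 * A" for s
    proof -
      have "\<bar>- (poly (pderiv (weight_poly l a m)) s) / (S s)\<^sup>2\<bar> = \<bar>poly (pderiv (weight_poly l a m)) s\<bar> * (1 / S s)\<^sup>2"
        by (simp add: power_divide)
      also have "\<dots> \<le> (Cd * \<Omega> s * exp (a * \<bar>s\<bar> powr l)) * (c1 * w s)\<^sup>2"
        using Cd(2)[of m s] inv[OF that] S0[of s] Cd(1) \<Omega>_ge_1[of s]
        by (intro mult_mono power_mono) (auto simp: \<Omega>_def)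
      also have "\<dots> = Cd * exp (32 - b) * (\<Omega> s * w s)"
      proof -
        have "exp (a * \<bar>s\<bar> powr l) * (c1 * w s)\<^sup>2 = exp (32 - b) * w s"
          by (simp add: c1_def freud_weight_def power2_eq_square mult_exp_exp algebra_simps)
        then show ?thesis by (simp add: mult_ac)
      qed
      finally show ?thesis .
    qed
    have acS: "ac_deriv (\<lambda>x. 1 / S x) (\<lambda>x. - (poly (pderiv (weight_poly l a m)) x) / (S x)\<^sup>2)"
    proof (rule ac_deriv_C1)
      fix x
      show "((\<lambda>x. 1 / S x) has_field_derivative - (poly (pderiv (weight_poly l a m)) x) / (S x)\<^sup>2) (at x)"
        unfolding S_def using S0[of x] S_def
        by (auto intro!: derivative_eq_intros simp: power2_eq_square)
      have "\<And>x. S x \<noteq> 0" using S0 by (metis less_irrefl)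
      then show "continuous_on UNIV (\<lambda>x. - poly (pderiv (weight_poly l a m)) x / (S x)\<^sup>2)"
        unfolding S_def by (intro continuous_intros) auto
    qed
    have TV: "ennreal \<bar>F z\<bar> \<le> total_var g z" for z
      using ac_deriv_bound[OF F, of 0 z] F0 by (simp add: total_var_def)
    have TVmono: "total_var g z \<le> total_var g s" if "min 0 s \<le> z" "z \<le> max 0 s" for z s
      unfolding total_var_def
      by (intro nn_integral_mono mult_right_mono) (use that in \<open>auto simp: seg_def min_def max_def split: if_splits\<close>)
    \<comment> \<open>Here y lies between 0 and x. The product rule is arranged so that \<phi>
      multiplies the increment of F at the outer point x, where \<open>1 / S\<close> is smallest,
      and F stands at the inner point y, where \<open>total_var\<close> is smallest; both factors
      can then be moved to any s in between.\<close>
    have step1: "ennreal \<bar>G x - G y\<bar> \<le> (\<integral>\<^sup>+s. seg x y s * h s \<partial>lborel)"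
      if y: "min 0 x \<le> y" "y \<le> max 0 x" and x: "\<bar>x\<bar> \<le> 2 * A" for x y
    proof -
      have yx: "\<bar>y\<bar> \<le> \<bar>x\<bar>" using y by (auto simp: min_def max_def split: if_splits)
      have sx: "\<bar>s\<bar> \<le> \<bar>x\<bar>" "\<bar>y\<bar> \<le> \<bar>s\<bar>" "min 0 s \<le> y" "y \<le> max 0 s"
        if "min x y \<le> s" "s \<le> max x y" for s
        using that y by (auto simp: min_def max_def split: if_splits)
      define \<phi> where "\<phi> z = cutoff A z / S z" for z
      have \<phi>x: "0 \<le> \<phi> x" "\<phi> x \<le> 1 / S x" using S0[of x] cutoff(1,2)[OF A] by (auto simp: \<phi>_def divide_right_mono)
      have e: "G x - G y = (F x - F y) * \<phi> x + F y * (\<phi> x - \<phi> y)" by (simp add: G_def \<phi>_def diff_divide_distrib algebra_simps)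
      have p1: "ennreal (\<bar>F x - F y\<bar> * \<phi> x) \<le> (\<integral>\<^sup>+s. seg x y s * ennreal (c1 * \<bar>g s * w s\<bar>) \<partial>lborel)"
      proof -
        have "ennreal (\<bar>F x - F y\<bar> * \<phi> x) = ennreal (\<phi> x) * ennreal \<bar>F x - F y\<bar>"
          using \<phi>x by (simp add: ennreal_mult' mult.commute)
        also have "\<dots> \<le> ennreal (\<phi> x) * (\<integral>\<^sup>+s. seg x y s * ennreal \<bar>g s\<bar> \<partial>lborel)"
          by (intro mult_left_mono ac_deriv_bound[OF F]) auto
        also have "\<dots> = (\<integral>\<^sup>+s. ennreal (\<phi> x) * (seg x y s * ennreal \<bar>g s\<bar>) \<partial>lborel)"
          by (rule nn_integral_cmult[symmetric]) measurable
        also have "\<dots> \<le> (\<integral>\<^sup>+s. seg x y s * ennreal (c1 * \<bar>g s * w s\<bar>) \<partial>lborel)"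
        proof (rule nn_integral_mono)
          fix s
          show "ennreal (\<phi> x) * (seg x y s * ennreal \<bar>g s\<bar>) \<le> seg x y s * ennreal (c1 * \<bar>g s * w s\<bar>)"
          proof (cases "min x y \<le> s \<and> s \<le> max x y")
            case True
            then have s: "\<bar>s\<bar> \<le> \<bar>x\<bar>" using sx by blast
            have "1 / S x \<le> 1 / S s" using Smono[OF s] S0 by (intro divide_left_mono mult_pos_pos) auto
            then have "\<phi> x \<le> c1 * w s" using \<phi>x inv[of s] s x by linarith
            then have "\<phi> x * \<bar>g s\<bar> \<le> (c1 * w s) * \<bar>g s\<bar>" by (intro mult_right_mono) auto
            then have "ennreal (\<phi> x * \<bar>g s\<bar>) \<le> ennreal (c1 * \<bar>g s * w s\<bar>)"
              using w_pos[of s] by (intro ennreal_leI) (simp add: abs_mult mult_ac)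
            then show ?thesis using True \<phi>x by (simp add: seg_def ennreal_mult')
          qed (auto simp: seg_def)
        qed
        finally show ?thesis .
      qed
      have p2: "ennreal \<bar>\<phi> x - \<phi> y\<bar> \<le> (\<integral>\<^sup>+s. seg x y s * ennreal (c2 * (\<Omega> s * w s)) \<partial>lborel)"
      proof -
        have "\<phi> x - \<phi> y = cutoff A y * (1 / S x - 1 / S y) + (cutoff A x - cutoff A y) * (1 / S x)"
          using S0[of x] S0[of y] by (simp add: \<phi>_def field_simps)
        then have "\<bar>\<phi> x - \<phi> y\<bar> \<le> \<bar>cutoff A y\<bar> * \<bar>1 / S x - 1 / S y\<bar> + \<bar>cutoff A x - cutoff A y\<bar> * \<bar>1 / S x\<bar>"
          by (metis abs_mult abs_triangle_ineq)
        also have "\<dots> \<le> 1 * \<bar>1 / S x - 1 / S y\<bar> + \<bar>x - y\<bar> * (1 / S x)"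
          using cutoff(1,2,5)[OF A] S0[of x] by (intro add_mono mult_mono) auto
        finally have "ennreal \<bar>\<phi> x - \<phi> y\<bar> \<le> ennreal (\<bar>1 / S x - 1 / S y\<bar> + \<bar>x - y\<bar> * (1 / S x))"
          by (intro ennreal_leI) simp
        also have "\<dots> = ennreal \<bar>1 / S x - 1 / S y\<bar> + ennreal (1 / S x) * ennreal \<bar>x - y\<bar>"
          using S0[of x] by (simp only: ennreal_mult'[OF abs_ge_zero] ennreal_plus abs_ge_zero divide_nonneg_pos zero_le_one mult_nonneg_nonneg less_imp_le mult.commute)
        also have "\<dots> \<le> (\<integral>\<^sup>+s. seg x y s * ennreal \<bar>- (poly (pderiv (weight_poly l a m)) s) / (S s)\<^sup>2\<bar> \<partial>lborel)
            + ennreal (1 / S x) * (\<integral>\<^sup>+s. seg x y s \<partial>lborel)"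
          unfolding nn_integral_seg by (intro add_mono ac_deriv_bound[OF acS]) auto
        also have "\<dots> = (\<integral>\<^sup>+s. seg x y s * ennreal \<bar>- (poly (pderiv (weight_poly l a m)) s) / (S s)\<^sup>2\<bar> + ennreal (1 / S x) * seg x y s \<partial>lborel)"
          unfolding S_def by (subst nn_integral_add) (auto simp: nn_integral_cmult)
        also have "\<dots> \<le> (\<integral>\<^sup>+s. seg x y s * ennreal (c2 * (\<Omega> s * w s)) \<partial>lborel)"
        proof (rule nn_integral_mono)
          fix s
          show "seg x y s * ennreal \<bar>- (poly (pderiv (weight_poly l a m)) s) / (S s)\<^sup>2\<bar> + ennreal (1 / S x) * seg x y s
              \<le> seg x y s * ennreal (c2 * (\<Omega> s * w s))"
          proof (cases "min x y \<le> s \<and> s \<le> max x y")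
            case True
            then have s: "\<bar>s\<bar> \<le> \<bar>x\<bar>" using sx by blast
            have "1 / S x \<le> 1 / S s" using Smono[OF s] S0 by (intro divide_left_mono mult_pos_pos) auto
            also have "\<dots> \<le> c1 * w s" using inv[of s] s x by linarith
            also have "\<dots> \<le> c1 * (\<Omega> s * w s)" using c1 \<Omega>_ge_1[of s] w_pos[of s] by (intro mult_left_mono) (auto simp: mult_le_cancel_right1)
            finally have "\<bar>- (poly (pderiv (weight_poly l a m)) s) / (S s)\<^sup>2\<bar> + 1 / S x \<le> c2 * (\<Omega> s * w s)"
              using dinv[of s] s x unfolding c2_def distrib_right by linarith
            then have "ennreal (\<bar>- (poly (pderiv (weight_poly l a m)) s) / (S s)\<^sup>2\<bar> + 1 / S x) \<le> ennreal (c2 * (\<Omega> s * w s))"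
              by (rule ennreal_leI)
            then show ?thesis using True S0[of x] by (simp add: seg_def)
          qed (auto simp: seg_def)
        qed
        finally show ?thesis .
      qed
      have "ennreal \<bar>G x - G y\<bar> \<le> ennreal (\<bar>F x - F y\<bar> * \<phi> x + \<bar>F y\<bar> * \<bar>\<phi> x - \<phi> y\<bar>)"
        unfolding e using \<phi>x by (intro ennreal_leI order_trans[OF abs_triangle_ineq]) (simp add: abs_mult)
      also have "\<dots> = ennreal (\<bar>F x - F y\<bar> * \<phi> x) + ennreal \<bar>F y\<bar> * ennreal \<bar>\<phi> x - \<phi> y\<bar>"
        using \<phi>x by (simp add: ennreal_mult')
      also have "\<dots> \<le> (\<integral>\<^sup>+s. seg x y s * ennreal (c1 * \<bar>g s * w s\<bar>) \<partial>lborel)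
          + total_var g y * (\<integral>\<^sup>+s. seg x y s * ennreal (c2 * (\<Omega> s * w s)) \<partial>lborel)"
        by (intro add_mono p1 mult_mono TV p2) auto
      also have "\<dots> = (\<integral>\<^sup>+s. seg x y s * ennreal (c1 * \<bar>g s * w s\<bar>) + total_var g y * (seg x y s * ennreal (c2 * (\<Omega> s * w s))) \<partial>lborel)"
        by (subst nn_integral_add) (auto simp: nn_integral_cmult)
      also have "\<dots> \<le> (\<integral>\<^sup>+s. seg x y s * h s \<partial>lborel)"
      proof (rule nn_integral_mono)
        fix s
        show "seg x y s * ennreal (c1 * \<bar>g s * w s\<bar>) + total_var g y * (seg x y s * ennreal (c2 * (\<Omega> s * w s))) \<le> seg x y s * h s"
        proof (cases "min x y \<le> s \<and> s \<le> max x y")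
          case True
          then have tv: "total_var g y \<le> total_var g s" using TVmono sx by blast
          have "ennreal (c1 * \<bar>g s * w s\<bar>) \<le> ennreal (c2 * \<bar>g s * w s\<bar>)"
            using c1 by (intro ennreal_leI mult_right_mono) auto
          then have "ennreal (c1 * \<bar>g s * w s\<bar>) + total_var g y * ennreal (c2 * (\<Omega> s * w s))
              \<le> ennreal (c2 * \<bar>g s * w s\<bar>) + total_var g s * ennreal (c2 * (\<Omega> s * w s))"
            using tv by (intro add_mono mult_right_mono) auto
          also have "\<dots> = h s" using c2 by (simp add: h_def distrib_left ennreal_mult' mult_ac)
          finally show ?thesis using True by (simp add: seg_def)
        qed (auto simp: seg_def)
      qed
      finally show ?thesis .
    qed
    have G0: "G z = 0" if "2 * A \<le> \<bar>z\<bar>" for z using cutoff(4)[OF A that] by (simp add: G_def)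
    \<comment> \<open>Beyond \<open>2 * A\<close> the quotient vanishes, so x may be replaced by the
      end point z on its side.\<close>
    have step2: "ennreal \<bar>G x - G y\<bar> \<le> (\<integral>\<^sup>+s. seg x y s * h s \<partial>lborel)"
      if y: "min 0 x \<le> y" "y \<le> max 0 x" for x y
    proof (cases "\<bar>x\<bar> \<le> 2 * A")
      case True
      then show ?thesis using step1[OF y] by blast
    next
      case x: False
      show ?thesis
      proof (cases "2 * A \<le> \<bar>y\<bar>")
        case True
        then show ?thesis using G0[of x] G0[of y] x by simp
      next
        case False
        define z where "z = (if 0 \<le> x then 2 * A else - (2 * A))"
        have z: "\<bar>z\<bar> = 2 * A" "G z = 0" using A G0[of z] by (auto simp: z_def)
        have "ennreal \<bar>G x - G y\<bar> = ennreal \<bar>G z - G y\<bar>" using z G0[of x] x by simp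
        also have "\<dots> \<le> (\<integral>\<^sup>+s. seg z y s * h s \<partial>lborel)"
          by (rule step1) (use y False z A in \<open>auto simp: z_def min_def max_def split: if_splits\<close>)
        also have "\<dots> \<le> (\<integral>\<^sup>+s. seg x y s * h s \<partial>lborel)"
          by (intro nn_integral_mono mult_right_mono)
             (use x False y A in \<open>auto simp: seg_def z_def min_def max_def split: if_splits\<close>)
        finally show ?thesis .
      qed
    qed
    have "ennreal \<bar>G x - G y\<bar> \<le> (\<integral>\<^sup>+s. seg x y s * h s \<partial>lborel)"
    proof -
      \<comment> \<open>Points on opposite sides of 0 are joined through 0; the two segments overlap
        only in a null set.\<close>
      consider "min 0 x \<le> y" "y \<le> max 0 x" | "min 0 y \<le> x" "x \<le> max 0 y" | "min x y < 0" "0 < max x y" "min x y \<le> 0"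
        by (cases "x = 0"; cases "y = 0"; cases "0 \<le> x"; cases "0 \<le> y"; cases "x \<le> y") (auto simp: min_def max_def)
      then show ?thesis
      proof cases
        case 1
        then show ?thesis by (rule step2)
      next
        case 2
        from step2[OF 2] show ?thesis by (simp add: seg_commute abs_minus_commute)
      next
        case 3
        have z1: "ennreal \<bar>G x - G 0\<bar> \<le> (\<integral>\<^sup>+s. seg x 0 s * h s \<partial>lborel)" by (rule step2) auto
        have z2: "ennreal \<bar>G y - G 0\<bar> \<le> (\<integral>\<^sup>+s. seg y 0 s * h s \<partial>lborel)" by (rule step2) auto
        have "ennreal \<bar>G x - G y\<bar> \<le> ennreal (\<bar>G x - G 0\<bar> + \<bar>G y - G 0\<bar>)" by (intro ennreal_leI) simp
        also have "\<dots> = ennreal \<bar>G x - G 0\<bar> + ennreal \<bar>G y - G 0\<bar>" by simp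
        also have "\<dots> \<le> (\<integral>\<^sup>+s. seg x 0 s * h s \<partial>lborel) + (\<integral>\<^sup>+s. seg y 0 s * h s \<partial>lborel)"
          by (rule add_mono[OF z1 z2])
        also have "\<dots> = (\<integral>\<^sup>+s. seg x 0 s * h s + seg y 0 s * h s \<partial>lborel)"
          by (subst nn_integral_add) auto
        also have "\<dots> \<le> (\<integral>\<^sup>+s. seg x y s * h s \<partial>lborel)"
        proof (rule nn_integral_mono_AE)
          have "AE s in lborel. s \<noteq> (0::real)" by (rule AE_lborel_singleton)
          then show "AE s in lborel. seg x 0 s * h s + seg y 0 s * h s \<le> seg x y s * h s"
            by eventually_elim (use 3 in \<open>auto simp: seg_def min_def max_def split: if_splits\<close>)
        qed
        finally show ?thesis .
      qed
    qed
    then show "ennreal \<bar>F x * cutoff A x / poly (weight_poly l a m) x - F y * cutoff A y / poly (weight_poly l a m) y\<bar>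
     \<le> (\<integral>\<^sup>+s. seg x y s * (ennreal c2 * (ennreal \<bar>g s * w s\<bar> + ennreal (\<Omega> s * w s) * total_var g s)) \<partial>lborel)"
      unfolding G_def S_def h_def .
  qed
qed


lemma hardy_ac:
  "\<exists>C>0. \<forall>p\<ge>1. \<forall>F g c. ac_deriv F g \<longrightarrow> g \<in> borel_measurable borel \<longrightarrow> F 0 = 0 \<longrightarrow> 0 \<le> c \<longrightarrow>
     Lp_le p (\<lambda>x. ennreal \<bar>g x * w x\<bar>) c \<longrightarrow> Lp_le p (\<lambda>x. ennreal (\<Omega> x * \<bar>F x * w x\<bar>)) (C * c)"
proof -
  obtain C where C: "0 < C" "\<And>p g c. 1 \<le> p \<Longrightarrow> g \<in> borel_measurable borel \<Longrightarrow> 0 \<le> c \<Longrightarrow>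
     Lp_le p (\<lambda>x. ennreal \<bar>g x * w x\<bar>) c \<Longrightarrow> Lp_le p (\<lambda>x. ennreal (\<Omega> x * w x) * total_var g x) (C * c)"
    using hardy by blast
  show ?thesis
  proof (intro exI[of _ C] conjI C(1) allI impI)
    fix p F g c
    assume p: "1 \<le> p" and F: "ac_deriv F g" and g: "g \<in> borel_measurable borel" and F0: "F 0 = 0" and c: "0 \<le> c"
      and Lp: "Lp_le p (\<lambda>x. ennreal \<bar>g x * w x\<bar>) c"
    show "Lp_le p (\<lambda>x. ennreal (\<Omega> x * \<bar>F x * w x\<bar>)) (C * c)"
    proof (rule Lp_le_mono[OF C(2)[OF p g c Lp] _ p])
      have "ennreal (\<Omega> x * \<bar>F x * w x\<bar>) \<le> ennreal (\<Omega> x * w x) * total_var g x" for x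
      proof -
        have "ennreal (\<Omega> x * \<bar>F x * w x\<bar>) = ennreal (\<Omega> x * w x) * ennreal \<bar>F x\<bar>"
          using \<Omega>_ge_1[of x] w_pos[of x] by (subst ennreal_mult'[symmetric]) (simp_all add: abs_mult mult_ac)
        also have "\<dots> \<le> ennreal (\<Omega> x * w x) * total_var g x"
          using ac_deriv_bound[OF F, of 0 x] F0 by (intro mult_left_mono) (auto simp: total_var_def)
        finally show ?thesis .
      qed
      then show "AE x in lborel. ennreal (\<Omega> x * \<bar>F x * w x\<bar>) \<le> ennreal (\<Omega> x * w x) * total_var g x" by simp
    qed (use C(1) c in auto)
  qed
qed

lemma cutoff_quotient_integrable:
  assumes A: "1 \<le> A" and F: "continuous_on UNIV F"
  shows "integrable lborel (\<lambda>y. F y * cutoff A y / poly (weight_poly l a m) y * poly q y)"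
proof -
  have ne: "poly (weight_poly l a m) y \<noteq> 0" for y using weight_poly_ge_1[of m y] by linarith
  have "continuous_on {- (2 * A)..2 * A} F" by (rule continuous_on_subset[OF F]) simp
  then have "set_integrable lborel {- (2 * A)..2 * A} (\<lambda>y. F y * cutoff A y / poly (weight_poly l a m) y * poly q y)"
    using ne by (intro borel_integrable_atLeastAtMost' continuous_intros cutoff(6)[OF A]) auto
  moreover have "(\<lambda>y. indicator {- (2 * A)..2 * A} y *\<^sub>R (F y * cutoff A y / poly (weight_poly l a m) y * poly q y))
      = (\<lambda>y. F y * cutoff A y / poly (weight_poly l a m) y * poly q y)"
  proof
    fix y
    show "indicator {- (2 * A)..2 * A} y *\<^sub>R (F y * cutoff A y / poly (weight_poly l a m) y * poly q y)
      = F y * cutoff A y / poly (weight_poly l a m) y * poly q y"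
    proof (cases "y \<in> {- (2 * A)..2 * A}")
      case False
      then have "2 * A \<le> \<bar>y\<bar>" by auto
      then show ?thesis by (simp add: cutoff(4)[OF A])
    qed simp
  qed
  ultimately show ?thesis unfolding set_integrable_def by simp
qed

text \<open>Hardy's inequality bounds the majorant of \<open>weighted_variation\<close> in
  \<open>L\<^sub>p\<close>, so \<open>jackson_smoothing\<close> applies to the quotient, whose
  support has radius \<open>2 * A\<close>.\<close>

lemma jackson_truncated:
  "\<exists>C>0. \<forall>n\<ge>1. \<forall>p\<ge>1. \<forall>A m F g c X. 1 \<le> A \<longrightarrow> 2 * (a * (2 * A) powr l) + 6 \<le> real m \<longrightarrow> ac_deriv F g \<longrightarrow>
     g \<in> borel_measurable borel \<longrightarrow> F 0 = 0 \<longrightarrow> 0 < c \<longrightarrow> Lp_le p (\<lambda>x. ennreal \<bar>g x * w x\<bar>) c \<longrightarrow> 0 \<le> X \<longrightarrow>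
     (\<exists>R. degree R \<le> 8 * n \<and>
       Lp_le p (\<lambda>x. ennreal \<bar>F x * cutoff A x / poly (weight_poly l a m) x - poly R x\<bar> * indicator {-X..X} x)
         (C * (X + 2 * A) / real n * c))"
proof -
  obtain CH where CH: "0 < CH" "\<And>p g c. 1 \<le> p \<Longrightarrow> g \<in> borel_measurable borel \<Longrightarrow> 0 \<le> c \<Longrightarrow>
     Lp_le p (\<lambda>x. ennreal \<bar>g x * w x\<bar>) c \<Longrightarrow> Lp_le p (\<lambda>x. ennreal (\<Omega> x * w x) * total_var g x) (CH * c)"
    using hardy by blast
  obtain C2 where C2: "0 < C2"
    and var: "\<And>A m F g x y. 1 \<le> A \<Longrightarrow> 2 * (a * (2 * A) powr l) + 6 \<le> real m \<Longrightarrow> ac_deriv F g \<Longrightarrow>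
     g \<in> borel_measurable borel \<Longrightarrow> F 0 = 0 \<Longrightarrow>
     ennreal \<bar>F x * cutoff A x / poly (weight_poly l a m) x - F y * cutoff A y / poly (weight_poly l a m) y\<bar>
     \<le> (\<integral>\<^sup>+s. seg x y s * (ennreal C2 * (ennreal \<bar>g s * w s\<bar> + ennreal (\<Omega> s * w s) * total_var g s)) \<partial>lborel)"
    using weighted_variation by blast
  define C where "C = 4 * (C2 * (1 + CH))"
  have C: "0 < C" using CH(1) C2 by (simp add: C_def add_pos_pos)
  show ?thesis
  proof (intro exI[of _ C] conjI C allI impI)
    fix n :: nat and p and A :: real and m :: nat and F g and c X :: real
    assume n: "1 \<le> n" and p: "1 \<le> p" and A: "1 \<le> A" and m: "2 * (a * (2 * A) powr l) + 6 \<le> real m" and F: "ac_deriv F g"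
      and g [measurable]: "g \<in> borel_measurable borel" and F0: "F 0 = 0" and c: "0 < c"
      and Lp: "Lp_le p (\<lambda>x. ennreal \<bar>g x * w x\<bar>) c" and X: "0 \<le> X"
    define h where "h = (\<lambda>s. ennreal C2 * (ennreal \<bar>g s * w s\<bar> + ennreal (\<Omega> s * w s) * total_var g s))"
    define G where "G = (\<lambda>x. F x * cutoff A x / poly (weight_poly l a m) x)"
    have [measurable]: "F \<in> borel_measurable borel" by (rule ac_deriv_measurable[OF F])
    have [measurable]: "cutoff A \<in> borel_measurable borel" unfolding cutoff_def by measurable
    have "Lp_le p h (C2 * (c + CH * c))" unfolding h_def
    proof (rule Lp_le_cmult[OF _ C2 _ p])
      show "Lp_le p (\<lambda>s. ennreal \<bar>g s * w s\<bar> + ennreal (\<Omega> s * w s) * total_var g s) (c + CH * c)"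
        by (rule Lp_le_add[OF Lp CH(2)[OF p g _ Lp] p c]) (use c CH(1) in auto)
    qed (use c CH(1) in auto)
    then have h: "Lp_le p h (C2 * (1 + CH) * c)" by (simp add: algebra_simps)
    have "\<exists>R. degree R \<le> 8 * n \<and> Lp_le p (\<lambda>x. ennreal \<bar>G x - poly R x\<bar> * indicator {-X..X} x)
        (4 * (X + 2 * A) / real n * (C2 * (1 + CH) * c))"
    proof (rule jackson_smoothing[OF n X _ p _ _ _ _ _ _ h])
      show "0 < 2 * A" using A by simp
      show "0 \<le> C2 * (1 + CH) * c" using C2 CH(1) c by simp
      show "integrable lborel (\<lambda>y. G y * poly q y)" for q
        unfolding G_def by (rule cutoff_quotient_integrable[OF A ac_deriv_continuous[OF F]])
      show "G \<in> borel_measurable borel" unfolding G_def by measurable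
      show "h \<in> borel_measurable borel" unfolding h_def by measurable
      show "G x = 0" if "2 * A < \<bar>x\<bar>" for x using that cutoff(4)[OF A, of x] by (simp add: G_def)
      show "ennreal \<bar>G x - G y\<bar> \<le> (\<integral>\<^sup>+s. seg x y s * h s \<partial>lborel)" for x y
        unfolding G_def h_def by (rule var[OF A m F g F0])
    qed
    moreover have "4 * (X + 2 * A) / real n * (C2 * (1 + CH) * c) = C * (X + 2 * A) / real n * c"
      by (simp add: C_def)
    ultimately show "\<exists>R. degree R \<le> 8 * n \<and>
       Lp_le p (\<lambda>x. ennreal \<bar>F x * cutoff A x / poly (weight_poly l a m) x - poly R x\<bar> * indicator {-X..X} x)
         (C * (X + 2 * A) / real n * c)" by (simp only: G_def)
  qed
qed

text \<open>The approximant is \<open>Q = S * R0\<close>. For \<bar>x\<bar> \<le> X the bound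
  \<open>S * w \<le> 9 * exp b\<close> returns to the weighted norm; where the cutoff differs from
  1, \<Omega> is at least \<open>n powr \<beta>\<close> and Hardy's inequality gives the rate; for
  larger \<bar>x\<bar> the restricted range inequality controls Q.\<close>

lemma jackson_centered:
  "\<exists>C K. 0 < C \<and> 1 \<le> K \<and> (\<forall>n\<ge>1. \<forall>p\<ge>1. \<forall>F g c. ac_deriv F g \<longrightarrow> g \<in> borel_measurable borel \<longrightarrow> F 0 = 0 \<longrightarrow> 0 < c \<longrightarrow>
     Lp_le p (\<lambda>x. ennreal \<bar>g x * w x\<bar>) c \<longrightarrow>
     (\<exists>R. degree R \<le> K * n \<and> Lp_le p (\<lambda>x. ennreal \<bar>(F x - poly R x) * w x\<bar>) (C * real n powr (- \<beta>) * c)))"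
proof -
  obtain CH where CH: "0 < CH" and hardyF: "\<And>p F g c. 1 \<le> p \<Longrightarrow> ac_deriv F g \<Longrightarrow> g \<in> borel_measurable borel \<Longrightarrow> F 0 = 0 \<Longrightarrow> 0 \<le> c \<Longrightarrow>
     Lp_le p (\<lambda>x. ennreal \<bar>g x * w x\<bar>) c \<Longrightarrow> Lp_le p (\<lambda>x. ennreal (\<Omega> x * \<bar>F x * w x\<bar>)) (CH * c)"
    using hardy_ac by blast
  obtain C1 where C1_trunc: "0 < C1 \<and> (\<forall>n\<ge>1. \<forall>p\<ge>1. \<forall>A m F g c X. 1 \<le> A \<longrightarrow> 2 * (a * (2 * A) powr l) + 6 \<le> real m \<longrightarrow>
     ac_deriv F g \<longrightarrow> g \<in> borel_measurable borel \<longrightarrow> F 0 = 0 \<longrightarrow> 0 < c \<longrightarrow> Lp_le p (\<lambda>x. ennreal \<bar>g x * w x\<bar>) c \<longrightarrow> 0 \<le> X \<longrightarrow>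
     (\<exists>R. degree R \<le> 8 * n \<and>
       Lp_le p (\<lambda>x. ennreal \<bar>F x * cutoff A x / poly (weight_poly l a m) x - poly R x\<bar> * indicator {-X..X} x)
         (C1 * (X + 2 * A) / real n * c)))"
    using jackson_truncated ..
  note C1 = C1_trunc[THEN conjunct1] and trunc = C1_trunc[THEN conjunct2, rule_format]
  obtain B \<kappa> where "range_const B \<kappa>" using restricted_range by blast
  note B = range_constD(1,2)[OF this] and RR = range_constD(3)[OF this]
  obtain D where D: "0 < D" "\<And>p. 1 \<le> p \<Longrightarrow> Lp_le p (\<lambda>x. ennreal (exp (- \<kappa> * \<bar>x\<bar> powr l))) D"
    using Lp_le_exp_decay[OF B(2)] by blast
  \<comment> \<open>So that \<open>2 * (a * (2 * A) powr l) = d * n\<close> for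
    \<open>A = width n\<close>.\<close>
  define d where "d = 2 * a * 2 powr l"
  have d: "0 < d" using a by (simp add: d_def)
  \<comment> \<open>The substitute S has degree at most \<open>l * m\<close> with
    \<open>m \<le> (d + 7) * n\<close>, and R0 at most \<open>8 * n\<close>.\<close>
  define K where "K = nat \<lceil>l * (d + 7)\<rceil> + 8"
  have K: "1 \<le> K" "l * (d + 7) + 8 \<le> real K" by (auto simp: K_def) linarith
  define Ca where "Ca = 9 * exp b * (C1 * (B * real K powr (1 / l) + 2))"
  have Ca: "0 < Ca" using C1 B(1) by (simp add: Ca_def add_nonneg_pos)
  define Ce where "Ce = 2 * (CH + Ca) * D / \<kappa>"
  have Ce: "0 < Ce" using Ca CH D(1) B(2) by (simp add: Ce_def add_pos_pos)
  define C where "C = Ca + CH + Ce"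
  have C: "0 < C" using Ca CH Ce by (simp add: C_def add_pos_pos)
  show ?thesis
  proof (rule exI[of _ C], rule exI[of _ K], intro conjI C K(1) allI impI)
    fix n :: nat and p F g c
    assume n: "1 \<le> n" and p: "1 \<le> p" and F: "ac_deriv F g" and g: "g \<in> borel_measurable borel" and F0: "F 0 = 0"
      and c: "0 < c" and Lp: "Lp_le p (\<lambda>x. ennreal \<bar>g x * w x\<bar>) c"
    have [measurable]: "F \<in> borel_measurable borel" by (rule ac_deriv_measurable[OF F])
    define A where "A = width n"
    have A: "1 \<le> A" "A powr l = real n" using width[OF n] by (auto simp: A_def)
    have [measurable]: "cutoff A \<in> borel_measurable borel" unfolding cutoff_def by measurable
    define m where "m = nat \<lceil>d * real n\<rceil> + 6"
    have m0: "d * real n + 6 \<le> real m" by (simp add: m_def) linarith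
    have "real m \<le> d * real n + 7" using d by (simp add: m_def) linarith
    also have "\<dots> \<le> d * real n + 7 * real n" using n by simp
    finally have m1: "real m \<le> (d + 7) * real n" by (simp add: algebra_simps)
    have m: "2 * (a * (2 * A) powr l) + 6 \<le> real m"
      using m0 A by (simp add: d_def powr_mult mult_ac)
    define S where "S = poly (weight_poly l a m)"
    define n1 where "n1 = K * n"
    have n1: "1 \<le> n1" "n \<le> n1" using K(1) n by (auto simp: n1_def)
    \<comment> \<open>The interval must fit the degree bound \<open>K * n\<close> of Q. This is not
      circular, because the degree of R0 does not depend on X.\<close>
    define X where "X = B * width n1"
    have wn1: "width n1 = real K powr (1 / l) * A" by (simp add: n1_def width_def A_def powr_mult)
    have "1 * width n1 \<le> X" unfolding X_def using B(1) width(3)[OF n1(1)] by (intro mult_right_mono) auto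
    then have X: "width n1 \<le> X" "A \<le> X" "0 \<le> X" using width(4)[OF n1(2)] A by (auto simp: A_def)
    define e where "e = real n powr (- \<beta>)"
    have e: "0 < e" "e \<le> 1" using n \<beta> powr_mono[of "- \<beta>" 0 "real n"] by (auto simp: e_def)
    have "real n powr (- \<beta>) = real n powr (1 / l) / real n powr 1"
      using n by (simp add: \<beta>_def powr_diff)
    then have An: "A / real n = e" by (simp add: e_def A_def width_def)
    obtain R0 where R0: "degree R0 \<le> 8 * n"
      and "Lp_le p (\<lambda>x. ennreal \<bar>F x * cutoff A x / S x - poly R0 x\<bar> * indicator {-X..X} x)
         (C1 * (X + 2 * A) / real n * c)"
      using trunc[OF n p A(1) m F g F0 c Lp X(3)] unfolding S_def by blast
    moreover have "C1 * (X + 2 * A) / real n * c = C1 * (B * real K powr (1 / l) + 2) * (A / real n) * c"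
      by (simp add: X_def wn1 algebra_simps add_divide_distrib)
    ultimately have t0: "Lp_le p (\<lambda>x. ennreal \<bar>F x * cutoff A x / S x - poly R0 x\<bar> * indicator {-X..X} x)
         (C1 * (B * real K powr (1 / l) + 2) * e * c)" by (simp only: An)
    define u where "u x = ennreal (9 * exp b) * (ennreal \<bar>F x * cutoff A x / S x - poly R0 x\<bar> * indicator {-X..X} x)" for x
    define v where "v x = ennreal (\<Omega> x * \<bar>F x * w x\<bar>)" for x
    have [measurable]: "u \<in> borel_measurable borel" "v \<in> borel_measurable borel"
      unfolding u_def v_def S_def by measurable
    have "Lp_le p u (9 * exp b * (C1 * (B * real K powr (1 / l) + 2) * e * c))"
      unfolding u_def by (rule Lp_le_cmult[OF t0 _ _ p]) (use C1 B(1) e c in \<open>auto simp: S_def\<close>)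
    then have u: "Lp_le p u (Ca * e * c)" by (simp add: Ca_def mult_ac)
    have v: "Lp_le p v (CH * c)" unfolding v_def by (rule hardyF[OF p F g F0 _ Lp]) (use c in simp)
    define Q where "Q = weight_poly l a m * R0"
    have Q: "poly Q x = S x * poly R0 x" for x by (simp add: Q_def S_def)
    have S1: "1 \<le> S x" for x unfolding S_def by (rule weight_poly_ge_1)
    have Sw: "S x * w x \<le> 9 * exp b" for x
    proof -
      have "S x * w x \<le> (9 * exp (a * \<bar>x\<bar> powr l)) * w x"
        unfolding S_def using w_pos[of x] by (intro mult_right_mono weight_poly_upper[OF l a]) auto
      also have "\<dots> = 9 * exp b" by (simp add: freud_weight_def mult_exp_exp)
      finally show ?thesis .
    qed
    have degQ: "degree Q \<le> K * n"
    proof -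
      have "real (degree Q) \<le> real (degree (weight_poly l a m)) + real (degree R0)"
        unfolding Q_def using degree_mult_le[of "weight_poly l a m" R0] by linarith
      also have "\<dots> \<le> l * real m + 8 * real n"
        using degree_weight_poly[OF l a, of m] R0 by (intro add_mono) auto
      also have "\<dots> \<le> l * ((d + 7) * real n) + 8 * real n"
        using m1 l by (intro add_mono mult_left_mono) auto
      also have "\<dots> = (l * (d + 7) + 8) * real n" by (simp add: algebra_simps)
      also have "\<dots> \<le> real K * real n" using K(2) by (intro mult_right_mono) auto
      finally show ?thesis by (simp flip: of_nat_mult)
    qed
    have loc: "ennreal \<bar>(F x * cutoff A x - poly Q x) * w x\<bar> \<le> u x" if "\<bar>x\<bar> \<le> X" for x
    proof -
      have S0: "0 < S x" using S1[of x] by simp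
      have "(F x * cutoff A x - poly Q x) * w x = (S x * w x) * (F x * cutoff A x / S x - poly R0 x)"
        using S0 by (simp add: Q field_simps)
      then have "\<bar>(F x * cutoff A x - poly Q x) * w x\<bar> = (S x * w x) * \<bar>F x * cutoff A x / S x - poly R0 x\<bar>"
        using S0 w_pos[of x] by (simp add: abs_mult)
      also have "\<dots> \<le> 9 * exp b * \<bar>F x * cutoff A x / S x - poly R0 x\<bar>"
        by (intro mult_right_mono Sw) auto
      finally have "ennreal \<bar>(F x * cutoff A x - poly Q x) * w x\<bar> \<le> ennreal (9 * exp b * \<bar>F x * cutoff A x / S x - poly R0 x\<bar>)"
        by (rule ennreal_leI)
      also have "\<dots> = u x" using that by (simp add: u_def ennreal_mult' abs_le_iff)
      finally show ?thesis .
    qed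
    have far: "ennreal \<bar>F x * w x\<bar> \<le> ennreal e * v x" if "A \<le> \<bar>x\<bar>" for x
    proof -
      have "1 / e = real n powr \<beta>" by (simp add: e_def powr_minus divide_inverse)
      also have "\<dots> = A powr (l - 1)" using l by (simp add: \<beta>_def A_def width_def powr_powr diff_divide_distrib)
      also have "\<dots> \<le> \<bar>x\<bar> powr (l - 1)" using that A l by (intro powr_mono2) auto
      also have "\<dots> \<le> \<Omega> x" by (simp add: \<Omega>_def)
      finally have "1 \<le> e * \<Omega> x" using e by (simp add: field_simps)
      then have "1 * \<bar>F x * w x\<bar> \<le> (e * \<Omega> x) * \<bar>F x * w x\<bar>" by (intro mult_right_mono) auto
      then have "ennreal \<bar>F x * w x\<bar> \<le> ennreal (e * (\<Omega> x * \<bar>F x * w x\<bar>))" by (intro ennreal_leI) (simp add: mult_ac)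
      then show ?thesis using e by (simp add: v_def ennreal_mult')
    qed
    \<comment> \<open>A bound without the gain e is enough here, since the restricted range
      inequality adds an exponentially small factor.\<close>
    have Qw: "Lp_le p (\<lambda>x. ennreal \<bar>poly Q x * w x\<bar> * indicator {- width n1..width n1} x) ((CH + Ca) * c)"
    proof (rule Lp_le_mono[OF Lp_le_add[OF v u p] _ p])
      have "ennreal \<bar>poly Q x * w x\<bar> * indicator {- width n1..width n1} x \<le> v x + u x" for x
      proof (cases "\<bar>x\<bar> \<le> width n1")
        case True
        then have x: "\<bar>x\<bar> \<le> X" using X by simp
        have "\<bar>F x * cutoff A x * w x\<bar> \<le> 1 * \<bar>F x * w x\<bar>"
          using cutoff(1,2)[OF A(1), of x] w_pos[of x] mult_right_mono[of "cutoff A x" 1 "\<bar>F x * w x\<bar>"]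
          by (simp add: abs_mult mult_ac)
        also have "\<dots> \<le> \<Omega> x * \<bar>F x * w x\<bar>" using \<Omega>_ge_1[of x] by (intro mult_right_mono) auto
        finally have "ennreal \<bar>F x * cutoff A x * w x\<bar> \<le> v x" unfolding v_def by (rule ennreal_leI)
        moreover have "ennreal \<bar>poly Q x * w x\<bar> \<le> ennreal (\<bar>F x * cutoff A x * w x\<bar> + \<bar>(F x * cutoff A x - poly Q x) * w x\<bar>)"
          by (intro ennreal_leI) (simp add: left_diff_distrib)
        ultimately show ?thesis using True loc[OF x]
          by (auto simp: abs_le_iff intro: order_trans add_mono)
      next
        case False
        then have "x \<notin> {- width n1..width n1}" by auto
        then show ?thesis by simp
      qed
      then show "AE x in lborel. ennreal \<bar>poly Q x * w x\<bar> * indicator {- width n1..width n1} x \<le> v x + u x" by simp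
      have "Ca * e * c \<le> Ca * 1 * c" using Ca e c by (intro mult_right_mono mult_left_mono) auto
      then show "CH * c + Ca * e * c \<le> (CH + Ca) * c" by (simp add: algebra_simps)
    qed (use CH Ca e c in \<open>auto simp: add_pos_pos less_imp_le\<close>)
    define T where "T x = ennreal (2 * ((CH + Ca) * c) * exp (- \<kappa> * real n1)) * ennreal (exp (- \<kappa> * \<bar>x\<bar> powr l))" for x
    have [measurable]: "T \<in> borel_measurable borel" unfolding T_def by measurable
    have tail: "ennreal \<bar>poly Q x * w x\<bar> \<le> T x" if "X \<le> \<bar>x\<bar>" for x
    proof -
      have "\<bar>poly Q x * w x\<bar> \<le> 2 * ((CH + Ca) * c) * exp (- \<kappa> * real n1) * exp (- \<kappa> * \<bar>x\<bar> powr l)"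
        by (rule RR[OF n1(1) _ p _ Qw]) (use degQ that CH Ca c in \<open>auto simp: n1_def X_def\<close>)
      then have "ennreal \<bar>poly Q x * w x\<bar> \<le> ennreal (2 * ((CH + Ca) * c) * exp (- \<kappa> * real n1) * exp (- \<kappa> * \<bar>x\<bar> powr l))"
        by (rule ennreal_leI)
      also have "\<dots> = T x" unfolding T_def using CH Ca c by (intro ennreal_mult') auto
      finally show ?thesis .
    qed
    have T: "Lp_le p T (2 * ((CH + Ca) * c) * exp (- \<kappa> * real n1) * D)"
      unfolding T_def by (rule Lp_le_cmult[OF D(2)[OF p] _ _ p]) (use CH Ca c D(1) in auto)
    \<comment> \<open>Of the exponential decay only \<open>1 / n\<close> is kept, which is at most
      \<open>A / n = e\<close>.\<close>
    have ek: "exp (- \<kappa> * real n1) \<le> e / \<kappa>"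
    proof -
      have "\<kappa> * real n \<le> \<kappa> * real n1" using n1(2) B(2) by (intro mult_left_mono) auto
      then have "\<kappa> * real n \<le> exp (\<kappa> * real n1)" using exp_ge_add_one_self[of "\<kappa> * real n1"] by linarith
      then have "1 / exp (\<kappa> * real n1) \<le> 1 / (\<kappa> * real n)" using B(2) n by (intro divide_left_mono) auto
      then have "exp (- \<kappa> * real n1) \<le> (1 / real n) / \<kappa>" by (simp add: exp_minus inverse_eq_divide mult.commute)
      also have "\<dots> \<le> e / \<kappa>"
        using An A n B(2) by (intro divide_right_mono) (auto simp flip: An simp: divide_right_mono)
      finally show ?thesis .
    qed
    have pw: "ennreal \<bar>(F x - poly Q x) * w x\<bar> \<le> u x + (ennreal e * v x + T x)" for x
    proof (cases "\<bar>x\<bar> \<le> X")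
      case True
      have "ennreal \<bar>F x * (1 - cutoff A x) * w x\<bar> \<le> ennreal e * v x"
      proof (cases "\<bar>x\<bar> \<le> A")
        case True
        then show ?thesis by (simp add: cutoff(3)[OF A(1)])
      next
        case False
        have "\<bar>F x * (1 - cutoff A x) * w x\<bar> \<le> 1 * \<bar>F x * w x\<bar>"
          using cutoff(1,2)[OF A(1), of x] w_pos[of x] mult_right_mono[of "1 - cutoff A x" 1 "\<bar>F x * w x\<bar>"]
          by (simp add: abs_mult mult_ac)
        then have "ennreal \<bar>F x * (1 - cutoff A x) * w x\<bar> \<le> ennreal \<bar>F x * w x\<bar>" by (intro ennreal_leI) simp
        then show ?thesis using far[of x] False by (meson linear order_trans)
      qed
      moreover have "\<bar>(F x - poly Q x) * w x\<bar> \<le> \<bar>(F x * cutoff A x - poly Q x) * w x\<bar> + \<bar>F x * (1 - cutoff A x) * w x\<bar>"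
        by (rule order_trans[OF _ abs_triangle_ineq]) (simp add: algebra_simps)
      then have "ennreal \<bar>(F x - poly Q x) * w x\<bar> \<le> ennreal \<bar>(F x * cutoff A x - poly Q x) * w x\<bar> + ennreal \<bar>F x * (1 - cutoff A x) * w x\<bar>"
        by (subst ennreal_plus[symmetric]) (simp_all only: abs_ge_zero ennreal_leI)
      ultimately have "ennreal \<bar>(F x - poly Q x) * w x\<bar> \<le> u x + ennreal e * v x"
        using loc[OF True] by (meson add_mono order_trans)
      also have "\<dots> \<le> u x + (ennreal e * v x + T x)" by (intro add_mono) auto
      finally show ?thesis .
    next
      case False
      then have x: "X \<le> \<bar>x\<bar>" "A \<le> \<bar>x\<bar>" using X by auto
      have "\<bar>(F x - poly Q x) * w x\<bar> \<le> \<bar>F x * w x\<bar> + \<bar>poly Q x * w x\<bar>"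
        using abs_triangle_ineq4[of "F x * w x" "poly Q x * w x"] by (simp add: left_diff_distrib)
      then have "ennreal \<bar>(F x - poly Q x) * w x\<bar> \<le> ennreal \<bar>F x * w x\<bar> + ennreal \<bar>poly Q x * w x\<bar>"
        by (subst ennreal_plus[symmetric]) (simp_all only: abs_ge_zero ennreal_leI)
      also have "\<dots> \<le> ennreal e * v x + T x" by (intro add_mono far tail x)
      also have "\<dots> \<le> u x + (ennreal e * v x + T x)" by (simp add: add_increasing)
      finally show ?thesis .
    qed
    have ev: "Lp_le p (\<lambda>x. ennreal e * v x) (e * (CH * c))"
      by (rule Lp_le_cmult[OF v e(1) _ p]) (use CH c in auto)
    have sum1: "Lp_le p (\<lambda>x. ennreal e * v x + T x) (e * (CH * c) + 2 * ((CH + Ca) * c) * exp (- \<kappa> * real n1) * D)"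
      by (rule Lp_le_add[OF ev T p]) (use e CH Ca c D(1) in \<open>auto simp: add_pos_pos\<close>)
    have sum2: "Lp_le p (\<lambda>x. u x + (ennreal e * v x + T x)) (Ca * e * c + (e * (CH * c) + 2 * ((CH + Ca) * c) * exp (- \<kappa> * real n1) * D))"
      by (rule Lp_le_add[OF u sum1 p]) (use e CH Ca c D(1) in \<open>auto intro!: add_pos_pos mult_pos_pos\<close>)
    have fin: "Lp_le p (\<lambda>x. ennreal \<bar>(F x - poly Q x) * w x\<bar>) (C * e * c)"
    proof (rule Lp_le_mono[OF sum2 _ p])
      show "AE x in lborel. ennreal \<bar>(F x - poly Q x) * w x\<bar> \<le> u x + (ennreal e * v x + T x)" using pw by simp
      show "0 \<le> Ca * e * c + (e * (CH * c) + 2 * ((CH + Ca) * c) * exp (- \<kappa> * real n1) * D)"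
        using e CH Ca c D(1) by (intro add_nonneg_nonneg mult_nonneg_nonneg) auto
      have "2 * ((CH + Ca) * c) * exp (- \<kappa> * real n1) * D \<le> 2 * ((CH + Ca) * c) * (e / \<kappa>) * D"
        using CH Ca c D(1) by (intro mult_right_mono mult_left_mono ek) auto
      also have "\<dots> = Ce * e * c" by (simp add: Ce_def)
      finally show "Ca * e * c + (e * (CH * c) + 2 * ((CH + Ca) * c) * exp (- \<kappa> * real n1) * D) \<le> C * e * c"
        unfolding C_def by (simp add: algebra_simps)
    qed
    then show "\<exists>R. degree R \<le> K * n \<and> Lp_le p (\<lambda>x. ennreal \<bar>(F x - poly R x) * w x\<bar>) (C * real n powr (- \<beta>) * c)"
      using degQ unfolding e_def by blast
  qed
qed

lemma ac_deriv_diff: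
  assumes F: "ac_deriv F f" and G: "ac_deriv G g"
  shows "ac_deriv (\<lambda>x. F x - G x) (\<lambda>x. f x - g x)"
  unfolding ac_deriv_def
proof (intro allI impI conjI)
  fix s t :: real assume st: "s \<le> t"
  have f: "set_integrable lborel {s..t} f" "F t - F s = (LBINT x:{s..t}. f x)"
    and g: "set_integrable lborel {s..t} g" "G t - G s = (LBINT x:{s..t}. g x)"
    using F G st by (auto simp: ac_deriv_def)
  show "set_integrable lborel {s..t} (\<lambda>x. f x - g x)" by (rule set_integral_diff(1)[OF f(1) g(1)])
  show "F t - G t - (F s - G s) = (LBINT x:{s..t}. f x - g x)"
    using f(2) g(2) by (simp add: set_integral_diff(2)[OF f(1) g(1)])
qed

lemma ac_deriv_poly: "ac_deriv (poly R) (poly (pderiv R))"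
  by (rule ac_deriv_C1) (auto intro!: poly_DERIV continuous_intros)

lemma jackson:
  "\<exists>C K. 0 < C \<and> 1 \<le> K \<and> (\<forall>n\<ge>1. \<forall>p\<ge>1. \<forall>F g c. ac_deriv F g \<longrightarrow> g \<in> borel_measurable borel \<longrightarrow> 0 < c \<longrightarrow>
     Lp_le p (\<lambda>x. ennreal \<bar>g x * w x\<bar>) c \<longrightarrow>
     (\<exists>R. degree R \<le> K * n \<and> Lp_le p (\<lambda>x. ennreal \<bar>(F x - poly R x) * w x\<bar>) (C * real n powr (- \<beta>) * c)))"
proof -
  obtain C K where CK: "0 < C" "1 \<le> K" and J: "\<And>n p F g c. 1 \<le> n \<Longrightarrow> 1 \<le> p \<Longrightarrow> ac_deriv F g \<Longrightarrow> g \<in> borel_measurable borel \<Longrightarrow>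
     F 0 = 0 \<Longrightarrow> 0 < c \<Longrightarrow> Lp_le p (\<lambda>x. ennreal \<bar>g x * w x\<bar>) c \<Longrightarrow>
     \<exists>R. degree R \<le> K * n \<and> Lp_le p (\<lambda>x. ennreal \<bar>(F x - poly R x) * w x\<bar>) (C * real n powr (- \<beta>) * c)"
    using jackson_centered by blast
  show ?thesis
  proof (rule exI[of _ C], rule exI[of _ K], intro conjI CK allI impI)
    fix n :: nat and p F g c
    assume n: "1 \<le> n" and p: "1 \<le> p" and F: "ac_deriv F g" and g: "g \<in> borel_measurable borel"
      and c: "0 < c" and Lp: "Lp_le p (\<lambda>x. ennreal \<bar>g x * w x\<bar>) c"
    have "ac_deriv (\<lambda>x. F x - F 0) g" using ac_deriv_diff[OF F ac_deriv_poly[of "[:F 0:]"]] by simp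
    then obtain R where R: "degree R \<le> K * n"
      "Lp_le p (\<lambda>x. ennreal \<bar>(F x - F 0 - poly R x) * w x\<bar>) (C * real n powr (- \<beta>) * c)"
      using J[OF n p _ g _ c Lp, of "\<lambda>x. F x - F 0"] by auto
    have "degree (R + [:F 0:]) \<le> K * n" using R(1) by (intro degree_add_le) auto
    moreover have "F x - poly (R + [:F 0:]) x = F x - F 0 - poly R x" for x by simp
    ultimately show "\<exists>R. degree R \<le> K * n \<and> Lp_le p (\<lambda>x. ennreal \<bar>(F x - poly R x) * w x\<bar>) (C * real n powr (- \<beta>) * c)"
      using R(2) by (intro exI[of _ "R + [:F 0:]"] conjI) (simp_all only:)
  qed
qed

lemma pderiv_surj: "\<exists>P. pderiv P = (R :: real poly) \<and> degree P \<le> Suc (degree R)"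
proof (intro exI conjI)
  let ?P = "\<Sum>i\<le>degree R. monom (coeff R i / real (Suc i)) (Suc i)"
  have "pderiv ?P = (\<Sum>i\<le>degree R. monom (coeff R i) i)"
    unfolding pderiv_sum by (intro sum.cong refl) (simp add: pderiv_monom del: of_nat_Suc)
  then show "pderiv ?P = R" by (simp add: poly_as_sum_of_monoms)
  show "degree ?P \<le> Suc (degree R)"
    by (intro degree_sum_le order_trans[OF degree_monom_le]) auto
qed

text \<open>Approximate \<open>F 1\<close> by the induction hypothesis, integrate the polynomial to
  P, and apply \<open>jackson\<close> to \<open>F 0 - P\<close>, whose derivative is already small.
  The degree gained by integration is absorbed in the multiple of n, as n \<ge> 1.\<close>

lemma jackson_iterated:
  "\<exists>C K. 0 < C \<and> 1 \<le> K \<and> (\<forall>n\<ge>1. \<forall>p\<ge>1. \<forall>F c. (\<forall>k<r. ac_deriv (F k) (F (Suc k))) \<longrightarrow>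
     F r \<in> borel_measurable borel \<longrightarrow> 0 < c \<longrightarrow> Lp_le p (\<lambda>x. ennreal \<bar>F r x * w x\<bar>) c \<longrightarrow>
     (\<exists>R. degree R \<le> K * n \<and> Lp_le p (\<lambda>x. ennreal \<bar>(F 0 x - poly R x) * w x\<bar>) (C * real n powr (- \<beta> * real r) * c)))"
proof (induction r)
  case 0
  show ?case
  proof (rule exI[of _ 1], rule exI[of _ 1], intro conjI allI impI)
    fix n :: nat and p F c
    assume "1 \<le> n" and "Lp_le p (\<lambda>x. ennreal \<bar>F 0 x * w x\<bar>) c"
    then show "\<exists>R. degree R \<le> 1 * n \<and> Lp_le p (\<lambda>x. ennreal \<bar>(F 0 x - poly R x) * w x\<bar>) (1 * real n powr (- \<beta> * real 0) * c)"
      by (intro exI[of _ 0]) simp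
  qed auto
next
  case (Suc r)
  obtain C K where CK: "0 < C" "1 \<le> K" and IH: "\<And>n p F c. 1 \<le> n \<Longrightarrow> 1 \<le> p \<Longrightarrow> (\<forall>k<r. ac_deriv (F k) (F (Suc k))) \<Longrightarrow>
     F r \<in> borel_measurable borel \<Longrightarrow> 0 < c \<Longrightarrow> Lp_le p (\<lambda>x. ennreal \<bar>F r x * w x\<bar>) c \<Longrightarrow>
     \<exists>R. degree R \<le> K * n \<and> Lp_le p (\<lambda>x. ennreal \<bar>(F 0 x - poly R x) * w x\<bar>) (C * real n powr (- \<beta> * real r) * c)"
    using Suc.IH by blast
  obtain C' K' where CK': "0 < C'" "1 \<le> K'" and J: "\<And>n p F g c. 1 \<le> n \<Longrightarrow> 1 \<le> p \<Longrightarrow> ac_deriv F g \<Longrightarrow> g \<in> borel_measurable borel \<Longrightarrow>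
     0 < c \<Longrightarrow> Lp_le p (\<lambda>x. ennreal \<bar>g x * w x\<bar>) c \<Longrightarrow>
     \<exists>R. degree R \<le> K' * n \<and> Lp_le p (\<lambda>x. ennreal \<bar>(F x - poly R x) * w x\<bar>) (C' * real n powr (- \<beta>) * c)"
    using jackson by blast
  show ?case
  proof (rule exI[of _ "C' * C"], rule exI[of _ "K + K' + 1"], intro conjI allI impI)
    fix n :: nat and p F c
    assume n: "1 \<le> n" and p: "1 \<le> p" and F: "\<forall>k<Suc r. ac_deriv (F k) (F (Suc k))"
      and Fm: "F (Suc r) \<in> borel_measurable borel" and c: "0 < c" and Lp: "Lp_le p (\<lambda>x. ennreal \<bar>F (Suc r) x * w x\<bar>) c"
    have F0: "ac_deriv (F 0) (F 1)" using F by auto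
    have F1m: "F 1 \<in> borel_measurable borel"
    proof (cases r)
      case 0 then show ?thesis using Fm by simp
    next
      case (Suc r')
      then have "ac_deriv (F 1) (F 2)" using F[rule_format, of 1] by (simp add: numeral_2_eq_2)
      then show ?thesis by (rule ac_deriv_measurable)
    qed
    define F' where "F' k = F (Suc k)" for k
    define c' where "c' = C * real n powr (- \<beta> * real r) * c"
    have c': "0 < c'" using CK c n by (simp add: c'_def)
    have "\<exists>R. degree R \<le> K * n \<and> Lp_le p (\<lambda>x. ennreal \<bar>(F' 0 x - poly R x) * w x\<bar>) c'"
      unfolding c'_def by (rule IH[OF n p _ _ c]) (use F Fm Lp in \<open>auto simp: F'_def\<close>)
    then obtain R1 where R1: "degree R1 \<le> K * n" "Lp_le p (\<lambda>x. ennreal \<bar>(F 1 x - poly R1 x) * w x\<bar>) c'"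
      unfolding F'_def by auto
    obtain P where P: "pderiv P = R1" "degree P \<le> Suc (degree R1)" using pderiv_surj by blast
    have "ac_deriv (\<lambda>x. F 0 x - poly P x) (\<lambda>x. F 1 x - poly R1 x)"
      using ac_deriv_diff[OF F0 ac_deriv_poly[of P]] P by simp
    moreover have "(\<lambda>x. F 1 x - poly R1 x) \<in> borel_measurable borel"
      using F1m by measurable
    ultimately obtain R2 where R2: "degree R2 \<le> K' * n"
      "Lp_le p (\<lambda>x. ennreal \<bar>(F 0 x - poly P x - poly R2 x) * w x\<bar>) (C' * real n powr (- \<beta>) * c')"
      using J[OF n p _ _ c' R1(2)] by blast
    have "Suc (K * n) \<le> (K + K' + 1) * n" "K' * n \<le> (K + K' + 1) * n" using n by (auto simp: algebra_simps)
    then have "degree (P + R2) \<le> (K + K' + 1) * n"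
      using P(2) R1(1) R2(1) by (intro degree_add_le) linarith+
    moreover have "C' * real n powr (- \<beta>) * c' = C' * C * real n powr (- \<beta> * real (Suc r)) * c"
      by (simp add: c'_def powr_add[symmetric] algebra_simps)
    moreover have "F 0 x - poly (P + R2) x = F 0 x - poly P x - poly R2 x" for x by simp
    ultimately show "\<exists>R. degree R \<le> (K + K' + 1) * n \<and>
        Lp_le p (\<lambda>x. ennreal \<bar>(F 0 x - poly R x) * w x\<bar>) (C' * C * real n powr (- \<beta> * real (Suc r)) * c)"
      using R2(2) by (intro exI[of _ "P + R2"] conjI) (simp_all only:)
  qed (use CK CK' in auto)
qed

end

subsection \<open>Approximation of Sobolev functions\<close>

lemma ac_deriv_cong_AE:
  assumes F: "ac_deriv F g" and ae: "AE x in lborel. g x = h x"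
    and [measurable]: "g \<in> borel_measurable borel" "h \<in> borel_measurable borel"
  shows "ac_deriv F h"
  unfolding ac_deriv_def
proof (intro allI impI conjI)
  fix s t :: real assume "s \<le> t"
  then have g: "set_integrable lborel {s..t} g" "F t - F s = (LBINT x:{s..t}. g x)"
    using F by (auto simp: ac_deriv_def)
  have ae': "AE x in lborel. indicator {s..t} x *\<^sub>R g x = indicator {s..t} x *\<^sub>R h x"
    using ae by eventually_elim simp
  show "set_integrable lborel {s..t} h"
    using g(1) unfolding set_integrable_def by (rule integrable_cong_AE_imp[OF _ _ ae']) simp
  show "F t - F s = (LBINT x:{s..t}. h x)"
    unfolding g(2) set_lebesgue_integral_def by (rule integral_cong_AE[OF _ _ ae']) simp_all
qed

context freud
begin

section \<open>Representatives of Sobolev functions\<close>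

text \<open>The passage from the norms over Lebesgue measure to \<open>Lp_le\<close> for a Borel
  representative.\<close>

lemma wLp_norm_le_iff:
  assumes f [measurable]: "f \<in> borel_measurable lebesgue" and F [measurable]: "F \<in> borel_measurable borel"
    and ae: "AE x in lborel. f x = F x" and p: "1 \<le> p" and c: "0 \<le> c"
  shows "wLp_norm w p f \<le> ennreal c \<longleftrightarrow> Lp_le p (\<lambda>x. ennreal \<bar>F x * w x\<bar>) c"
proof -
  have [measurable]: "w \<in> borel_measurable lebesgue"
    using measurable_w by (simp add: measurable_completion)
  show ?thesis
  proof (cases rule: exponent_cases[OF p])
    case 1
    have "esssup lebesgue (\<lambda>x. ennreal \<bar>f x * w x\<bar>) \<le> ennreal c \<longleftrightarrow> (AE x in lebesgue. ennreal \<bar>f x * w x\<bar> \<le> ennreal c)"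
    proof
      assume le: "esssup lebesgue (\<lambda>x. ennreal \<bar>f x * w x\<bar>) \<le> ennreal c"
      have "AE x in lebesgue. ennreal \<bar>f x * w x\<bar> \<le> esssup lebesgue (\<lambda>x. ennreal \<bar>f x * w x\<bar>)"
        by (rule esssup_AE)
      then show "AE x in lebesgue. ennreal \<bar>f x * w x\<bar> \<le> ennreal c"
        by eventually_elim (rule order_trans[OF _ le])
    next
      assume "AE x in lebesgue. ennreal \<bar>f x * w x\<bar> \<le> ennreal c"
      then show "esssup lebesgue (\<lambda>x. ennreal \<bar>f x * w x\<bar>) \<le> ennreal c"
        by (rule esssup_I[rotated]) measurable
    qed
    also have "\<dots> \<longleftrightarrow> (AE x in lborel. ennreal \<bar>f x * w x\<bar> \<le> ennreal c)" by (rule AE_completion_iff)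
    also have "\<dots> \<longleftrightarrow> (AE x in lborel. ennreal \<bar>F x * w x\<bar> \<le> ennreal c)"
    proof (rule eventually_subst)
      show "AE x in lborel. (ennreal \<bar>f x * w x\<bar> \<le> ennreal c) = (ennreal \<bar>F x * w x\<bar> \<le> ennreal c)"
        using ae by eventually_elim simp
    qed
    finally show ?thesis using 1 by (simp add: wLp_norm_def Lp_le_def)
  next
    case (2 s)
    define I where "I = (\<integral>\<^sup>+x. ennpowr (ennreal \<bar>F x * w x\<bar>) s \<partial>lborel)"
    have "(\<integral>\<^sup>+x. ennreal (\<bar>f x * w x\<bar> powr s) \<partial>lebesgue) = (\<integral>\<^sup>+x. ennreal (\<bar>f x * w x\<bar> powr s) \<partial>lborel)"
      by (rule nn_integral_completion)
    also have "\<dots> = I" unfolding I_def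
      by (rule nn_integral_cong_AE) (use ae in eventually_elim, simp)
    finally have e: "wLp_norm w p f = ennpowr I (1 / s)" using 2 by (simp add: wLp_norm_def)
    have "ennpowr I (1 / s) \<le> ennreal c \<longleftrightarrow> I \<le> ennreal (c powr s)"
    proof
      assume "ennpowr I (1 / s) \<le> ennreal c"
      then have "ennpowr (ennpowr I (1 / s)) s \<le> ennpowr (ennreal c) s" by (rule ennpowr_mono) (use 2 in simp)
      then show "I \<le> ennreal (c powr s)" using 2 c by (simp add: ennpowr_ennpowr)
    next
      assume "I \<le> ennreal (c powr s)"
      then have "ennpowr I (1 / s) \<le> ennpowr (ennreal (c powr s)) (1 / s)" by (rule ennpowr_mono) (use 2 in simp)
      then show "ennpowr I (1 / s) \<le> ennreal c" using 2 c by (simp add: powr_powr)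
    qed
    then show ?thesis unfolding e using 2 by (simp add: Lp_le_def I_def)
  qed
qed

lemma wSobolev_ball_deriv:
  assumes f: "f \<in> wSobolev_ball w r p" and p: "1 \<le> p" and k: "k \<le> r"
  shows "is_weak_deriv k f (weak_deriv k f)" "wLp_norm w p (weak_deriv k f) \<le> 1"
proof -
  have ex: "\<exists>g. is_weak_deriv j f g" if "j \<le> r" for j
    using f that unfolding wSobolev_ball_def wSobolev_def by blast
  show "is_weak_deriv k f (weak_deriv k f)"
  proof (cases "k = 0")
    case True
    \<comment> \<open>\<open>weak_deriv 0 f\<close> is f itself, and being its own derivative of
      order 0 requires only local integrability, which any witness g supplies.\<close>
    obtain g where "is_weak_deriv 0 f g" using ex[of 0] by blast
    then show ?thesis using True by (simp add: is_weak_deriv_def weak_deriv_def)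
  next
    case False
    then show ?thesis using someI_ex[OF ex[OF k]] by (simp add: weak_deriv_def)
  qed
  have one: "ennpowr 1 t = 1" for t using ennpowr_ennreal[of 1 t] by simp
  have n: "wSobolev_norm w r p f \<le> 1" using f by (simp add: wSobolev_ball_def)
  show "wLp_norm w p (weak_deriv k f) \<le> 1"
  proof (cases rule: exponent_cases[OF p])
    case 1
    then show ?thesis using n k by (simp add: wSobolev_norm_def)
  next
    case (2 s)
    let ?N = "\<lambda>k. ennpowr (wLp_norm w p (weak_deriv k f)) s"
    have "ennpowr (\<Sum>k\<le>r. ?N k) (1 / s) \<le> 1" using n 2 by (simp add: wSobolev_norm_def)
    then have "ennpowr (ennpowr (\<Sum>k\<le>r. ?N k) (1 / s)) s \<le> ennpowr 1 s"
      using 2 by (intro ennpowr_mono) auto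
    then have "(\<Sum>k\<le>r. ?N k) \<le> 1" using 2 by (simp add: ennpowr_ennpowr one)
    moreover have "?N k \<le> (\<Sum>k\<le>r. ?N k)" using k by (intro member_le_sum) auto
    ultimately have "?N k \<le> 1" by (rule order_trans[rotated])
    then have "ennpowr (?N k) (1 / s) \<le> ennpowr 1 (1 / s)"
      using 2 by (intro ennpowr_mono) auto
    then show ?thesis using 2 by (simp add: ennpowr_ennpowr one)
  qed
qed

text \<open>Each consecutive pair of weak derivatives yields a primitive with its derivative.
  Representatives of the same weak derivative coming from neighbouring pairs agree almost
  everywhere, and \<open>ac_deriv\<close> does not see null sets in the derivative, so the pairs can
  be linked.\<close>

lemma wSobolev_ball_chain:
  assumes f: "f \<in> wSobolev_ball w r p" and p: "1 \<le> p" and r: "1 \<le> r"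
  shows "\<exists>F. (\<forall>k<r. ac_deriv (F k) (F (Suc k))) \<and> F r \<in> borel_measurable borel \<and>
    (AE x in lborel. f x = F 0 x) \<and> Lp_le p (\<lambda>x. ennreal \<bar>F 0 x * w x\<bar>) 1 \<and> Lp_le p (\<lambda>x. ennreal \<bar>F r x * w x\<bar>) 1"
proof -
  define D where "D k = weak_deriv k f" for k
  have D: "is_weak_deriv k f (D k)" "wLp_norm w p (D k) \<le> 1" if "k \<le> r" for k
    using wSobolev_ball_deriv[OF f p that] by (simp_all add: D_def)
  have "\<exists>F g. ac_deriv F g \<and> g \<in> borel_measurable borel \<and> (AE x in lborel. D k x = F x) \<and> (AE x in lborel. D (Suc k) x = g x)"
    if "k < r" for k
  proof -
    have "is_weak_deriv 1 (D k) (D (Suc k))"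
      by (rule is_weak_deriv_step[OF D(1) D(1)]) (use that in auto)
    then show ?thesis by (rule weak_deriv_ac) blast
  qed
  then have "\<forall>k. \<exists>F g. k < r \<longrightarrow> ac_deriv F g \<and> g \<in> borel_measurable borel \<and>
      (AE x in lborel. D k x = F x) \<and> (AE x in lborel. D (Suc k) x = g x)" by blast
  from choice[OF this] obtain F' where F': "\<forall>k. \<exists>g. k < r \<longrightarrow> ac_deriv (F' k) g \<and> g \<in> borel_measurable borel \<and>
      (AE x in lborel. D k x = F' k x) \<and> (AE x in lborel. D (Suc k) x = g x)" ..
  from choice[OF F'] obtain g' where FG: "\<forall>k. k < r \<longrightarrow> ac_deriv (F' k) (g' k) \<and> g' k \<in> borel_measurable borel \<and>
      (AE x in lborel. D k x = F' k x) \<and> (AE x in lborel. D (Suc k) x = g' k x)" ..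
  \<comment> \<open>The highest derivative need not have a continuous representative; it is taken
    from the derivative part of the last pair.\<close>
  define F where "F k = (if k < r then F' k else g' (r - 1))" for k
  have Fm: "F k \<in> borel_measurable borel" for k
    using FG r ac_deriv_measurable by (auto simp: F_def)
  have Fae: "AE x in lborel. D k x = F k x" if "k \<le> r" for k
  proof (cases "k < r")
    case True
    then show ?thesis using FG by (simp add: F_def)
  next
    case False
    then have "k = r" using that by simp
    then show ?thesis using FG[rule_format, of "r - 1"] r by (simp add: F_def)
  qed
  have "ac_deriv (F k) (F (Suc k))" if k: "k < r" for k
  proof (rule ac_deriv_cong_AE)
    show "ac_deriv (F k) (g' k)" using FG k by (simp add: F_def)
    have "AE x in lborel. D (Suc k) x = F (Suc k) x" by (rule Fae) (use k in simp)
    moreover have "AE x in lborel. D (Suc k) x = g' k x" using FG k by simp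
    ultimately show "AE x in lborel. g' k x = F (Suc k) x" by eventually_elim simp
    show "g' k \<in> borel_measurable borel" using FG k by simp
    show "F (Suc k) \<in> borel_measurable borel" by (rule Fm)
  qed
  moreover have "Lp_le p (\<lambda>x. ennreal \<bar>F k x * w x\<bar>) 1" if k: "k \<le> r" for k
  proof -
    have "D k \<in> borel_measurable lebesgue"
      using is_weak_deriv_locally_integrable(2)[OF D(1)[OF k]] by (rule locally_integrable_measurable)
    from wLp_norm_le_iff[OF this Fm Fae[OF k] p, of 1] show ?thesis using D(2)[OF k] by simp
  qed
  moreover have "AE x in lborel. f x = F 0 x" using Fae[of 0] by (simp add: D_def weak_deriv_def)
  ultimately show ?thesis using Fm by blast
qed

section \<open>Errors of de la Vallee Poussin sums\<close>

lemma vp_diff: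
  assumes f: "Lp_le p (\<lambda>x. ennreal \<bar>f x * w x\<bar>) c" and g: "Lp_le p (\<lambda>x. ennreal \<bar>g x * w x\<bar>) d" and p: "1 \<le> p"
    and [measurable]: "f \<in> borel_measurable borel" "g \<in> borel_measurable borel"
  shows "vp P n (\<lambda>x. f x - g x) x = vp P n f x - vp P n g x"
proof -
  have "fourier_coeff w P (\<lambda>x. f x - g x) k = fourier_coeff w P f k - fourier_coeff w P g k" for k
    using integrable_times_poly[OF f p, of "P k"] integrable_times_poly[OF g p, of "P k"]
    by (simp add: fourier_coeff_lborel left_diff_distrib)
  then have "fourier_sum w P m (\<lambda>x. f x - g x) x = fourier_sum w P m f x - fourier_sum w P m g x" for m
    by (simp add: fourier_sum_def left_diff_distrib sum_subtractf)
  then show ?thesis by (simp add: vallee_poussin_def sum_subtractf diff_divide_distrib)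
qed

text \<open>As \<open>vp\<close> reproduces R, the error of F is that of \<open>g = F - R\<close>,
  to which boundedness applies. The bound d only secures that the Fourier coefficients of F
  exist.\<close>

lemma vp_near_best:
  "\<exists>C\<ge>1. \<forall>P. orth P \<longrightarrow> (\<forall>n\<ge>1. \<forall>p\<ge>1. \<forall>F R c d. F \<in> borel_measurable borel \<longrightarrow> 0 < c \<longrightarrow>
     Lp_le p (\<lambda>x. ennreal \<bar>F x * w x\<bar>) d \<longrightarrow> degree R \<le> n \<longrightarrow>
     Lp_le p (\<lambda>x. ennreal \<bar>(F x - poly R x) * w x\<bar>) c \<longrightarrow>
     Lp_le p (\<lambda>x. ennreal \<bar>(F x - vp P n F x) * w x\<bar>) (C * c))"
proof -
  obtain C where C: "1 \<le> C" and vpb: "\<And>P n p f c. orth P \<Longrightarrow> 1 \<le> n \<Longrightarrow> 1 \<le> p \<Longrightarrow> f \<in> borel_measurable borel \<Longrightarrow> 0 \<le> c \<Longrightarrow>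
     Lp_le p (\<lambda>x. ennreal \<bar>f x * w x\<bar>) c \<Longrightarrow> Lp_le p (\<lambda>x. ennreal \<bar>vp P n f x * w x\<bar>) (C * c)"
    using vp_bounded by blast
  show ?thesis
  proof (intro exI[of _ "1 + C"] conjI allI impI)
    show "1 \<le> 1 + C" using C by simp
    fix P n p F R c d
    assume P: "orth P" and n: "1 \<le> n" and p: "1 \<le> p" and Fm [measurable]: "F \<in> borel_measurable borel" and c: "0 < c"
      and F: "Lp_le p (\<lambda>x. ennreal \<bar>F x * w x\<bar>) d" and R: "degree R \<le> n"
      and FR: "Lp_le p (\<lambda>x. ennreal \<bar>(F x - poly R x) * w x\<bar>) c"
    define g where "g = (\<lambda>x. F x - poly R x)"
    have [measurable]: "g \<in> borel_measurable borel" unfolding g_def by measurable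
    have g: "Lp_le p (\<lambda>x. ennreal \<bar>g x * w x\<bar>) c" using FR by (simp add: g_def)
    have "vp P n (\<lambda>x. F x - g x) x = vp P n F x - vp P n g x" for x
      by (rule vp_diff[OF F g p]) measurable
    moreover have "(\<lambda>x. F x - g x) = poly R" by (simp add: g_def)
    ultimately have e: "F x - vp P n F x = g x - vp P n g x" for x
      using vp_polynomial[OF P R n, of x] by (simp add: g_def)
    have Vg: "Lp_le p (\<lambda>x. ennreal \<bar>vp P n g x * w x\<bar>) (C * c)" by (rule vpb[OF P n p _ _ g]) (use c in auto)
    have "Lp_le p (\<lambda>x. ennreal \<bar>g x * w x\<bar> + ennreal \<bar>vp P n g x * w x\<bar>) (c + C * c)"
      by (rule Lp_le_add[OF g Vg p]) (use c C in auto)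
    then show "Lp_le p (\<lambda>x. ennreal \<bar>(F x - vp P n F x) * w x\<bar>) ((1 + C) * c)"
    proof (rule Lp_le_mono[OF _ _ p])
      have "ennreal \<bar>(F x - vp P n F x) * w x\<bar> \<le> ennreal \<bar>g x * w x\<bar> + ennreal \<bar>vp P n g x * w x\<bar>" for x
        unfolding e using abs_triangle_ineq4[of "g x * w x" "vp P n g x * w x"]
        by (subst ennreal_plus[symmetric]) (simp_all only: abs_ge_zero ennreal_leI left_diff_distrib)
      then show "AE x in lborel. ennreal \<bar>(F x - vp P n F x) * w x\<bar> \<le> ennreal \<bar>g x * w x\<bar> + ennreal \<bar>vp P n g x * w x\<bar>" by simp
      show "0 \<le> c + C * c" using c C by simp
      show "c + C * c \<le> (1 + C) * c" by (simp add: algebra_simps)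
    qed
  qed
qed

text \<open>Jackson's polynomial of order n' has degree at most \<open>K * n'\<close>, so
  \<open>n' = n div K\<close> keeps it within degree n at the price of a constant. For
  \<open>n < K\<close> the zero polynomial is good enough, because \<open>F 0\<close> has norm at
  most 1.\<close>

lemma vp_error_same_norm:
  "\<exists>C>0. \<forall>P. orth P \<longrightarrow> (\<forall>n\<ge>1. \<forall>p\<ge>1. \<forall>F. (\<forall>k<r. ac_deriv (F k) (F (Suc k))) \<longrightarrow>
     F r \<in> borel_measurable borel \<longrightarrow> F 0 \<in> borel_measurable borel \<longrightarrow>
     Lp_le p (\<lambda>x. ennreal \<bar>F 0 x * w x\<bar>) 1 \<longrightarrow> Lp_le p (\<lambda>x. ennreal \<bar>F r x * w x\<bar>) 1 \<longrightarrow>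
     Lp_le p (\<lambda>x. ennreal \<bar>(F 0 x - vp P n (F 0) x) * w x\<bar>) (C * real n powr (- \<beta> * real r)))"
proof -
  obtain CV where CV: "1 \<le> CV" and near: "\<And>P n p F R c d. orth P \<Longrightarrow> 1 \<le> n \<Longrightarrow> 1 \<le> p \<Longrightarrow> F \<in> borel_measurable borel \<Longrightarrow> 0 < c \<Longrightarrow>
     Lp_le p (\<lambda>x. ennreal \<bar>F x * w x\<bar>) d \<Longrightarrow> degree R \<le> n \<Longrightarrow>
     Lp_le p (\<lambda>x. ennreal \<bar>(F x - poly R x) * w x\<bar>) c \<Longrightarrow>
     Lp_le p (\<lambda>x. ennreal \<bar>(F x - vp P n F x) * w x\<bar>) (CV * c)"
    using vp_near_best by blast
  obtain C K where J_ex: "0 < C \<and> 1 \<le> K \<and> (\<forall>n\<ge>1. \<forall>p\<ge>1. \<forall>F c. (\<forall>k<r. ac_deriv (F k) (F (Suc k))) \<longrightarrow>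
     F r \<in> borel_measurable borel \<longrightarrow> 0 < c \<longrightarrow> Lp_le p (\<lambda>x. ennreal \<bar>F r x * w x\<bar>) c \<longrightarrow>
     (\<exists>R. degree R \<le> K * n \<and> Lp_le p (\<lambda>x. ennreal \<bar>(F 0 x - poly R x) * w x\<bar>) (C * real n powr (- \<beta> * real r) * c)))"
    using jackson_iterated[of r] by (elim exE) (rule that)
  have C: "0 < C" and K: "1 \<le> K" using J_ex by simp_all
  note J = J_ex[THEN conjunct2, THEN conjunct2, rule_format]
  define s where "s = \<beta> * real r"
  have s: "0 \<le> s" using \<beta> by (simp add: s_def)
  define C' where "C' = (1 + C) * (2 * real K) powr s"
  have C': "0 < C'" using C K by (simp add: C'_def)
  show ?thesis
  proof (intro exI[of _ "CV * C'"] conjI allI impI)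
    show "0 < CV * C'" using CV C' by simp
    fix P n p F
    assume P: "orth P" and n: "(1::nat) \<le> n" and p: "1 \<le> p" and chain: "\<forall>k<r. ac_deriv (F k) (F (Suc k))"
      and Fr: "F r \<in> borel_measurable borel" and F0: "F 0 \<in> borel_measurable borel"
      and L0: "Lp_le p (\<lambda>x. ennreal \<bar>F 0 x * w x\<bar>) 1" and Lr: "Lp_le p (\<lambda>x. ennreal \<bar>F r x * w x\<bar>) 1"
    have "\<exists>R. degree R \<le> n \<and> Lp_le p (\<lambda>x. ennreal \<bar>(F 0 x - poly R x) * w x\<bar>) (C' * real n powr (- s))"
    proof (cases "K \<le> n")
      case True
      define n' where "n' = n div K"
      have n': "1 \<le> n'" using True K div_le_mono[of K n K] by (simp add: n'_def)
      have nn: "real n \<le> 2 * real K * real n'"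
      proof -
        have "n < K * (n' + 1)" using dividend_less_times_div[of K n] K by (simp add: n'_def)
        also have "K * (n' + 1) \<le> 2 * K * n'" using n' by simp
        finally have "real n \<le> real (2 * K * n')" by linarith
        then show ?thesis by simp
      qed
      obtain R where R: "degree R \<le> K * n'" "Lp_le p (\<lambda>x. ennreal \<bar>(F 0 x - poly R x) * w x\<bar>) (C * real n' powr (- \<beta> * real r) * 1)"
        using J[where n=n' and p=p and F=F and c=1] n' p Fr Lr chain by auto
      have "K * n' \<le> n" by (simp add: n'_def)
      then have dR: "degree R \<le> n" using R(1) by simp
      have "real n' powr (- s) \<le> (real n / (2 * real K)) powr (- s)"
        using nn n K s by (intro powr_mono2') (auto simp: field_simps)
      also have "\<dots> = (2 * real K) powr s * real n powr (- s)"
        using n K by (simp add: powr_divide powr_minus field_simps)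
      finally have "C * real n' powr (- s) \<le> (1 + C) * ((2 * real K) powr s * real n powr (- s))"
        using C by (intro mult_mono) auto
      then have "C * real n' powr (- \<beta> * real r) * 1 \<le> C' * real n powr (- s)" by (simp add: C'_def s_def)
      then show ?thesis using C by (intro exI[of _ R] conjI dR Lp_le_mono[OF R(2) _ p]) auto
    next
      case False
      have "1 = real n powr s * real n powr (- s)" using n by (simp add: powr_add[symmetric])
      also have "\<dots> \<le> (2 * real K) powr s * real n powr (- s)"
        using False s n by (intro mult_right_mono powr_mono2) auto
      also have "\<dots> \<le> C' * real n powr (- s)"
        unfolding C'_def using C mult_right_mono[of 1 "1 + C" "(2 * real K) powr s"] by (intro mult_right_mono) auto
      finally have "1 \<le> C' * real n powr (- s)" .
      then show ?thesis using L0 by (intro exI[of _ 0] conjI Lp_le_mono[OF L0 _ p]) auto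
    qed
    then obtain R where R: "degree R \<le> n" "Lp_le p (\<lambda>x. ennreal \<bar>(F 0 x - poly R x) * w x\<bar>) (C' * real n powr (- s))"
      by blast
    have "0 < C' * real n powr (- s)" using C' n by simp
    from near[OF P n p F0 this L0 R]
    show "Lp_le p (\<lambda>x. ennreal \<bar>(F 0 x - vp P n (F 0) x) * w x\<bar>) (CV * C' * real n powr (- \<beta> * real r))"
      by (simp add: s_def mult.assoc)
  qed
qed

text \<open>The errors at the orders \<open>N j\<close> are summable in \<open>L\<^sub>p\<close>,
  hence tend to 0 almost everywhere, so the first error is bounded almost everywhere by the series
  of differences. Countable Minkowski then bounds it in \<open>L\<^sub>q\<close> without knowing
  beforehand that f belongs to that space.\<close>

lemma vp_error_change_norm:
  assumes p: "1 \<le> p" and q: "1 \<le> q" and C: "0 < C" and rho: "0 < s - delta_exponent l p q"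
  shows "\<exists>C'>0. \<forall>P. orth P \<longrightarrow> (\<forall>n\<ge>1. \<forall>f. f \<in> borel_measurable borel \<longrightarrow>
     (\<forall>m\<ge>1. Lp_le p (\<lambda>x. ennreal \<bar>(f x - vp P m f x) * w x\<bar>) (C * real m powr (- s))) \<longrightarrow> 0 < s \<longrightarrow>
     Lp_le q (\<lambda>x. ennreal \<bar>(f x - vp P n f x) * w x\<bar>) (C' * real n powr (- (s - delta_exponent l p q))))"
proof -
  define \<delta> where "\<delta> = delta_exponent l p q"
  define \<rho> where "\<rho> = s - \<delta>"
  have \<rho>: "0 < \<rho>" using rho by (simp add: \<rho>_def \<delta>_def)
  obtain CN where CN: "0 < CN" and nik: "\<And>P n R c. orth P \<Longrightarrow> 1 \<le> n \<Longrightarrow> degree R \<le> n \<Longrightarrow> 0 < c \<Longrightarrow>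
     Lp_le p (\<lambda>x. ennreal \<bar>poly R x * w x\<bar>) c \<Longrightarrow>
     Lp_le q (\<lambda>x. ennreal \<bar>poly R x * w x\<bar>) (CN * real n powr \<delta> * c)"
    using nikolskii[OF p q] unfolding \<delta>_def by blast
  \<comment> \<open>Consecutive means differ by a polynomial of degree at most
    \<open>4 * N j\<close>, whence \<open>4 powr \<delta>\<close>; \<open>2 * C\<close> adds the two
    errors.\<close>
  define C2 where "C2 = CN * 4 powr \<delta> * (2 * C)"
  have C2: "0 < C2" using CN C by (simp add: C2_def)
  have geo: "0 < (2::real) powr (- t)" "(2::real) powr (- t) < 1" if "0 < t" for t
    using that powr_less_mono[of "- t" 0 2] by auto
  define C' where "C' = C2 / (1 - 2 powr (- \<rho>))"
  have C': "0 < C'" using C2 geo[OF \<rho>] by (simp add: C'_def)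
  show ?thesis
  proof (intro exI[of _ C'] conjI C' allI impI)
    fix P n f
    assume P: "orth P" and n: "(1::nat) \<le> n" and fm [measurable]: "f \<in> borel_measurable borel"
      and err: "\<forall>m\<ge>1. Lp_le p (\<lambda>x. ennreal \<bar>(f x - vp P m f x) * w x\<bar>) (C * real m powr (- s))" and s: "0 < s"
    define N where "N j = 2 ^ j * n" for j
    have N: "1 \<le> N j" "N j \<le> N (Suc j)" for j using n by (auto simp: N_def)
    have Npowr: "real (N j) powr (- t) = real n powr (- t) * (2 powr (- t)) ^ j" for j t
    proof -
      have "real (N j) powr (- t) = (2 ^ j) powr (- t) * real n powr (- t)" using n by (simp add: N_def powr_mult)
      also have "(2 ^ j) powr (- t) = ((2::real) powr (- t)) ^ j"
        by (simp add: powr_realpow[symmetric] powr_powr mult.commute)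
      finally show ?thesis by simp
    qed
    have summ: "summable (\<lambda>j. c * real (N j) powr (- t))" "(\<Sum>j. c * real (N j) powr (- t)) = c * (1 / (1 - 2 powr (- t))) * real n powr (- t)"
      if t: "0 < t" for c t
    proof -
      have "norm ((2::real) powr (- t)) < 1" using geo[OF t] by simp
      then have "(\<lambda>j. ((2::real) powr (- t)) ^ j) sums (1 / (1 - 2 powr (- t)))" by (rule geometric_sums)
      from sums_mult[OF this, of "c * real n powr (- t)"]
      have "(\<lambda>j. c * real (N j) powr (- t)) sums (c * (1 / (1 - 2 powr (- t))) * real n powr (- t))"
        by (simp add: Npowr mult_ac)
      then show "summable (\<lambda>j. c * real (N j) powr (- t))" "(\<Sum>j. c * real (N j) powr (- t)) = c * (1 / (1 - 2 powr (- t))) * real n powr (- t)"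
        by (auto simp: sums_iff)
    qed
    define E where "E j x = (f x - vp P (N j) f x) * w x" for j x
    have [measurable]: "E j \<in> borel_measurable borel" for j unfolding E_def by measurable
    have E: "Lp_le p (\<lambda>x. ennreal \<bar>E j x\<bar>) (C * real (N j) powr (- s))" for j
      unfolding E_def using err N by blast
    have Npos: "0 < real (N j) powr t" for j t using N(1)[of j] by simp
    \<comment> \<open>The \<open>L\<^sub>p\<close> rate s > 0 alone makes this series converge
      almost everywhere, which identifies f as the pointwise limit.\<close>
    have "AE x in lborel. (\<Sum>j. ennreal \<bar>E j x\<bar>) < \<infinity>"
      by (rule Lp_le_AE_finite[OF Lp_le_suminf[OF E p _ summ(1)[OF s]] p]) (use C Npos in auto)
    then have lim: "AE x in lborel. (\<lambda>j. E j x) \<longlonglongrightarrow> 0"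
    proof eventually_elim
      case (elim x)
      then have "summable (\<lambda>j. \<bar>E j x\<bar>)" by (intro summable_suminf_not_top) auto
      then have "(\<lambda>j. \<bar>E j x\<bar>) \<longlonglongrightarrow> 0" by (rule summable_LIMSEQ_zero)
      then show ?case by (simp add: tendsto_rabs_zero_iff)
    qed
    have D: "Lp_le q (\<lambda>x. ennreal \<bar>E j x - E (Suc j) x\<bar>) (C2 * real (N j) powr (- \<rho>))" for j
    proof -
      obtain R1 where R1: "degree R1 \<le> 2 * N (Suc j)" "vp P (N (Suc j)) f = poly R1" using vp_is_poly[OF P] by blast
      obtain R0 where R0: "degree R0 \<le> 2 * N j" "vp P (N j) f = poly R0" using vp_is_poly[OF P] by blast
      have e: "E j x - E (Suc j) x = poly (R1 - R0) x * w x" for x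
        by (simp add: E_def R1(2) R0(2) left_diff_distrib)
      have deg: "degree (R1 - R0) \<le> 4 * N j" using R1(1) R0(1) by (intro degree_diff_le) (auto simp: N_def)
      have "Lp_le p (\<lambda>x. ennreal \<bar>E j x\<bar> + ennreal \<bar>E (Suc j) x\<bar>) (C * real (N j) powr (- s) + C * real (N (Suc j)) powr (- s))"
        by (rule Lp_le_add[OF E E p]) (use C Npos in auto)
      then have "Lp_le p (\<lambda>x. ennreal \<bar>poly (R1 - R0) x * w x\<bar>) (2 * C * real (N j) powr (- s))"
      proof (rule Lp_le_mono[OF _ _ p])
        show "AE x in lborel. ennreal \<bar>poly (R1 - R0) x * w x\<bar> \<le> ennreal \<bar>E j x\<bar> + ennreal \<bar>E (Suc j) x\<bar>"
          unfolding e[symmetric]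
          by (subst ennreal_plus[symmetric]) (simp_all only: abs_ge_zero ennreal_leI abs_triangle_ineq4 AE_I2)
        have "real (N (Suc j)) powr (- s) \<le> real (N j) powr (- s)"
          using N[of j] s by (intro powr_mono2') auto
        then show "C * real (N j) powr (- s) + C * real (N (Suc j)) powr (- s) \<le> 2 * C * real (N j) powr (- s)"
          using C by (simp add: mult.assoc)
        show "0 \<le> C * real (N j) powr (- s) + C * real (N (Suc j)) powr (- s)" using C by simp
      qed
      then have "Lp_le q (\<lambda>x. ennreal \<bar>poly (R1 - R0) x * w x\<bar>) (CN * real (4 * N j) powr \<delta> * (2 * C * real (N j) powr (- s)))"
        using N(1)[of j] C Npos by (intro nik[OF P _ deg]) auto
      moreover have "CN * real (4 * N j) powr \<delta> * (2 * C * real (N j) powr (- s)) = C2 * (real (N j) powr \<delta> * real (N j) powr (- s))"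
        by (simp add: C2_def powr_mult)
      moreover have "real (N j) powr \<delta> * real (N j) powr (- s) = real (N j) powr (- \<rho>)"
        by (simp add: powr_add[symmetric] \<rho>_def)
      ultimately show ?thesis unfolding e by simp
    qed
    have sumD: "Lp_le q (\<lambda>x. \<Sum>j. ennreal \<bar>E j x - E (Suc j) x\<bar>) (\<Sum>j. C2 * real (N j) powr (- \<rho>))"
      by (rule Lp_le_suminf[OF D q _ summ(1)[OF \<rho>]]) (use C2 Npos in auto)
    have "Lp_le q (\<lambda>x. ennreal \<bar>E 0 x\<bar>) (C' * real n powr (- \<rho>))"
    proof (rule Lp_le_mono[OF sumD _ q])
      show "AE x in lborel. ennreal \<bar>E 0 x\<bar> \<le> (\<Sum>j. ennreal \<bar>E j x - E (Suc j) x\<bar>)"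
        using lim
      proof eventually_elim
        case (elim x)
        have "ennreal \<bar>E 0 x\<bar> \<le> ennreal \<bar>E J x\<bar> + (\<Sum>j. ennreal \<bar>E j x - E (Suc j) x\<bar>)" for J
        proof -
          \<comment> \<open>Only finite sums are telescoped; the remainder \<open>E J x\<close> is
            removed by letting J tend to infinity.\<close>
          have "E 0 x = E J x + (\<Sum>j<J. E j x - E (Suc j) x)"
            using sum_lessThan_telescope'[of "\<lambda>j. E j x" J] by simp
          then have "\<bar>E 0 x\<bar> \<le> \<bar>E J x\<bar> + (\<Sum>j<J. \<bar>E j x - E (Suc j) x\<bar>)"
            using abs_triangle_ineq[of "E J x" "\<Sum>j<J. E j x - E (Suc j) x"] sum_abs[of "\<lambda>j. E j x - E (Suc j) x" "{..<J}"] by linarith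
          then have "ennreal \<bar>E 0 x\<bar> \<le> ennreal (\<bar>E J x\<bar> + (\<Sum>j<J. \<bar>E j x - E (Suc j) x\<bar>))" by (rule ennreal_leI)
          also have "\<dots> = ennreal \<bar>E J x\<bar> + (\<Sum>j<J. ennreal \<bar>E j x - E (Suc j) x\<bar>)"
            by (simp add: sum_nonneg sum_ennreal)
          also have "\<dots> \<le> ennreal \<bar>E J x\<bar> + (\<Sum>j. ennreal \<bar>E j x - E (Suc j) x\<bar>)"
            by (intro add_left_mono sum_le_suminf) auto
          finally show ?thesis .
        qed
        moreover have "(\<lambda>J. ennreal \<bar>E J x\<bar> + (\<Sum>j. ennreal \<bar>E j x - E (Suc j) x\<bar>)) \<longlonglongrightarrow> 0 + (\<Sum>j. ennreal \<bar>E j x - E (Suc j) x\<bar>)"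
          using tendsto_ennrealI[OF tendsto_rabs_zero[OF elim]] by (intro tendsto_add) auto
        ultimately show ?case by (intro LIMSEQ_le_const) auto
      qed
      show "0 \<le> (\<Sum>j. C2 * real (N j) powr (- \<rho>))" using C2 by (intro suminf_nonneg summ(1)[OF \<rho>]) auto
      show "(\<Sum>j. C2 * real (N j) powr (- \<rho>)) \<le> C' * real n powr (- \<rho>)" by (simp add: summ(2)[OF \<rho>] C'_def)
    qed
    then show "Lp_le q (\<lambda>x. ennreal \<bar>(f x - vp P n f x) * w x\<bar>) (C' * real n powr (- (s - delta_exponent l p q)))"
      by (simp add: E_def N_def \<rho>_def \<delta>_def)
  qed
qed

lemma vp_cong_AE:
  assumes f: "f \<in> borel_measurable lebesgue" and F: "F \<in> borel_measurable borel" and ae: "AE x in lborel. f x = F x"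
  shows "vp P n f = vp P n F"
proof -
  have "fourier_coeff w P f k = fourier_coeff w P F k" for k
  proof -
    have "(LINT x|lebesgue. f x * (poly (P k) x * (w x)\<^sup>2)) = (\<integral>x. F x * (poly (P k) x * (w x)\<^sup>2) \<partial>lborel)"
      by (rule LINT_lebesgue_borel_version[OF f F ae]) measurable
    then show ?thesis unfolding fourier_coeff_lborel[OF F] by (simp add: fourier_coeff_def mult.assoc)
  qed
  then show ?thesis by (simp add: vallee_poussin_def fourier_sum_def fun_eq_iff)
qed

lemma vp_approximation:
  assumes p: "1 \<le> p" and q: "1 \<le> q" and r: "1 \<le> r" and rate: "0 < rate_exponent l r p q"
  shows "\<exists>C>0. \<forall>P. orth P \<longrightarrow> (\<forall>n\<ge>1. (SUP f \<in> wSobolev_ball w r p. wLp_norm w q (\<lambda>x. f x - vp P n f x))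
       \<le> ennreal (C * real n powr (- rate_exponent l r p q)))"
proof -
  define s where "s = \<beta> * real r"
  have s: "0 < s" using \<beta> r by (simp add: s_def)
  have rate_eq: "rate_exponent l r p q = s - delta_exponent l p q"
    by (simp add: rate_exponent_def r_exponent_def s_def \<beta>_def)
  obtain C0 where C0: "0 < C0" and same: "\<And>P n p F. orth P \<Longrightarrow> 1 \<le> n \<Longrightarrow> 1 \<le> p \<Longrightarrow> (\<forall>k<r. ac_deriv (F k) (F (Suc k))) \<Longrightarrow>
     F r \<in> borel_measurable borel \<Longrightarrow> F 0 \<in> borel_measurable borel \<Longrightarrow>
     Lp_le p (\<lambda>x. ennreal \<bar>F 0 x * w x\<bar>) 1 \<Longrightarrow> Lp_le p (\<lambda>x. ennreal \<bar>F r x * w x\<bar>) 1 \<Longrightarrow>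
     Lp_le p (\<lambda>x. ennreal \<bar>(F 0 x - vp P n (F 0) x) * w x\<bar>) (C0 * real n powr (- \<beta> * real r))"
    using vp_error_same_norm[of r] by blast
  obtain C where C: "0 < C" and change: "\<And>P n f. orth P \<Longrightarrow> 1 \<le> n \<Longrightarrow> f \<in> borel_measurable borel \<Longrightarrow>
     (\<forall>m\<ge>1. Lp_le p (\<lambda>x. ennreal \<bar>(f x - vp P m f x) * w x\<bar>) (C0 * real m powr (- s))) \<Longrightarrow> 0 < s \<Longrightarrow>
     Lp_le q (\<lambda>x. ennreal \<bar>(f x - vp P n f x) * w x\<bar>) (C * real n powr (- (s - delta_exponent l p q)))"
    using vp_error_change_norm[OF p q C0 rate[unfolded rate_eq]] by blast
  show ?thesis
  proof (intro exI[of _ C] conjI C allI impI SUP_least)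
    fix P n f
    assume P: "orth P" and n: "(1::nat) \<le> n" and f: "f \<in> wSobolev_ball w r p"
    obtain F where chain: "\<forall>k<r. ac_deriv (F k) (F (Suc k))" and Fr: "F r \<in> borel_measurable borel"
      and ae: "AE x in lborel. f x = F 0 x" and L0: "Lp_le p (\<lambda>x. ennreal \<bar>F 0 x * w x\<bar>) 1"
      and Lr: "Lp_le p (\<lambda>x. ennreal \<bar>F r x * w x\<bar>) 1"
      using wSobolev_ball_chain[OF f p r] by blast
    have F0 [measurable]: "F 0 \<in> borel_measurable borel" using chain r ac_deriv_measurable by auto
    have fm [measurable]: "f \<in> borel_measurable lebesgue"
      using f by (auto simp: wSobolev_ball_def wSobolev_def wLp_def)
    have "Lp_le q (\<lambda>x. ennreal \<bar>(F 0 x - vp P n (F 0) x) * w x\<bar>) (C * real n powr (- rate_exponent l r p q))"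
      unfolding rate_eq
    proof (rule change[OF P n F0 _ s], intro allI impI)
      fix m :: nat assume m: "1 \<le> m"
      show "Lp_le p (\<lambda>x. ennreal \<bar>(F 0 x - vp P m (F 0) x) * w x\<bar>) (C0 * real m powr - s)"
        using same[OF P m p chain Fr F0 L0 Lr] by (simp add: s_def)
    qed
    moreover have "AE x in lborel. f x - vp P n f x = F 0 x - vp P n (F 0) x"
      using ae unfolding vp_cong_AE[OF fm F0 ae] by eventually_elim simp
    moreover have "(\<lambda>x. f x - vp P n f x) \<in> borel_measurable lebesgue"
      using measurable_vp[of P n f] by (intro borel_measurable_diff fm) (simp add: measurable_completion)
    ultimately show "wLp_norm w q (\<lambda>x. f x - vp P n f x) \<le> ennreal (C * real n powr (- rate_exponent l r p q))"
      using C q by (subst wLp_norm_le_iff[where F="\<lambda>x. F 0 x - vp P n (F 0) x"]) auto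
  qed
qed

end

theorem theorem2p3:
  fixes l a b :: real and p q :: ennreal and r :: nat
  defines "w \<equiv> freud_weight l a b"
  assumes "l > 1" and "a > 0"
    and "1 \<le> p" and "1 \<le> q" and "r \<ge> 1"
    and "rate_exponent l r p q > 0"
  shows "\<exists>C>0. \<forall>P. orthonormal_polys w P \<longrightarrow>
    (\<forall>n\<ge>1. (SUP f \<in> wSobolev_ball w r p. wLp_norm w q (\<lambda>x. f x - vallee_poussin w P n f x))
       \<le> ennreal (C * real n powr (- rate_exponent l r p q)))"
proof -
  interpret freud l a b using assms by unfold_locales
  show ?thesis unfolding w_def by (rule vp_approximation) fact+
qed

end
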